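(* Let $0<\alpha<1$ and let $l$ be a function varying slowly at $\infty$ such that $$\mathbb{P}(R_2-R_1>x)\sim\frac{x^{-\alpha}l(x)}{\Gamma(1-\alpha)}\quad\text{as }x\to\infty.$$ Let $\hat F(\lambda)=\mathbb{E}(e^{-\lambda(R_2-R_1)})$. Let $f$ be a bounded special function such that $\mu(f)=0$, and put $C(f)=\sup_{x\in E}\mathbb{E}_x\int_0^{R_1}|f|(X_s)ds$, $K(f)=\|f\|_\infty+C(f)$, $B(f)=\max(K^2(f),K(f))$. Then there exist a number $t_0\ge0$ and a function $L$ varying slowly at infinity such that for all $x$, for any initial measure $\pi$, for all $t\ge t_0$ and for all $0<\eta\le\frac\alpha2$, $$P_\pi\left(\left|\int_0^tf(X_s)ds\right|\ge t^{\frac\alpha2+\eta}x\right)\le4\exp\left(-\frac{1}{42\,B(f)}t^{2\eta/(2-\alpha)}(x^2\wedge x)L(t)\right)+4e\exp\left(-\frac{1}{6K(f)}t^{\frac\alpha2+\eta}x\right)+8\exp\left(-\frac12t^{2\eta/(2-\alpha)}(x\vee1)\Lambda_t^*\right),$$ where $$\Lambda_t^*=\sup_{\lambda>0}\left[-\log\hat F(\lambda)\,t^{\alpha-\alpha\frac{2\eta}{2-\alpha}}\frac1{L(t)}-\lambda t^{1-\frac{2\eta}{2-\alpha}}\right]>0$$ is positive and does not depend on $t$ asymptotically, in the sense that $$\liminf_{t\to\infty}\Lambda_t^*\ge(1-\alpha)\alpha^{\alpha/(1-\alpha)}>0.$$ Here $t_0$ is given explicitly by the requirement that, for all $t\ge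 t_0$, $$\frac{t^\gamma}{L(t)}\,t^{-\frac\alpha2-\eta}\ge1,\qquad\text{where }\gamma=\alpha+2\eta\frac{1-\alpha}{2-\alpha}.$$
   Context: Process. $X=(X_t)_{t\ge0}$ is a strong Markov process with càdlàg paths on $(\Omega,\mathcal A,(P_x)_x)$, with values in a locally compact Polish space $(E,\mathcal E)$, $X_0=x$ $P_x$-a.s., with semigroup $(P_t)_t$. It is Harris recurrent with ($\sigma$-finite) invariant measure $\mu$, unique up to a multiplicative constant: $\mu(A)>0$ implies $\limsup_{t\to\infty}1_A(X_t)=1$ a.s. Standing assumption: there is a $\sigma$-finite positive measure $\Lambda$ on $E$ with $P_t(x,dy)=p_t(x,y)\Lambda(dy)$ for every $t>0$, $(t,x,y)\mapsto p_t(x,y)$ jointly measurable. $P_\pi,E_\pi$: law and expectation of $X$ with initial measure $\pi$ (a probability measure on $E$). Special functions. A measurable $f:E\to\mathbb{R}_+$ is special if for every bounded positive measurable $h$ with $\mu(h)>0$ the function $x\mapsto E_x\int_0^\infty\exp[-\int_0^th(X_s)ds]f(X_t)dt$ is bounded. A signed $f$ is called special if $|f|$ is special. Nummelin splitting. Let $U^1(x,dy)=\int_0^\infty e^{-t}P_t(x,dy)dt$ and $u^1(x,x')=\int_0^\infty e^{-t}p_t(x,x')dt$. Fix $a\in(0,1)$, a set $C$ with $\mu(C)>0$ (which may be taken compact), and a probability $\nu$ equivalent to $\mu(\cdot\cap C)$ such that $U^1(x,dy)\ge a1_C(x)\nu(dy)$ (such a choice always exists). Define a kernel $Q$ from $E\times[0,1]$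 to $E$: $Q((x,u),dy)=\nu(dy)$ if $x\in C,u\le a$; $=\frac1{1-a}(U^1(x,dy)-a\nu(dy))$ if $x\in C,u>a$; $=U^1(x,dy)$ if $x\notin C$. On an extension of the space, define the process $Z=(Z^1,Z^2,Z^3)$ in $E\times[0,1]\times E$ with jump times $0=T_0<T_1<\dots$: $Z_0^1$ has the initial law, $Z_0^2$ is uniform on $[0,1]$, $Z^3_0\sim Q((Z_0^1,Z_0^2),\cdot)$. Inductively, given $Z_{T_n}=(x,u,x')$: $\sigma_{n+1}=T_{n+1}-T_n$ has density $e^{-t}p_t(x,x')/u^1(x,x')$ on $\mathbb{R}_+$ (conventions $0/0:=b/\infty:=1$, $b\ge 0$); given $\sigma_{n+1}=t$, on $[T_n,T_{n+1})$ one has $Z^2=u$, $Z^3=x'$ and $Z^1$ evolves as the bridge of $X$ from $x$ to $x'$ of length $t$, i.e. $Z^1_{T_n+s}\sim\frac{p_s(x,y)p_{t-s}(y,x')}{p_t(x,x')}\Lambda(dy)$ and, given $Z^1_{T_n+s}=y$, $Z^1_{T_n+s+r}\sim\frac{p_r(y,y')p_{t-s-r}(y',x')}{p_{t-s}(y,x')}\Lambda(dy')$ for $s+r<t$ (equal to a fixed point $x_0$ where the denominator vanishes); at $T_{n+1}$, $Z^1_{T_{n+1}}=x'$, $Z^2_{T_{n+1}}$ is a fresh independent uniform variable on $[0,1]$, and $Z^3_{T_{n+1}}\sim Q((Z^1_{T_{n+1}},Z^2_{T_{n+1}}),\cdot)$. Then $(Z^1,(T_n)_n)$ has the law of $X$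 together with the partial sums of an independent i.i.d. exp(1) sequence; $X$ is identified with $Z^1$. $\mathbb{P}_\pi,\mathbb{E}_\pi$ denote law and expectation of $Z$ started from $\pi(dx)\otimes U(du)\otimes Q((x,u),dy)$, $U$ uniform on $[0,1]$; $\mathbb{E}_x=\mathbb{E}_{\delta_x}$. Regeneration times. $S_0=R_0=0$, $S_{n+1}=\inf\{T_k>R_n:Z_{T_k}\in C\times[0,a]\times E\}$, $R_{n+1}=\inf\{T_k:T_k>S_{n+1}\}$. For $n\ge1$, $Z_{R_n}\sim\nu(dx)U(du)Q((x,u),dx')$, so the law of $R_2-R_1$ does not depend on the initial measure (hence the notation $\mathbb{P},\mathbb{E}$ without index). $\mu$ is normalized by $\mu(g)=\mathbb{E}_\pi\int_{R_1}^{R_2}g(X_s)ds$ (independent of $\pi$). For special $f$ it is known that $C(f)=\sup_x\mathbb{E}_x\int_0^{R_1}|f|(X_s)ds<\infty$. $x\wedge y=\min(x,y)$, $x\vee y=\max(x,y)$; $\Gamma$ is the Gamma function; $\sim$ between functions means that the ratio tends to 1. *)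

theory Defs
  imports "HOL-Probability.Probability" "HOL-Library.Landau_Symbols"
begin

text \<open>
  Time is indexed by \<^typ>\<open>real\<close>; only times \<open>t \<ge> 0\<close> are meaningful.  The state space is a type of
  class \<^class>\<open>polish_space\<close> with its Borel sets.  An initial measure is an element of
  \<open>space (prob_algebra borel)\<close>, and the law with initial measure \<open>\<pi>\<close> of a family \<open>(P x)\<close> of
  probability measures is the mixture \<open>\<pi> \<bind> P\<close>.
\<close>

section \<open>Slowly varying functions\<close>

definition slowly_varying :: "(real \<Rightarrow> real) \<Rightarrow> bool" where
  "slowly_varying l \<longleftrightarrow>
     (\<exists>b. l \<in> borel_measurable (restrict_space borel {b..}) \<and> (\<forall>t\<ge>b. 0 < l t)) \<and>
     (\<forall>c>0. ((\<lambda>t. l (c * t) / l t) \<longlongrightarrow> 1) at_top)"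

section \<open>Harris recurrent strong Markov processes\<close>

definition cadlag :: "(real \<Rightarrow> 'e::topological_space) \<Rightarrow> bool" where
  "cadlag w \<longleftrightarrow> (\<forall>t\<ge>0. (w \<longlongrightarrow> w t) (at_right t)) \<and> (\<forall>t>0. \<exists>y. (w \<longlongrightarrow> y) (at_left t))"

text \<open>The natural filtration; the index \<open>\<infinity>\<close> is included so that stopping times may be infinite.\<close>

definition natural_filtration ::
  "'w measure \<Rightarrow> (real \<Rightarrow> 'w \<Rightarrow> 'e::topological_space) \<Rightarrow> ennreal \<Rightarrow> 'w measure" where
  "natural_filtration M X t =
     sigma (space M) {X s -` B \<inter> space M | s B. 0 \<le> s \<and> ennreal s \<le> t \<and> B \<in> sets borel}"

definition semigroup ::
  "('e \<Rightarrow> 'w measure) \<Rightarrow> (real \<Rightarrow> 'w \<Rightarrow> 'e::topological_space) \<Rightarrow> real \<Rightarrow> 'e \<Rightarrow> 'e measure" where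
  "semigroup P X t x = distr (P x) borel (X t)"

definition strong_markov ::
  "'w measure \<Rightarrow> ('e \<Rightarrow> 'w measure) \<Rightarrow> (real \<Rightarrow> 'w \<Rightarrow> 'e::topological_space) \<Rightarrow> bool" where
  "strong_markov M P X \<longleftrightarrow>
     (\<forall>x \<tau> A t B.
        stopping_time (natural_filtration M X) \<tau> \<longrightarrow>
        A \<in> sets (filtration.pre_sigma (space M) (natural_filtration M X) \<tau>) \<longrightarrow>
        0 \<le> t \<longrightarrow> B \<in> sets borel \<longrightarrow>
        emeasure (P x) {\<omega> \<in> A. \<tau> \<omega> < \<infinity> \<and> X (enn2real (\<tau> \<omega>) + t) \<omega> \<in> B} =
        (\<integral>\<^sup>+\<omega> \<in> {\<omega> \<in> A. \<tau> \<omega> < \<infinity>}.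
            emeasure (semigroup P X t (X (enn2real (\<tau> \<omega>)) \<omega>)) B \<partial>P x))"

locale harris_process =
  fixes M :: "'w measure"
    and P :: "'e::polish_space \<Rightarrow> 'w measure"
    and X :: "real \<Rightarrow> 'w \<Rightarrow> 'e"
    and \<mu> \<Lambda> :: "'e measure"
    and p :: "real \<Rightarrow> 'e \<Rightarrow> 'e \<Rightarrow> real"
  assumes locally_compact: "locally compact (UNIV :: 'e set)"
    and P_kernel: "P \<in> borel \<rightarrow>\<^sub>M prob_algebra M"
    and X_measurable: "\<And>t. 0 \<le> t \<Longrightarrow> X t \<in> M \<rightarrow>\<^sub>M borel"
    and X_cadlag: "\<And>\<omega>. \<omega> \<in> space M \<Longrightarrow> cadlag (\<lambda>t. X t \<omega>)"
    and X_start: "\<And>x. AE \<omega> in P x. X 0 \<omega> = x"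
    and X_strong_markov: "strong_markov M P X"
    and sets_\<mu>: "sets \<mu> = sets borel"
    and sigma_finite_\<mu>: "sigma_finite_measure \<mu>"
    and \<mu>_invariant: "\<And>t B. 0 \<le> t \<Longrightarrow> B \<in> sets borel \<Longrightarrow>
          (\<integral>\<^sup>+x. emeasure (semigroup P X t x) B \<partial>\<mu>) = emeasure \<mu> B"
    and harris_recurrent: "\<And>A x. A \<in> sets borel \<Longrightarrow> 0 < emeasure \<mu> A \<Longrightarrow>
          AE \<omega> in P x. Limsup at_top (\<lambda>t. indicator A (X t \<omega>) :: ereal) = 1"
    and sets_\<Lambda>: "sets \<Lambda> = sets borel"
    and sigma_finite_\<Lambda>: "sigma_finite_measure \<Lambda>"
    and p_nonneg: "\<And>t x y. 0 < t \<Longrightarrow> 0 \<le> p t x y"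
    and p_measurable: "(\<lambda>(t, x, y). p t x y) \<in>
          borel_measurable (restrict_space borel {0<..} \<Otimes>\<^sub>M borel \<Otimes>\<^sub>M borel)"
    and semigroup_density: "\<And>t x. 0 < t \<Longrightarrow>
          semigroup P X t x = density \<Lambda> (\<lambda>y. ennreal (p t x y))"

definition special_nonneg ::
  "('e \<Rightarrow> 'w measure) \<Rightarrow> (real \<Rightarrow> 'w \<Rightarrow> 'e::topological_space) \<Rightarrow> 'e measure \<Rightarrow> ('e \<Rightarrow> real) \<Rightarrow> bool"
where
  "special_nonneg P X \<mu> f \<longleftrightarrow> f \<in> borel_measurable borel \<and> (\<forall>x. 0 \<le> f x) \<and>
     (\<forall>h. h \<in> borel_measurable borel \<and> (\<forall>x. 0 \<le> h x) \<and> bounded (range h) \<and>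
          0 < (\<integral>\<^sup>+x. ennreal (h x) \<partial>\<mu>) \<longrightarrow>
       (\<exists>c::real. \<forall>x.
          (\<integral>\<^sup>+\<omega>. (\<integral>\<^sup>+t\<in>{0..}.
              ennreal (exp (- (LINT s:{0..t}|lborel. h (X s \<omega>))) * f (X t \<omega>)) \<partial>lborel) \<partial>P x)
          \<le> ennreal c))"

definition special ::
  "('e \<Rightarrow> 'w measure) \<Rightarrow> (real \<Rightarrow> 'w \<Rightarrow> 'e::topological_space) \<Rightarrow> 'e measure \<Rightarrow> ('e \<Rightarrow> real) \<Rightarrow> bool"
where
  "special P X \<mu> f \<longleftrightarrow> f \<in> borel_measurable borel \<and> special_nonneg P X \<mu> (\<lambda>x. \<bar>f x\<bar>)"

section \<open>Nummelin splitting in continuous time\<close>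

definition U1 ::
  "('e \<Rightarrow> 'w measure) \<Rightarrow> (real \<Rightarrow> 'w \<Rightarrow> 'e::topological_space) \<Rightarrow> 'e \<Rightarrow> 'e measure" where
  "U1 P X x = measure_of UNIV (sets borel)
     (\<lambda>B. \<integral>\<^sup>+t\<in>{0..}. ennreal (exp (- t)) * emeasure (semigroup P X t x) B \<partial>lborel)"

definition u1 :: "(real \<Rightarrow> 'e \<Rightarrow> 'e \<Rightarrow> real) \<Rightarrow> 'e \<Rightarrow> 'e \<Rightarrow> ennreal" where
  "u1 p x x' = (\<integral>\<^sup>+t\<in>{0<..}. ennreal (exp (- t) * p t x x') \<partial>lborel)"

definition split_kernel ::
  "('e \<Rightarrow> 'w measure) \<Rightarrow> (real \<Rightarrow> 'w \<Rightarrow> 'e::topological_space) \<Rightarrow>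
   'e set \<Rightarrow> real \<Rightarrow> 'e measure \<Rightarrow> 'e \<Rightarrow> real \<Rightarrow> 'e measure" where
  "split_kernel P X C a \<nu> x u =
     (if x \<in> C then
        if u \<le> a then \<nu>
        else scale_measure (ennreal (1 / (1 - a)))
               (diff_measure (U1 P X x) (scale_measure (ennreal a) \<nu>))
      else U1 P X x)"

text \<open>
  The conventions \<open>0/0 = b/\<infinity> = 1\<close> are applied to the quotient \<open>p\<^sub>t(x,x') / u\<^sup>1(x,x')\<close>, so that the
  holding time is then exponentially distributed with parameter 1.
\<close>

definition holding_density :: "(real \<Rightarrow> 'e \<Rightarrow> 'e \<Rightarrow> real) \<Rightarrow> 'e \<Rightarrow> 'e \<Rightarrow> real \<Rightarrow> ennreal" where
  "holding_density p x x' t = ennreal (exp (- t)) *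
     (if u1 p x x' = \<infinity> \<or> (u1 p x x' = 0 \<and> p t x x' = 0) then 1
      else ennreal (p t x x') / u1 p x x')"

text \<open>
  \<open>bridge_kernel \<Lambda> p x0 t r y x'\<close> is the law after time \<open>r\<close> of the bridge from \<open>y\<close> to \<open>x'\<close> of
  remaining length \<open>t\<close>, where \<open>0 < r < t\<close>.
\<close>

definition bridge_kernel ::
  "'e::topological_space measure \<Rightarrow> (real \<Rightarrow> 'e \<Rightarrow> 'e \<Rightarrow> real) \<Rightarrow> 'e \<Rightarrow>
   real \<Rightarrow> real \<Rightarrow> 'e \<Rightarrow> 'e \<Rightarrow> 'e measure" where
  "bridge_kernel \<Lambda> p x0 t r y x' =
     (if p t y x' = 0 then return borel x0
      else density \<Lambda> (\<lambda>y'. ennreal (p r y y' * p (t - r) y' x' / p t y x')))"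

text \<open>Information given by \<open>T\<^sub>0, \<dots>, T\<^sub>m\<close> and the path of \<open>Z\<close> up to and including the random time \<open>\<tau>\<close>.\<close>

definition stopped_history ::
  "'v measure \<Rightarrow> (real \<Rightarrow> 'v \<Rightarrow> 'z::topological_space) \<Rightarrow> (nat \<Rightarrow> 'v \<Rightarrow> real) \<Rightarrow>
   nat \<Rightarrow> ('v \<Rightarrow> real) \<Rightarrow> 'v measure" where
  "stopped_history N Z T m \<tau> = sigma (space N)
     ({T k -` B \<inter> space N | k B. k \<le> m \<and> B \<in> sets borel} \<union>
      {{\<omega> \<in> space N. Z (min q (\<tau> \<omega>)) \<omega> \<in> A} | q A. 0 \<le> q \<and> A \<in> sets borel})"

text \<open>Information given by \<open>T\<^sub>0, \<dots>, T\<^sub>m\<close> and the path of \<open>Z\<close> strictly before \<open>T\<^sub>m\<close>.\<close>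

definition prejump_history ::
  "'v measure \<Rightarrow> (real \<Rightarrow> 'v \<Rightarrow> 'z::topological_space) \<Rightarrow> (nat \<Rightarrow> 'v \<Rightarrow> real) \<Rightarrow> nat \<Rightarrow> 'v measure"
where
  "prejump_history N Z T m = sigma (space N)
     ({T k -` B \<inter> space N | k B. k \<le> m \<and> B \<in> sets borel} \<union>
      {{\<omega> \<in> space N. q < T m \<omega> \<and> Z q \<omega> \<in> A} | q A. 0 \<le> q \<and> A \<in> sets borel})"

definition uniform01 :: "real measure" where
  "uniform01 = uniform_measure lborel {0..1}"

text \<open>
  The regeneration times: \<open>S\<^sub>n\<^sub>+\<^sub>1\<close> is \<open>atom_time \<dots> (R\<^sub>n)\<close> and \<open>R\<^sub>n\<^sub>+\<^sub>1\<close> is \<open>next_jump \<dots> (S\<^sub>n\<^sub>+\<^sub>1)\<close>.  The sets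
  under the infima are nonempty almost surely, by Harris recurrence.
\<close>

definition atom_time ::
  "'e set \<Rightarrow> real \<Rightarrow> (real \<Rightarrow> 'v \<Rightarrow> 'e \<times> real \<times> 'e) \<Rightarrow> (nat \<Rightarrow> 'v \<Rightarrow> real) \<Rightarrow> 'v \<Rightarrow> real \<Rightarrow> real" where
  "atom_time C a Z T \<omega> r = Inf {T k \<omega> | k. r < T k \<omega> \<and> Z (T k \<omega>) \<omega> \<in> C \<times> {0..a} \<times> UNIV}"

definition next_jump :: "(nat \<Rightarrow> 'v \<Rightarrow> real) \<Rightarrow> 'v \<Rightarrow> real \<Rightarrow> real" where
  "next_jump T \<omega> s = Inf {T k \<omega> | k. s < T k \<omega>}"

primrec regen_time ::
  "'e set \<Rightarrow> real \<Rightarrow> (real \<Rightarrow> 'v \<Rightarrow> 'e \<times> real \<times> 'e) \<Rightarrow> (nat \<Rightarrow> 'v \<Rightarrow> real) \<Rightarrow> nat \<Rightarrow> 'v \<Rightarrow> real" where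
  "regen_time C a Z T 0 \<omega> = 0"
| "regen_time C a Z T (Suc n) \<omega> = next_jump T \<omega> (atom_time C a Z T \<omega> (regen_time C a Z T n \<omega>))"

text \<open>
  \<open>(N, PP)\<close> is an extension of \<open>(M, P)\<close> via the projection \<open>pr\<close>, and \<open>Z\<^sup>1\<close> is the process \<open>X\<close> read on the
  extension.  The conditional laws in the inductive construction of \<open>Z\<close> are stated in integrated
  form over the events of the respective past.  In \<open>bridge\<close>, the case \<open>s = 0\<close> is the law of
  \<open>Z\<^sup>1\<close> at time \<open>T\<^sub>n + r\<close> given \<open>Z\<close> at \<open>T\<^sub>n\<close> and the holding time; there \<open>T\<^sub>n\<^sub>+\<^sub>1\<close> belongs to the past,
  and the events are restricted to \<open>s + r < T\<^sub>n\<^sub>+\<^sub>1 - T\<^sub>n\<close>.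
\<close>

locale nummelin_splitting = harris_process M P X \<mu> \<Lambda> p
  for M :: "'w measure"
    and P :: "'e::polish_space \<Rightarrow> 'w measure"
    and X :: "real \<Rightarrow> 'w \<Rightarrow> 'e"
    and \<mu> \<Lambda> :: "'e measure"
    and p :: "real \<Rightarrow> 'e \<Rightarrow> 'e \<Rightarrow> real" +
  fixes C :: "'e set"
    and a :: real
    and \<nu> :: "'e measure"
    and x0 :: 'e
    and N :: "'v measure"
    and PP :: "'e \<Rightarrow> 'v measure"
    and pr :: "'v \<Rightarrow> 'w"
    and Z :: "real \<Rightarrow> 'v \<Rightarrow> 'e \<times> real \<times> 'e"
    and T :: "nat \<Rightarrow> 'v \<Rightarrow> real"
  assumes a_bounds: "0 < a" "a < 1"
    and C_sets: "C \<in> sets borel"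
    and C_pos: "0 < emeasure \<mu> C"
    and \<nu>_prob: "\<nu> \<in> space (prob_algebra borel)"
    and \<nu>_equivalent: "\<And>B. B \<in> sets borel \<Longrightarrow> emeasure \<nu> B = 0 \<longleftrightarrow> emeasure \<mu> (B \<inter> C) = 0"
    and minorization: "\<And>x B. B \<in> sets borel \<Longrightarrow>
          ennreal a * indicator C x * emeasure \<nu> B \<le> emeasure (U1 P X x) B"
    and PP_kernel: "PP \<in> borel \<rightarrow>\<^sub>M prob_algebra N"
    and pr_measurable: "pr \<in> N \<rightarrow>\<^sub>M M"
    and extension: "\<And>x. distr (PP x) M pr = P x"
    and T_measurable: "\<And>n. T n \<in> borel_measurable N"
    and Z_measurable: "\<And>t. 0 \<le> t \<Longrightarrow> Z t \<in> N \<rightarrow>\<^sub>M borel"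
    and Z1_eq_X: "\<And>t \<omega>. 0 \<le> t \<Longrightarrow> \<omega> \<in> space N \<Longrightarrow> fst (Z t \<omega>) = X t (pr \<omega>)"
    and Z2_range: "\<And>t \<omega>. 0 \<le> t \<Longrightarrow> \<omega> \<in> space N \<Longrightarrow> fst (snd (Z t \<omega>)) \<in> {0..1}"
    and T_0: "\<And>\<omega>. \<omega> \<in> space N \<Longrightarrow> T 0 \<omega> = 0"
    and T_increasing: "\<And>n \<omega>. \<omega> \<in> space N \<Longrightarrow> T n \<omega> < T (Suc n) \<omega>"
    and T_unbounded: "\<And>\<omega>. \<omega> \<in> space N \<Longrightarrow> filterlim (\<lambda>n. T n \<omega>) at_top sequentially"
    and Z23_constant: "\<And>n t \<omega>. \<omega> \<in> space N \<Longrightarrow> T n \<omega> \<le> t \<Longrightarrow> t < T (Suc n) \<omega> \<Longrightarrow>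
          snd (Z t \<omega>) = snd (Z (T n \<omega>) \<omega>)"
    and Z1_at_jump: "\<And>n \<omega>. \<omega> \<in> space N \<Longrightarrow>
          fst (Z (T (Suc n) \<omega>) \<omega>) = snd (snd (Z (T n \<omega>) \<omega>))"
    and initial_law: "\<And>x A B D. A \<in> sets borel \<Longrightarrow> B \<in> sets borel \<Longrightarrow> D \<in> sets borel \<Longrightarrow>
          emeasure (PP x) {\<omega> \<in> space N. Z 0 \<omega> \<in> D \<times> A \<times> B} =
          indicator D x * (\<integral>\<^sup>+u\<in>A. emeasure (split_kernel P X C a \<nu> x u) B \<partial>uniform01)"
    and holding_time: "\<And>x n G B. G \<in> sets (stopped_history N Z T n (T n)) \<Longrightarrow> B \<in> sets borel \<Longrightarrow>
          emeasure (PP x) {\<omega> \<in> G. T (Suc n) \<omega> - T n \<omega> \<in> B} =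
          (\<integral>\<^sup>+\<omega>\<in>G. (\<integral>\<^sup>+t\<in>B \<inter> {0<..}.
              holding_density p (fst (Z (T n \<omega>) \<omega>)) (snd (snd (Z (T n \<omega>) \<omega>))) t \<partial>lborel) \<partial>PP x)"
    and bridge: "\<And>x n s r G B. 0 \<le> s \<Longrightarrow> 0 < r \<Longrightarrow>
          G \<in> sets (stopped_history N Z T (Suc n) (\<lambda>\<omega>. T n \<omega> + s)) \<Longrightarrow> B \<in> sets borel \<Longrightarrow>
          emeasure (PP x)
            {\<omega> \<in> G. s + r < T (Suc n) \<omega> - T n \<omega> \<and> fst (Z (T n \<omega> + s + r) \<omega>) \<in> B} =
          (\<integral>\<^sup>+\<omega>\<in>{\<omega> \<in> G. s + r < T (Suc n) \<omega> - T n \<omega>}.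
              emeasure (bridge_kernel \<Lambda> p x0 (T (Suc n) \<omega> - T n \<omega> - s) r
                (fst (Z (T n \<omega> + s) \<omega>)) (snd (snd (Z (T n \<omega>) \<omega>)))) B \<partial>PP x)"
    and jump: "\<And>x n G A B. G \<in> sets (prejump_history N Z T (Suc n)) \<Longrightarrow>
          A \<in> sets borel \<Longrightarrow> B \<in> sets borel \<Longrightarrow>
          emeasure (PP x) {\<omega> \<in> G. snd (Z (T (Suc n) \<omega>) \<omega>) \<in> A \<times> B} =
          (\<integral>\<^sup>+\<omega>\<in>G. (\<integral>\<^sup>+u\<in>A.
              emeasure (split_kernel P X C a \<nu> (fst (Z (T (Suc n) \<omega>) \<omega>)) u) B \<partial>uniform01) \<partial>PP x)"
    and \<mu>_normalized: "\<And>\<pi> g. \<pi> \<in> space (prob_algebra borel) \<Longrightarrow> g \<in> borel_measurable borel \<Longrightarrow>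
          (\<integral>\<^sup>+x. g x \<partial>\<mu>) =
          (\<integral>\<^sup>+\<omega>. (\<integral>\<^sup>+s\<in>{regen_time C a Z T 1 \<omega>..regen_time C a Z T 2 \<omega>}.
              g (X s (pr \<omega>)) \<partial>lborel) \<partial>(\<pi> \<bind> PP))"

section \<open>Quantities in the deviation inequality\<close>

text \<open>The supremum is finite for special \<open>f\<close>, so that \<^const>\<open>enn2real\<close> loses nothing.\<close>

definition C_const ::
  "('e \<Rightarrow> 'v measure) \<Rightarrow> (real \<Rightarrow> 'v \<Rightarrow> 'e \<times> real \<times> 'e) \<Rightarrow> (nat \<Rightarrow> 'v \<Rightarrow> real) \<Rightarrow>
   'e set \<Rightarrow> real \<Rightarrow> ('e \<Rightarrow> real) \<Rightarrow> real" where
  "C_const PP Z T C a f = enn2real (SUP x.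
     \<integral>\<^sup>+\<omega>. (\<integral>\<^sup>+s\<in>{0..regen_time C a Z T 1 \<omega>}. ennreal \<bar>f (fst (Z s \<omega>))\<bar> \<partial>lborel) \<partial>PP x)"

definition K_const ::
  "('e \<Rightarrow> 'v measure) \<Rightarrow> (real \<Rightarrow> 'v \<Rightarrow> 'e \<times> real \<times> 'e) \<Rightarrow> (nat \<Rightarrow> 'v \<Rightarrow> real) \<Rightarrow>
   'e set \<Rightarrow> real \<Rightarrow> ('e \<Rightarrow> real) \<Rightarrow> real" where
  "K_const PP Z T C a f = (SUP x. \<bar>f x\<bar>) + C_const PP Z T C a f"

definition B_const ::
  "('e \<Rightarrow> 'v measure) \<Rightarrow> (real \<Rightarrow> 'v \<Rightarrow> 'e \<times> real \<times> 'e) \<Rightarrow> (nat \<Rightarrow> 'v \<Rightarrow> real) \<Rightarrow>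
   'e set \<Rightarrow> real \<Rightarrow> ('e \<Rightarrow> real) \<Rightarrow> real" where
  "B_const PP Z T C a f = max ((K_const PP Z T C a f)\<^sup>2) (K_const PP Z T C a f)"

definition Lambda_objective ::
  "real \<Rightarrow> (real \<Rightarrow> real) \<Rightarrow> (real \<Rightarrow> real) \<Rightarrow> real \<Rightarrow> real \<Rightarrow> real \<Rightarrow> real" where
  "Lambda_objective \<alpha> F L \<eta> t r =
     - ln (F r) * t powr (\<alpha> - \<alpha> * (2 * \<eta> / (2 - \<alpha>))) * (1 / L t)
     - r * t powr (1 - 2 * \<eta> / (2 - \<alpha>))"

definition Lambda_star ::
  "real \<Rightarrow> (real \<Rightarrow> real) \<Rightarrow> (real \<Rightarrow> real) \<Rightarrow> real \<Rightarrow> real \<Rightarrow> real" where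
  "Lambda_star \<alpha> F L \<eta> t = (SUP r\<in>{0<..}. Lambda_objective \<alpha> F L \<eta> t r)"

definition threshold :: "real \<Rightarrow> (real \<Rightarrow> real) \<Rightarrow> real \<Rightarrow> bool" where
  "threshold \<alpha> L t0 \<longleftrightarrow> 0 \<le> t0 \<and>
     (\<forall>\<eta> t. 0 < \<eta> \<longrightarrow> \<eta> \<le> \<alpha> / 2 \<longrightarrow> t0 \<le> t \<longrightarrow>
        t powr (\<alpha> + 2 * \<eta> * ((1 - \<alpha>) / (2 - \<alpha>))) / L t * t powr (- (\<alpha> / 2) - \<eta>) \<ge> 1)"

end

theory Submission
  imports Defs
begin

text \<open>
  The integral of \<open>f\<close> is cut at the regeneration times.  The bridge that ends a cycle depends on the
  starting point of the next one, so consecutive cycles are not independent, but each cycle is independent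
  of the cycles with smaller index of the same parity.  For cycles of one parity, the exponential
  moment \<open>E exp (l \<integral>\<bar>f\<bar>) \<le> 1 + c C(f)\<close> with \<open>c = l / (1 - l K)\<close>, together with \<open>\<mu>(f) = 0\<close> and
  Doob's inequality for the products of exponentials, gives a maximal inequality of Bernstein type.
  The two incomplete cycles at \<open>0\<close> and \<open>t\<close> are controlled by the same exponential moment, and the
  number of cycles before \<open>t\<close> by the Laplace transform of their lengths.

  The function \<open>L\<close> is \<open>min\<^sub>j e\<^bsup>\<alpha>j\<^esup> P(R\<^sub>2 - R\<^sub>1 > e\<^sup>j) / (1 + \<lfloor>ln t\<rfloor>)\<close>, the minimum over
  \<open>j \<le> 1 + \<lfloor>ln t\<rfloor>\<close>, so that \<open>\<Lambda>\<^sub>t\<^sup>*\<close> even tends to infinity.  Below some \<open>t\<^sub>1\<close> it is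
  replaced by \<open>t + 2\<close>, which violates the threshold condition: every admissible threshold is at
  least \<open>t\<^sub>1\<close>.
\<close>

text \<open>Given its end point, a holding interval is governed by a bridge whose length depends on
  that end point, so neither the path in the interval nor its length is independent of what follows.
  Only after averaging the end point over \<open>U1\<close> does one recover an exponential time and
  the semigroup. For means this is enough, because they add up over intervals. An exponential moment
  is a product, and here \<open>bathtub_exp\<close> helps: on one interval it replaces
  \<open>exp (l A)\<close> by 1 plus a term linear in the path, whose mean costs the factor
  \<open>1 / (1 - l m)\<close>. The later factors are then kept exactly against the 1 and bounded
  uniformly in the linear term; the constant \<open>c\<close> is the fixed point of this recursion.
  Two facts come before: the atom is revisited almost surely, which is extracted from the
  normalization of \<open>\<mu>\<close> being the same for all initial laws, and the potential of
  the chain killed at the atom is bounded for special functions. The level \<open>y\<close> is split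
  as \<open>5/24 + 5/24\<close> for the two ends and \<open>7/24 + 7/24\<close> for the two
  parities, which leads to the rates \<open>1 / (6 K)\<close> and \<open>1 / (42 B)\<close>.\<close>

section \<open>Kernel disintegration, real inequalities and path measurability\<close>

text \<open>The conditional laws of the splitting are given on events of the past and sets of
  values. Such rectangles form an intersection-stable generator, so the identity extends to
  integrands of past and new value together. The weight \<open>e\<close> selects an event outside
  the past \<open>H\<close>, such as a visit to the atom; \<open>e \<le> 1\<close> keeps all masses
  finite, which the complement step of the induction uses for cancellation.\<close>

lemma nn_integral_kernel_step:
  fixes e :: "'a \<Rightarrow> ennreal" and \<phi> :: "'a \<times> 'b \<Rightarrow> ennreal"
  assumes M: "prob_space M" and H: "space H = space M" "sets H \<subseteq> sets M"
    and Y [measurable]: "Y \<in> M \<rightarrow>\<^sub>M L" and e [measurable]: "e \<in> borel_measurable M"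
    and e_le: "\<And>w. e w \<le> 1"
    and K: "\<And>w. w \<in> space M \<Longrightarrow> sets (K w) = sets L"
    and K_meas: "\<And>\<phi>. \<phi> \<in> borel_measurable (H \<Otimes>\<^sub>M L) \<Longrightarrow>
      (\<lambda>w. \<integral>\<^sup>+y. \<phi> (w, y) \<partial>K w) \<in> borel_measurable H"
    and eq: "\<And>G B. G \<in> sets H \<Longrightarrow> B \<in> sets L \<Longrightarrow>
      (\<integral>\<^sup>+w. e w * indicator G w * indicator B (Y w) \<partial>M) =
      (\<integral>\<^sup>+w. indicator G w * emeasure (K w) B \<partial>M)"
    and \<phi>: "\<phi> \<in> borel_measurable (H \<Otimes>\<^sub>M L)"
  shows "(\<integral>\<^sup>+w. e w * \<phi> (w, Y w) \<partial>M) = (\<integral>\<^sup>+w. \<integral>\<^sup>+y. \<phi> (w, y) \<partial>K w \<partial>M)"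
proof -
  interpret prob_space M by fact
  have id: "(\<lambda>w. w) \<in> M \<rightarrow>\<^sub>M H" using H by (intro measurableI) (auto dest: sets.sets_into_space)
  have pr [measurable]: "(\<lambda>w. (w, Y w)) \<in> M \<rightarrow>\<^sub>M H \<Otimes>\<^sub>M L" using id by simp
  have HM: "f \<in> borel_measurable M" if "f \<in> borel_measurable H" for f :: "'a \<Rightarrow> ennreal"
    using measurable_comp[OF id that] by (simp add: comp_def)
  have [measurable]: "(\<lambda>w. \<integral>\<^sup>+y. \<psi> (w, y) \<partial>K w) \<in> borel_measurable M"
    if "\<psi> \<in> borel_measurable (H \<Otimes>\<^sub>M L)" for \<psi> using HM[OF K_meas[OF that]] .
  have sec: "(\<lambda>y. \<psi> (w, y)) \<in> borel_measurable (K w)"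
    if "\<psi> \<in> borel_measurable (H \<Otimes>\<^sub>M L)" "w \<in> space M" for \<psi> :: "'a \<times> 'b \<Rightarrow> ennreal" and w
    using measurable_Pair2[OF that(1), of w] that(2) H(1) K[OF that(2)]
    by (simp cong: measurable_cong_sets)
  let ?P = "\<lambda>\<psi>. (\<integral>\<^sup>+w. e w * \<psi> (w, Y w) \<partial>M) = (\<integral>\<^sup>+w. \<integral>\<^sup>+y. \<psi> (w, y) \<partial>K w \<partial>M)"
  have spK: "space (K w) = space L" if "w \<in> space M" for w
    using K[OF that] by (rule sets_eq_imp_space_eq)
  have rect: "?P (indicator (a \<times> b))" if "a \<in> sets H" "b \<in> sets L" for a b
  proof -
    have "(\<integral>\<^sup>+y. indicator (a \<times> b) (w, y) \<partial>K w) = indicator a w * emeasure (K w) b" if "w \<in> space M" for w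
    proof -
      have "(\<integral>\<^sup>+y. indicator (a \<times> b) (w, y) \<partial>K w) = (\<integral>\<^sup>+y. indicator a w * indicator b y \<partial>K w)"
        by (intro nn_integral_cong) (auto split: split_indicator)
      then show ?thesis using K[OF that] \<open>b \<in> sets L\<close> by (simp add: nn_integral_cmult)
    qed
    then have "(\<integral>\<^sup>+w. \<integral>\<^sup>+y. indicator (a \<times> b) (w, y) \<partial>K w \<partial>M) = (\<integral>\<^sup>+w. indicator a w * emeasure (K w) b \<partial>M)"
      by (intro nn_integral_cong) auto
    also have "\<dots> = (\<integral>\<^sup>+w. e w * indicator a w * indicator b (Y w) \<partial>M)" using eq[OF that] by simp
    also have "\<dots> = (\<integral>\<^sup>+w. e w * indicator (a \<times> b) (w, Y w) \<partial>M)"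
      by (intro nn_integral_cong) (auto split: split_indicator)
    finally show ?thesis by simp
  qed
  have sets: "?P (indicator A)" if "A \<in> sets (H \<Otimes>\<^sub>M L)" for A
    using Int_stable_pair_measure_generator pair_measure_closed that unfolding sets_pair_measure
  proof (induct rule: sigma_sets_induct_disjoint)
    case (basic A) then show ?case using rect by auto
  next
    case empty then show ?case by simp
  next
    case (compl A)
    let ?O = "space H \<times> space L"
    have A [measurable]: "A \<in> sets (H \<Otimes>\<^sub>M L)" using compl(1) by (simp add: sets_pair_measure)
    have O: "?O \<in> sets (H \<Otimes>\<^sub>M L)" by auto
    have OA [measurable]: "?O - A \<in> sets (H \<Otimes>\<^sub>M L)" using O A by (rule sets.Diff)
    have AO: "A \<subseteq> ?O" using sets.sets_into_space[OF A] by (simp add: space_pair_measure)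
    have ind: "indicator ?O z = indicator A z + (indicator (?O - A) z :: ennreal)" for z
      using AO by (auto split: split_indicator)
    have 1: "(\<integral>\<^sup>+w. e w * indicator ?O (w, Y w) \<partial>M) =
      (\<integral>\<^sup>+w. e w * indicator A (w, Y w) \<partial>M) + (\<integral>\<^sup>+w. e w * indicator (?O - A) (w, Y w) \<partial>M)"
      unfolding ind distrib_left by (rule nn_integral_add) measurable
    have "(\<integral>\<^sup>+y. indicator ?O (w, y) \<partial>K w) = (\<integral>\<^sup>+y. indicator A (w, y) \<partial>K w) + (\<integral>\<^sup>+y. indicator (?O - A) (w, y) \<partial>K w)"
      if "w \<in> space M" for w
      unfolding ind by (intro nn_integral_add sec that borel_measurable_indicator A OA)
    then have "(\<integral>\<^sup>+w. \<integral>\<^sup>+y. indicator ?O (w, y) \<partial>K w \<partial>M) =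
      (\<integral>\<^sup>+w. (\<integral>\<^sup>+y. indicator A (w, y) \<partial>K w) + (\<integral>\<^sup>+y. indicator (?O - A) (w, y) \<partial>K w) \<partial>M)"
      by (intro nn_integral_cong)
    also have "\<dots> = (\<integral>\<^sup>+w. \<integral>\<^sup>+y. indicator A (w, y) \<partial>K w \<partial>M) + (\<integral>\<^sup>+w. \<integral>\<^sup>+y. indicator (?O - A) (w, y) \<partial>K w \<partial>M)"
      by (rule nn_integral_add) measurable
    finally have 2: "(\<integral>\<^sup>+w. \<integral>\<^sup>+y. indicator ?O (w, y) \<partial>K w \<partial>M) = \<dots>" .
    have "(\<integral>\<^sup>+w. e w * indicator A (w, Y w) \<partial>M) \<le> (\<integral>\<^sup>+w. 1 \<partial>M)"
      by (intro nn_integral_mono) (use e_le in \<open>auto split: split_indicator\<close>)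
    also have "\<dots> < \<infinity>" by (simp add: emeasure_space_1)
    finally have fin: "(\<integral>\<^sup>+w. e w * indicator A (w, Y w) \<partial>M) < \<infinity>" .
    have "(\<integral>\<^sup>+w. e w * indicator A (w, Y w) \<partial>M) + (\<integral>\<^sup>+w. e w * indicator (?O - A) (w, Y w) \<partial>M)
      = (\<integral>\<^sup>+w. e w * indicator A (w, Y w) \<partial>M) + (\<integral>\<^sup>+w. \<integral>\<^sup>+y. indicator (?O - A) (w, y) \<partial>K w \<partial>M)"
      using rect[of "space H" "space L"] 1 2 compl(2) by simp
    then show ?case using fin unfolding ennreal_add_left_cancel by auto
  next
    case (union A)
    have A [measurable]: "A i \<in> sets (H \<Otimes>\<^sub>M L)" for i using union(2) by (auto simp add: sets_pair_measure)
    have ind: "indicator (\<Union>i. A i) z = (\<Sum>i. indicator (A i) z :: ennreal)" for z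
      using suminf_indicator[OF union(1), of z] by simp
    have "(\<integral>\<^sup>+w. e w * indicator (\<Union>i. A i) (w, Y w) \<partial>M) = (\<integral>\<^sup>+w. (\<Sum>i. e w * indicator (A i) (w, Y w)) \<partial>M)"
      unfolding ind by simp
    also have "\<dots> = (\<Sum>i. \<integral>\<^sup>+w. e w * indicator (A i) (w, Y w) \<partial>M)"
      by (rule nn_integral_suminf) measurable
    also have "\<dots> = (\<Sum>i. \<integral>\<^sup>+w. \<integral>\<^sup>+y. indicator (A i) (w, y) \<partial>K w \<partial>M)" using union(3) by simp
    also have "\<dots> = (\<integral>\<^sup>+w. (\<Sum>i. \<integral>\<^sup>+y. indicator (A i) (w, y) \<partial>K w) \<partial>M)"
      by (rule nn_integral_suminf[symmetric]) measurable
    also have "\<dots> = (\<integral>\<^sup>+w. \<integral>\<^sup>+y. indicator (\<Union>i. A i) (w, y) \<partial>K w \<partial>M)"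
      unfolding ind by (intro nn_integral_cong nn_integral_suminf[symmetric] sec borel_measurable_indicator A)
    finally show ?case .
  qed
  show ?thesis using \<phi>
  proof (induct rule: borel_measurable_induct)
    case (cong f g)
    have "(\<integral>\<^sup>+w. e w * f (w, Y w) \<partial>M) = (\<integral>\<^sup>+w. e w * g (w, Y w) \<partial>M)"
      using measurable_space[OF pr] cong(3) by (intro nn_integral_cong) auto
    moreover have "(\<integral>\<^sup>+w. \<integral>\<^sup>+y. f (w, y) \<partial>K w \<partial>M) = (\<integral>\<^sup>+w. \<integral>\<^sup>+y. g (w, y) \<partial>K w \<partial>M)"
      using cong(3) H(1) spK by (intro nn_integral_cong) (auto simp: space_pair_measure)
    ultimately show ?case using cong by simp
  next
    case (set A) then show ?case using sets by simp
  next
    case (mult u c)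
    note [measurable] = mult(2)
    have "(\<integral>\<^sup>+w. e w * (c * u (w, Y w)) \<partial>M) = c * (\<integral>\<^sup>+w. e w * u (w, Y w) \<partial>M)"
      by (subst nn_integral_cmult[symmetric]) (auto simp: ac_simps)
    also have "\<dots> = (\<integral>\<^sup>+w. c * (\<integral>\<^sup>+y. u (w, y) \<partial>K w) \<partial>M)"
      using mult by (simp add: nn_integral_cmult)
    also have "\<dots> = (\<integral>\<^sup>+w. \<integral>\<^sup>+y. c * u (w, y) \<partial>K w \<partial>M)"
      by (intro nn_integral_cong nn_integral_cmult[symmetric] sec mult)
    finally show ?case .
  next
    case (add u v)
    note [measurable] = add(1,4)
    have "(\<integral>\<^sup>+w. e w * (v (w, Y w) + u (w, Y w)) \<partial>M) = (\<integral>\<^sup>+w. e w * v (w, Y w) \<partial>M) + (\<integral>\<^sup>+w. e w * u (w, Y w) \<partial>M)"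
      unfolding distrib_left by (rule nn_integral_add) measurable
    also have "\<dots> = (\<integral>\<^sup>+w. (\<integral>\<^sup>+y. v (w, y) \<partial>K w) + (\<integral>\<^sup>+y. u (w, y) \<partial>K w) \<partial>M)"
      using add by (simp add: nn_integral_add)
    also have "\<dots> = (\<integral>\<^sup>+w. \<integral>\<^sup>+y. v (w, y) + u (w, y) \<partial>K w \<partial>M)"
      by (intro nn_integral_cong nn_integral_add[symmetric] sec add)
    finally show ?case .
  next
    case (seq U)
    note [measurable] = seq(1)
    have inc: "U i z \<le> U (Suc i) z" for i z using \<open>incseq U\<close> by (cases z) (auto simp: incseq_Suc_iff le_fun_def)
    have "(\<integral>\<^sup>+w. e w * (SUP i. U i) (w, Y w) \<partial>M) = (\<integral>\<^sup>+w. (SUP i. e w * U i (w, Y w)) \<partial>M)"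
      by (intro nn_integral_cong) (simp add: SUP_mult_left_ennreal image_comp)
    also have "\<dots> = (SUP i. \<integral>\<^sup>+w. e w * U i (w, Y w) \<partial>M)"
      by (rule nn_integral_monotone_convergence_SUP)
        (auto simp: incseq_Suc_iff le_fun_def intro!: mult_left_mono inc)
    also have "\<dots> = (SUP i. \<integral>\<^sup>+w. \<integral>\<^sup>+y. U i (w, y) \<partial>K w \<partial>M)" using seq by simp
    also have "\<dots> = (\<integral>\<^sup>+w. (SUP i. \<integral>\<^sup>+y. U i (w, y) \<partial>K w) \<partial>M)"
      by (rule nn_integral_monotone_convergence_SUP[symmetric])
        (auto simp: incseq_Suc_iff le_fun_def intro!: nn_integral_mono inc)
    also have "\<dots> = (\<integral>\<^sup>+w. \<integral>\<^sup>+y. (SUP i. U i) (w, y) \<partial>K w \<partial>M)"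
    proof (rule nn_integral_cong)
      fix w assume w: "w \<in> space M"
      have "(SUP i. \<integral>\<^sup>+y. U i (w, y) \<partial>K w) = (\<integral>\<^sup>+y. (SUP i. U i (w, y)) \<partial>K w)"
        by (intro nn_integral_monotone_convergence_SUP[symmetric] incseq_SucI le_funI inc sec seq(1) w)
      then show "(SUP i. \<integral>\<^sup>+y. U i (w, y) \<partial>K w) = (\<integral>\<^sup>+y. (SUP i. U i) (w, y) \<partial>K w)"
        by (simp add: image_comp)
    qed
    finally show ?case .
  qed
qed

lemma set_integrable_bounded:
  fixes g :: "real \<Rightarrow> real"
  assumes "g \<in> borel_measurable borel" and "\<And>s. s \<in> {a..b} \<Longrightarrow> \<bar>g s\<bar> \<le> B"
  shows "set_integrable lborel {a..b} g"
  unfolding set_integrable_def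
  by (rule integrableI_bounded_set_indicator[where B=B])
    (use assms in \<open>auto simp: emeasure_lborel_Icc_eq\<close>)

lemma nn_set_integral_eq_LINT:
  fixes g :: "real \<Rightarrow> real"
  assumes "set_integrable lborel A g" and "\<And>s. s \<in> A \<Longrightarrow> 0 \<le> g s"
  shows "(\<integral>\<^sup>+s\<in>A. ennreal (g s) \<partial>lborel) = ennreal (LINT s:A|lborel. g s)"
proof -
  have "(\<integral>\<^sup>+s\<in>A. ennreal (g s) \<partial>lborel) = (\<integral>\<^sup>+s. ennreal (indicator A s *\<^sub>R g s) \<partial>lborel)"
    by (intro nn_integral_cong) (auto split: split_indicator)
  also have "\<dots> = ennreal (LINT s:A|lborel. g s)"
    unfolding set_lebesgue_integral_def
    by (rule nn_integral_eq_integral) (use assms in \<open>auto simp: set_integrable_def split: split_indicator\<close>)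
  finally show ?thesis .
qed

text \<open>Among the densities \<open>0 \<le> g \<le> m\<close> of given mass on \<open>[a, b]\<close>, the integral on the right is
  smallest when the mass sits at the end of the interval.\<close>
lemma bathtub_exp:
  fixes g :: "real \<Rightarrow> real"
  assumes g [measurable]: "g \<in> borel_measurable borel" and g0: "\<And>s. 0 \<le> g s" and gm: "\<And>s. g s \<le> m"
    and l: "0 < l" and m: "0 < m" and ab: "a \<le> b"
  shows "ennreal (exp (l * (LINT s:{a..b}|lborel. g s))) \<le>
    1 + ennreal l * (\<integral>\<^sup>+s\<in>{a..b}. ennreal (g s * exp (l * m * (b - s))) \<partial>lborel)"
proof -
  define A where "A = (LINT s:{a..b}|lborel. g s)"
  have ig: "set_integrable lborel {a..b} g"
    by (rule set_integrable_bounded[where B=m]) (use g0 gm in \<open>auto simp: abs_le_iff intro: order_trans[of _ 0]\<close>)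
  have A0: "0 \<le> A" unfolding A_def set_lebesgue_integral_def using g0 by (intro integral_nonneg_AE) auto
  have "A \<le> (LINT s:{a..b}|lborel. m)" unfolding A_def
    by (rule set_integral_mono[OF ig]) (auto intro!: gm set_integrable_bounded[where B="\<bar>m\<bar>"])
  then have Am: "A \<le> m * (b - a)" using ab by (simp add: set_lebesgue_integral_def mult.commute)
  define c where "c = b - A / m"
  have cab: "a \<le> c" "c \<le> b" using A0 Am m by (auto simp: c_def field_simps)
  define w where "w s = exp (l * m * (b - s))" for s
  have [measurable]: "w \<in> borel_measurable borel" unfolding w_def by measurable
  have w0: "0 \<le> w s" for s by (simp add: w_def)
  have w_le: "w s \<le> exp (l * m * (b - a))" "0 < w s" if "a \<le> s" for s
    using that l m by (auto simp: w_def)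
  let ?i = "indicat_real {c..b}"
  have igw: "set_integrable lborel {a..b} (\<lambda>s. g s * w s)"
    by (rule set_integrable_bounded[where B="m * exp (l * m * (b - a))"])
      (use g0 gm m w_le in \<open>auto simp: abs_mult w0 intro!: mult_mono\<close>)
  have iiw: "set_integrable lborel {a..b} (\<lambda>s. m * ?i s * w s)"
    by (rule set_integrable_bounded[where B="m * exp (l * m * (b - a))"])
      (use m w_le in \<open>auto simp: abs_mult w0 split: split_indicator intro!: mult_mono\<close>)
  have ii: "set_integrable lborel {a..b} (\<lambda>s. m * ?i s)"
    by (rule set_integrable_bounded[where B=m]) (use m in \<open>auto split: split_indicator\<close>)
  \<comment> \<open>Both factors change sign at \<open>c\<close>: to its left
    \<open>g s \<ge> 0\<close> and \<open>w s \<ge> w c\<close>, to its right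
    \<open>g s \<le> m\<close> and \<open>w s \<le> w c\<close>. Since \<open>g\<close> and
    \<open>m * ?i\<close> have the same mass, the constant \<open>w c\<close> drops out after
    integration.\<close>
  have pt: "0 \<le> (g s - m * ?i s) * (w s - w c)" if "s \<in> {a..b}" for s
  proof (cases "c \<le> s")
    case True
    then have "w s \<le> w c" using l m by (auto simp: w_def)
    then show ?thesis using gm[of s] True that by (auto intro!: mult_nonpos_nonpos)
  next
    case False
    then have "w c \<le> w s" using l m by (auto simp: w_def)
    then show ?thesis using g0[of s] False that by auto
  qed
  have iA: "(LINT s:{a..b}|lborel. m * ?i s) = A"
  proof -
    have "(LINT s:{a..b}|lborel. m * ?i s) = (LINT s|lborel. m * ?i s)"
      unfolding set_lebesgue_integral_def using cab
      by (intro Bochner_Integration.integral_cong) (auto split: split_indicator)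
    then show ?thesis using cab m by (simp add: c_def)
  qed
  have "0 \<le> (LINT s:{a..b}|lborel. (g s - m * ?i s) * (w s - w c))"
    unfolding set_lebesgue_integral_def using pt
    by (intro integral_nonneg_AE) (auto split: split_indicator)
  also have "\<dots> = (LINT s:{a..b}|lborel. (g s * w s - m * ?i s * w s) - (g s * w c - (m * ?i s) * w c))"
    by (simp add: algebra_simps)
  also have "\<dots> = ((LINT s:{a..b}|lborel. g s * w s) - (LINT s:{a..b}|lborel. m * ?i s * w s))
      - ((LINT s:{a..b}|lborel. g s * w c) - (LINT s:{a..b}|lborel. (m * ?i s) * w c))"
    using ig ii igw iiw by (simp add: set_integral_diff)
  also have "\<dots> = (LINT s:{a..b}|lborel. g s * w s) - (LINT s:{a..b}|lborel. m * ?i s * w s)"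
    using iA by (simp add: A_def)
  finally have 1: "(LINT s:{a..b}|lborel. m * ?i s * w s) \<le> (LINT s:{a..b}|lborel. g s * w s)" by simp
  have "has_bochner_integral lborel (\<lambda>x. w x * indicator {c..b} x) ((- w b / (l * m)) - (- w c / (l * m)))"
  proof (rule has_bochner_integral_FTC_Icc_real)
    show "DERIV (\<lambda>x. - w x / (l * m)) x :> w x" if "c \<le> x" "x \<le> b" for x
      unfolding w_def using l m by (auto intro!: derivative_eq_intros)
    show "isCont w x" for x unfolding w_def by (intro continuous_intros)
  qed (use cab in auto)
  then have "(LINT s|lborel. w s * ?i s) = (w c - 1) / (l * m)"
    by (auto dest!: has_bochner_integral_integral_eq simp: w_def diff_divide_distrib)
  moreover have "(LINT s:{a..b}|lborel. m * ?i s * w s) = (LINT s|lborel. m * (w s * ?i s))"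
    unfolding set_lebesgue_integral_def using cab
    by (intro Bochner_Integration.integral_cong) (auto split: split_indicator)
  \<comment> \<open>As \<open>w c = exp (l A)\<close>, the claimed inequality is an equality for the
    extremal density \<open>m * ?i\<close>.\<close>
  ultimately have "(LINT s:{a..b}|lborel. m * ?i s * w s) = (w c - 1) / l" using m by simp
  moreover have "w c = exp (l * A)" using m by (simp add: w_def c_def)
  ultimately have 2: "exp (l * A) \<le> 1 + l * (LINT s:{a..b}|lborel. g s * w s)"
    using mult_left_mono[OF 1, of l] l by simp
  have 3: "(\<integral>\<^sup>+s\<in>{a..b}. ennreal (g s * w s) \<partial>lborel) = ennreal (LINT s:{a..b}|lborel. g s * w s)"
    by (rule nn_set_integral_eq_LINT[OF igw]) (auto intro!: mult_nonneg_nonneg g0 w0)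
  have 4: "0 \<le> (LINT s:{a..b}|lborel. g s * w s)"
    unfolding set_lebesgue_integral_def
    by (intro integral_nonneg_AE) (auto intro!: mult_nonneg_nonneg g0 w0)
  have "ennreal (exp (l * A)) \<le> ennreal (1 + l * (LINT s:{a..b}|lborel. g s * w s))" using 2 by (rule ennreal_leI)
  also have "\<dots> = 1 + ennreal l * (\<integral>\<^sup>+s\<in>{a..b}. ennreal (g s * w s) \<partial>lborel)"
    using l 4 unfolding 3 by (simp add: ennreal_mult)
  finally show ?thesis unfolding A_def w_def .
qed

text \<open>Both sides of the exponential formula below differ by a function of \<open>u\<close> whose increments are
  quadratically small, hence by a constant.\<close>
lemma exp_integral_formula:
  fixes q :: "real \<Rightarrow> real"
  assumes q [measurable]: "q \<in> borel_measurable borel" and q0: "\<And>s. 0 \<le> q s" and q1: "\<And>s. q s \<le> 1"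
    and st: "s \<le> t"
  shows "exp (LINT v:{s..t}|lborel. q v) =
    1 + (LINT u:{s..t}|lborel. q u * exp (LINT v:{u..t}|lborel. q v))"
proof -
  define Q where "Q u = (LINT v:{u..t}|lborel. q v)" for u
  have iq: "set_integrable lborel {u..v} q" for u v
    by (rule set_integrable_bounded[where B=1]) (use q0 q1 in \<open>auto simp: abs_le_iff intro: order_trans[of _ 0]\<close>)
  have Q_diff: "Q u = (LINT w:{u..v}|lborel. q w) + Q v" if "u \<le> v" "v \<le> t" for u v
  proof -
    have "(LINT w:{u..t}|lborel. q w) = (LINT w:{u..v} \<union> {v..t}|lborel. q w)"
      using that by (simp add: ivl_disj_un)
    also have "\<dots> = (LINT w:{u..v}|lborel. q w) + (LINT w:{v..t}|lborel. q w)"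
    proof (rule set_integral_Un_AE[OF _ _ _ iq iq])
      show "AE x in lborel. \<not> (x \<in> {u..v} \<and> x \<in> {v..t})"
        using AE_lborel_singleton[of v] by eventually_elim auto
    qed auto
    finally show ?thesis by (simp add: Q_def)
  qed
  have Qb: "0 \<le> (LINT w:{u..v}|lborel. q w)" "(LINT w:{u..v}|lborel. q w) \<le> v - u" if "u \<le> v" for u v
  proof -
    show "0 \<le> (LINT w:{u..v}|lborel. q w)"
      unfolding set_lebesgue_integral_def using q0 by (intro integral_nonneg_AE) auto
    have "(LINT w:{u..v}|lborel. q w) \<le> (LINT w:{u..v}|lborel. 1)"
      by (rule set_integral_mono[OF iq]) (auto intro!: q1 set_integrable_bounded[where B=1])
    then show "(LINT w:{u..v}|lborel. q w) \<le> v - u" using that by (simp add: set_lebesgue_integral_def)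
  qed
  have Q_anti: "Q v \<le> Q u" "Q u \<le> Q v + (v - u)" if "u \<le> v" "v \<le> t" for u v
    using Q_diff[OF that] Qb[OF that(1)] by auto
  have Q_zero: "Q u = (LINT v:{}|lborel. q v)" if "t < u" for u using that by (simp add: Q_def)
  have Q_meas [measurable]: "Q \<in> borel_measurable borel"
  proof -
    have "(\<lambda>u. LINT v|lborel. indicator {x. u \<le> x \<and> x \<le> t} v *\<^sub>R q v) \<in> borel_measurable borel"
      by (rule lborel.borel_measurable_lebesgue_integral) (simp add: indicator_def split_beta', measurable)
    then show ?thesis unfolding Q_def set_lebesgue_integral_def atLeastAtMost_def atLeast_def atMost_def Int_def by simp
  qed
  define D where "D = t - s"
  have Qt: "0 \<le> Q u" "Q u \<le> D" if "u \<in> {s..t}" for u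
    using Qb[of u t] that by (auto simp: Q_def D_def)
  define E where "E u = (LINT w:{u..t}|lborel. q w * exp (Q w))" for u
  have iE: "set_integrable lborel {u..v} (\<lambda>w. q w * exp (Q w))" if "s \<le> u" "v \<le> t" for u v
  proof (rule set_integrable_bounded[where B="1 * exp D"])
    fix w assume "w \<in> {u..v}"
    then show "\<bar>q w * exp (Q w)\<bar> \<le> 1 * exp D"
      unfolding abs_mult using q0[of w] q1[of w] Qt[of w] that by (intro mult_mono) auto
  qed measurable
  have E_diff: "E u = (LINT w:{u..v}|lborel. q w * exp (Q w)) + E v" if "s \<le> u" "u \<le> v" "v \<le> t" for u v
  proof -
    have "(LINT w:{u..t}|lborel. q w * exp (Q w)) = (LINT w:{u..v} \<union> {v..t}|lborel. q w * exp (Q w))"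
      using that by (simp add: ivl_disj_un)
    also have "\<dots> = (LINT w:{u..v}|lborel. q w * exp (Q w)) + (LINT w:{v..t}|lborel. q w * exp (Q w))"
    proof (rule set_integral_Un_AE)
      show "AE x in lborel. \<not> (x \<in> {u..v} \<and> x \<in> {v..t})"
        using AE_lborel_singleton[of v] by eventually_elim auto
    qed (use that iE in auto)
    finally show ?thesis by (simp add: E_def)
  qed
  define f where "f u = exp (Q u) - E u" for u
  \<comment> \<open>\<open>q\<close> is only measurable, so \<open>Q\<close> may fail to be
    differentiable at some points, and a quadratic bound on increments takes the place of a
    derivative. Both \<open>exp (Q u) - exp (Q v)\<close> and the integral \<open>I\<close> lie
    between \<open>d * exp (Q v)\<close> and \<open>d * exp (Q u)\<close>, which differ by order
    \<open>d^2\<close>.\<close>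
  have quad: "\<bar>f v - f u\<bar> \<le> (exp D * exp D) * (v - u)\<^sup>2" if "s \<le> u" "u \<le> v" "v \<le> t" for u v
  proof -
    define d I where "d = (LINT w:{u..v}|lborel. q w)" and "I = (LINT w:{u..v}|lborel. q w * exp (Q w))"
    have d: "0 \<le> d" "d \<le> v - u" using Qb[of u v] that by (auto simp: d_def)
    have Quv: "Q u = d + Q v" using Q_diff[of u v] that by (simp add: d_def)
    have "I \<le> (LINT w:{u..v}|lborel. q w * exp (Q u))"
      unfolding I_def by (rule set_integral_mono) (use that iE[of u v] iq Q_anti q0 in \<open>auto intro!: mult_left_mono\<close>)
    then have I1: "I \<le> d * exp (Q u)" by (simp add: d_def)
    have "(LINT w:{u..v}|lborel. q w * exp (Q v)) \<le> I"
      unfolding I_def by (rule set_integral_mono) (use that iE[of u v] iq Q_anti q0 in \<open>auto intro!: mult_left_mono\<close>)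
    then have I2: "d * exp (Q v) \<le> I" by (simp add: d_def)
    have e1: "d \<le> exp d - 1" using exp_ge_add_one_self[of d] by linarith
    have e2: "exp d - 1 \<le> d * exp d"
      using exp_ge_add_one_self[of "- d"] by (simp add: exp_minus field_simps)
    have "exp (Q u) - exp (Q v) = exp (Q v) * (exp d - 1)" unfolding Quv exp_add by (simp add: algebra_simps)
    moreover have "exp (Q v) * d \<le> exp (Q v) * (exp d - 1)" "exp (Q v) * (exp d - 1) \<le> exp (Q v) * (d * exp d)"
      using e1 e2 by (auto intro!: mult_left_mono)
    moreover have "exp (Q v) * (d * exp d) = d * exp (Q u)" unfolding Quv exp_add by (simp add: algebra_simps)
    ultimately have "\<bar>(exp (Q u) - exp (Q v)) - I\<bar> \<le> d * exp (Q u) - d * exp (Q v)"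
      using I1 I2 unfolding abs_le_iff by (simp only: mult.commute[of _ d]) linarith
    also have "\<dots> = d * exp (Q v) * (exp d - 1)" unfolding Quv exp_add by (simp add: algebra_simps)
    also have "\<dots> \<le> d * exp (Q v) * (d * exp d)" using e2 d by (intro mult_left_mono) auto
    also have "\<dots> = d\<^sup>2 * (exp (Q v) * exp d)" by (simp add: power2_eq_square)
    also have "\<dots> \<le> (v - u)\<^sup>2 * (exp D * exp D)"
    proof -
      have "exp (Q v) \<le> exp D" "exp d \<le> exp D" using d Qt[of v] that by (auto simp: D_def)
      then have "exp (Q v) * exp d \<le> exp D * exp D" by (intro mult_mono) simp_all
      moreover have "d\<^sup>2 \<le> (v - u)\<^sup>2" using d by (intro power_mono) simp_all
      ultimately show ?thesis
        using mult_mono[of "d\<^sup>2" "(v - u)\<^sup>2" "exp (Q v) * exp d" "exp D * exp D"] by simp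
    qed
    finally have *: "\<bar>(exp (Q u) - exp (Q v)) - I\<bar> \<le> (exp D * exp D) * (v - u)\<^sup>2" by (simp only: mult.commute)
    have "f v - f u = - ((exp (Q u) - exp (Q v)) - I)" using E_diff[of u v] that by (simp add: f_def I_def)
    then show ?thesis using * by (simp only: abs_minus_cancel)
  qed
  have f_const: "f s = f t"
  proof (cases "s = t")
    case False
    then have st': "s < t" using st by simp
    \<comment> \<open>Cutting \<open>[s, t]\<close> into \<open>n\<close> equal pieces leaves
      \<open>n\<close> increments of size at most \<open>exp D * exp D * (D / n)^2\<close>, hence a
      total of order \<open>1 / n\<close>.\<close>
    have "\<bar>f s - f t\<bar> \<le> 0 + e" if "0 < e" for e
    proof -
      obtain n :: nat where n: "exp D * exp D * D\<^sup>2 / e < real n" "0 < n"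
        using reals_Archimedean2[of "max 1 (exp D * exp D * D\<^sup>2 / e)"] by (auto simp: max_def split: if_splits) 
      define x where "x i = s + D * (real i / real n)" for i :: nat
      have x0: "x 0 = s" and xn: "x n = t" using n by (auto simp: x_def D_def)
      have step: "\<bar>f (x (Suc i)) - f (x i)\<bar> \<le> exp D * exp D * (D / n)\<^sup>2" if "i < n" for i
      proof -
        have "x (Suc i) - x i = D / n" using n by (simp add: x_def field_simps)
        moreover have "s \<le> x i" "x i \<le> x (Suc i)" using st' by (auto simp: x_def D_def intro!: divide_right_mono mult_left_mono)
        moreover have "D * (real (Suc i) / real n) \<le> D * 1" using st' that n(2) by (intro mult_left_mono) (auto simp: D_def)
        then have "x (Suc i) \<le> t" by (simp add: x_def D_def)
        ultimately show ?thesis using quad[of "x i" "x (Suc i)"] by simp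
      qed
      have "\<bar>f t - f s\<bar> = \<bar>\<Sum>i<n. f (x (Suc i)) - f (x i)\<bar>"
        using sum_lessThan_telescope[of "\<lambda>i. f (x i)" n] x0 xn by simp
      also have "\<dots> \<le> (\<Sum>i<n. exp D * exp D * (D / n)\<^sup>2)"
        by (rule order_trans[OF sum_abs]) (intro sum_mono step, simp)
      also have "\<dots> = exp D * exp D * D\<^sup>2 / n" using n(2) by (simp add: power2_eq_square)
      also have "\<dots> \<le> e" using n that by (simp add: field_simps)
      finally show ?thesis by (simp add: abs_minus_commute)
    qed
    then have "\<bar>f s - f t\<bar> \<le> 0" by (rule field_le_epsilon)
    then show ?thesis by simp
  qed simp
  have "(LINT w:{t..t}|lborel. h w) = 0" for h :: "real \<Rightarrow> real"
  proof -
    have "(LINT w:{t..t}|lborel. h w) = (LINT w|lborel. indicat_real {t} w * h t)"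
      unfolding set_lebesgue_integral_def
      by (intro Bochner_Integration.integral_cong) (auto split: split_indicator)
    then show ?thesis by simp
  qed
  then have "f t = 1" by (simp add: f_def Q_def E_def)
  then show ?thesis using f_const by (simp add: f_def Q_def E_def)
qed

text \<open>Reading the path at a grid point involves countably many coordinates and is jointly
  measurable. The \<open>+ 1\<close> in the grid index puts the grid point strictly to the right of
  \<open>t\<close>, so right continuity gives the limit as the mesh shrinks. Negative times are
  frozen at 0 because the index type is all of the reals.\<close>

lemma right_continuous_measurable:
  fixes Y :: "real \<Rightarrow> 'w \<Rightarrow> 'e::polish_space"
  assumes Y: "\<And>q. 0 \<le> q \<Longrightarrow> Y q \<in> H \<rightarrow>\<^sub>M borel"
    and rc: "\<And>w t. w \<in> space H \<Longrightarrow> 0 \<le> t \<Longrightarrow> ((\<lambda>s. Y s w) \<longlongrightarrow> Y t w) (at_right t)"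
  shows "(\<lambda>(t, w). Y (max 0 t) w) \<in> borel \<Otimes>\<^sub>M H \<rightarrow>\<^sub>M borel"
proof -
  define k where "k n t = \<lfloor>max 0 t * real (Suc n)\<rfloor> + 1" for n and t :: real
  define f where "f n z = Y (real_of_int (max 0 (k n (fst z))) / real (Suc n)) (snd z)" for n and z :: "real \<times> 'w"
  have "f n \<in> borel \<Otimes>\<^sub>M H \<rightarrow>\<^sub>M borel" for n
  proof -
    have 1: "(\<lambda>z. Y (real_of_int (max 0 i) / real (Suc n)) (snd z)) \<in> borel \<Otimes>\<^sub>M H \<rightarrow>\<^sub>M borel" for i :: int
      by (rule measurable_compose[OF measurable_snd Y]) simp
    have 2: "(\<lambda>z. k n (fst z)) \<in> borel \<Otimes>\<^sub>M H \<rightarrow>\<^sub>M count_space UNIV"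
      unfolding k_def by measurable
    show ?thesis unfolding f_def
      by (rule measurable_compose_countable[OF 1 2])
  qed
  moreover have "(\<lambda>n. f n z) \<longlonglongrightarrow> (case z of (t, w) \<Rightarrow> Y (max 0 t) w)" if "z \<in> space (borel \<Otimes>\<^sub>M H)" for z
  proof -
    obtain t w where z: "z = (t, w)" by (cases z)
    then have wt: "w \<in> space H" using that by (simp add: space_pair_measure)
    let ?t = "max 0 t"
    define s where "s n = real_of_int (max 0 (k n t)) / real (Suc n)" for n
    have s1: "?t < s n" and s2: "s n \<le> ?t + 1 / real (Suc n)" for n
    proof -
      have *: "0 \<le> \<lfloor>?t * real (Suc n)\<rfloor>" by (simp only: zero_le_floor) (simp only: zero_le_mult_iff, simp)
      have sn: "s n * real (Suc n) = real_of_int \<lfloor>?t * real (Suc n)\<rfloor> + 1"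
        using * by (simp add: s_def k_def)
      have "?t * real (Suc n) < s n * real (Suc n)" unfolding sn by linarith
      then show "?t < s n" by (rule mult_right_less_imp_less) simp
      have "s n * real (Suc n) \<le> ?t * real (Suc n) + 1" unfolding sn by linarith
      also have "\<dots> = (?t + 1 / real (Suc n)) * real (Suc n)" by (simp add: distrib_right)
      finally show "s n \<le> ?t + 1 / real (Suc n)" by (rule mult_right_le_imp_le) simp
    qed
    have "s \<longlonglongrightarrow> ?t"
    proof (rule tendsto_sandwich)
      show "\<forall>\<^sub>F n in sequentially. ?t \<le> s n" using s1 by (intro always_eventually allI order_less_imp_le)
      show "\<forall>\<^sub>F n in sequentially. s n \<le> ?t + 1 / real (Suc n)" using s2 by (intro always_eventually allI)
      show "(\<lambda>n. ?t + 1 / real (Suc n)) \<longlonglongrightarrow> ?t"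
        using tendsto_add[OF tendsto_const[of ?t] LIMSEQ_inverse_real_of_nat] by (simp add: inverse_eq_divide)
    qed simp
    moreover have "\<forall>\<^sub>F n in sequentially. s n \<in> {?t<..} \<and> s n \<noteq> ?t"
      using s1 by (intro always_eventually allI) (metis greaterThan_iff less_irrefl)
    ultimately have "filterlim s (at_right ?t) sequentially" by (simp add: filterlim_at)
    from filterlim_compose[OF rc[OF wt, of ?t] this] show ?thesis
      by (simp add: z f_def s_def)
  qed
  ultimately show ?thesis by (rule borel_measurable_LIMSEQ_metric)
qed

section \<open>Densities, the resolvent and the Markov property\<close>

context harris_process
begin

abbreviation "UU \<phi> x \<equiv> \<integral>\<^sup>+y. \<phi> y \<partial>U1 P X x"

text \<open>\<open>p\<close> is measurable only where time is positive. Setting it to 0 elsewhere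
  gives a function measurable in all three arguments over the whole line, as the repeated use of
  Fubini requires.\<close>

definition pp :: "real \<Rightarrow> 'e \<Rightarrow> 'e \<Rightarrow> ennreal" where
  "pp t x y = (if 0 < t then ennreal (p t x y) else 0)"

lemma measurable_pp [measurable (raw)]:
  assumes [measurable]: "f \<in> borel_measurable M'" "g \<in> M' \<rightarrow>\<^sub>M borel" "h \<in> M' \<rightarrow>\<^sub>M borel"
  shows "(\<lambda>z. pp (f z) (g z) (h z)) \<in> borel_measurable M'"
proof -
  have m: "(\<lambda>z. (if 0 < f z then f z else 1, g z, h z)) \<in> M' \<rightarrow>\<^sub>M restrict_space borel {0<..} \<Otimes>\<^sub>M borel \<Otimes>\<^sub>M borel"
    by (intro measurable_Pair measurable_restrict_space2) auto
  have [measurable]: "(\<lambda>z. p (if 0 < f z then f z else 1) (g z) (h z)) \<in> borel_measurable M'"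
    using measurable_compose[OF m p_measurable] by simp
  have "(\<lambda>z. pp (f z) (g z) (h z)) = (\<lambda>z. if 0 < f z then ennreal (p (if 0 < f z then f z else 1) (g z) (h z)) else 0)"
    by (auto simp: pp_def)
  then show ?thesis by simp
qed

declare sets_\<Lambda> [measurable_cong] sets_\<mu> [measurable_cong]

interpretation L: sigma_finite_measure \<Lambda> by (rule sigma_finite_\<Lambda>)

lemma space_\<Lambda> [simp]: "space \<Lambda> = UNIV" using sets_eq_imp_space_eq[OF sets_\<Lambda>] by simp

lemma P_prob: "prob_space (P x)" and sets_P [measurable_cong]: "sets (P x) = sets M"
  using measurable_space[OF P_kernel, of x] by (auto simp: space_prob_algebra)

lemma space_P [simp]: "space (P x) = space M" by (rule sets_eq_imp_space_eq[OF sets_P])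

lemma measurable_X_P: "0 \<le> t \<Longrightarrow> X t \<in> P x \<rightarrow>\<^sub>M borel"
  using X_measurable[of t] by (simp cong: measurable_cong_sets add: sets_P)

lemma sets_semigroup [simp, measurable_cong]: "sets (semigroup P X t x) = sets borel"
  by (simp add: semigroup_def)

lemma semigroup_prob: "0 \<le> t \<Longrightarrow> prob_space (semigroup P X t x)"
  unfolding semigroup_def by (rule prob_space.prob_space_distr[OF P_prob measurable_X_P])

lemma emeasure_semigroup_UNIV: "0 \<le> t \<Longrightarrow> emeasure (semigroup P X t x) UNIV = 1"
  using prob_space.emeasure_space_1[OF semigroup_prob[of t x]] by (simp add: semigroup_def)

lemma space_semigroup [simp]: "space (semigroup P X t x) = UNIV"
  by (simp add: semigroup_def)

lemma nn_integral_semigroup: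
  assumes "0 < t" "\<phi> \<in> borel_measurable borel"
  shows "(\<integral>\<^sup>+y. \<phi> y \<partial>semigroup P X t x) = (\<integral>\<^sup>+y. pp t x y * \<phi> y \<partial>\<Lambda>)"
proof -
  have "(\<lambda>y. pp t x y) \<in> borel_measurable \<Lambda>" by measurable
  moreover have "(\<lambda>y. pp t x y) = (\<lambda>y. ennreal (p t x y))" using assms by (simp add: pp_def)
  ultimately show ?thesis
    using assms by (simp add: semigroup_density nn_integral_density)
qed

lemma pp_prob: "0 < t \<Longrightarrow> (\<integral>\<^sup>+y. pp t x y \<partial>\<Lambda>) = 1"
  using nn_integral_semigroup[of t "\<lambda>_. 1" x] prob_space.emeasure_space_1[OF semigroup_prob[of t x]] by simp

lemma u1_pp: "u1 p x y = (\<integral>\<^sup>+t\<in>{0<..}. ennreal (exp (- t)) * pp t x y \<partial>lborel)"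
  unfolding u1_def by (intro nn_integral_cong) (auto simp: pp_def ennreal_mult' split: split_indicator)

lemma measurable_u1 [measurable (raw)]:
  assumes [measurable]: "g \<in> M' \<rightarrow>\<^sub>M borel" "h \<in> M' \<rightarrow>\<^sub>M borel"
  shows "(\<lambda>z. u1 p (g z) (h z)) \<in> borel_measurable M'"
  unfolding u1_pp by measurable

lemma nn_integral_u1:
  assumes [measurable]: "\<phi> \<in> borel_measurable borel"
  shows "(\<integral>\<^sup>+y. u1 p x y * \<phi> y \<partial>\<Lambda>) =
    (\<integral>\<^sup>+t\<in>{0<..}. ennreal (exp (- t)) * (\<integral>\<^sup>+y. \<phi> y \<partial>semigroup P X t x) \<partial>lborel)"
proof -
  interpret LL: pair_sigma_finite lborel \<Lambda> ..
  have "(\<integral>\<^sup>+y. u1 p x y * \<phi> y \<partial>\<Lambda>) = (\<integral>\<^sup>+y. \<integral>\<^sup>+t. ennreal (exp (- t)) * pp t x y * indicator {0<..} t * \<phi> y \<partial>lborel \<partial>\<Lambda>)"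
    unfolding u1_pp by (intro nn_integral_cong nn_integral_multc[symmetric]) measurable
  also have "\<dots> = (\<integral>\<^sup>+t. \<integral>\<^sup>+y. ennreal (exp (- t)) * pp t x y * indicator {0<..} t * \<phi> y \<partial>\<Lambda> \<partial>lborel)"
    by (rule LL.Fubini') measurable
  also have "\<dots> = (\<integral>\<^sup>+t\<in>{0<..}. ennreal (exp (- t)) * (\<integral>\<^sup>+y. \<phi> y \<partial>semigroup P X t x) \<partial>lborel)"
  proof (intro nn_integral_cong)
    fix t :: real
    have "(\<integral>\<^sup>+y. ennreal (exp (- t)) * pp t x y * indicator {0<..} t * \<phi> y \<partial>\<Lambda>) =
      (\<integral>\<^sup>+y. (ennreal (exp (- t)) * indicator {0<..} t) * (pp t x y * \<phi> y) \<partial>\<Lambda>)"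
      by (intro nn_integral_cong) (simp add: ac_simps)
    also have "\<dots> = (ennreal (exp (- t)) * indicator {0<..} t) * (\<integral>\<^sup>+y. pp t x y * \<phi> y \<partial>\<Lambda>)"
      by (rule nn_integral_cmult) measurable
    finally show "(\<integral>\<^sup>+y. ennreal (exp (- t)) * pp t x y * indicator {0<..} t * \<phi> y \<partial>\<Lambda>) =
      ennreal (exp (- t)) * (\<integral>\<^sup>+y. \<phi> y \<partial>semigroup P X t x) * indicator {0<..} t"
      by (cases "0 < t") (simp_all add: nn_integral_semigroup)
  qed
  finally show ?thesis .
qed

text \<open>\<open>U1\<close> is introduced through \<open>measure_of\<close>, which returns the
  intended values only for a countably additive set function. Tonelli identifies that set function
  with the measure of density \<open>u1\<close>, which settles additivity and absolute continuity at
  once.\<close>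

lemma U1_density: "U1 P X x = density \<Lambda> (u1 p x)"
proof -
  let ?D = "density \<Lambda> (u1 p x)"
  have D: "sets ?D = sets borel" "space ?D = UNIV" by (simp_all add: sets_\<Lambda>)
  have "emeasure ?D B = (\<integral>\<^sup>+t\<in>{0..}. ennreal (exp (- t)) * emeasure (semigroup P X t x) B \<partial>lborel)"
    if B: "B \<in> sets borel" for B
  proof -
    have "emeasure ?D B = (\<integral>\<^sup>+y. u1 p x y * indicator B y \<partial>\<Lambda>)"
      by (rule emeasure_density) (use B in \<open>auto simp: sets_\<Lambda>\<close>)
    also have "\<dots> = (\<integral>\<^sup>+t\<in>{0<..}. ennreal (exp (- t)) * emeasure (semigroup P X t x) B \<partial>lborel)"
      using B by (subst nn_integral_u1) (auto simp: nn_integral_indicator)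
    also have "\<dots> = (\<integral>\<^sup>+t\<in>{0..}. ennreal (exp (- t)) * emeasure (semigroup P X t x) B \<partial>lborel)"
    proof (rule nn_integral_cong_AE)
      show "AE t in lborel. ennreal (exp (- t)) * emeasure (semigroup P X t x) B * indicator {0<..} t =
        ennreal (exp (- t)) * emeasure (semigroup P X t x) B * indicator {0..} t"
        using AE_lborel_singleton[of 0] by eventually_elim (auto split: split_indicator)
    qed
    finally show ?thesis .
  qed
  then have "U1 P X x = measure_of UNIV (sets borel) (emeasure ?D)"
    unfolding U1_def by (intro measure_of_eq) (auto simp: sets.sigma_sets_eq[of borel, simplified])
  also have "\<dots> = ?D" using measure_of_of_measure[of ?D] D by simp
  finally show ?thesis .
qed

lemma sets_U1 [simp, measurable_cong]: "sets (U1 P X x) = sets borel"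
  by (simp add: U1_density sets_\<Lambda>)

lemma space_U1 [simp]: "space (U1 P X x) = UNIV" using sets_eq_imp_space_eq[OF sets_U1] by simp

lemma nn_integral_U1_u1:
  assumes [measurable]: "\<phi> \<in> borel_measurable borel"
  shows "UU \<phi> x = (\<integral>\<^sup>+y. u1 p x y * \<phi> y \<partial>\<Lambda>)"
  unfolding U1_density by (rule nn_integral_density) measurable

lemma nn_integral_U1:
  assumes [measurable]: "\<phi> \<in> borel_measurable borel"
  shows "UU \<phi> x = (\<integral>\<^sup>+t\<in>{0<..}. ennreal (exp (- t)) * (\<integral>\<^sup>+y. \<phi> y \<partial>semigroup P X t x) \<partial>lborel)"
  by (simp add: nn_integral_U1_u1 nn_integral_u1)

lemma nn_integral_exp_shift: "(\<integral>\<^sup>+t\<in>{v<..}. ennreal (exp (v - t)) \<partial>lborel) = 1"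
proof -
  have "(\<integral>\<^sup>+t\<in>{v<..}. ennreal (exp (v - t)) \<partial>lborel) = (\<integral>\<^sup>+t\<in>{v..}. ennreal (exp (v - t)) \<partial>lborel)"
    by (rule nn_integral_cong_AE, use AE_lborel_singleton[of v] in eventually_elim) (auto split: split_indicator)
  also have "\<dots> = ennreal (0 - (- exp (v - v)))"
  proof (rule nn_integral_FTC_atLeast[where F="\<lambda>t. - exp (v - t)"])
    show "DERIV (\<lambda>t. - exp (v - t)) t :> exp (v - t)" for t by (auto intro!: derivative_eq_intros)
    show "((\<lambda>t. - exp (v - t)) \<longlongrightarrow> 0) at_top"
    proof -
      have "filterlim (\<lambda>t. v - t) at_bot at_top" 
        using filterlim_tendsto_add_at_top[OF tendsto_const[of "-v"] filterlim_ident]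
        by (simp add: filterlim_uminus_at_top)
      then have "((\<lambda>t. exp (v - t)) \<longlongrightarrow> 0) at_top" by (rule filterlim_compose[OF exp_at_bot])
      then show ?thesis using tendsto_minus by fastforce
    qed
  qed auto
  finally show ?thesis by simp
qed

lemma U1_prob: "prob_space (U1 P X x)"
proof
  have "emeasure (U1 P X x) (space (U1 P X x)) = UU (\<lambda>_. 1) x" by simp
  also have "\<dots> = (\<integral>\<^sup>+t\<in>{0<..}. ennreal (exp (0 - t)) \<partial>lborel)"
    by (subst nn_integral_U1)
      (auto intro!: nn_integral_cong simp: emeasure_semigroup_UNIV split: split_indicator)
  finally show "emeasure (U1 P X x) (space (U1 P X x)) = 1" by (simp only: nn_integral_exp_shift)
qed

lemma measurable_U1 [measurable]: "U1 P X \<in> borel \<rightarrow>\<^sub>M subprob_algebra borel"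
proof (rule measurable_subprob_algebra)
  show "subprob_space (U1 P X x)" for x using U1_prob by (rule prob_space_imp_subprob_space)
  show "(\<lambda>x. emeasure (U1 P X x) B) \<in> borel_measurable borel" if "B \<in> sets borel" for B
  proof -
    note [measurable] = that
    have "(\<lambda>x. emeasure (U1 P X x) B) = (\<lambda>x. \<integral>\<^sup>+y. u1 p x y * indicator B y \<partial>\<Lambda>)"
      using nn_integral_U1_u1[of "indicator B"] by auto
    then show ?thesis by simp
  qed
qed simp

lemma measurable_UU [measurable (raw)]:
  assumes [measurable]: "(\<lambda>(z, y). \<phi> z y) \<in> borel_measurable (M' \<Otimes>\<^sub>M borel)" "g \<in> M' \<rightarrow>\<^sub>M borel"
  shows "(\<lambda>z. UU (\<phi> z) (g z)) \<in> borel_measurable M'"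
  by (rule nn_integral_measurable_subprob_algebra2[where N=borel]) (auto intro: measurable_compose[OF _ measurable_U1])

lemma measurable_path [measurable (raw)]:
  assumes [measurable]: "f \<in> borel_measurable M'" "g \<in> M' \<rightarrow>\<^sub>M M"
  shows "(\<lambda>z. X (max 0 (f z)) (g z)) \<in> M' \<rightarrow>\<^sub>M borel"
proof -
  have 1: "(\<lambda>(t, w). X (max 0 t) w) \<in> borel \<Otimes>\<^sub>M M \<rightarrow>\<^sub>M borel"
    by (rule right_continuous_measurable) (use X_measurable X_cadlag in \<open>auto simp: cadlag_def\<close>)
  show ?thesis using measurable_compose[OF measurable_Pair[OF assms] 1] by simp
qed

lemma space_F [simp]: "space (natural_filtration M X t) = space M"
  unfolding natural_filtration_def by (rule space_measure_of) auto

lemma sets_F: "sets (natural_filtration M X t) = sigma_sets (space M) {X s -` B \<inter> space M | s B. 0 \<le> s \<and> ennreal s \<le> t \<and> B \<in> sets borel}"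
  unfolding natural_filtration_def by (rule sets_measure_of) auto

lemma F_mono: "s \<le> t \<Longrightarrow> sets (natural_filtration M X s) \<subseteq> sets (natural_filtration M X t)"
  unfolding sets_F by (rule sigma_sets_mono') (auto intro: order_trans)

lemma F_subset_M: "sets (natural_filtration M X t) \<subseteq> sets M"
  unfolding sets_F by (rule sets.sigma_sets_subset) (auto intro: measurable_sets[OF X_measurable])

lemma X_F: "0 \<le> s \<Longrightarrow> s \<le> t \<Longrightarrow> X s \<in> natural_filtration M X (ennreal t) \<rightarrow>\<^sub>M borel"
proof (rule measurableI)
  fix A :: "'e set" assume "0 \<le> s" "s \<le> t" "A \<in> sets borel"
  then show "X s -` A \<inter> space (natural_filtration M X (ennreal t)) \<in> sets (natural_filtration M X (ennreal t))"
    unfolding sets_F space_F by (intro sigma_sets.Basic) (auto intro: ennreal_leI)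
qed auto

lemma F_measurable_mono:
  assumes "f \<in> borel_measurable (natural_filtration M X (ennreal s))" "s \<le> t"
  shows "f \<in> borel_measurable (natural_filtration M X (ennreal t))"
  using assms F_mono[OF ennreal_leI[OF assms(2)]] by (auto simp: measurable_def)

lemma F_measurable_M:
  assumes "f \<in> borel_measurable (natural_filtration M X t)" shows "f \<in> borel_measurable M"
  using assms F_subset_M[of t] by (auto simp: measurable_def)

lemma markov_at:
  fixes W :: "'w \<Rightarrow> ennreal"
  assumes s: "0 \<le> s" and t: "0 < t" and W: "W \<in> borel_measurable (natural_filtration M X (ennreal s))"
    and \<phi> [measurable]: "\<phi> \<in> borel_measurable borel"
  shows "(\<integral>\<^sup>+w. W w * \<phi> (X (s + t) w) \<partial>P x) = (\<integral>\<^sup>+w. W w * (\<integral>\<^sup>+y. pp t (X s w) y * \<phi> y \<partial>\<Lambda>) \<partial>P x)"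
proof -
  let ?F = "natural_filtration M X" and ?\<tau> = "\<lambda>_::'w. ennreal s"
  interpret F: filtration "space M" ?F
    by unfold_locales (auto intro: F_mono[THEN subsetD])
  have tau: "stopping_time ?F ?\<tau>" by (rule stopping_time_const)
  note [measurable] = X_F[OF s order_refl]
  have "(\<integral>\<^sup>+w. 1 * (case (w, X (s + t) w) of (w, y) \<Rightarrow> W w * \<phi> y) \<partial>P x) =
    (\<integral>\<^sup>+w. \<integral>\<^sup>+y. (case (w, y) of (w, y) \<Rightarrow> W w * \<phi> y) \<partial>density \<Lambda> (\<lambda>y. pp t (X s w) y) \<partial>P x)"
  proof (rule nn_integral_kernel_step[where H="?F (ennreal s)" and L=borel and e="\<lambda>_. 1", OF P_prob])
    show "space (?F (ennreal s)) = space (P x)" by simp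
    show "sets (?F (ennreal s)) \<subseteq> sets (P x)" using F_subset_M by (simp add: sets_P)
    show "X (s + t) \<in> P x \<rightarrow>\<^sub>M borel" using s t by (intro measurable_X_P) auto
    show "(\<lambda>w. \<integral>\<^sup>+y. \<psi> (w, y) \<partial>density \<Lambda> (pp t (X s w))) \<in> borel_measurable (?F (ennreal s))"
      if [measurable]: "\<psi> \<in> borel_measurable (?F (ennreal s) \<Otimes>\<^sub>M borel)" for \<psi>
    proof -
      have "(\<lambda>w. \<integral>\<^sup>+y. pp t (X s w) y * \<psi> (w, y) \<partial>\<Lambda>) \<in> borel_measurable (?F (ennreal s))" by measurable
      then show ?thesis by (rule measurable_cong[THEN iffD1, rotated]) (subst nn_integral_density, auto)
    qed
    show "(\<lambda>(w, y). W w * \<phi> y) \<in> borel_measurable (?F (ennreal s) \<Otimes>\<^sub>M borel)"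
      using W by measurable
    fix G B assume G: "G \<in> sets (?F (ennreal s))" and B [measurable]: "B \<in> sets (borel :: 'e measure)"
    have GM [measurable]: "G \<in> sets M" using G F_subset_M by auto
    \<comment> \<open>For the constant time \<open>s\<close>, every event of the filtration at
      \<open>s\<close> belongs to the stopped sigma-algebra: the set to be tested is
      \<open>G\<close> or empty.\<close>
    have Gp: "G \<in> sets (F.pre_sigma ?\<tau>)"
    proof (rule F.sets_pre_sigmaI[OF tau])
      fix r show "{w \<in> G. ennreal s \<le> r} \<in> sets (?F r)"
        using G F_mono[of "ennreal s" r] by (cases "ennreal s \<le> r") auto
    qed
    have [measurable]: "X (s + t) \<in> P x \<rightarrow>\<^sub>M borel" "X s \<in> P x \<rightarrow>\<^sub>M borel" using s t by (auto intro: measurable_X_P)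
    have "emeasure (P x) {w \<in> G. ?\<tau> w < \<infinity> \<and> X (enn2real (?\<tau> w) + t) w \<in> B} =
        (\<integral>\<^sup>+w \<in> {w \<in> G. ?\<tau> w < \<infinity>}. emeasure (semigroup P X t (X (enn2real (?\<tau> w)) w)) B \<partial>P x)"
      using X_strong_markov tau Gp t B unfolding strong_markov_def by (meson less_imp_le)
    then have eq: "emeasure (P x) {w \<in> G. X (s + t) w \<in> B} =
        (\<integral>\<^sup>+w\<in>G. emeasure (semigroup P X t (X s w)) B \<partial>P x)"
      using s by simp
    have "(\<integral>\<^sup>+w. 1 * indicator G w * indicator B (X (s + t) w) \<partial>P x) = (\<integral>\<^sup>+w. indicator {w \<in> G. X (s + t) w \<in> B} w \<partial>P x)"
      by (intro nn_integral_cong) (auto split: split_indicator)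
    also have "\<dots> = emeasure (P x) {w \<in> G. X (s + t) w \<in> B}"
    proof (rule nn_integral_indicator)
      have "{w \<in> G. X (s + t) w \<in> B} = G \<inter> (X (s + t) -` B \<inter> space (P x))"
        using sets.sets_into_space[OF GM] by auto
      then show "{w \<in> G. X (s + t) w \<in> B} \<in> sets (P x)" by (simp add: measurable_sets[OF \<open>X (s+t) \<in> _\<close>] sets_P)
    qed
    also have "\<dots> = (\<integral>\<^sup>+w. indicator G w * emeasure (density \<Lambda> (pp t (X s w))) B \<partial>P x)"
      unfolding eq
    proof (intro nn_integral_cong)
      fix w
      have "pp t (X s w) = (\<lambda>y. ennreal (p t (X s w) y))" using t by (auto simp: pp_def)
      then show "emeasure (semigroup P X t (X s w)) B * indicator G w = indicator G w * emeasure (density \<Lambda> (pp t (X s w))) B"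
        using t by (simp add: semigroup_density mult.commute)
    qed
    finally show "(\<integral>\<^sup>+w. 1 * indicator G w * indicator B (X (s + t) w) \<partial>P x) =
      (\<integral>\<^sup>+w. indicator G w * emeasure (density \<Lambda> (pp t (X s w))) B \<partial>P x)" .
  qed (auto simp: sets_\<Lambda>)
  moreover have "(\<integral>\<^sup>+y. W w * \<phi> y \<partial>density \<Lambda> (pp t (X s w))) = W w * (\<integral>\<^sup>+y. pp t (X s w) y * \<phi> y \<partial>\<Lambda>)" for w
    by (subst nn_integral_density) (auto simp: nn_integral_cmult mult.left_commute)
  ultimately show ?thesis by simp
qed

text \<open>An exponential clock of rate 1, independent of the path and started at \<open>s\<close>,
  moves the path by \<open>U1\<close>. The clock is integrated out as the density
  \<open>exp (s - u)\<close>, so everything stays on the space of the path.\<close>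

lemma markov_U1:
  fixes W :: "'w \<Rightarrow> ennreal"
  assumes s: "0 \<le> s" and W: "W \<in> borel_measurable (natural_filtration M X (ennreal s))"
    and \<phi> [measurable]: "\<phi> \<in> borel_measurable borel"
  shows "(\<integral>\<^sup>+u. ennreal (exp (s - u)) * indicator {s<..} u * (\<integral>\<^sup>+w. W w * \<phi> (X (max 0 u) w) \<partial>P x) \<partial>lborel) =
    (\<integral>\<^sup>+w. W w * UU \<phi> (X s w) \<partial>P x)"
proof -
  interpret prob_space "P x" by (rule P_prob)
  interpret LP: pair_sigma_finite lborel "P x" ..
  have [measurable]: "W \<in> borel_measurable (P x)" "X s \<in> P x \<rightarrow>\<^sub>M borel"
    using F_measurable_M[OF W] measurable_X_P[OF s] by (auto cong: measurable_cong_sets simp: sets_P)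
  have "(\<integral>\<^sup>+u. ennreal (exp (s - u)) * indicator {s<..} u * (\<integral>\<^sup>+w. W w * \<phi> (X (max 0 u) w) \<partial>P x) \<partial>lborel) =
    (\<integral>\<^sup>+u. ennreal (exp (s - (s + 1 * u))) * indicator {s<..} (s + 1 * u) * (\<integral>\<^sup>+w. W w * \<phi> (X (max 0 (s + 1 * u)) w) \<partial>P x) \<partial>lborel)"
    by (subst nn_integral_real_affine[where c=1 and t=s]) auto
  also have "\<dots> = (\<integral>\<^sup>+u. \<integral>\<^sup>+w. W w * (ennreal (exp (- u)) * (\<integral>\<^sup>+y. pp u (X s w) y * \<phi> y \<partial>\<Lambda>) * indicator {0<..} u) \<partial>P x \<partial>lborel)"
  proof (intro nn_integral_cong)
    fix u :: real
    show "ennreal (exp (s - (s + 1 * u))) * indicator {s<..} (s + 1 * u) * (\<integral>\<^sup>+w. W w * \<phi> (X (max 0 (s + 1 * u)) w) \<partial>P x) =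
      (\<integral>\<^sup>+w. W w * (ennreal (exp (- u)) * (\<integral>\<^sup>+y. pp u (X s w) y * \<phi> y \<partial>\<Lambda>) * indicator {0<..} u) \<partial>P x)"
    proof (cases "0 < u")
      case True
      then have "(\<integral>\<^sup>+w. W w * \<phi> (X (max 0 (s + 1 * u)) w) \<partial>P x) = (\<integral>\<^sup>+w. W w * (\<integral>\<^sup>+y. pp u (X s w) y * \<phi> y \<partial>\<Lambda>) \<partial>P x)"
        using markov_at[OF s True W \<phi>, of x] s by (simp add: max_def)
      then show ?thesis using True
        by (simp add: nn_integral_cmult[symmetric] ac_simps)
    qed simp
  qed
  also have "\<dots> = (\<integral>\<^sup>+w. \<integral>\<^sup>+u. W w * (ennreal (exp (- u)) * (\<integral>\<^sup>+y. pp u (X s w) y * \<phi> y \<partial>\<Lambda>) * indicator {0<..} u) \<partial>lborel \<partial>P x)"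
    by (rule LP.Fubini'[symmetric]) measurable
  also have "\<dots> = (\<integral>\<^sup>+w. W w * UU \<phi> (X s w) \<partial>P x)"
  proof (intro nn_integral_cong)
    fix w
    have "UU \<phi> (X s w) = (\<integral>\<^sup>+u. ennreal (exp (- u)) * (\<integral>\<^sup>+y. pp u (X s w) y * \<phi> y \<partial>\<Lambda>) * indicator {0<..} u \<partial>lborel)"
      unfolding nn_integral_U1[OF \<phi>]
      by (intro nn_integral_cong) (auto simp: nn_integral_semigroup split: split_indicator)
    then show "(\<integral>\<^sup>+u. W w * (ennreal (exp (- u)) * (\<integral>\<^sup>+y. pp u (X s w) y * \<phi> y \<partial>\<Lambda>) * indicator {0<..} u) \<partial>lborel) = W w * UU \<phi> (X s w)"
      by (simp add: nn_integral_cmult)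
  qed
  finally show ?thesis .
qed

text \<open>Take the ticks of a rate 1 Poisson clock after time \<open>s\<close>. For a fixed path
  \<open>w\<close>, this is the mean over the clock of \<open>g\<close> at tick \<open>n + 1\<close>
  times the product of \<open>q\<close> over the first \<open>n\<close> ticks. Averaging over the
  path as well gives \<open>iterated_U1\<close>.\<close>

primrec iterated_path :: "('e \<Rightarrow> real) \<Rightarrow> ('e \<Rightarrow> ennreal) \<Rightarrow> nat \<Rightarrow> real \<Rightarrow> 'w \<Rightarrow> ennreal" where
  "iterated_path q g 0 s w = (\<integral>\<^sup>+u. ennreal (exp (s - u)) * indicator {s<..} u * g (X (max 0 u) w) \<partial>lborel)"
| "iterated_path q g (Suc n) s w = (\<integral>\<^sup>+u. ennreal (exp (s - u)) * indicator {s<..} u * (ennreal (q (X (max 0 u) w)) * iterated_path q g n u w) \<partial>lborel)"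

primrec iterated_U1 :: "('e \<Rightarrow> real) \<Rightarrow> ('e \<Rightarrow> ennreal) \<Rightarrow> nat \<Rightarrow> 'e \<Rightarrow> ennreal" where
  "iterated_U1 q g 0 x = UU g x"
| "iterated_U1 q g (Suc n) x = UU (\<lambda>y. ennreal (q y) * iterated_U1 q g n y) x"

lemma measurable_iterated_path:
  assumes [measurable]: "q \<in> borel_measurable borel" "g \<in> borel_measurable borel"
  shows "(\<lambda>(s, w). iterated_path q g n s w) \<in> borel_measurable (borel \<Otimes>\<^sub>M M)"
proof (induction n)
  case (Suc n)
  then have [measurable (raw)]: "(\<lambda>z. iterated_path q g n (f z) (h z)) \<in> borel_measurable M'"
    if "f \<in> borel_measurable M'" "h \<in> M' \<rightarrow>\<^sub>M M" for f h and M' :: "((real \<times> 'w) \<times> real) measure"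
    using measurable_compose[OF measurable_Pair[OF that] Suc] by simp
  show ?case unfolding iterated_path.simps split_beta' indicator_def greaterThan_iff by measurable
next
  case 0
  show ?case unfolding iterated_path.simps split_beta' indicator_def greaterThan_iff by measurable
qed

lemma measurable_iterated_U1 [measurable]:
  assumes [measurable]: "q \<in> borel_measurable borel" "g \<in> borel_measurable borel"
  shows "iterated_U1 q g n \<in> borel_measurable borel"
proof (induction n)
  case (Suc n)
  note [measurable] = Suc
  show ?case by (simp add: measurable_UU)
qed (simp add: measurable_UU)

lemma iterated_path_integral:
  assumes [measurable]: "q \<in> borel_measurable borel" "g \<in> borel_measurable borel"
  shows "0 \<le> s \<Longrightarrow> W \<in> borel_measurable (natural_filtration M X (ennreal s)) \<Longrightarrow>
    (\<integral>\<^sup>+w. W w * iterated_path q g n s w \<partial>P x) = (\<integral>\<^sup>+w. W w * iterated_U1 q g n (X s w) \<partial>P x)"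
proof (induction n arbitrary: s W)
  case 0
  interpret prob_space "P x" by (rule P_prob)
  interpret LP: pair_sigma_finite lborel "P x" ..
  have [measurable]: "W \<in> borel_measurable (P x)"
    using F_measurable_M[OF 0(2)] by (auto cong: measurable_cong_sets simp: sets_P)
  have "(\<integral>\<^sup>+w. W w * iterated_path q g 0 s w \<partial>P x) =
    (\<integral>\<^sup>+w. \<integral>\<^sup>+u. ennreal (exp (s - u)) * indicator {s<..} u * (W w * g (X (max 0 u) w)) \<partial>lborel \<partial>P x)"
  proof (intro nn_integral_cong)
    fix w assume "w \<in> space (P x)"
    then have [measurable]: "w \<in> space M" by simp
    show "W w * iterated_path q g 0 s w = (\<integral>\<^sup>+u. ennreal (exp (s - u)) * indicator {s<..} u * (W w * g (X (max 0 u) w)) \<partial>lborel)" 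
      unfolding iterated_path.simps
      by (subst nn_integral_cmult[symmetric]) (auto intro!: nn_integral_cong simp: mult_ac)
  qed
  also have "\<dots> = (\<integral>\<^sup>+u. \<integral>\<^sup>+w. ennreal (exp (s - u)) * indicator {s<..} u * (W w * g (X (max 0 u) w)) \<partial>P x \<partial>lborel)"
    by (rule LP.Fubini') measurable
  also have "\<dots> = (\<integral>\<^sup>+u. ennreal (exp (s - u)) * indicator {s<..} u * (\<integral>\<^sup>+w. W w * g (X (max 0 u) w) \<partial>P x) \<partial>lborel)"
    by (intro nn_integral_cong nn_integral_cmult) measurable
  also have "\<dots> = (\<integral>\<^sup>+w. W w * iterated_U1 q g 0 (X s w) \<partial>P x)"
    using markov_U1[OF 0] by simp
  finally show ?case .
next
  case (Suc n)
  interpret prob_space "P x" by (rule P_prob)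
  interpret LP: pair_sigma_finite lborel "P x" ..
  have [measurable]: "W \<in> borel_measurable (P x)"
    using F_measurable_M[OF Suc(3)] by (auto cong: measurable_cong_sets simp: sets_P)
  have [measurable (raw)]: "(\<lambda>z. iterated_path q g n (f z) (h z)) \<in> borel_measurable M'"
    if "f \<in> borel_measurable M'" "h \<in> M' \<rightarrow>\<^sub>M M" for f h and M' :: "'z measure"
    using measurable_compose[OF measurable_Pair[OF that] measurable_iterated_path[of q g n]] assms by simp
  have "(\<integral>\<^sup>+w. W w * iterated_path q g (Suc n) s w \<partial>P x) =
    (\<integral>\<^sup>+w. \<integral>\<^sup>+u. ennreal (exp (s - u)) * indicator {s<..} u * (W w * ennreal (q (X (max 0 u) w)) * iterated_path q g n u w) \<partial>lborel \<partial>P x)"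
  proof (intro nn_integral_cong)
    fix w assume "w \<in> space (P x)"
    then have [measurable]: "w \<in> space M" by simp
    show "W w * iterated_path q g (Suc n) s w = (\<integral>\<^sup>+u. ennreal (exp (s - u)) * indicator {s<..} u * (W w * ennreal (q (X (max 0 u) w)) * iterated_path q g n u w) \<partial>lborel)" 
      unfolding iterated_path.simps
      by (subst nn_integral_cmult[symmetric]) (auto intro!: nn_integral_cong simp: mult_ac)
  qed
  also have "\<dots> = (\<integral>\<^sup>+u. \<integral>\<^sup>+w. ennreal (exp (s - u)) * indicator {s<..} u * (W w * ennreal (q (X (max 0 u) w)) * iterated_path q g n u w) \<partial>P x \<partial>lborel)"
    by (rule LP.Fubini') measurable
  also have "\<dots> = (\<integral>\<^sup>+u. ennreal (exp (s - u)) * indicator {s<..} u * (\<integral>\<^sup>+w. W w * (ennreal (q (X (max 0 u) w)) * iterated_U1 q g n (X (max 0 u) w)) \<partial>P x) \<partial>lborel)"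
  proof (intro nn_integral_cong)
    fix u :: real
    show "(\<integral>\<^sup>+w. ennreal (exp (s - u)) * indicator {s<..} u * (W w * ennreal (q (X (max 0 u) w)) * iterated_path q g n u w) \<partial>P x) =
      ennreal (exp (s - u)) * indicator {s<..} u * (\<integral>\<^sup>+w. W w * (ennreal (q (X (max 0 u) w)) * iterated_U1 q g n (X (max 0 u) w)) \<partial>P x)"
    proof (cases "s < u")
      case True
      then have u: "0 \<le> u" "s \<le> u" using Suc(2) by auto
      have [measurable]: "W \<in> borel_measurable (natural_filtration M X (ennreal u))"
        by (rule F_measurable_mono[OF Suc(3) u(2)])
      have [measurable]: "X u \<in> natural_filtration M X (ennreal u) \<rightarrow>\<^sub>M borel" using X_F u by simp
      have Wq: "(\<lambda>w. W w * ennreal (q (X (max 0 u) w))) \<in> borel_measurable (natural_filtration M X (ennreal u))"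
        using u by (simp add: max_def)
      have [measurable]: "X u \<in> P x \<rightarrow>\<^sub>M borel" using measurable_X_P u by simp
      from Suc.IH[OF u(1) Wq] show ?thesis using True u
        by (simp add: nn_integral_cmult max_def mult.assoc)
    qed simp
  qed
  also have "\<dots> = (\<integral>\<^sup>+w. W w * iterated_U1 q g (Suc n) (X s w) \<partial>P x)"
    using markov_U1[OF Suc(2,3), of "\<lambda>y. ennreal (q y) * iterated_U1 q g n y" x] by simp
  finally show ?case .
qed

text \<open>Thinning: if a tick survives with probability \<open>1 - h\<close> at its position, then
  with probability \<open>exp (- \<integral> h)\<close> no tick in \<open>(s, t)\<close> fails.
  Summing over all \<open>n\<close> would give equality; partial sums allow an induction that splits
  at the first tick and applies the bound for \<open>N\<close> terms from there on.\<close>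

lemma discounted_path_integral:
  assumes [measurable]: "h \<in> borel_measurable borel" and g [measurable]: "g \<in> borel_measurable borel"
    and h: "\<And>x. 0 \<le> h x" "\<And>x. h x \<le> 1" and wt: "w \<in> space M" and s: "0 \<le> s"
  shows "(\<Sum>n<N. iterated_path (\<lambda>x. 1 - h x) g n s w) \<le>
    (\<integral>\<^sup>+t. ennreal (exp (- (LINT v:{s..t}|lborel. h (X (max 0 v) w)))) * indicator {s<..} t * g (X (max 0 t) w) \<partial>lborel)"
  using s
proof (induction N arbitrary: s)
  case (Suc N)
  define q where "q v = 1 - h (X (max 0 v) w)" for v
  define gw where "gw v = g (X (max 0 v) w)" for v
  have [measurable]: "(\<lambda>v. X (max 0 v) w) \<in> borel \<rightarrow>\<^sub>M borel" using wt by measurable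
  have [measurable]: "q \<in> borel_measurable borel" "gw \<in> borel_measurable borel" unfolding q_def gw_def by measurable
  have q01: "0 \<le> q v" "q v \<le> 1" for v using h by (auto simp: q_def)
  have iq: "set_integrable lborel {u..t} q" for u t
    by (rule set_integrable_bounded[where B=1]) (use q01 in auto)
  have ih: "(LINT v:{u..t}|lborel. h (X (max 0 v) w)) = (t - u) - (LINT v:{u..t}|lborel. q v)" if "u \<le> t" for u t
  proof -
    have "(LINT v:{u..t}|lborel. h (X (max 0 v) w)) = (LINT v:{u..t}|lborel. 1 - q v)" by (simp add: q_def)
    also have "\<dots> = (LINT v:{u..t}|lborel. 1) - (LINT v:{u..t}|lborel. q v)"
      by (rule set_integral_diff(2)) (use iq in \<open>auto intro: set_integrable_bounded[where B=1]\<close>)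
    finally show ?thesis using that by (simp add: set_lebesgue_integral_def)
  qed
  define E where "E u t = exp (- (LINT v:{u..t}|lborel. h (X (max 0 v) w)))" for u t
  have E_eq: "E u t = exp (u - t) * exp (LINT v:{u..t}|lborel. q v)" if "u \<le> t" for u t
    using ih[OF that] by (simp add: E_def exp_add[symmetric])
  have Em: "(\<lambda>z. E (f z) (k z)) \<in> borel_measurable M'"
    if [measurable]: "f \<in> borel_measurable M'" "k \<in> borel_measurable M'" for f k and M' :: "'z measure"
  proof -
    have "(\<lambda>z. LINT v|lborel. indicator {x. f z \<le> x \<and> x \<le> k z} v *\<^sub>R h (X (max 0 v) w)) \<in> borel_measurable M'"
      by (rule lborel.borel_measurable_lebesgue_integral) (simp add: indicator_def split_beta', measurable)
    moreover have "{x. f z \<le> x \<and> x \<le> k z} = {f z..k z}" for z by auto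
    ultimately show ?thesis unfolding E_def set_lebesgue_integral_def by simp
  qed
  have E1: "(\<lambda>v. E u v) \<in> borel_measurable borel" for u
    by (rule Em[of "\<lambda>_. u" borel "\<lambda>v. v"]; measurable)
  have E2: "(\<lambda>v. E v u) \<in> borel_measurable borel" for u
    by (rule Em[of "\<lambda>v. v" borel "\<lambda>_. u"]; measurable)
  have E3: "(\<lambda>z. E (fst z) (snd z)) \<in> borel_measurable (borel \<Otimes>\<^sub>M borel)"
    by (rule Em; measurable)
  note [measurable] = E1 E2 E3
  \<comment> \<open>Either there is no tick in \<open>(s, t)\<close>, or the first one, at
    \<open>u\<close>, survives. With \<open>exp (s - t)\<close> factored out this is
    \<open>exp_integral_formula\<close>.\<close>
  have key: "ennreal (exp (s - t)) + (\<integral>\<^sup>+u. ennreal (exp (s - u) * q u * E u t) * indicator {s<..<t} u \<partial>lborel) = ennreal (E s t)" if "s < t" for t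
  proof -
    have "(\<integral>\<^sup>+u. ennreal (exp (s - u) * q u * E u t) * indicator {s<..<t} u \<partial>lborel) =
      (\<integral>\<^sup>+u\<in>{s..t}. ennreal (exp (s - t) * (q u * exp (LINT v:{u..t}|lborel. q v))) \<partial>lborel)"
    proof (rule nn_integral_cong_AE)
      show "AE u in lborel. ennreal (exp (s - u) * q u * E u t) * indicator {s<..<t} u =
        ennreal (exp (s - t) * (q u * exp (LINT v:{u..t}|lborel. q v))) * indicator {s..t} u"
        using AE_lborel_singleton[of s] AE_lborel_singleton[of t]
      proof eventually_elim
        case (elim u)
        have "exp (s - u) * exp (u - t) = exp (s - t)" by (simp add: exp_add[symmetric])
        then have "exp (s - u) * q u * (exp (u - t) * Y) = exp (s - t) * (q u * Y)" for Y
            by (simp only: mult.assoc mult.left_commute[of "q u"] \<open>exp (s - u) * exp (u - t) = exp (s - t)\<close>[symmetric])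
          then have "exp (s - u) * q u * E u t = exp (s - t) * (q u * exp (LINT v:{u..t}|lborel. q v))" if "u \<le> t"
            unfolding E_eq[OF that] .
          note eq = this
          show ?case
          proof (cases "s < u \<and> u < t")
            case True
            then have "u \<in> {s<..<t}" "u \<in> {s..t}" "u \<le> t" by auto
            then show ?thesis by (simp only: indicator_simps eq)
          next
            case False
            then have z: "indicator {s<..<t} u = (0::ennreal)" "indicator {s..t} u = (0::ennreal)"
              using elim by (auto split: split_indicator)
            show ?thesis unfolding z by simp
          qed
      qed
    qed
    also have "\<dots> = ennreal (LINT u:{s..t}|lborel. exp (s - t) * (q u * exp (LINT v:{u..t}|lborel. q v)))"
    proof (rule nn_set_integral_eq_LINT)
      have [measurable]: "(\<lambda>u. LINT v:{u..t}|lborel. q v) \<in> borel_measurable borel"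
      proof -
        have "(\<lambda>z. LINT v|lborel. indicator {x. z \<le> x \<and> x \<le> t} v *\<^sub>R q v) \<in> borel_measurable borel"
          by (rule lborel.borel_measurable_lebesgue_integral) (simp add: indicator_def split_beta', measurable)
        moreover have "{x. z \<le> x \<and> x \<le> t} = {z..t}" for z by auto
        ultimately show ?thesis unfolding set_lebesgue_integral_def by simp
      qed
      show "set_integrable lborel {s..t} (\<lambda>u. exp (s - t) * (q u * exp (LINT v:{u..t}|lborel. q v)))"
      proof (rule set_integrable_bounded[where B="exp (s - t) * (1 * exp (t - s))"])
        fix u assume u: "u \<in> {s..t}"
        have "(LINT v:{u..t}|lborel. q v) \<le> (LINT v:{u..t}|lborel. 1)"
          by (rule set_integral_mono) (use iq q01 in \<open>auto intro: set_integrable_bounded[where B=1]\<close>)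
        then have "exp (LINT v:{u..t}|lborel. q v) \<le> exp (t - s)"
          using u by (simp add: set_lebesgue_integral_def)
        then show "\<bar>exp (s - t) * (q u * exp (LINT v:{u..t}|lborel. q v))\<bar> \<le> exp (s - t) * (1 * exp (t - s))"
          unfolding abs_mult using q01[of u] by (intro mult_mono) auto
      qed measurable
    qed (use q01 in auto)
    also have "(LINT u:{s..t}|lborel. exp (s - t) * (q u * exp (LINT v:{u..t}|lborel. q v))) =
      exp (s - t) * (exp (LINT v:{s..t}|lborel. q v) - 1)"
      using exp_integral_formula[of q s t] q01 that by simp
    finally have "ennreal (exp (s - t)) + (\<integral>\<^sup>+u. ennreal (exp (s - u) * q u * E u t) * indicator {s<..<t} u \<partial>lborel) =
      ennreal (exp (s - t)) + ennreal (exp (s - t) * (exp (LINT v:{s..t}|lborel. q v) - 1))" by simp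
    also have "\<dots> = ennreal (exp (s - t) + exp (s - t) * (exp (LINT v:{s..t}|lborel. q v) - 1))"
    proof (rule ennreal_plus[symmetric])
      have "0 \<le> (LINT v:{s..t}|lborel. q v)"
        unfolding set_lebesgue_integral_def using q01 by (intro integral_nonneg_AE) auto
      then show "0 \<le> exp (s - t) * (exp (LINT v:{s..t}|lborel. q v) - 1)" by simp
    qed simp
    also have "\<dots> = ennreal (E s t)" using E_eq[of s t] that by (simp add: algebra_simps)
    finally show ?thesis .
  qed
  have it [measurable]: "(\<lambda>u. iterated_path (\<lambda>x. 1 - h x) g n u w) \<in> borel_measurable borel" for n
  proof -
    have 1: "(\<lambda>u. (u, w)) \<in> borel \<rightarrow>\<^sub>M borel \<Otimes>\<^sub>M M" using wt by measurable
    have 2: "(\<lambda>(s, w). iterated_path (\<lambda>x. 1 - h x) g n s w) \<in> borel_measurable (borel \<Otimes>\<^sub>M M)"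
      by (rule measurable_iterated_path) measurable
    show ?thesis using measurable_compose[OF 1 2] by simp
  qed
  have split: "(\<Sum>n<Suc N. iterated_path (\<lambda>x. 1 - h x) g n s w) =
    iterated_path (\<lambda>x. 1 - h x) g 0 s w + (\<Sum>n<N. iterated_path (\<lambda>x. 1 - h x) g (Suc n) s w)"
    by (rule sum.lessThan_Suc_shift)
  have "(\<Sum>n<N. iterated_path (\<lambda>x. 1 - h x) g (Suc n) s w) =
    (\<integral>\<^sup>+u. ennreal (exp (s - u)) * indicator {s<..} u * (ennreal (q u) * (\<Sum>n<N. iterated_path (\<lambda>x. 1 - h x) g n u w)) \<partial>lborel)"
    by (simp add: q_def[symmetric] sum_distrib_left nn_integral_sum)
  also have "\<dots> \<le> (\<integral>\<^sup>+u. ennreal (exp (s - u)) * indicator {s<..} u * (ennreal (q u) *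
      (\<integral>\<^sup>+t. ennreal (E u t) * indicator {u<..} t * gw t \<partial>lborel)) \<partial>lborel)"
    using Suc.IH Suc.prems unfolding E_def gw_def
    by (intro nn_integral_mono) (auto intro!: mult_left_mono split: split_indicator)
  also have "\<dots> = (\<integral>\<^sup>+u. \<integral>\<^sup>+t. ennreal (exp (s - u) * q u * E u t) * indicator {s<..<t} u * (indicator {s<..} t * gw t) \<partial>lborel \<partial>lborel)"
  proof (intro nn_integral_cong)
    fix u :: real
    have "ennreal (exp (s - u)) * indicator {s<..} u * (ennreal (q u) * (\<integral>\<^sup>+t. ennreal (E u t) * indicator {u<..} t * gw t \<partial>lborel)) =
      (\<integral>\<^sup>+t. ennreal (exp (s - u)) * indicator {s<..} u * (ennreal (q u) * (ennreal (E u t) * indicator {u<..} t * gw t)) \<partial>lborel)"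
    proof -
      have m: "(\<lambda>t. ennreal (E u t) * indicator {u<..} t * gw t) \<in> borel_measurable lborel" by measurable
      then have m': "(\<lambda>t. ennreal (q u) * (ennreal (E u t) * indicator {u<..} t * gw t)) \<in> borel_measurable lborel" by measurable
      show ?thesis by (simp only: nn_integral_cmult[OF m'] nn_integral_cmult[OF m])
    qed
    also have "\<dots> = (\<integral>\<^sup>+t. ennreal (exp (s - u) * q u * E u t) * indicator {s<..<t} u * (indicator {s<..} t * gw t) \<partial>lborel)"
    proof (intro nn_integral_cong)
      fix t
      have "0 \<le> E u t" by (simp add: E_def)
      then show "ennreal (exp (s - u)) * indicator {s<..} u * (ennreal (q u) * (ennreal (E u t) * indicator {u<..} t * gw t)) =
        ennreal (exp (s - u) * q u * E u t) * indicator {s<..<t} u * (indicator {s<..} t * gw t)"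
        using q01[of u] by (cases "s < u"; cases "u < t") (simp_all add: ennreal_mult mult.assoc)
    qed
    finally show "ennreal (exp (s - u)) * indicator {s<..} u * (ennreal (q u) * (\<integral>\<^sup>+t. ennreal (E u t) * indicator {u<..} t * gw t \<partial>lborel)) = \<dots>" .
  qed
  also have "\<dots> = (\<integral>\<^sup>+t. \<integral>\<^sup>+u. ennreal (exp (s - u) * q u * E u t) * indicator {s<..<t} u * (indicator {s<..} t * gw t) \<partial>lborel \<partial>lborel)"
    by (rule lborel_pair.Fubini'[symmetric]) (simp only: indicator_def split_beta' greaterThanLessThan_iff greaterThan_iff, measurable)
  also have "\<dots> = (\<integral>\<^sup>+t. (\<integral>\<^sup>+u. ennreal (exp (s - u) * q u * E u t) * indicator {s<..<t} u \<partial>lborel) * (indicator {s<..} t * gw t) \<partial>lborel)"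
    by (intro nn_integral_cong nn_integral_multc) (simp only: indicator_def greaterThanLessThan_iff, measurable)
  finally have rest: "(\<Sum>n<N. iterated_path (\<lambda>x. 1 - h x) g (Suc n) s w) \<le>
    (\<integral>\<^sup>+t. (\<integral>\<^sup>+u. ennreal (exp (s - u) * q u * E u t) * indicator {s<..<t} u \<partial>lborel) * (indicator {s<..} t * gw t) \<partial>lborel)" .
  have "iterated_path (\<lambda>x. 1 - h x) g 0 s w +
    (\<integral>\<^sup>+t. (\<integral>\<^sup>+u. ennreal (exp (s - u) * q u * E u t) * indicator {s<..<t} u \<partial>lborel) * (indicator {s<..} t * gw t) \<partial>lborel) =
    (\<integral>\<^sup>+t. ennreal (exp (s - t)) * indicator {s<..} t * gw t +
      (\<integral>\<^sup>+u. ennreal (exp (s - u) * q u * E u t) * indicator {s<..<t} u \<partial>lborel) * (indicator {s<..} t * gw t) \<partial>lborel)"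
    unfolding iterated_path.simps gw_def[symmetric]
    proof (rule nn_integral_add[symmetric])
    have [measurable]: "(\<lambda>z. E (snd z) (fst z)) \<in> borel_measurable (borel \<Otimes>\<^sub>M borel)"
      by (rule Em; measurable)
    have "(\<lambda>(t, u). ennreal (exp (s - u) * q u * E u t) * (if s < u \<and> u < t then 1 else 0)) \<in> borel_measurable (borel \<Otimes>\<^sub>M borel)"
      unfolding split_beta' by measurable
    then have "(\<lambda>t. \<integral>\<^sup>+u. ennreal (exp (s - u) * q u * E u t) * indicator {s<..<t} u \<partial>lborel) \<in> borel_measurable borel"
      unfolding indicator_def greaterThanLessThan_iff by measurable
    then show "(\<lambda>t. (\<integral>\<^sup>+u. ennreal (exp (s - u) * q u * E u t) * indicator {s<..<t} u \<partial>lborel) * (indicator {s<..} t * gw t)) \<in> borel_measurable lborel"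
      by measurable
  qed measurable
  also have "\<dots> = (\<integral>\<^sup>+t. ennreal (E s t) * indicator {s<..} t * gw t \<partial>lborel)"
  proof (intro nn_integral_cong)
    fix t
    show "ennreal (exp (s - t)) * indicator {s<..} t * gw t +
      (\<integral>\<^sup>+u. ennreal (exp (s - u) * q u * E u t) * indicator {s<..<t} u \<partial>lborel) * (indicator {s<..} t * gw t) =
      ennreal (E s t) * indicator {s<..} t * gw t"
      proof (cases "s < t")
      case True
      show ?thesis unfolding key[OF True, symmetric] by (simp only: distrib_right mult.assoc)
    qed simp
  qed
  finally show ?case
    using add_left_mono[OF rest, of "iterated_path (\<lambda>x. 1 - h x) g 0 s w"] unfolding split E_def gw_def by simp
qed simp

text \<open>Turns the defining bound of special functions, which lives in continuous time, into a
  bound for the chain with kernel \<open>U1\<close> weighted by \<open>1 - h\<close> at every step.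
  In this form it can be compared with the chain killed at the atom.\<close>

lemma special_iterated_bound:
  assumes f: "special_nonneg P X \<mu> f" and h [measurable]: "h \<in> borel_measurable borel"
    and h01: "\<And>x. 0 \<le> h x" "\<And>x. h x \<le> 1" and hpos: "0 < (\<integral>\<^sup>+x. ennreal (h x) \<partial>\<mu>)"
  obtains c :: real where "\<And>x N. (\<Sum>n<N. iterated_U1 (\<lambda>x. 1 - h x) (\<lambda>x. ennreal (f x)) n x) \<le> ennreal c"
proof -
  have [measurable]: "f \<in> borel_measurable borel" and f0: "\<And>x. 0 \<le> f x" using f by (auto simp: special_nonneg_def)
  have "bounded (range h)" using h01 by (intro boundedI[where B=1]) auto
  then have "h \<in> borel_measurable borel \<and> (\<forall>x. 0 \<le> h x) \<and> bounded (range h) \<and> 0 < (\<integral>\<^sup>+x. ennreal (h x) \<partial>\<mu>)"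
    using h h01 hpos by simp
  then have "\<exists>c::real. \<forall>x. (\<integral>\<^sup>+w. (\<integral>\<^sup>+t\<in>{0..}. ennreal (exp (- (LINT s:{0..t}|lborel. h (X s w))) * f (X t w)) \<partial>lborel) \<partial>P x) \<le> ennreal c"
    using f unfolding special_nonneg_def by (elim conjE allE[where x=h]) simp
  then obtain c :: real where c: "\<And>x. (\<integral>\<^sup>+w. (\<integral>\<^sup>+t\<in>{0..}. ennreal (exp (- (LINT s:{0..t}|lborel. h (X s w))) * f (X t w)) \<partial>lborel) \<partial>P x) \<le> ennreal c"
    by auto
  have "(\<Sum>n<N. iterated_U1 (\<lambda>x. 1 - h x) (\<lambda>x. ennreal (f x)) n x) \<le> ennreal c" for x N
  proof -
    interpret prob_space "P x" by (rule P_prob)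
    let ?q = "\<lambda>x. 1 - h x" and ?f = "\<lambda>x. ennreal (f x)"
    have [measurable]: "(\<lambda>w. iterated_path ?q ?f n 0 w) \<in> borel_measurable (P x)" for n
      using measurable_compose[OF measurable_Pair1' measurable_iterated_path[of ?q ?f n], of 0]
      by (simp cong: measurable_cong_sets add: sets_P)
    have "(\<Sum>n<N. iterated_U1 ?q ?f n x) = (\<Sum>n<N. \<integral>\<^sup>+w. iterated_U1 ?q ?f n (X 0 w) \<partial>P x)"
    proof (intro sum.cong refl)
      fix n
      have "(\<integral>\<^sup>+w. iterated_U1 ?q ?f n (X 0 w) \<partial>P x) = (\<integral>\<^sup>+w. iterated_U1 ?q ?f n x \<partial>P x)"
        by (rule nn_integral_cong_AE) (use X_start[of x] in eventually_elim, simp)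
      then show "iterated_U1 ?q ?f n x = (\<integral>\<^sup>+w. iterated_U1 ?q ?f n (X 0 w) \<partial>P x)"
        using emeasure_space_1 by simp
    qed
    also have "\<dots> = (\<Sum>n<N. \<integral>\<^sup>+w. iterated_path ?q ?f n 0 w \<partial>P x)"
      using iterated_path_integral[of ?q ?f 0 "\<lambda>_. 1" x] by simp
    also have "\<dots> = (\<integral>\<^sup>+w. (\<Sum>n<N. iterated_path ?q ?f n 0 w) \<partial>P x)"
      by (rule nn_integral_sum[symmetric]) measurable
    also have "\<dots> \<le> (\<integral>\<^sup>+w. (\<integral>\<^sup>+t. ennreal (exp (- (LINT v:{0..t}|lborel. h (X (max 0 v) w)))) * indicator {0<..} t * ?f (X (max 0 t) w) \<partial>lborel) \<partial>P x)"
      by (intro nn_integral_mono discounted_path_integral) (auto simp: h01)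
    also have "\<dots> \<le> (\<integral>\<^sup>+w. (\<integral>\<^sup>+t\<in>{0..}. ennreal (exp (- (LINT s:{0..t}|lborel. h (X s w))) * f (X t w)) \<partial>lborel) \<partial>P x)"
    proof (intro nn_integral_mono)
      fix w t
      have "(LINT v:{0..t}|lborel. h (X (max 0 v) w)) = (LINT v:{0..t}|lborel. h (X v w))"
        unfolding set_lebesgue_integral_def
        by (intro Bochner_Integration.integral_cong) (auto split: split_indicator simp: max_def)
      then show "ennreal (exp (- (LINT v:{0..t}|lborel. h (X (max 0 v) w)))) * indicator {0<..} t * ?f (X (max 0 t) w) \<le>
        ennreal (exp (- (LINT s:{0..t}|lborel. h (X s w))) * f (X t w)) * indicator {0..} t"
        using f0 by (auto split: split_indicator simp: ennreal_mult max_def)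
    qed
    also have "\<dots> \<le> ennreal c" by (rule c)
    finally show ?thesis .
  qed
  then show ?thesis by (rule that)
qed

end

section \<open>Holding times and bridges, averaged over their end point\<close>

lemma nn_integral_measure_add:
  assumes s: "sets M1 = sets M" "sets M2 = sets M"
    and e: "\<And>B. B \<in> sets M \<Longrightarrow> emeasure M B = emeasure M1 B + emeasure M2 B"
    and \<phi>: "\<phi> \<in> borel_measurable M"
  shows "(\<integral>\<^sup>+x. \<phi> x \<partial>M) = (\<integral>\<^sup>+x. \<phi> x \<partial>M1) + (\<integral>\<^sup>+x. \<phi> x \<partial>M2)"
  using \<phi>
proof (induct rule: borel_measurable_induct)
  case (cong f g)
  moreover have "space M1 = space M" "space M2 = space M" using s by (auto dest: sets_eq_imp_space_eq)
  ultimately show ?case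
    using nn_integral_cong[of M f g] nn_integral_cong[of M1 f g] nn_integral_cong[of M2 f g] by simp
next
  case (set A) then show ?case using e s by simp
next
  case (mult u c)
  then show ?case using s by (simp add: nn_integral_cmult distrib_left cong: measurable_cong_sets)
next
  case (add u v)
  then show ?case using s by (simp add: nn_integral_add ac_simps cong: measurable_cong_sets)
next
  case (seq U)
  have m: "U i \<in> borel_measurable M1" "U i \<in> borel_measurable M2" for i
    using seq(1)[of i] s by (simp_all cong: measurable_cong_sets)
  have i: "incseq U" by fact
  have inc: "incseq (\<lambda>i. integral\<^sup>N K (U i))" for K
    using i by (auto simp: incseq_def le_fun_def intro!: nn_integral_mono)
  have S: "(\<integral>\<^sup>+x. (SUP i. U i) x \<partial>K) = (SUP i. integral\<^sup>N K (U i))" if "\<And>i. U i \<in> borel_measurable K" for K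
    using nn_integral_monotone_convergence_SUP[OF i that] by (simp add: image_comp)
  show ?case
    unfolding S[OF seq(1)] S[OF m(1)] S[OF m(2)] seq
    by (rule ennreal_SUP_add[OF inc inc])
qed

lemma nn_integral_exp_tail:
  assumes c: "0 < b"
  shows "(\<integral>\<^sup>+t\<in>{r<..}. ennreal (exp (- b * (t - r))) \<partial>lborel) = ennreal (1 / b)"
proof -
  have "(\<integral>\<^sup>+t\<in>{r<..}. ennreal (exp (- b * (t - r))) \<partial>lborel) = (\<integral>\<^sup>+t\<in>{r..}. ennreal (exp (- b * (t - r))) \<partial>lborel)"
    by (rule nn_integral_cong_AE, use AE_lborel_singleton[of r] in eventually_elim) (auto split: split_indicator)
  also have "\<dots> = ennreal (0 - (- exp (- b * (r - r)) / b))"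
  proof (rule nn_integral_FTC_atLeast[where F="\<lambda>t. - exp (- b * (t - r)) / b"])
    show "DERIV (\<lambda>t. - exp (- b * (t - r)) / b) t :> exp (- b * (t - r))" for t
      using c by (auto intro!: derivative_eq_intros simp: field_simps)
    have 1: "filterlim (\<lambda>t. - r + t) at_top at_top"
      by (rule filterlim_tendsto_add_at_top[OF tendsto_const filterlim_ident])
    have 2: "filterlim (\<lambda>t. b * (- r + t)) at_top at_top"
      by (rule filterlim_tendsto_pos_mult_at_top[OF tendsto_const _ 1]) (use c in simp)
    have "filterlim (\<lambda>t. - b * (t - r)) at_bot at_top"
      using 2 by (simp add: filterlim_uminus_at_top algebra_simps)
    then have "((\<lambda>t. exp (- b * (t - r))) \<longlongrightarrow> 0) at_top" by (rule filterlim_compose[OF exp_at_bot])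
    then have "((\<lambda>t. - exp (- b * (t - r)) / b) \<longlongrightarrow> - 0 / b) at_top"
      using c by (intro tendsto_intros) auto
    then show "((\<lambda>t. - exp (- b * (t - r)) / b) \<longlongrightarrow> 0) at_top" by simp
  qed auto
  finally show ?thesis by simp
qed

context harris_process
begin

interpretation L: sigma_finite_measure \<Lambda> by (rule sigma_finite_\<Lambda>)
interpretation LL: pair_sigma_finite lborel \<Lambda> ..

text \<open>\<open>holding_density\<close> written with \<open>pp\<close>: the same for positive
  \<open>t\<close>, and jointly measurable in all arguments.\<close>

definition hd :: "'e \<Rightarrow> 'e \<Rightarrow> real \<Rightarrow> ennreal" where
  "hd x y t = ennreal (exp (- t)) *
     (if u1 p x y = \<infinity> \<or> (u1 p x y = 0 \<and> pp t x y = 0) then 1 else pp t x y / u1 p x y)"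

lemma holding_density_eq: "0 < t \<Longrightarrow> holding_density p x y t = hd x y t"
  using p_nonneg[of t x y] by (simp add: holding_density_def hd_def pp_def)

lemma measurable_hd [measurable (raw)]:
  assumes [measurable]: "f \<in> borel_measurable M'" "g \<in> M' \<rightarrow>\<^sub>M borel" "h \<in> M' \<rightarrow>\<^sub>M borel"
  shows "(\<lambda>z. hd (g z) (h z) (f z)) \<in> borel_measurable M'"
  unfolding hd_def by measurable

lemma u1_finite_AE: "AE y in \<Lambda>. u1 p x y \<noteq> \<infinity>"
proof -
  have "(\<integral>\<^sup>+y. u1 p x y \<partial>\<Lambda>) = UU (\<lambda>_. 1) x" by (subst nn_integral_U1_u1) simp_all
  also have "\<dots> = 1" using prob_space.emeasure_space_1[OF U1_prob[of x]] by simp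
  finally have "(\<integral>\<^sup>+y. u1 p x y \<partial>\<Lambda>) \<noteq> \<infinity>" by simp
  then show ?thesis by (intro nn_integral_PInf_AE) auto
qed

text \<open>Multiplying by \<open>u1\<close> cancels the denominator and leaves the joint law of an
  exponential time and the position of \<open>X\<close> at that time. The conventions for the
  quotient are harmless: \<open>u1 = \<infinity>\<close> occurs on a null set, and where
  \<open>u1 = 0\<close> the density \<open>pp\<close> vanishes for almost every
  \<open>t\<close>.\<close>

lemma holding_identity:
  assumes [measurable]: "(\<lambda>(y, t). \<Phi> y t) \<in> borel_measurable (borel \<Otimes>\<^sub>M borel)"
  shows "UU (\<lambda>y. \<integral>\<^sup>+t\<in>{0<..}. hd x y t * \<Phi> y t \<partial>lborel) x =
    (\<integral>\<^sup>+t\<in>{0<..}. ennreal (exp (- t)) * (\<integral>\<^sup>+y. pp t x y * \<Phi> y t \<partial>\<Lambda>) \<partial>lborel)"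
proof -
  have "UU (\<lambda>y. \<integral>\<^sup>+t\<in>{0<..}. hd x y t * \<Phi> y t \<partial>lborel) x =
    (\<integral>\<^sup>+y. u1 p x y * (\<integral>\<^sup>+t\<in>{0<..}. hd x y t * \<Phi> y t \<partial>lborel) \<partial>\<Lambda>)"
    by (rule nn_integral_U1_u1) measurable
  also have "\<dots> = (\<integral>\<^sup>+y. \<integral>\<^sup>+t. ennreal (exp (- t)) * pp t x y * \<Phi> y t * indicator {0<..} t \<partial>lborel \<partial>\<Lambda>)"
  proof (rule nn_integral_cong_AE, use u1_finite_AE[of x] in eventually_elim)
    fix y assume fin: "u1 p x y \<noteq> \<infinity>"
    show "u1 p x y * (\<integral>\<^sup>+t\<in>{0<..}. hd x y t * \<Phi> y t \<partial>lborel) =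
      (\<integral>\<^sup>+t. ennreal (exp (- t)) * pp t x y * \<Phi> y t * indicator {0<..} t \<partial>lborel)"
    proof (cases "u1 p x y = 0")
      case True
      then have "(\<integral>\<^sup>+t\<in>{0<..}. ennreal (exp (- t)) * pp t x y \<partial>lborel) = 0" by (simp add: u1_pp)
      then have ae: "AE t in lborel. ennreal (exp (- t)) * pp t x y * indicator {0<..} t = 0"
        by (subst (asm) nn_integral_0_iff_AE) auto
      have "(\<integral>\<^sup>+t. ennreal (exp (- t)) * pp t x y * \<Phi> y t * indicator {0<..} t \<partial>lborel) = (\<integral>\<^sup>+(t::real). 0 \<partial>lborel)"
        by (rule nn_integral_cong_AE, use ae in eventually_elim) (auto split: split_indicator)
      then show ?thesis using True by simp
    next
      case False
      have "u1 p x y * hd x y t = ennreal (exp (- t)) * pp t x y" for t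
      proof -
        have "u1 p x y * (pp t x y / u1 p x y) = pp t x y"
          using False fin by (simp add: ennreal_times_divide mult.commute[of "u1 p x y"] mult_divide_eq_ennreal)
        moreover have "u1 p x y * hd x y t = ennreal (exp (- t)) * (u1 p x y * (pp t x y / u1 p x y))"
          using False fin by (simp add: hd_def mult.left_commute)
        ultimately show ?thesis by simp
      qed
      then have "u1 p x y * (hd x y t * \<Phi> y t * indicator {0<..} t) = ennreal (exp (- t)) * pp t x y * \<Phi> y t * indicator {0<..} t" for t
        by (simp only: mult.assoc[symmetric])
      then show ?thesis by (subst nn_integral_cmult[symmetric]) simp_all
    qed
  qed
  also have "\<dots> = (\<integral>\<^sup>+t. \<integral>\<^sup>+y. ennreal (exp (- t)) * pp t x y * \<Phi> y t * indicator {0<..} t \<partial>\<Lambda> \<partial>lborel)"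
    by (rule LL.Fubini') measurable
  also have "\<dots> = (\<integral>\<^sup>+t\<in>{0<..}. ennreal (exp (- t)) * (\<integral>\<^sup>+y. pp t x y * \<Phi> y t \<partial>\<Lambda>) \<partial>lborel)"
    by (intro nn_integral_cong) (auto simp: nn_integral_cmult mult.assoc split: split_indicator)
  finally show ?thesis .
qed

lemma holding_total:
  assumes [measurable]: "\<Phi> \<in> borel_measurable borel"
  shows "UU (\<lambda>y. \<integral>\<^sup>+t\<in>{0<..}. hd x y t * \<Phi> t \<partial>lborel) x = (\<integral>\<^sup>+t\<in>{0<..}. ennreal (exp (- t)) * \<Phi> t \<partial>lborel)"
proof -
  have "UU (\<lambda>y. \<integral>\<^sup>+t\<in>{0<..}. hd x y t * \<Phi> t \<partial>lborel) x =
    (\<integral>\<^sup>+t\<in>{0<..}. ennreal (exp (- t)) * (\<integral>\<^sup>+y. pp t x y * \<Phi> t \<partial>\<Lambda>) \<partial>lborel)"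
    by (rule holding_identity) measurable
  also have "\<dots> = (\<integral>\<^sup>+t\<in>{0<..}. ennreal (exp (- t)) * \<Phi> t \<partial>lborel)"
    by (intro nn_integral_cong) (auto simp: nn_integral_multc pp_prob split: split_indicator)
  finally show ?thesis .
qed

definition br :: "'e \<Rightarrow> ('e \<Rightarrow> ennreal) \<Rightarrow> real \<Rightarrow> real \<Rightarrow> 'e \<Rightarrow> 'e \<Rightarrow> ennreal" where
  "br z0 g t r x y = (if pp t x y = 0 then g z0 else (\<integral>\<^sup>+z. pp r x z * pp (t - r) z y / pp t x y * g z \<partial>\<Lambda>))"

lemma br_eq:
  assumes "0 < r" "r < t" and [measurable]: "g \<in> borel_measurable borel"
  shows "(\<integral>\<^sup>+z. g z \<partial>bridge_kernel \<Lambda> p z0 t r x y) = br z0 g t r x y"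
proof (cases "p t x y = 0")
  case True then show ?thesis using assms by (simp add: br_def bridge_kernel_def pp_def nn_integral_return)
next
  case False
  then have pos: "0 < p t x y" using p_nonneg[of t x y] assms by simp
  have d: "ennreal (p r x z * p (t - r) z y / p t x y) = pp r x z * pp (t - r) z y / pp t x y" for z
    using pos assms p_nonneg[of r x z] p_nonneg[of "t - r" z y]
    by (simp add: pp_def divide_ennreal[symmetric] ennreal_mult)
  have m: "(\<lambda>z. pp r x z * pp (t - r) z y / pp t x y) \<in> borel_measurable \<Lambda>" by measurable
  have "bridge_kernel \<Lambda> p z0 t r x y = density \<Lambda> (\<lambda>z. pp r x z * pp (t - r) z y / pp t x y)"
    using False by (simp only: bridge_kernel_def d if_False)
  moreover have "pp t x y \<noteq> 0" using pos assms by (simp add: pp_def)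
  ultimately show ?thesis by (simp add: br_def nn_integral_density[OF m])
qed

lemma measurable_br [measurable (raw)]:
  assumes [measurable]: "f1 \<in> borel_measurable M'" "f2 \<in> borel_measurable M'" "f3 \<in> M' \<rightarrow>\<^sub>M borel" "f4 \<in> M' \<rightarrow>\<^sub>M borel"
    "g \<in> borel_measurable borel"
  shows "(\<lambda>z. br z0 g (f1 z) (f2 z) (f3 z) (f4 z)) \<in> borel_measurable M'"
  unfolding br_def by measurable

lemma Chapman_Kolmogorov:
  assumes s: "0 < s" and t: "0 < t" and [measurable]: "\<phi> \<in> borel_measurable borel"
  shows "(\<integral>\<^sup>+y. pp s x y * (\<integral>\<^sup>+z. pp t y z * \<phi> z \<partial>\<Lambda>) \<partial>\<Lambda>) = (\<integral>\<^sup>+y. pp (s + t) x y * \<phi> y \<partial>\<Lambda>)"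
proof -
  have m: "X r \<in> P x \<rightarrow>\<^sub>M borel" if "0 < r" for r using that by (simp add: measurable_X_P)
  have "(\<integral>\<^sup>+y. pp (s + t) x y * \<phi> y \<partial>\<Lambda>) = (\<integral>\<^sup>+w. 1 * \<phi> (X (s + t) w) \<partial>P x)"
    using s t m by (simp add: nn_integral_semigroup[symmetric] semigroup_def nn_integral_distr)
  also have "\<dots> = (\<integral>\<^sup>+w. 1 * (\<integral>\<^sup>+z. pp t (X s w) z * \<phi> z \<partial>\<Lambda>) \<partial>P x)"
    by (rule markov_at) (use s t in auto)
  also have "\<dots> = (\<integral>\<^sup>+y. (\<integral>\<^sup>+z. pp t y z * \<phi> z \<partial>\<Lambda>) \<partial>semigroup P X s x)"
    unfolding semigroup_def using m[OF s] by (subst nn_integral_distr) auto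
  also have "\<dots> = (\<integral>\<^sup>+y. pp s x y * (\<integral>\<^sup>+z. pp t y z * \<phi> z \<partial>\<Lambda>) \<partial>\<Lambda>)"
    by (rule nn_integral_semigroup[OF s]) measurable
  finally show ?thesis by simp
qed

lemma pp_finite: "pp t x y \<noteq> \<infinity>" by (simp add: pp_def)

text \<open>Cancelling the denominator \<open>pp t x y\<close> could lose mass where it vanishes.
  Chapman-Kolmogorov shows that the numerator vanishes there too, for almost every end point, so no
  mass is lost and the fallback value \<open>g z0\<close> is multiplied by 0.\<close>

lemma bridge_identity:
  assumes r: "0 < r" "r < t" and [measurable]: "g \<in> borel_measurable borel"
  shows "(\<integral>\<^sup>+y. pp t x y * br z0 g t r x y \<partial>\<Lambda>) = (\<integral>\<^sup>+z. pp r x z * g z \<partial>\<Lambda>)"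
proof -
  interpret PL: pair_sigma_finite \<Lambda> \<Lambda> ..
  define k where "k y = (\<integral>\<^sup>+z. pp r x z * pp (t - r) z y \<partial>\<Lambda>)" for y
  have [measurable]: "k \<in> borel_measurable borel" unfolding k_def by measurable
  have "(\<integral>\<^sup>+y. k y * indicator {y. pp t x y = 0} y \<partial>\<Lambda>) =
    (\<integral>\<^sup>+y. \<integral>\<^sup>+z. pp r x z * pp (t - r) z y * indicator {y. pp t x y = 0} y \<partial>\<Lambda> \<partial>\<Lambda>)"
    unfolding k_def by (intro nn_integral_cong nn_integral_multc[symmetric]) measurable
  also have "\<dots> = (\<integral>\<^sup>+z. \<integral>\<^sup>+y. pp r x z * pp (t - r) z y * indicator {y. pp t x y = 0} y \<partial>\<Lambda> \<partial>\<Lambda>)"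
    by (rule PL.Fubini') measurable
  also have "\<dots> = (\<integral>\<^sup>+z. pp r x z * (\<integral>\<^sup>+y. pp (t - r) z y * indicator {y. pp t x y = 0} y \<partial>\<Lambda>) \<partial>\<Lambda>)"
    by (intro nn_integral_cong) (simp add: nn_integral_cmult mult.assoc)
  also have "\<dots> = (\<integral>\<^sup>+y. pp (r + (t - r)) x y * indicator {y. pp t x y = 0} y \<partial>\<Lambda>)"
    by (rule Chapman_Kolmogorov) (use r in auto)
  also have "\<dots> = (\<integral>\<^sup>+y. 0 \<partial>\<Lambda>)" by (intro nn_integral_cong) (auto split: split_indicator)
  finally have "(\<integral>\<^sup>+y. k y * indicator {y. pp t x y = 0} y \<partial>\<Lambda>) = 0" by simp
  then have "AE y in \<Lambda>. k y * indicator {y. pp t x y = 0} y = 0"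
    by (subst (asm) nn_integral_0_iff_AE) auto
  then have null: "AE y in \<Lambda>. pp t x y = 0 \<longrightarrow> k y = 0" by eventually_elim (auto split: split_indicator_asm)
  have "(\<integral>\<^sup>+y. pp t x y * br z0 g t r x y \<partial>\<Lambda>) = (\<integral>\<^sup>+y. \<integral>\<^sup>+z. pp r x z * pp (t - r) z y * g z \<partial>\<Lambda> \<partial>\<Lambda>)"
  proof (rule nn_integral_cong_AE, use null in eventually_elim)
    fix y assume k: "pp t x y = 0 \<longrightarrow> k y = 0"
    show "pp t x y * br z0 g t r x y = (\<integral>\<^sup>+z. pp r x z * pp (t - r) z y * g z \<partial>\<Lambda>)"
    proof (cases "pp t x y = 0")
      case True
      with k have "AE z in \<Lambda>. pp r x z * pp (t - r) z y = 0"
        unfolding k_def by (subst (asm) nn_integral_0_iff_AE) auto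
      then have "(\<integral>\<^sup>+z. pp r x z * pp (t - r) z y * g z \<partial>\<Lambda>) = (\<integral>\<^sup>+z. 0 \<partial>\<Lambda>)"
        by (intro nn_integral_cong_AE, elim eventually_mono) auto
      then show ?thesis using True by simp
    next
      case False
      have "pp t x y * (pp r x z * pp (t - r) z y / pp t x y * g z) = pp r x z * pp (t - r) z y * g z" for z
      proof -
        have "pp t x y * (pp r x z * pp (t - r) z y / pp t x y) = pp r x z * pp (t - r) z y"
          using False pp_finite[of t x y]
          by (simp add: ennreal_times_divide mult.commute[of "pp t x y"] mult_divide_eq_ennreal)
        then show ?thesis by (simp only: mult.assoc[symmetric])
      qed
      then show ?thesis using False by (simp add: br_def nn_integral_cmult[symmetric])
    qed
  qed
  also have "\<dots> = (\<integral>\<^sup>+z. \<integral>\<^sup>+y. pp r x z * pp (t - r) z y * g z \<partial>\<Lambda> \<partial>\<Lambda>)"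
    by (rule PL.Fubini') measurable
  also have "\<dots> = (\<integral>\<^sup>+z. pp r x z * g z \<partial>\<Lambda>)"
  proof (intro nn_integral_cong)
    fix z
    have "(\<integral>\<^sup>+y. pp r x z * pp (t - r) z y * g z \<partial>\<Lambda>) = (\<integral>\<^sup>+y. (pp r x z * g z) * pp (t - r) z y \<partial>\<Lambda>)"
      by (simp add: mult_ac)
    then show "(\<integral>\<^sup>+y. pp r x z * pp (t - r) z y * g z \<partial>\<Lambda>) = pp r x z * g z"
      using r by (simp add: nn_integral_cmult pp_prob)
  qed
  finally show ?thesis .
qed

text \<open>The time spent in a holding interval after the instant \<open>r\<close> is again exponential, and
  averaging the bridge over its end point restores the semigroup.\<close>
lemma holding_bridge_identity:
  assumes r: "0 < r" and c: "c < 1" and [measurable]: "g \<in> borel_measurable borel"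
  shows "UU (\<lambda>y. \<integral>\<^sup>+t\<in>{0<..}. hd x y t * (indicator {r<..} t * ennreal (exp (c * (t - r))) * br z0 g t r x y) \<partial>lborel) x =
    ennreal (1 / (1 - c)) * (ennreal (exp (- r)) * (\<integral>\<^sup>+z. pp r x z * g z \<partial>\<Lambda>))"
proof -
  define I where "I = (\<integral>\<^sup>+z. pp r x z * g z \<partial>\<Lambda>)"
  have "UU (\<lambda>y. \<integral>\<^sup>+t\<in>{0<..}. hd x y t * (indicator {r<..} t * ennreal (exp (c * (t - r))) * br z0 g t r x y) \<partial>lborel) x =
    (\<integral>\<^sup>+t\<in>{0<..}. ennreal (exp (- t)) * (\<integral>\<^sup>+y. pp t x y * (indicator {r<..} t * ennreal (exp (c * (t - r))) * br z0 g t r x y) \<partial>\<Lambda>) \<partial>lborel)"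
    by (rule holding_identity) measurable
  also have "\<dots> = (\<integral>\<^sup>+t. (ennreal (exp (- r)) * I) * (ennreal (exp (- (1 - c) * (t - r))) * indicator {r<..} t) \<partial>lborel)"
  proof (intro nn_integral_cong)
    fix t :: real
    have "(\<integral>\<^sup>+y. pp t x y * (indicator {r<..} t * ennreal (exp (c * (t - r))) * br z0 g t r x y) \<partial>\<Lambda>) =
      (\<integral>\<^sup>+y. (indicator {r<..} t * ennreal (exp (c * (t - r)))) * (pp t x y * br z0 g t r x y) \<partial>\<Lambda>)"
      by (simp add: mult_ac)
    also have "\<dots> = (indicator {r<..} t * ennreal (exp (c * (t - r)))) * (\<integral>\<^sup>+y. pp t x y * br z0 g t r x y \<partial>\<Lambda>)"
      by (rule nn_integral_cmult) measurable
    also have "\<dots> = (indicator {r<..} t * ennreal (exp (c * (t - r)))) * I"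
      using r by (cases "r < t") (simp_all add: bridge_identity I_def)
    finally have 1: "(\<integral>\<^sup>+y. pp t x y * (indicator {r<..} t * ennreal (exp (c * (t - r))) * br z0 g t r x y) \<partial>\<Lambda>) = \<dots>" .
    have 2: "ennreal (exp (- t)) * ennreal (exp (c * (t - r))) = ennreal (exp (- r)) * ennreal (exp (- (1 - c) * (t - r)))"
      by (simp add: ennreal_mult[symmetric] exp_add[symmetric] algebra_simps)
    show "ennreal (exp (- t)) * (\<integral>\<^sup>+y. pp t x y * (indicator {r<..} t * ennreal (exp (c * (t - r))) * br z0 g t r x y) \<partial>\<Lambda>) * indicator {0<..} t =
      (ennreal (exp (- r)) * I) * (ennreal (exp (- (1 - c) * (t - r))) * indicator {r<..} t)"
    proof (cases "r < t")
      case True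
      then have "0 < t" using r by simp
      then have "ennreal (exp (- t)) * (\<integral>\<^sup>+y. pp t x y * (indicator {r<..} t * ennreal (exp (c * (t - r))) * br z0 g t r x y) \<partial>\<Lambda>) * indicator {0<..} t
        = (ennreal (exp (- t)) * ennreal (exp (c * (t - r)))) * I" using True unfolding 1 by (simp add: mult.assoc)
      then show ?thesis unfolding 2 using True by (simp add: mult_ac)
    qed (simp add: 1)
  qed
  also have "\<dots> = (ennreal (exp (- r)) * I) * (\<integral>\<^sup>+t. ennreal (exp (- (1 - c) * (t - r))) * indicator {r<..} t \<partial>lborel)"
    by (rule nn_integral_cmult) measurable
  also have "(\<integral>\<^sup>+t. ennreal (exp (- (1 - c) * (t - r))) * indicator {r<..} t \<partial>lborel) = ennreal (1 / (1 - c))"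
    using nn_integral_exp_tail[of "1 - c" r] c by simp
  finally show ?thesis by (simp add: I_def mult.commute)
qed

end

section \<open>Histories of the split chain\<close>

context nummelin_splitting
begin

definition xs :: "nat \<Rightarrow> 'v \<Rightarrow> 'e" where "xs k w = fst (Z (T k w) w)"
definition us :: "nat \<Rightarrow> 'v \<Rightarrow> real" where "us k w = fst (snd (Z (T k w) w))"
definition ys :: "nat \<Rightarrow> 'v \<Rightarrow> 'e" where "ys k w = snd (snd (Z (T k w) w))"
definition atom :: "nat \<Rightarrow> 'v \<Rightarrow> bool" where "atom k w \<longleftrightarrow> xs k w \<in> C \<and> us k w \<in> {0..a}"

text \<open>What is known just before the labels \<open>us k\<close> and \<open>ys k\<close> of step
  \<open>k\<close> are drawn. For \<open>k > 0\<close> the past before \<open>T k\<close> already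
  reveals \<open>xs k\<close>, which is the label \<open>ys\<close> of the preceding step. For
  \<open>k = 0\<close> nothing happens before \<open>T 0 = 0\<close>, so the starting point has to
  be put in by hand.\<close>

definition hist :: "nat \<Rightarrow> 'v measure" where
  "hist k = (if k = 0 then vimage_algebra (space N) (\<lambda>w. fst (Z 0 w)) borel else prejump_history N Z T k)"

lemma T_mono: "w \<in> space N \<Longrightarrow> m \<le> n \<Longrightarrow> T m w \<le> T n w"
  by (rule lift_Suc_mono_le[of "\<lambda>n. T n w"]) (auto intro: less_imp_le T_increasing)

lemma T_less: "w \<in> space N \<Longrightarrow> m < n \<Longrightarrow> T m w < T n w"
  by (rule lift_Suc_mono_less[of "\<lambda>n. T n w"]) (auto intro: T_increasing)

lemma T_less_iff: "w \<in> space N \<Longrightarrow> T m w < T n w \<longleftrightarrow> m < n"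
  using T_less T_mono by (meson leD le_less_linear)

lemma T_nonneg: "w \<in> space N \<Longrightarrow> 0 \<le> T n w"
  using T_mono[of w 0 n] T_0 by simp

text \<open>\<open>Z\<close> at the random time \<open>T k\<close> is not among the generators of
  the histories. Its last two components are constant up to \<open>T (Suc k)\<close>, so they can be
  read at any rational inside the holding interval.\<close>

lemma snd_Z_rat_iff:
  assumes w: "w \<in> space N"
  shows "(\<exists>r\<in>\<rat> \<inter> {0..}. T k w \<le> r \<and> r < T (Suc k) w \<and> snd (Z r w) \<in> B) \<longleftrightarrow> snd (Z (T k w) w) \<in> B"
proof
  assume "\<exists>r\<in>\<rat> \<inter> {0..}. T k w \<le> r \<and> r < T (Suc k) w \<and> snd (Z r w) \<in> B"
  then obtain r where "T k w \<le> r" "r < T (Suc k) w" "snd (Z r w) \<in> B" by blast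
  then show "snd (Z (T k w) w) \<in> B" using Z23_constant[OF w] by simp
next
  assume B: "snd (Z (T k w) w) \<in> B"
  obtain r where r: "r \<in> \<rat>" "T k w < r" "r < T (Suc k) w"
    using Rats_dense_in_real[OF T_increasing[OF w, of k]] by auto
  then have "snd (Z r w) \<in> B" using Z23_constant[OF w, of k r] B by simp
  then show "\<exists>r\<in>\<rat> \<inter> {0..}. T k w \<le> r \<and> r < T (Suc k) w \<and> snd (Z r w) \<in> B"
    using r T_nonneg[OF w, of k] by (intro bexI[of _ r]) auto
qed

lemma xs_Suc: "w \<in> space N \<Longrightarrow> xs (Suc k) w = ys k w"
  using Z1_at_jump by (simp add: xs_def ys_def)

lemma PP_prob: "prob_space (PP x)" and sets_PP [measurable_cong]: "sets (PP x) = sets N"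
  using measurable_space[OF PP_kernel, of x] by (auto simp: space_prob_algebra)

lemma space_PP [simp]: "space (PP x) = space N" by (rule sets_eq_imp_space_eq[OF sets_PP])

declare T_measurable [measurable] pr_measurable [measurable] C_sets [measurable]

lemma sets_\<nu> [measurable_cong, simp]: "sets \<nu> = sets borel" and prob_\<nu>: "prob_space \<nu>"
  using \<nu>_prob by (auto simp: space_prob_algebra)

lemma space_\<nu> [simp]: "space \<nu> = UNIV" using sets_eq_imp_space_eq[OF sets_\<nu>] by simp

text \<open>The hypothesis gives \<open>Z\<close> stopped at \<open>T k\<close> for fixed
  \<open>q\<close>; every integer \<open>q \<ge> T k\<close> shows the value at \<open>T k\<close>
  itself.\<close>

lemma measurable_Z_at:
  assumes Tm: "T k \<in> borel_measurable H" and Zm: "\<And>q A. 0 \<le> q \<Longrightarrow> A \<in> sets borel \<Longrightarrow> {w \<in> space H. Z (min q (T k w)) w \<in> A} \<in> sets H"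
    and sp: "space H = space N"
  shows "(\<lambda>w. Z (T k w) w) \<in> H \<rightarrow>\<^sub>M borel"
proof (rule measurableI)
  fix A :: "('e \<times> real \<times> 'e) set" assume A: "A \<in> sets borel"
  have "(\<lambda>w. Z (T k w) w) -` A \<inter> space H =
    (\<Union>n::nat. {w \<in> space H. T k w \<le> real n} \<inter> {w \<in> space H. Z (min (real n) (T k w)) w \<in> A})"
  proof (intro set_eqI iffI)
    fix w assume w: "w \<in> (\<lambda>w. Z (T k w) w) -` A \<inter> space H"
    obtain n :: nat where "T k w \<le> real n" using real_arch_simple by blast
    then show "w \<in> (\<Union>n::nat. {w \<in> space H. T k w \<le> real n} \<inter> {w \<in> space H. Z (min (real n) (T k w)) w \<in> A})"
      using w by (intro UN_I[of n]) (auto simp: min_absorb2)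
  qed (auto simp: min_absorb2)
  also have "\<dots> \<in> sets H" 
  proof (intro sets.countable_UN' image_subsetI)
    fix n :: nat
    have "{w \<in> space H. T k w \<le> real n} \<in> sets H" using Tm by measurable
    then show "{w \<in> space H. T k w \<le> real n} \<inter> {w \<in> space H. Z (min (real n) (T k w)) w \<in> A} \<in> sets H"
      using Zm[of "real n" A] A by (intro sets.Int) auto
  qed auto
  finally show "(\<lambda>w. Z (T k w) w) -` A \<inter> space H \<in> sets H" .
qed simp

lemma space_stopped [simp]: "space (stopped_history N Z T m \<tau>) = space N"
  unfolding stopped_history_def by (rule space_measure_of) (auto intro!: Int_lower2)

lemma sets_stopped: "sets (stopped_history N Z T m \<tau>) = sigma_sets (space N)
     ({T k -` B \<inter> space N | k B. k \<le> m \<and> B \<in> sets borel} \<union>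
      {{w \<in> space N. Z (min q (\<tau> w)) w \<in> A} | q A. 0 \<le> q \<and> A \<in> sets borel})"
  unfolding stopped_history_def by (rule sets_measure_of) auto

lemma space_prejump [simp]: "space (prejump_history N Z T m) = space N"
  unfolding prejump_history_def by (rule space_measure_of) auto

lemma sets_prejump: "sets (prejump_history N Z T m) = sigma_sets (space N)
     ({T k -` B \<inter> space N | k B. k \<le> m \<and> B \<in> sets borel} \<union>
      {{w \<in> space N. q < T m w \<and> Z q w \<in> A} | q A. 0 \<le> q \<and> A \<in> sets borel})"
  unfolding prejump_history_def by (rule sets_measure_of) auto

lemma space_hist [simp]: "space (hist k) = space N" by (simp add: hist_def)

abbreviation "stopped k \<equiv> stopped_history N Z T k (T k)"
text \<open>The hypothesis on bridges at \<open>s = 0\<close> conditions on \<open>T (Suc k)\<close>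
  as well; the summand 0 keeps the exact form in which it is stated.\<close>

abbreviation "bridged k \<equiv> stopped_history N Z T (Suc k) (\<lambda>w. T k w + 0)"

lemma stopped_T: "k \<le> m \<Longrightarrow> T k \<in> borel_measurable (stopped_history N Z T m \<tau>)"
  by (rule measurableI) (auto simp: sets_stopped intro!: sigma_sets.Basic)

lemma stopped_Z: "0 \<le> q \<Longrightarrow> A \<in> sets borel \<Longrightarrow> {w \<in> space N. Z (min q (\<tau> w)) w \<in> A} \<in> sets (stopped_history N Z T m \<tau>)"
  by (auto simp: sets_stopped intro!: sigma_sets.Basic)

lemma prejump_T: "k \<le> m \<Longrightarrow> T k \<in> borel_measurable (prejump_history N Z T m)"
  by (rule measurableI) (auto simp: sets_prejump intro!: sigma_sets.Basic)

lemma prejump_Z: "0 \<le> q \<Longrightarrow> A \<in> sets borel \<Longrightarrow> {w \<in> space N. q < T m w \<and> Z q w \<in> A} \<in> sets (prejump_history N Z T m)"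
  by (auto simp: sets_prejump intro!: sigma_sets.Basic)

lemma sets_hist_0: "sets (hist 0) = {(\<lambda>w. fst (Z 0 w)) -` A \<inter> space N | A. A \<in> sets borel}"
  by (simp add: hist_def sets_vimage_algebra2)

lemma hist_stopped: "sets (hist k) \<subseteq> sets (stopped k)"
proof (cases "k = 0")
  case True
  show ?thesis
  proof
    fix G assume "G \<in> sets (hist k)"
    then obtain A :: "'e set" where A: "A \<in> sets borel" and G: "G = (\<lambda>w. fst (Z 0 w)) -` A \<inter> space N"
      using True sets_hist_0 by auto
    have "G = {w \<in> space N. Z (min 0 (T k w)) w \<in> A \<times> UNIV}"
      using True T_0 unfolding G by (auto simp: mem_Times_iff)
    also have "\<dots> \<in> sets (stopped k)" using A by (intro stopped_Z) (auto intro: borel_Times)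
    finally show "G \<in> sets (stopped k)" .
  qed
next
  case False
  show ?thesis unfolding hist_def if_not_P[OF False] sets_prejump
  proof (rule sets.sigma_sets_subset[of _ "stopped k", unfolded space_stopped], safe)
    fix m B assume "m \<le> k" "B \<in> sets (borel :: real measure)"
    then show "T m -` B \<inter> space N \<in> sets (stopped k)"
      using measurable_sets[OF stopped_T[of m k "T k"]] by simp
  next
    fix q :: real and A :: "('e \<times> real \<times> 'e) set" assume q: "0 \<le> q" "A \<in> sets borel"
    have "{w \<in> space N. q < T k w \<and> Z q w \<in> A} = {w \<in> space (stopped k). q < T k w} \<inter> {w \<in> space N. Z (min q (T k w)) w \<in> A}"
      by auto
    also have "\<dots> \<in> sets (stopped k)"
    proof (intro sets.Int stopped_Z q)
      show "{w \<in> space (stopped k). q < T k w} \<in> sets (stopped k)"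
        using stopped_T[of k k "T k"] by measurable
    qed
    finally show "{w \<in> space N. q < T k w \<and> Z q w \<in> A} \<in> sets (stopped k)" .
  qed
qed

lemma stopped_bridged: "sets (stopped k) \<subseteq> sets (bridged k)"
  unfolding sets_stopped
proof (rule sigma_sets_mono', rule Un_mono)
  show "{T j -` B \<inter> space N |j B. j \<le> k \<and> B \<in> sets borel} \<subseteq> {T j -` B \<inter> space N |j B. j \<le> Suc k \<and> B \<in> sets borel}"
    by (blast intro: le_SucI)
qed simp

text \<open>The first component at a random time is the jointly measurable path of \<open>X\<close>;
  the other two, when \<open>q\<close> exceeds \<open>T k\<close>, are read at rationals by
  \<open>snd_Z_rat_iff\<close>.\<close>

lemma bridged_N: "sets (bridged k) \<subseteq> sets N"
  unfolding sets_stopped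
proof (rule sets.sigma_sets_subset, safe)
  fix m and B :: "real set" assume "B \<in> sets borel"
  then show "T m -` B \<inter> space N \<in> sets N" by measurable
next
  fix q :: real and A :: "('e \<times> real \<times> 'e) set" assume q: "0 \<le> q" and A: "A \<in> sets borel"
  have 1: "(\<lambda>w. fst (Z (min q (T k w + 0)) w)) \<in> N \<rightarrow>\<^sub>M borel"
  proof (rule measurable_cong[THEN iffD2])
    show "fst (Z (min q (T k w + 0)) w) = X (max 0 (min q (T k w))) (pr w)" if "w \<in> space N" for w
      using q T_nonneg[OF that, of k] that Z1_eq_X[of "min q (T k w)" w] by simp
  qed measurable
  have 2: "(\<lambda>w. snd (Z (min q (T k w + 0)) w)) \<in> N \<rightarrow>\<^sub>M borel"
  proof (rule measurableI)
    fix B :: "(real \<times> 'e) set" assume B: "B \<in> sets borel"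
    have Zq: "{w \<in> space N. snd (Z r w) \<in> B} \<in> sets N" if "0 \<le> r" for r
    proof -
      have "{w \<in> space N. snd (Z r w) \<in> B} = Z r -` (UNIV \<times> B) \<inter> space N" by (auto simp: mem_Times_iff)
      also have "\<dots> \<in> sets N" using B that by (intro measurable_sets[OF Z_measurable] borel_Times) auto
      finally show ?thesis .
    qed
    have "(\<lambda>w. snd (Z (min q (T k w + 0)) w)) -` B \<inter> space N =
      ({w \<in> space N. q \<le> T k w} \<inter> {w \<in> space N. snd (Z q w) \<in> B}) \<union>
      ({w \<in> space N. T k w < q} \<inter> (\<Union>r\<in>\<rat> \<inter> {0..}. {w \<in> space N. T k w \<le> r \<and> r < T (Suc k) w} \<inter> {w \<in> space N. snd (Z r w) \<in> B}))"
      (is "_ = ?R")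
    proof (intro set_eqI)
      fix w
      show "w \<in> (\<lambda>w. snd (Z (min q (T k w + 0)) w)) -` B \<inter> space N \<longleftrightarrow> w \<in> ?R"
      proof (cases "w \<in> space N")
        case True
        have "w \<in> ?R \<longleftrightarrow> (q \<le> T k w \<and> snd (Z q w) \<in> B) \<or> (T k w < q \<and>
          (\<exists>r\<in>\<rat> \<inter> {0..}. T k w \<le> r \<and> r < T (Suc k) w \<and> snd (Z r w) \<in> B))"
          using True by (simp add: conj_assoc)
        then show ?thesis unfolding snd_Z_rat_iff[OF True] using True by (cases "q \<le> T k w") (auto simp: min_def)
      qed simp
    qed
    also have "?R \<in> sets N"
    proof (intro sets.Un sets.Int sets.countable_UN' image_subsetI Zq q)
      show "countable (\<rat> \<inter> {0::real..})" by (rule countable_subset[OF Int_lower1 countable_rat])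
    qed (use T_measurable in auto)
    finally show "(\<lambda>w. snd (Z (min q (T k w + 0)) w)) -` B \<inter> space N \<in> sets N" .
  qed simp
  have "(\<lambda>w. Z (min q (T k w + 0)) w) \<in> N \<rightarrow>\<^sub>M borel"
    using borel_measurable_Pair[OF 1 2] by simp
  from measurable_sets[OF this A] show "{w \<in> space N. Z (min q (T k w + 0)) w \<in> A} \<in> sets N"
    by (simp add: vimage_def Int_def conj_commute)
qed

lemma hist_N: "sets (hist k) \<subseteq> sets N"
  using hist_stopped stopped_bridged bridged_N by blast

lemma measurable_hist_N: "f \<in> hist k \<rightarrow>\<^sub>M L \<Longrightarrow> f \<in> N \<rightarrow>\<^sub>M L"
  using hist_N[of k] by (auto simp: measurable_def)

lemma measurable_hist_stopped: "f \<in> hist k \<rightarrow>\<^sub>M L \<Longrightarrow> f \<in> stopped k \<rightarrow>\<^sub>M L"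
  using hist_stopped[of k] by (auto simp: measurable_def)

lemma measurable_stopped_bridged: "f \<in> stopped k \<rightarrow>\<^sub>M L \<Longrightarrow> f \<in> bridged k \<rightarrow>\<^sub>M L"
  using stopped_bridged[of k] by (auto simp: measurable_def)

lemma measurable_bridged_N: "f \<in> bridged k \<rightarrow>\<^sub>M L \<Longrightarrow> f \<in> N \<rightarrow>\<^sub>M L"
  using bridged_N[of k] by (auto simp: measurable_def)

lemma hist_Suc: "sets (hist k) \<subseteq> sets (hist (Suc k))"
proof (cases "k = 0")
  case True
  show ?thesis
  proof
    fix G assume "G \<in> sets (hist k)"
    then obtain A :: "'e set" where A: "A \<in> sets borel" and G: "G = (\<lambda>w. fst (Z 0 w)) -` A \<inter> space N"
      using True sets_hist_0 by auto
    have "G = {w \<in> space N. 0 < T (Suc k) w \<and> Z 0 w \<in> A \<times> UNIV}"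
      using True T_0 T_increasing[of _ 0] unfolding G by (auto simp: mem_Times_iff)
    also have "\<dots> \<in> sets (hist (Suc k))" unfolding hist_def using A by (simp, intro prejump_Z) (auto intro: borel_Times)
    finally show "G \<in> sets (hist (Suc k))" .
  qed
next
  case False
  let ?H = "prejump_history N Z T (Suc k)"
  have "sets (prejump_history N Z T k) \<subseteq> sets ?H" unfolding sets_prejump[of k]
  proof (rule sets.sigma_sets_subset[of _ ?H, unfolded space_prejump], safe)
    fix m B assume "m \<le> k" "B \<in> sets (borel :: real measure)"
    then show "T m -` B \<inter> space N \<in> sets ?H"
      using measurable_sets[OF prejump_T[of m "Suc k"]] by simp
  next
    fix q :: real and A :: "('e \<times> real \<times> 'e) set" assume q: "0 \<le> q" "A \<in> sets borel"
    have "{w \<in> space N. q < T k w \<and> Z q w \<in> A} = {w \<in> space ?H. q < T k w} \<inter> {w \<in> space N. q < T (Suc k) w \<and> Z q w \<in> A}"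
      using T_increasing[of _ k] by (auto intro: less_trans)
    also have "\<dots> \<in> sets ?H"
    proof (intro sets.Int prejump_Z q)
      show "{w \<in> space ?H. q < T k w} \<in> sets ?H"
        using prejump_T[of k "Suc k"] by measurable
    qed
    finally show "{w \<in> space N. q < T k w \<and> Z q w \<in> A} \<in> sets ?H" .
  qed
  then show ?thesis using False by (simp add: hist_def)
qed

lemma measurable_hist_mono:
  assumes "f \<in> hist k \<rightarrow>\<^sub>M L" "k \<le> m" shows "f \<in> hist m \<rightarrow>\<^sub>M L"
proof -
  have "sets (hist k) \<subseteq> sets (hist m)" using \<open>k \<le> m\<close> by (rule lift_Suc_mono_le[of "\<lambda>k. sets (hist k)", OF hist_Suc])
  then show ?thesis using assms(1) by (auto simp: measurable_def)
qed

lemma T_hist: "k \<le> m \<Longrightarrow> T k \<in> borel_measurable (hist m)"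
proof (cases "m = 0")
  case True
  assume "k \<le> m"
  then have "T k w = 0" if "w \<in> space (hist m)" for w using True T_0 that by simp
  then have "T k \<in> borel_measurable (hist m) \<longleftrightarrow> (\<lambda>_. 0::real) \<in> borel_measurable (hist m)"
    by (rule measurable_cong)
  then show ?thesis by simp
qed (simp add: hist_def prejump_T)

lemma snd_Z_hist: "(\<lambda>w. snd (Z (T k w) w)) \<in> hist (Suc k) \<rightarrow>\<^sub>M borel"
proof (rule measurableI)
  let ?H = "hist (Suc k)"
  fix A :: "(real \<times> 'e) set" assume A: "A \<in> sets borel"
  have "(\<lambda>w. snd (Z (T k w) w)) -` A \<inter> space ?H =
    (\<Union>r\<in>\<rat> \<inter> {0..}. {w \<in> space ?H. T k w \<le> r} \<inter> {w \<in> space N. r < T (Suc k) w \<and> Z r w \<in> UNIV \<times> A})" (is "_ = ?R")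
  proof (intro set_eqI)
    fix w
    have "w \<in> ?R \<longleftrightarrow> w \<in> space N \<and> (\<exists>r\<in>\<rat> \<inter> {0..}. T k w \<le> r \<and> r < T (Suc k) w \<and> snd (Z r w) \<in> A)"
      by (auto simp: mem_Times_iff)
    then show "w \<in> (\<lambda>w. snd (Z (T k w) w)) -` A \<inter> space ?H \<longleftrightarrow> w \<in> ?R"
      using snd_Z_rat_iff by auto
  qed
  also have "?R \<in> sets ?H"
  proof (intro sets.countable_UN' image_subsetI sets.Int)
    show "{w \<in> space N. r < T (Suc k) w \<and> Z r w \<in> UNIV \<times> A} \<in> sets ?H" if "r \<in> \<rat> \<inter> {0..}" for r
      using that A unfolding hist_def by (simp, intro prejump_Z borel_Times) auto
    show "{w \<in> space ?H. T k w \<le> r} \<in> sets ?H" for r using T_hist[of k "Suc k"] by measurable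
    show "countable (\<rat> \<inter> {0::real..})" by (rule countable_subset[OF Int_lower1 countable_rat])
  qed
  finally show "(\<lambda>w. snd (Z (T k w) w)) -` A \<inter> space ?H \<in> sets ?H" .
qed simp

lemma us_hist: "k < m \<Longrightarrow> us k \<in> borel_measurable (hist m)"
  and ys_hist: "k < m \<Longrightarrow> ys k \<in> hist m \<rightarrow>\<^sub>M borel"
proof -
  assume "k < m"
  then have "(\<lambda>w. snd (Z (T k w) w)) \<in> hist m \<rightarrow>\<^sub>M borel"
    by (intro measurable_hist_mono[OF snd_Z_hist]) simp
  then have *: "(\<lambda>w. snd (Z (T k w) w)) \<in> hist m \<rightarrow>\<^sub>M borel \<Otimes>\<^sub>M borel" by (simp add: borel_prod)
  show "us k \<in> borel_measurable (hist m)" "ys k \<in> hist m \<rightarrow>\<^sub>M borel"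
    using measurable_compose[OF * measurable_fst] measurable_compose[OF * measurable_snd] by (simp_all add: us_def[abs_def] ys_def[abs_def])
qed

lemma xs_hist: "k \<le> m \<Longrightarrow> xs k \<in> hist m \<rightarrow>\<^sub>M borel"
proof (cases k)
  case 0
  have "(\<lambda>w. fst (Z 0 w)) \<in> hist 0 \<rightarrow>\<^sub>M borel"
    unfolding hist_def by (simp add: measurable_vimage_algebra1)
  then have "xs k \<in> hist 0 \<rightarrow>\<^sub>M borel"
    by (rule measurable_cong[THEN iffD1, rotated]) (simp add: 0 xs_def T_0)
  then show "k \<le> m \<Longrightarrow> ?thesis" by (rule measurable_hist_mono) simp
next
  case (Suc j)
  assume "k \<le> m"
  with Suc have "ys j \<in> hist m \<rightarrow>\<^sub>M borel" by (intro ys_hist) simp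
  then show ?thesis by (rule measurable_cong[THEN iffD1, rotated]) (simp add: Suc xs_Suc)
qed

lemma atom_hist: "k < m \<Longrightarrow> Measurable.pred (hist m) (atom k)"
  unfolding atom_def using us_hist[of k m] xs_hist[of k m] by measurable

lemma Z_stopped: "(\<lambda>w. Z (T k w) w) \<in> stopped k \<rightarrow>\<^sub>M borel"
  by (rule measurable_Z_at) (auto intro: stopped_T stopped_Z)

lemma xs_stopped: "xs k \<in> stopped k \<rightarrow>\<^sub>M borel" and us_stopped: "us k \<in> borel_measurable (stopped k)"
  and ys_stopped: "ys k \<in> stopped k \<rightarrow>\<^sub>M borel"
proof -
  have *: "(\<lambda>w. Z (T k w) w) \<in> stopped k \<rightarrow>\<^sub>M borel \<Otimes>\<^sub>M (borel \<Otimes>\<^sub>M borel)"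
    using Z_stopped by (simp add: borel_prod)
  note m2 = measurable_compose[OF * measurable_snd]
  show "xs k \<in> stopped k \<rightarrow>\<^sub>M borel" "us k \<in> borel_measurable (stopped k)" "ys k \<in> stopped k \<rightarrow>\<^sub>M borel"
    using measurable_compose[OF * measurable_fst] measurable_compose[OF m2 measurable_fst] measurable_compose[OF m2 measurable_snd]
    by (simp_all add: xs_def[abs_def] us_def[abs_def] ys_def[abs_def])
qed

lemma atom_stopped: "Measurable.pred (stopped k) (atom k)"
  unfolding atom_def using us_stopped[of k] xs_stopped[of k] by measurable

lemma xs_N [measurable]: "xs k \<in> N \<rightarrow>\<^sub>M borel" and us_N [measurable]: "us k \<in> borel_measurable N"
  and ys_N [measurable]: "ys k \<in> N \<rightarrow>\<^sub>M borel" and atom_N [measurable]: "Measurable.pred N (atom k)"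
  using xs_stopped us_stopped ys_stopped atom_stopped
  by (auto intro!: measurable_bridged_N measurable_stopped_bridged)

text \<open>From \<open>T m\<close> on the path is not in \<open>hist m\<close>, so it is replaced
  by the constant \<open>x0\<close>. The modified path stays right continuous, because the
  replacement starts at \<open>T m\<close> itself, and \<open>right_continuous_measurable\<close>
  applies.\<close>

lemma path_hist:
  assumes m: "0 < m"
  shows "(\<lambda>(t, w). if 0 \<le> t \<and> t < T m w then X t (pr w) else x0) \<in> borel \<Otimes>\<^sub>M hist m \<rightarrow>\<^sub>M borel"
proof -
  define Y where "Y t w = (if t < T m w then fst (Z t w) else x0)" for t w
  have [measurable]: "T m \<in> borel_measurable (hist m)" by (rule T_hist) simp
  have "(\<lambda>(t, w). Y (max 0 t) w) \<in> borel \<Otimes>\<^sub>M hist m \<rightarrow>\<^sub>M borel"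
  proof (rule right_continuous_measurable)
    fix q :: real assume q: "0 \<le> q"
    show "Y q \<in> hist m \<rightarrow>\<^sub>M borel"
    proof (rule measurableI)
      fix A :: "'e set" assume A: "A \<in> sets borel"
      have "Y q -` A \<inter> space (hist m) = {w \<in> space N. q < T m w \<and> Z q w \<in> A \<times> UNIV} \<union>
        {w \<in> space (hist m). \<not> q < T m w \<and> x0 \<in> A}" by (auto simp: Y_def mem_Times_iff split: if_splits)
      also have "\<dots> \<in> sets (hist m)"
      proof (rule sets.Un)
        show "{w \<in> space N. q < T m w \<and> Z q w \<in> A \<times> UNIV} \<in> sets (hist m)"
          using m q A unfolding hist_def by (simp, intro prejump_Z borel_Times) auto
      qed measurable
      finally show "Y q -` A \<inter> space (hist m) \<in> sets (hist m)" .
    qed simp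
  next
    fix w t assume w: "w \<in> space (hist m)" and t: "(0::real) \<le> t"
    have cl: "((\<lambda>s. X s (pr w)) \<longlongrightarrow> X t (pr w)) (at_right t)"
      using X_cadlag[of "pr w"] w t measurable_space[OF pr_measurable, of w] by (simp add: cadlag_def)
    show "((\<lambda>s. Y s w) \<longlongrightarrow> Y t w) (at_right t)"
    proof (cases "t < T m w")
      case True
      have ev: "\<forall>\<^sub>F s in at_right t. X s (pr w) = Y s w"
      proof (rule eventually_at_rightI[OF _ True])
        fix s assume "s \<in> {t<..<T m w}"
        then show "X s (pr w) = Y s w" using t w Z1_eq_X[of s w] by (simp add: Y_def)
      qed
      have "Y t w = X t (pr w)" using True t w Z1_eq_X[of t w] by (simp add: Y_def)
      then show ?thesis using cl tendsto_cong[OF ev] by simp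
    next
      case False
      have "\<forall>\<^sub>F s in at_right t. x0 = Y s w"
        using eventually_at_right_less[of t] by eventually_elim (use False in \<open>simp add: Y_def\<close>)
      then have "((\<lambda>s. Y s w) \<longlongrightarrow> x0) (at_right t)" by (rule tendsto_cong[THEN iffD1]) simp
      moreover have "Y t w = x0" using False by (simp add: Y_def)
      ultimately show ?thesis by simp
    qed
  qed
  then have m1: "(\<lambda>z. Y (max 0 (fst z)) (snd z)) \<in> borel \<Otimes>\<^sub>M hist m \<rightarrow>\<^sub>M borel" by (simp add: split_beta')
  have "(\<lambda>z. if 0 \<le> fst z then Y (max 0 (fst z)) (snd z) else x0) \<in> borel \<Otimes>\<^sub>M hist m \<rightarrow>\<^sub>M borel"
    using m1 by measurable
  then show ?thesis
    by (rule measurable_cong[THEN iffD1, rotated]) (auto simp: Y_def space_pair_measure Z1_eq_X)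
qed

end

section \<open>One-step laws of the split chain\<close>

context nummelin_splitting
begin

text \<open>The part of the law of the next point that is carried by missing the atom. On
  \<open>C\<close> a miss has probability \<open>1 - a\<close>, which cancels the normalization in
  \<open>split_kernel\<close>; so \<open>Q0 x\<close> has mass \<open>1 - a * indicator C x\<close>,
  and adding \<open>a * \<nu>\<close> on \<open>C\<close> gives back \<open>U1\<close>.\<close>

definition Q0 :: "'e \<Rightarrow> 'e measure" where
  "Q0 x = (if x \<in> C then diff_measure (U1 P X x) (scale_measure (ennreal a) \<nu>) else U1 P X x)"

abbreviation "QQ \<phi> x \<equiv> \<integral>\<^sup>+y. \<phi> y \<partial>Q0 x"

lemma sets_Q0 [simp, measurable_cong]: "sets (Q0 x) = sets borel"
  by (simp add: Q0_def)

lemma space_Q0 [simp]: "space (Q0 x) = UNIV" using sets_eq_imp_space_eq[OF sets_Q0] by simp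

lemma emeasure_\<nu>_UNIV: "emeasure \<nu> UNIV = 1"
  using prob_space.emeasure_space_1[OF prob_\<nu>] by simp

lemma emeasure_Q0:
  assumes B: "B \<in> sets borel"
  shows "emeasure (Q0 x) B = emeasure (U1 P X x) B - ennreal a * indicator C x * emeasure \<nu> B"
proof (cases "x \<in> C")
  case True
  have fin: "finite_measure (U1 P X x)" using U1_prob[of x] by (simp add: prob_space.finite_measure)
  have "emeasure (diff_measure (U1 P X x) (scale_measure (ennreal a) \<nu>)) B =
    emeasure (U1 P X x) B - emeasure (scale_measure (ennreal a) \<nu>) B"
  proof (rule emeasure_diff_measure[OF fin])
    show "finite_measure (scale_measure (ennreal a) \<nu>)"
      by (rule finite_measureI) (simp add: space_scale_measure emeasure_\<nu>_UNIV)
    show "emeasure (scale_measure (ennreal a) \<nu>) A \<le> emeasure (U1 P X x) A" if "A \<in> sets (U1 P X x)" for A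
      using minorization[of A x] that True by simp
  qed (use B in simp_all)
  then show ?thesis using True by (simp add: Q0_def)
qed (simp add: Q0_def)

lemma Q0_add:
  assumes [measurable]: "\<phi> \<in> borel_measurable borel"
  shows "UU \<phi> x = QQ \<phi> x + ennreal a * indicator C x * (\<integral>\<^sup>+y. \<phi> y \<partial>\<nu>)"
proof -
  have "UU \<phi> x = QQ \<phi> x + (\<integral>\<^sup>+y. \<phi> y \<partial>scale_measure (ennreal a * indicator C x) \<nu>)"
  proof (rule nn_integral_measure_add)
    fix B assume "B \<in> sets (U1 P X x)"
    then have B: "B \<in> sets borel" by simp
    show "emeasure (U1 P X x) B = emeasure (Q0 x) B + emeasure (scale_measure (ennreal a * indicator C x) \<nu>) B"
      using minorization[OF B, of x] by (simp add: emeasure_Q0[OF B] diff_add_cancel_ennreal)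
  qed simp_all
  then show ?thesis by (simp add: nn_integral_scale_measure)
qed

lemma measurable_Q0 [measurable]: "Q0 \<in> borel \<rightarrow>\<^sub>M subprob_algebra borel"
proof (rule measurable_subprob_algebra)
  fix x
  show "subprob_space (Q0 x)"
  proof
    have "emeasure (Q0 x) (space (Q0 x)) \<le> emeasure (U1 P X x) UNIV"
      by (simp add: emeasure_Q0 diff_le_self_ennreal)
    also have "\<dots> = 1" using prob_space.emeasure_space_1[OF U1_prob[of x]] by simp
    finally show "emeasure (Q0 x) (space (Q0 x)) \<le> 1" .
  qed simp
next
  show "(\<lambda>x. emeasure (Q0 x) B) \<in> borel_measurable borel" if [measurable]: "B \<in> sets borel" for B
    unfolding emeasure_Q0[OF that] by measurable
qed simp

lemma measurable_QQ [measurable (raw)]: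
  assumes [measurable]: "(\<lambda>(z, y). \<phi> z y) \<in> borel_measurable (M' \<Otimes>\<^sub>M borel)" "g \<in> M' \<rightarrow>\<^sub>M borel"
  shows "(\<lambda>z. QQ (\<phi> z) (g z)) \<in> borel_measurable M'"
  by (rule nn_integral_measurable_subprob_algebra2[where N=borel]) (auto intro: measurable_compose[OF _ measurable_Q0])

interpretation nu: prob_space \<nu> by (rule prob_\<nu>)

lemma Z0_start: "AE w in PP x. fst (Z 0 w) = x"
proof (rule AE_I[where N="{w \<in> space N. Z 0 w \<in> (- {x}) \<times> UNIV \<times> UNIV}"])
  show "emeasure (PP x) {w \<in> space N. Z 0 w \<in> (- {x}) \<times> UNIV \<times> UNIV} = 0"
    using initial_law[of UNIV UNIV "- {x}" x] by simp
  show "{w \<in> space N. Z 0 w \<in> (- {x}) \<times> UNIV \<times> UNIV} \<in> sets (PP x)"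
  proof -
    have "{w \<in> space N. Z 0 w \<in> (- {x}) \<times> UNIV \<times> UNIV} = Z 0 -` ((- {x}) \<times> UNIV \<times> UNIV) \<inter> space N" by auto
    also have "\<dots> \<in> sets N" by (intro measurable_sets[OF Z_measurable] borel_Times) auto
    finally show ?thesis by (simp add: sets_PP)
  qed
qed (auto simp: mem_Times_iff)

lemma xs_0: "AE w in PP x. xs 0 w = x"
  using Z0_start[of x] by (rule AE_mp) (auto intro!: AE_I2 simp: xs_def T_0)

lemma id_hist: "(\<lambda>w. w) \<in> N \<rightarrow>\<^sub>M hist k"
  using hist_N[of k] by (intro measurableI) (auto dest: sets.sets_into_space)

text \<open>The initial law plays the part of the jump law at index 0, where \<open>hist 0\<close>
  knows only the starting point. From here on the first step is no exception.\<close>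

lemma jump_hist:
  assumes G: "G \<in> sets (hist k)" and A: "A \<in> sets borel" and B: "B \<in> sets borel"
  shows "emeasure (PP x) {w \<in> G. us k w \<in> A \<and> ys k w \<in> B} =
    (\<integral>\<^sup>+w\<in>G. (\<integral>\<^sup>+u\<in>A. emeasure (split_kernel P X C a \<nu> (xs k w) u) B \<partial>uniform01) \<partial>PP x)"
proof (cases k)
  case (Suc n)
  have "{w \<in> G. us k w \<in> A \<and> ys k w \<in> B} = {w \<in> G. snd (Z (T (Suc n) w) w) \<in> A \<times> B}"
    by (auto simp: us_def ys_def Suc mem_Times_iff)
  then show ?thesis using jump[of G n A B x] assms Suc by (simp add: hist_def xs_def)
next
  case 0
  obtain D :: "'e set" where D: "D \<in> sets borel" and GD: "G = (\<lambda>w. fst (Z 0 w)) -` D \<inter> space N"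
    using G 0 sets_hist_0 by auto
  let ?I = "\<lambda>x. \<integral>\<^sup>+u\<in>A. emeasure (split_kernel P X C a \<nu> x u) B \<partial>uniform01"
  have [measurable]: "G \<in> sets (PP x)" using G hist_N[of k] by (auto simp: sets_PP)
  have "{w \<in> G. us k w \<in> A \<and> ys k w \<in> B} = {w \<in> space N. Z 0 w \<in> D \<times> A \<times> B}"
    by (auto simp: us_def ys_def 0 T_0 GD mem_Times_iff)
  then have "emeasure (PP x) {w \<in> G. us k w \<in> A \<and> ys k w \<in> B} = indicator D x * ?I x"
    using initial_law[OF A B D] by simp
  also have "\<dots> = (\<integral>\<^sup>+w. indicator D x * ?I x \<partial>PP x)"
    using prob_space.emeasure_space_1[OF PP_prob[of x]] by simp
  also have "\<dots> = (\<integral>\<^sup>+w. ?I (xs k w) * indicator G w \<partial>PP x)"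
    by (rule nn_integral_cong_AE, use Z0_start[of x] AE_space in eventually_elim)
      (auto simp: 0 xs_def T_0 GD mult.commute split: split_indicator)
  finally show ?thesis .
qed

lemma uniform01_le: "emeasure uniform01 {0..a} = ennreal a"
  and uniform01_gt: "emeasure uniform01 {a<..} = ennreal (1 - a)"
  and uniform01_UNIV: "emeasure uniform01 UNIV = 1"
proof -
  have "{0..1} \<inter> {0..a} = {0..a}" "{0..1} \<inter> {a<..} = {a<..1}" using a_bounds by auto
  then show "emeasure uniform01 {0..a} = ennreal a" "emeasure uniform01 {a<..} = ennreal (1 - a)" "emeasure uniform01 UNIV = 1"
    using a_bounds by (simp_all add: uniform01_def divide_ennreal_def)
qed

lemma sets_uniform01 [simp, measurable_cong]: "sets uniform01 = sets borel" by (simp add: uniform01_def)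

lemma split_le:
  assumes "x \<in> C" shows "(\<integral>\<^sup>+u\<in>{0..a}. emeasure (split_kernel P X C a \<nu> x u) B \<partial>uniform01) = ennreal a * emeasure \<nu> B"
proof -
  have "(\<integral>\<^sup>+u\<in>{0..a}. emeasure (split_kernel P X C a \<nu> x u) B \<partial>uniform01) = (\<integral>\<^sup>+u. emeasure \<nu> B * indicator {0..a} u \<partial>uniform01)"
    using assms by (intro nn_integral_cong) (auto simp: split_kernel_def split: split_indicator)
  then show ?thesis by (simp add: nn_integral_cmult_indicator uniform01_le mult.commute)
qed

lemma split_gt:
  assumes "x \<in> C" shows "(\<integral>\<^sup>+u\<in>{a<..}. emeasure (split_kernel P X C a \<nu> x u) B \<partial>uniform01) = emeasure (Q0 x) B"
proof -
  have "(\<integral>\<^sup>+u\<in>{a<..}. emeasure (split_kernel P X C a \<nu> x u) B \<partial>uniform01) =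
    (\<integral>\<^sup>+u. (ennreal (1 / (1 - a)) * emeasure (Q0 x) B) * indicator {a<..} u \<partial>uniform01)"
    using assms by (intro nn_integral_cong) (auto simp: split_kernel_def Q0_def split: split_indicator)
  also have "\<dots> = (ennreal (1 / (1 - a)) * ennreal (1 - a)) * emeasure (Q0 x) B"
    by (subst nn_integral_cmult_indicator) (simp_all add: uniform01_gt mult_ac)
  also have "ennreal (1 / (1 - a)) * ennreal (1 - a) = 1"
    using a_bounds by (simp add: ennreal_mult[symmetric])
  finally show ?thesis by simp
qed

lemma split_outside:
  assumes "x \<notin> C" shows "(\<integral>\<^sup>+u\<in>UNIV. emeasure (split_kernel P X C a \<nu> x u) B \<partial>uniform01) = emeasure (Q0 x) B"
proof -
  have "space uniform01 = UNIV" by (simp add: uniform01_def)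
  then show ?thesis using assms by (simp add: split_kernel_def Q0_def uniform01_UNIV)
qed

lemma us_range: "w \<in> space N \<Longrightarrow> us k w \<in> {0..1}"
  using Z2_range[of "T k w" w] T_nonneg[of w k] by (simp add: us_def)

abbreviation "ia k \<equiv> indicator {w. atom k w} :: 'v \<Rightarrow> ennreal"
abbreviation "ina k \<equiv> indicator {w. \<not> atom k w} :: 'v \<Rightarrow> ennreal"

lemma at_na: "ia k w + ina k w = 1" by (auto split: split_indicator)

lemma at_hist: "k < m \<Longrightarrow> ia k \<in> borel_measurable (hist m)" and na_hist: "k < m \<Longrightarrow> ina k \<in> borel_measurable (hist m)"
  using atom_hist[of k m] by measurable

lemma at_N [measurable]: "ia k \<in> borel_measurable N" and na_N [measurable]: "ina k \<in> borel_measurable N"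
  by measurable

lemma at_stopped: "ia k \<in> borel_measurable (stopped k)" and na_stopped: "ina k \<in> borel_measurable (stopped k)"
  using atom_stopped[of k] by measurable

text \<open>On the atom the next point is drawn from \<open>\<nu>\<close> whatever the past: this is
  the source of all regeneration. The event is decided by \<open>us k\<close>, which is drawn only
  after \<open>hist k\<close>, so it enters as the weight \<open>e\<close> of the kernel
  lemma.\<close>

lemma step_at:
  assumes \<phi> [measurable]: "(\<lambda>(w, y). \<phi> w y) \<in> borel_measurable (hist k \<Otimes>\<^sub>M borel)"
  shows "(\<integral>\<^sup>+w. ia k w * \<phi> w (ys k w) \<partial>PP x) = (\<integral>\<^sup>+w. ennreal a * indicator C (xs k w) * (\<integral>\<^sup>+y. \<phi> w y \<partial>\<nu>) \<partial>PP x)"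
proof -
  have [measurable]: "xs k \<in> hist k \<rightarrow>\<^sub>M borel" by (rule xs_hist) simp
  have "(\<integral>\<^sup>+w. ia k w * (\<lambda>(w, y). \<phi> w y) (w, ys k w) \<partial>PP x) =
    (\<integral>\<^sup>+w. \<integral>\<^sup>+y. (\<lambda>(w, y). \<phi> w y) (w, y) \<partial>scale_measure (ennreal a * indicator C (xs k w)) \<nu> \<partial>PP x)"
  proof (rule nn_integral_kernel_step[where H="hist k" and L=borel, OF PP_prob])
    show "(\<lambda>w. \<integral>\<^sup>+y. \<psi> (w, y) \<partial>scale_measure (ennreal a * indicator C (xs k w)) \<nu>) \<in> borel_measurable (hist k)"
      if [measurable]: "\<psi> \<in> borel_measurable (hist k \<Otimes>\<^sub>M borel)" for \<psi>
    proof -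
      have "(\<lambda>w. ennreal a * indicator C (xs k w) * (\<integral>\<^sup>+y. \<psi> (w, y) \<partial>\<nu>)) \<in> borel_measurable (hist k)" by measurable
      then show ?thesis by (rule measurable_cong[THEN iffD1, rotated]) (subst nn_integral_scale_measure, auto)
    qed
    fix G B assume G: "G \<in> sets (hist k)" and B [measurable]: "B \<in> sets (borel :: 'e measure)"
    have GN [measurable]: "G \<in> sets N" using G hist_N by blast
    define G' where "G' = G \<inter> {w \<in> space (hist k). xs k w \<in> C}"
    have G': "G' \<in> sets (hist k)" using G unfolding G'_def by measurable
    have GsN: "G \<subseteq> space N" using sets.sets_into_space[OF GN] .
    have "(\<integral>\<^sup>+w. ia k w * indicator G w * indicator B (ys k w) \<partial>PP x) =
      (\<integral>\<^sup>+w. indicator {w \<in> G'. us k w \<in> {0..a} \<and> ys k w \<in> B} w \<partial>PP x)"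
      using GsN by (intro nn_integral_cong) (auto simp: atom_def G'_def split: split_indicator)
    also have "\<dots> = emeasure (PP x) {w \<in> G'. us k w \<in> {0..a} \<and> ys k w \<in> B}"
    proof (rule nn_integral_indicator)
      have "G' \<in> sets N" using G' hist_N by blast
      then have "{w \<in> space N. w \<in> G' \<and> us k w \<in> {0..a} \<and> ys k w \<in> B} \<in> sets N" by measurable
      also have "{w \<in> space N. w \<in> G' \<and> us k w \<in> {0..a} \<and> ys k w \<in> B} = {w \<in> G'. us k w \<in> {0..a} \<and> ys k w \<in> B}"
        by (auto simp: G'_def)
      finally show "{w \<in> G'. us k w \<in> {0..a} \<and> ys k w \<in> B} \<in> sets (PP x)" by (simp add: sets_PP)
    qed
    also have "\<dots> = (\<integral>\<^sup>+w\<in>G'. (\<integral>\<^sup>+u\<in>{0..a}. emeasure (split_kernel P X C a \<nu> (xs k w) u) B \<partial>uniform01) \<partial>PP x)"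
      by (rule jump_hist[OF G']) auto
    also have "\<dots> = (\<integral>\<^sup>+w. indicator G w * emeasure (scale_measure (ennreal a * indicator C (xs k w)) \<nu>) B \<partial>PP x)"
      using GsN by (intro nn_integral_cong) (auto simp: split_le G'_def split: split_indicator)
    finally show "(\<integral>\<^sup>+w. ia k w * indicator G w * indicator B (ys k w) \<partial>PP x) =
      (\<integral>\<^sup>+w. indicator G w * emeasure (scale_measure (ennreal a * indicator C (xs k w)) \<nu>) B \<partial>PP x)" .
  qed (use hist_N in \<open>auto simp: sets_PP split: split_indicator\<close>)
  also have "\<dots> = (\<integral>\<^sup>+w. ennreal a * indicator C (xs k w) * (\<integral>\<^sup>+y. \<phi> w y \<partial>\<nu>) \<partial>PP x)"
  proof (rule nn_integral_cong)
    fix w assume "w \<in> space (PP x)"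
    then have [measurable]: "w \<in> space (hist k)" by simp
    show "(\<integral>\<^sup>+y. (\<lambda>(w, y). \<phi> w y) (w, y) \<partial>scale_measure (ennreal a * indicator C (xs k w)) \<nu>) =
      ennreal a * indicator C (xs k w) * (\<integral>\<^sup>+y. \<phi> w y \<partial>\<nu>)"
      by (subst nn_integral_scale_measure) auto
  qed
  finally show ?thesis by simp
qed

lemma step_na:
  assumes \<phi> [measurable]: "(\<lambda>(w, y). \<phi> w y) \<in> borel_measurable (hist k \<Otimes>\<^sub>M borel)"
  shows "(\<integral>\<^sup>+w. ina k w * \<phi> w (ys k w) \<partial>PP x) = (\<integral>\<^sup>+w. QQ (\<phi> w) (xs k w) \<partial>PP x)"
proof -
  have [measurable]: "xs k \<in> hist k \<rightarrow>\<^sub>M borel" by (rule xs_hist) simp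
  have "(\<integral>\<^sup>+w. ina k w * (\<lambda>(w, y). \<phi> w y) (w, ys k w) \<partial>PP x) =
    (\<integral>\<^sup>+w. \<integral>\<^sup>+y. (\<lambda>(w, y). \<phi> w y) (w, y) \<partial>Q0 (xs k w) \<partial>PP x)"
  proof (rule nn_integral_kernel_step[where H="hist k" and L=borel, OF PP_prob])
    show "(\<lambda>w. \<integral>\<^sup>+y. \<psi> (w, y) \<partial>Q0 (xs k w)) \<in> borel_measurable (hist k)"
      if [measurable]: "\<psi> \<in> borel_measurable (hist k \<Otimes>\<^sub>M borel)" for \<psi> by measurable
    fix G B assume G: "G \<in> sets (hist k)" and B [measurable]: "B \<in> sets (borel :: 'e measure)"
    have GN [measurable]: "G \<in> sets N" using G hist_N by blast
    define G1 where "G1 = G \<inter> {w \<in> space (hist k). xs k w \<in> C}"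
    define G2 where "G2 = G \<inter> {w \<in> space (hist k). xs k w \<notin> C}"
    have G12: "G1 \<in> sets (hist k)" "G2 \<in> sets (hist k)" using G unfolding G1_def G2_def by measurable
    then have G12N: "G1 \<in> sets N" "G2 \<in> sets N" using hist_N by blast+
    have GsN: "G \<subseteq> space N" using sets.sets_into_space[OF GN] .
    have m: "{w \<in> G'. us k w \<in> A \<and> ys k w \<in> B} \<in> sets (PP x)" if "G' \<in> sets N" "A \<in> sets borel" for G' A
    proof -
      have "{w \<in> space N. w \<in> G' \<and> us k w \<in> A \<and> ys k w \<in> B} \<in> sets N" using that by measurable
      also have "{w \<in> space N. w \<in> G' \<and> us k w \<in> A \<and> ys k w \<in> B} = {w \<in> G'. us k w \<in> A \<and> ys k w \<in> B}"
        using sets.sets_into_space[OF that(1)] by auto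
      finally show ?thesis by (simp add: sets_PP)
    qed
    have "(\<integral>\<^sup>+w. ina k w * indicator G w * indicator B (ys k w) \<partial>PP x) =
      (\<integral>\<^sup>+w. indicator {w \<in> G1. us k w \<in> {a<..} \<and> ys k w \<in> B} w + indicator {w \<in> G2. us k w \<in> UNIV \<and> ys k w \<in> B} w \<partial>PP x)"
    proof (intro nn_integral_cong)
      fix w assume "w \<in> space (PP x)"
      then show "ina k w * indicator G w * indicator B (ys k w) =
        indicator {w \<in> G1. us k w \<in> {a<..} \<and> ys k w \<in> B} w + (indicator {w \<in> G2. us k w \<in> UNIV \<and> ys k w \<in> B} w :: ennreal)"
        using us_range[of w k] by (auto simp: atom_def G1_def G2_def split: split_indicator)
    qed
    also have "\<dots> = emeasure (PP x) {w \<in> G1. us k w \<in> {a<..} \<and> ys k w \<in> B} + emeasure (PP x) {w \<in> G2. us k w \<in> UNIV \<and> ys k w \<in> B}"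
      using m G12N by (subst nn_integral_add) auto
    also have "\<dots> = (\<integral>\<^sup>+w\<in>G1. (\<integral>\<^sup>+u\<in>{a<..}. emeasure (split_kernel P X C a \<nu> (xs k w) u) B \<partial>uniform01) \<partial>PP x) +
      (\<integral>\<^sup>+w\<in>G2. (\<integral>\<^sup>+u\<in>UNIV. emeasure (split_kernel P X C a \<nu> (xs k w) u) B \<partial>uniform01) \<partial>PP x)"
      using jump_hist[OF G12(1), of "{a<..}" B x] jump_hist[OF G12(2), of UNIV B x] by simp
    also have "\<dots> = (\<integral>\<^sup>+w\<in>G1. emeasure (Q0 (xs k w)) B \<partial>PP x) + (\<integral>\<^sup>+w\<in>G2. emeasure (Q0 (xs k w)) B \<partial>PP x)"
      by (intro arg_cong2[where f="(+)"] nn_integral_cong) (auto simp: split_gt split_outside[simplified] G1_def G2_def split: split_indicator)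
    also have "\<dots> = (\<integral>\<^sup>+w. emeasure (Q0 (xs k w)) B * indicator G1 w + emeasure (Q0 (xs k w)) B * indicator G2 w \<partial>PP x)"
    proof (rule nn_integral_add[symmetric])
      have "(\<lambda>w. emeasure (Q0 (xs k w)) B) \<in> borel_measurable (PP x)"
        by (rule measurable_compose[OF _ measurable_emeasure_kernel[OF measurable_Q0 B]]) measurable
      then show "(\<lambda>w. emeasure (Q0 (xs k w)) B * indicator G1 w) \<in> borel_measurable (PP x)"
        "(\<lambda>w. emeasure (Q0 (xs k w)) B * indicator G2 w) \<in> borel_measurable (PP x)"
        using G12N by measurable
    qed
    also have "\<dots> = (\<integral>\<^sup>+w. indicator G w * emeasure (Q0 (xs k w)) B \<partial>PP x)"
      by (intro nn_integral_cong) (auto simp: G1_def G2_def split: split_indicator)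
    finally show "(\<integral>\<^sup>+w. ina k w * indicator G w * indicator B (ys k w) \<partial>PP x) =
      (\<integral>\<^sup>+w. indicator G w * emeasure (Q0 (xs k w)) B \<partial>PP x)" .
  qed (use hist_N in \<open>auto simp: sets_PP split: split_indicator\<close>)
  then show ?thesis by simp
qed

lemma step_full:
  assumes \<phi> [measurable]: "(\<lambda>(w, y). \<phi> w y) \<in> borel_measurable (hist k \<Otimes>\<^sub>M borel)"
  shows "(\<integral>\<^sup>+w. \<phi> w (ys k w) \<partial>PP x) = (\<integral>\<^sup>+w. UU (\<phi> w) (xs k w) \<partial>PP x)"
proof -
  have [measurable]: "xs k \<in> hist k \<rightarrow>\<^sub>M borel" by (rule xs_hist) simp
  have id: "(\<lambda>w. w) \<in> N \<rightarrow>\<^sub>M hist k" by (rule id_hist)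
  have [measurable]: "(\<lambda>w. \<phi> w (ys k w)) \<in> borel_measurable N"
    using measurable_compose[OF measurable_Pair[OF id ys_N[of k]] \<phi>] by simp
  have "(\<lambda>w. QQ (\<phi> w) (xs k w)) \<in> borel_measurable (hist k)" by measurable
  note [measurable] = measurable_hist_N[OF this]
  have "(\<lambda>w. \<integral>\<^sup>+y. \<phi> w y \<partial>\<nu>) \<in> borel_measurable (hist k)" by measurable
  note [measurable] = measurable_hist_N[OF this]
  have "(\<integral>\<^sup>+w. \<phi> w (ys k w) \<partial>PP x) = (\<integral>\<^sup>+w. ina k w * \<phi> w (ys k w) + ia k w * \<phi> w (ys k w) \<partial>PP x)"
    by (intro nn_integral_cong) (auto split: split_indicator)
  also have "\<dots> = (\<integral>\<^sup>+w. QQ (\<phi> w) (xs k w) \<partial>PP x) + (\<integral>\<^sup>+w. ennreal a * indicator C (xs k w) * (\<integral>\<^sup>+y. \<phi> w y \<partial>\<nu>) \<partial>PP x)"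
    unfolding step_na[OF \<phi>, symmetric] step_at[OF \<phi>, symmetric] by (rule nn_integral_add) measurable
  also have "\<dots> = (\<integral>\<^sup>+w. QQ (\<phi> w) (xs k w) + ennreal a * indicator C (xs k w) * (\<integral>\<^sup>+y. \<phi> w y \<partial>\<nu>) \<partial>PP x)"
    by (rule nn_integral_add[symmetric]) measurable
  also have "\<dots> = (\<integral>\<^sup>+w. UU (\<phi> w) (xs k w) \<partial>PP x)"
  proof (rule nn_integral_cong)
    fix w assume "w \<in> space (PP x)"
    then have [measurable]: "w \<in> space (hist k)" by simp
    show "QQ (\<phi> w) (xs k w) + ennreal a * indicator C (xs k w) * (\<integral>\<^sup>+y. \<phi> w y \<partial>\<nu>) = UU (\<phi> w) (xs k w)"
      by (rule Q0_add[symmetric]) measurable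
  qed
  finally show ?thesis .
qed

end

section \<open>Integrals over one holding interval\<close>

context nummelin_splitting
begin

interpretation L: sigma_finite_measure \<Lambda> by (rule sigma_finite_\<Lambda>)

definition sg :: "nat \<Rightarrow> 'v \<Rightarrow> real" where "sg k w = T (Suc k) w - T k w"

lemma sg_N [measurable]: "sg k \<in> borel_measurable N" unfolding sg_def by measurable

lemma sg_bridged: "sg k \<in> borel_measurable (bridged k)"
  unfolding sg_def by (intro borel_measurable_diff stopped_T) auto

lemma holding_step:
  assumes \<psi> [measurable]: "(\<lambda>(w, t). \<psi> w t) \<in> borel_measurable (stopped k \<Otimes>\<^sub>M borel)"
  shows "(\<integral>\<^sup>+w. \<psi> w (sg k w) \<partial>PP x) = (\<integral>\<^sup>+w. (\<integral>\<^sup>+t\<in>{0<..}. hd (xs k w) (ys k w) t * \<psi> w t \<partial>lborel) \<partial>PP x)"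
proof -
  note [measurable] = xs_stopped[of k] ys_stopped[of k]
  define K where "K w = density lborel (\<lambda>t. hd (xs k w) (ys k w) t * indicator {0<..} t)" for w
  have sub: "sets (stopped k) \<subseteq> sets N" using stopped_bridged bridged_N by blast
  have "(\<integral>\<^sup>+w. 1 * (\<lambda>(w, t). \<psi> w t) (w, sg k w) \<partial>PP x) = (\<integral>\<^sup>+w. \<integral>\<^sup>+t. (\<lambda>(w, t). \<psi> w t) (w, t) \<partial>K w \<partial>PP x)"
  proof (rule nn_integral_kernel_step[where H="stopped k" and L=borel, OF PP_prob])
    show "(\<lambda>w. \<integral>\<^sup>+t. \<phi> (w, t) \<partial>K w) \<in> borel_measurable (stopped k)"
      if [measurable]: "\<phi> \<in> borel_measurable (stopped k \<Otimes>\<^sub>M borel)" for \<phi>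
    proof -
      have "(\<lambda>w. \<integral>\<^sup>+t. hd (xs k w) (ys k w) t * indicator {0<..} t * \<phi> (w, t) \<partial>lborel) \<in> borel_measurable (stopped k)" by measurable
      then show ?thesis
      proof (rule measurable_cong[THEN iffD1, rotated])
        fix w assume [measurable]: "w \<in> space (stopped k)"
        show "(\<integral>\<^sup>+t. hd (xs k w) (ys k w) t * indicator {0<..} t * \<phi> (w, t) \<partial>lborel) = (\<integral>\<^sup>+t. \<phi> (w, t) \<partial>K w)"
          unfolding K_def by (rule nn_integral_density[symmetric]) measurable
      qed
    qed
    fix G B assume G: "G \<in> sets (stopped k)" and B [measurable]: "B \<in> sets (borel :: real measure)"
    have GN: "G \<in> sets N" using G sub by blast
    have "(\<integral>\<^sup>+w. 1 * indicator G w * indicator B (sg k w) \<partial>PP x) = (\<integral>\<^sup>+w. indicator {w \<in> G. sg k w \<in> B} w \<partial>PP x)"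
      by (intro nn_integral_cong) (auto split: split_indicator)
    also have "\<dots> = emeasure (PP x) {w \<in> G. T (Suc k) w - T k w \<in> B}"
    proof -
      have "{w \<in> space N. w \<in> G \<and> sg k w \<in> B} \<in> sets N" using GN by measurable
      also have "{w \<in> space N. w \<in> G \<and> sg k w \<in> B} = {w \<in> G. sg k w \<in> B}"
        using sets.sets_into_space[OF GN] by auto
      finally show ?thesis by (simp add: sets_PP sg_def)
    qed
    also have "\<dots> = (\<integral>\<^sup>+w\<in>G. (\<integral>\<^sup>+t\<in>B \<inter> {0<..}. holding_density p (xs k w) (ys k w) t \<partial>lborel) \<partial>PP x)"
      using holding_time[OF G B, of x] by (simp add: xs_def ys_def)
    also have "\<dots> = (\<integral>\<^sup>+w. indicator G w * emeasure (K w) B \<partial>PP x)"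
    proof (intro nn_integral_cong)
      fix w
      have "(\<integral>\<^sup>+t\<in>B \<inter> {0<..}. holding_density p (xs k w) (ys k w) t \<partial>lborel) = (\<integral>\<^sup>+t. hd (xs k w) (ys k w) t * indicator {0<..} t * indicator B t \<partial>lborel)"
        by (intro nn_integral_cong) (auto simp: holding_density_eq split: split_indicator)
      also have "\<dots> = emeasure (K w) B" unfolding K_def by (rule emeasure_density[symmetric]) auto
      finally show "(\<integral>\<^sup>+t\<in>B \<inter> {0<..}. holding_density p (xs k w) (ys k w) t \<partial>lborel) * indicator G w = indicator G w * emeasure (K w) B"
        by (simp add: mult.commute)
    qed
    finally show "(\<integral>\<^sup>+w. 1 * indicator G w * indicator B (sg k w) \<partial>PP x) = (\<integral>\<^sup>+w. indicator G w * emeasure (K w) B \<partial>PP x)" .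
  qed (use sub in \<open>auto simp: sets_PP K_def\<close>)
  also have "\<dots> = (\<integral>\<^sup>+w. (\<integral>\<^sup>+t\<in>{0<..}. hd (xs k w) (ys k w) t * \<psi> w t \<partial>lborel) \<partial>PP x)"
  proof (rule nn_integral_cong)
    fix w assume "w \<in> space (PP x)"
    then have [measurable]: "w \<in> space (stopped k)" by simp
    have "(\<integral>\<^sup>+t. (\<lambda>(w, t). \<psi> w t) (w, t) \<partial>K w) = (\<integral>\<^sup>+t. hd (xs k w) (ys k w) t * indicator {0<..} t * \<psi> w t \<partial>lborel)"
      unfolding K_def split_conv by (rule nn_integral_density) measurable
    then show "(\<integral>\<^sup>+t. (\<lambda>(w, t). \<psi> w t) (w, t) \<partial>K w) = (\<integral>\<^sup>+t\<in>{0<..}. hd (xs k w) (ys k w) t * \<psi> w t \<partial>lborel)"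
      by (simp add: mult_ac)
  qed
  finally show ?thesis by simp
qed

lemma hist_pair_stopped:
  assumes "\<phi> \<in> borel_measurable (hist k \<Otimes>\<^sub>M L)"
  shows "\<phi> \<in> borel_measurable (stopped k \<Otimes>\<^sub>M L)"
proof -
  have id: "(\<lambda>w. w) \<in> stopped k \<rightarrow>\<^sub>M hist k"
    using hist_stopped[of k] by (intro measurableI) (auto dest: sets.sets_into_space)
  have "(\<lambda>z. (fst z, snd z)) \<in> stopped k \<Otimes>\<^sub>M L \<rightarrow>\<^sub>M hist k \<Otimes>\<^sub>M L"
    by (intro measurable_Pair measurable_compose[OF measurable_fst id] measurable_snd)
  from measurable_compose[OF this assms] show ?thesis by simp
qed

text \<open>Common form of the laws for a full step, a step that misses the atom and a step on it:
  \<open>e\<close> selects the event and \<open>S\<close> is the matching functional of the end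
  point. The holding time is integrated first, given the end point, and the end point
  second.\<close>

lemma step_time_weighted:
  assumes \<phi> [measurable]: "(\<lambda>(w, y, t). \<phi> w y t) \<in> borel_measurable (hist k \<Otimes>\<^sub>M borel \<Otimes>\<^sub>M borel)"
    and e: "e \<in> borel_measurable (stopped k)"
    and step: "\<And>\<psi>. (\<lambda>(w, y). \<psi> w y) \<in> borel_measurable (hist k \<Otimes>\<^sub>M borel) \<Longrightarrow>
      (\<integral>\<^sup>+w. e w * \<psi> w (ys k w) \<partial>PP x) = (\<integral>\<^sup>+w. S (\<psi> w) (xs k w) \<partial>PP x)"
  shows "(\<integral>\<^sup>+w. e w * \<phi> w (ys k w) (sg k w) \<partial>PP x) =
    (\<integral>\<^sup>+w. S (\<lambda>y. \<integral>\<^sup>+t\<in>{0<..}. hd (xs k w) y t * \<phi> w y t \<partial>lborel) (xs k w) \<partial>PP x)"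
proof -
  note [measurable del] = xs_N ys_N
  note [measurable] = e ys_stopped[of k] xs_hist[OF order_refl, of k]
  have "(\<lambda>z. (fst z, (ys k (fst z), snd z))) \<in> stopped k \<Otimes>\<^sub>M borel \<rightarrow>\<^sub>M stopped k \<Otimes>\<^sub>M borel \<Otimes>\<^sub>M borel" by measurable
  from measurable_compose[OF this hist_pair_stopped[OF \<phi>]]
  have [measurable]: "(\<lambda>z. \<phi> (fst z) (ys k (fst z)) (snd z)) \<in> borel_measurable (stopped k \<Otimes>\<^sub>M borel)" by simp
  have "(\<integral>\<^sup>+w. e w * \<phi> w (ys k w) (sg k w) \<partial>PP x) =
    (\<integral>\<^sup>+w. (\<integral>\<^sup>+t\<in>{0<..}. hd (xs k w) (ys k w) t * (e w * \<phi> w (ys k w) t) \<partial>lborel) \<partial>PP x)"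
    by (rule holding_step) measurable
  also have "\<dots> = (\<integral>\<^sup>+w. e w * (\<integral>\<^sup>+t\<in>{0<..}. hd (xs k w) (ys k w) t * \<phi> w (ys k w) t \<partial>lborel) \<partial>PP x)"
  proof (rule nn_integral_cong)
    fix w assume "w \<in> space (PP x)"
    then have [measurable]: "w \<in> space (hist k)" by simp
    show "(\<integral>\<^sup>+t\<in>{0<..}. hd (xs k w) (ys k w) t * (e w * \<phi> w (ys k w) t) \<partial>lborel) =
      e w * (\<integral>\<^sup>+t\<in>{0<..}. hd (xs k w) (ys k w) t * \<phi> w (ys k w) t \<partial>lborel)"
      by (subst nn_integral_cmult[symmetric]) (auto intro!: nn_integral_cong simp: mult_ac)
  qed
  also have "\<dots> = (\<integral>\<^sup>+w. S (\<lambda>y. \<integral>\<^sup>+t\<in>{0<..}. hd (xs k w) y t * \<phi> w y t \<partial>lborel) (xs k w) \<partial>PP x)"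
  proof (rule step)
    have "(\<lambda>z. (fst (fst z), (snd (fst z), snd z))) \<in> (hist k \<Otimes>\<^sub>M borel) \<Otimes>\<^sub>M lborel \<rightarrow>\<^sub>M hist k \<Otimes>\<^sub>M borel \<Otimes>\<^sub>M borel" by measurable
    from measurable_compose[OF this \<phi>]
    have [measurable]: "(\<lambda>z. \<phi> (fst (fst z)) (snd (fst z)) (snd z)) \<in> borel_measurable ((hist k \<Otimes>\<^sub>M borel) \<Otimes>\<^sub>M lborel)" by simp
    show "(\<lambda>(w, y). \<integral>\<^sup>+t\<in>{0<..}. hd (xs k w) y t * \<phi> w y t \<partial>lborel) \<in> borel_measurable (hist k \<Otimes>\<^sub>M borel)"
      unfolding split_beta' by measurable
  qed
  finally show ?thesis .
qed

lemma step_full_time: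
  assumes \<phi> [measurable]: "(\<lambda>(w, y, t). \<phi> w y t) \<in> borel_measurable (hist k \<Otimes>\<^sub>M borel \<Otimes>\<^sub>M borel)"
  shows "(\<integral>\<^sup>+w. \<phi> w (ys k w) (sg k w) \<partial>PP x) =
    (\<integral>\<^sup>+w. UU (\<lambda>y. \<integral>\<^sup>+t\<in>{0<..}. hd (xs k w) y t * \<phi> w y t \<partial>lborel) (xs k w) \<partial>PP x)"
  using step_time_weighted[where S=UU and e="\<lambda>_. 1", OF \<phi>] step_full by simp

text \<open>Given the end point the holding time is not exponential; it becomes so, and independent
  of \<open>hist k\<close>, once the end point is averaged over \<open>U1\<close>.\<close>

lemma exponential_step:
  assumes \<phi> [measurable]: "(\<lambda>(w, t). \<phi> w t) \<in> borel_measurable (hist k \<Otimes>\<^sub>M borel)"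
  shows "(\<integral>\<^sup>+w. \<phi> w (sg k w) \<partial>PP x) = (\<integral>\<^sup>+w. (\<integral>\<^sup>+t\<in>{0<..}. ennreal (exp (- t)) * \<phi> w t \<partial>lborel) \<partial>PP x)"
proof -
  have "(\<integral>\<^sup>+w. \<phi> w (sg k w) \<partial>PP x) =
    (\<integral>\<^sup>+w. UU (\<lambda>y. \<integral>\<^sup>+t\<in>{0<..}. hd (xs k w) y t * \<phi> w t \<partial>lborel) (xs k w) \<partial>PP x)"
    by (rule step_full_time) measurable
  also have "\<dots> = (\<integral>\<^sup>+w. (\<integral>\<^sup>+t\<in>{0<..}. ennreal (exp (- t)) * \<phi> w t \<partial>lborel) \<partial>PP x)"
  proof (rule nn_integral_cong)
    fix w assume "w \<in> space (PP x)"
    then have [measurable]: "w \<in> space (hist k)" by simp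
    show "UU (\<lambda>y. \<integral>\<^sup>+t\<in>{0<..}. hd (xs k w) y t * \<phi> w t \<partial>lborel) (xs k w) = (\<integral>\<^sup>+t\<in>{0<..}. ennreal (exp (- t)) * \<phi> w t \<partial>lborel)"
      by (rule holding_total) measurable
  qed
  finally show ?thesis .
qed

lemma bridge_step:
  assumes r: "0 < r" and wt: "wt \<in> borel_measurable (bridged k)" and g [measurable]: "g \<in> borel_measurable borel"
  shows "(\<integral>\<^sup>+w. indicator {r<..} (sg k w) * (wt w * g (X (max 0 (T k w + r)) (pr w))) \<partial>PP x) =
    (\<integral>\<^sup>+w. indicator {r<..} (sg k w) * (wt w * br x0 g (sg k w) r (xs k w) (ys k w)) \<partial>PP x)"
proof -
  note [measurable] = measurable_stopped_bridged[OF xs_stopped[of k]] measurable_stopped_bridged[OF ys_stopped[of k]] sg_bridged[of k] wt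
  \<comment> \<open>The null measure on \<open>sg k w \<le> r\<close> encodes the restriction to
    holding times longer than \<open>r\<close>, the range on which the bridge law is stated.\<close>
  define K where "K w = (if r < sg k w then bridge_kernel \<Lambda> p x0 (sg k w) r (xs k w) (ys k w) else null_measure borel)" for w
  have sK: "sets (K w) = sets borel" for w by (simp add: K_def bridge_kernel_def sets_\<Lambda>)
  have iK: "(\<integral>\<^sup>+y. \<phi> y \<partial>K w) = indicator {r<..} (sg k w) * br x0 \<phi> (sg k w) r (xs k w) (ys k w)"
    if "\<phi> \<in> borel_measurable borel" for \<phi> w
    using br_eq[OF r _ that] by (simp add: K_def nn_integral_null_measure)
  have "(\<integral>\<^sup>+w. indicator {r<..} (sg k w) * (\<lambda>(w, y). wt w * g y) (w, X (max 0 (T k w + r)) (pr w)) \<partial>PP x) =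
    (\<integral>\<^sup>+w. \<integral>\<^sup>+y. (\<lambda>(w, y). wt w * g y) (w, y) \<partial>K w \<partial>PP x)"
  proof (rule nn_integral_kernel_step[where H="bridged k" and L=borel, OF PP_prob])
    show "(\<lambda>w. \<integral>\<^sup>+y. \<phi> (w, y) \<partial>K w) \<in> borel_measurable (bridged k)"
      if [measurable]: "\<phi> \<in> borel_measurable (bridged k \<Otimes>\<^sub>M borel)" for \<phi>
    proof -
      have "(\<lambda>w. indicator {r<..} (sg k w) * br x0 (\<lambda>y. \<phi> (w, y)) (sg k w) r (xs k w) (ys k w)) \<in> borel_measurable (bridged k)"
        unfolding br_def by measurable
      then show ?thesis
      proof (rule measurable_cong[THEN iffD1, rotated])
        fix w assume [measurable]: "w \<in> space (bridged k)"
        show "indicator {r<..} (sg k w) * br x0 (\<lambda>y. \<phi> (w, y)) (sg k w) r (xs k w) (ys k w) = (\<integral>\<^sup>+y. \<phi> (w, y) \<partial>K w)"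
          by (rule iK[symmetric]) measurable
      qed
    qed
    show "(\<lambda>(w, y). wt w * g y) \<in> borel_measurable (bridged k \<Otimes>\<^sub>M borel)" by measurable
    fix G B assume G: "G \<in> sets (bridged k)" and B [measurable]: "B \<in> sets (borel :: 'e measure)"
    have GN: "G \<in> sets N" using G bridged_N by blast
    let ?E = "{w \<in> G. 0 + r < T (Suc k) w - T k w \<and> fst (Z (T k w + 0 + r) w) \<in> B}"
    have Zr: "fst (Z (T k w + r) w) = X (max 0 (T k w + r)) (pr w)" if "w \<in> space N" for w
      using Z1_eq_X[of "T k w + r" w] T_nonneg[OF that, of k] r that by simp
    have Gs: "w \<in> space N" if "w \<in> G" for w using sets.sets_into_space[OF GN] that by auto
    have "(\<integral>\<^sup>+w. indicator {r<..} (sg k w) * indicator G w * indicator B (X (max 0 (T k w + r)) (pr w)) \<partial>PP x) = (\<integral>\<^sup>+w. indicator ?E w \<partial>PP x)"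
      by (intro nn_integral_cong) (auto simp: sg_def Zr split: split_indicator)
    also have "\<dots> = emeasure (PP x) ?E"
    proof (rule nn_integral_indicator)
      have "{w \<in> space N. w \<in> G \<and> r < sg k w \<and> X (max 0 (T k w + r)) (pr w) \<in> B} \<in> sets N" using GN by measurable
      also have "{w \<in> space N. w \<in> G \<and> r < sg k w \<and> X (max 0 (T k w + r)) (pr w) \<in> B} = ?E"
        using Zr Gs by (auto simp: sg_def)
      finally show "?E \<in> sets (PP x)" by (simp add: sets_PP)
    qed
    also have "\<dots> = (\<integral>\<^sup>+w\<in>{w \<in> G. 0 + r < T (Suc k) w - T k w}.
              emeasure (bridge_kernel \<Lambda> p x0 (T (Suc k) w - T k w - 0) r
                (fst (Z (T k w + 0) w)) (snd (snd (Z (T k w) w)))) B \<partial>PP x)"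
      by (rule bridge[OF order_refl r G B])
    also have "\<dots> = (\<integral>\<^sup>+w. indicator G w * emeasure (K w) B \<partial>PP x)"
      by (intro nn_integral_cong) (auto simp: K_def sg_def xs_def ys_def split: split_indicator)
    finally show "(\<integral>\<^sup>+w. indicator {r<..} (sg k w) * indicator G w * indicator B (X (max 0 (T k w + r)) (pr w)) \<partial>PP x) =
      (\<integral>\<^sup>+w. indicator G w * emeasure (K w) B \<partial>PP x)" .
  qed (use bridged_N sK in \<open>auto simp: sets_PP split: split_indicator\<close>)
  also have "\<dots> = (\<integral>\<^sup>+w. indicator {r<..} (sg k w) * (wt w * br x0 g (sg k w) r (xs k w) (ys k w)) \<partial>PP x)"
  proof (rule nn_integral_cong)
    fix w
    have "(\<integral>\<^sup>+y. wt w * g y \<partial>K w) = wt w * (\<integral>\<^sup>+y. g y \<partial>K w)"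
      by (rule nn_integral_cmult) (simp cong: measurable_cong_sets add: sK)
    then show "(\<integral>\<^sup>+y. (\<lambda>(w, y). wt w * g y) (w, y) \<partial>K w) = indicator {r<..} (sg k w) * (wt w * br x0 g (sg k w) r (xs k w) (ys k w))"
      unfolding iK[OF g] by (simp add: mult_ac)
  qed
  finally show ?thesis by simp
qed

text \<open>With Fubini over the elapsed time \<open>r\<close>, the bridge gives the position at
  \<open>T k + r\<close>. Averaging the end point by \<open>holding_bridge_identity\<close> restores
  the semigroup up to \<open>r\<close> and leaves an exponential residual time, whose exponential
  moment at \<open>c\<close> is \<open>1 / (1 - c)\<close>. The weight \<open>W\<close> may only use
  what precedes the step.\<close>

lemma excursion_step:
  assumes W: "W \<in> borel_measurable (hist k)" and c: "c < 1" and g [measurable]: "g \<in> borel_measurable borel"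
  shows "(\<integral>\<^sup>+w. W w * (\<integral>\<^sup>+s\<in>{T k w<..<T (Suc k) w}. g (X (max 0 s) (pr w)) * ennreal (exp (c * (T (Suc k) w - s))) \<partial>lborel) \<partial>PP x) =
    ennreal (1 / (1 - c)) * (\<integral>\<^sup>+w. W w * UU g (xs k w) \<partial>PP x)"
proof -
  interpret prob_space "PP x" by (rule PP_prob)
  interpret LP: pair_sigma_finite lborel "PP x" ..
  note WN [measurable] = measurable_hist_N[OF W]
  define F where "F r w = indicator {r<..} (sg k w) * ((W w * ennreal (exp (c * (sg k w - r)))) * g (X (max 0 (T k w + r)) (pr w)))" for r w
  have "(\<integral>\<^sup>+w. W w * (\<integral>\<^sup>+s\<in>{T k w<..<T (Suc k) w}. g (X (max 0 s) (pr w)) * ennreal (exp (c * (T (Suc k) w - s))) \<partial>lborel) \<partial>PP x) =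
    (\<integral>\<^sup>+w. (\<integral>\<^sup>+r. F r w * indicator {0<..} r \<partial>lborel) \<partial>PP x)"
  proof (rule nn_integral_cong)
    fix w assume "w \<in> space (PP x)"
    then have [measurable]: "pr w \<in> space M" using measurable_space[OF pr_measurable, of w] by simp
    have "(\<integral>\<^sup>+s\<in>{T k w<..<T (Suc k) w}. g (X (max 0 s) (pr w)) * ennreal (exp (c * (T (Suc k) w - s))) \<partial>lborel) =
      (\<integral>\<^sup>+r. g (X (max 0 (T k w + 1 * r)) (pr w)) * ennreal (exp (c * (T (Suc k) w - (T k w + 1 * r)))) * indicator {T k w<..<T (Suc k) w} (T k w + 1 * r) \<partial>lborel)"
      by (subst nn_integral_real_affine[where c=1 and t="T k w"]) auto
    also have "\<dots> = (\<integral>\<^sup>+r. indicator {r<..} (sg k w) * (ennreal (exp (c * (sg k w - r))) * g (X (max 0 (T k w + r)) (pr w))) * indicator {0<..} r \<partial>lborel)"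
      by (intro nn_integral_cong) (auto simp: sg_def diff_diff_eq mult.commute split: split_indicator)
    finally show "W w * (\<integral>\<^sup>+s\<in>{T k w<..<T (Suc k) w}. g (X (max 0 s) (pr w)) * ennreal (exp (c * (T (Suc k) w - s))) \<partial>lborel) =
      (\<integral>\<^sup>+r. F r w * indicator {0<..} r \<partial>lborel)"
      by (simp add: F_def nn_integral_cmult[symmetric] mult_ac indicator_def)
  qed
  also have "\<dots> = (\<integral>\<^sup>+r. (\<integral>\<^sup>+w. F r w * indicator {0<..} r \<partial>PP x) \<partial>lborel)"
  proof (rule LP.Fubini')
    show "(\<lambda>(r, w). F r w * indicator {0<..} r) \<in> borel_measurable (lborel \<Otimes>\<^sub>M PP x)"
      unfolding F_def split_beta' indicator_def greaterThan_iff by measurable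
  qed
  also have "\<dots> = (\<integral>\<^sup>+r. (\<integral>\<^sup>+w. W w * (ennreal (1 / (1 - c)) * (ennreal (exp (- r)) * (\<integral>\<^sup>+z. pp r (xs k w) z * g z \<partial>\<Lambda>))) \<partial>PP x) * indicator {0<..} r \<partial>lborel)"
  proof (intro nn_integral_cong)
    fix r :: real
    show "(\<integral>\<^sup>+w. F r w * indicator {0<..} r \<partial>PP x) =
      (\<integral>\<^sup>+w. W w * (ennreal (1 / (1 - c)) * (ennreal (exp (- r)) * (\<integral>\<^sup>+z. pp r (xs k w) z * g z \<partial>\<Lambda>))) \<partial>PP x) * indicator {0<..} r"
    proof (cases "0 < r")
      case True
      note [measurable] = sg_bridged[of k] W xs_hist[of k k, simplified]
      have wb: "W \<in> borel_measurable (bridged k)" by (intro measurable_stopped_bridged measurable_hist_stopped W)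
      then have "(\<lambda>w. W w * ennreal (exp (c * (sg k w - r)))) \<in> borel_measurable (bridged k)" by measurable
      from bridge_step[OF True this g, of x]
      have "(\<integral>\<^sup>+w. F r w \<partial>PP x) = (\<integral>\<^sup>+w. indicator {r<..} (sg k w) * ((W w * ennreal (exp (c * (sg k w - r)))) * br x0 g (sg k w) r (xs k w) (ys k w)) \<partial>PP x)"
        unfolding F_def .
      also have "\<dots> = (\<integral>\<^sup>+w. UU (\<lambda>y. \<integral>\<^sup>+t\<in>{0<..}. hd (xs k w) y t * (indicator {r<..} t * ((W w * ennreal (exp (c * (t - r)))) * br x0 g t r (xs k w) y)) \<partial>lborel) (xs k w) \<partial>PP x)"
        by (rule step_full_time) measurable
      also have "\<dots> = (\<integral>\<^sup>+w. W w * (ennreal (1 / (1 - c)) * (ennreal (exp (- r)) * (\<integral>\<^sup>+z. pp r (xs k w) z * g z \<partial>\<Lambda>))) \<partial>PP x)"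
      proof (rule nn_integral_cong)
        fix w
        define \<xi> where "\<xi> y t = hd (xs k w) y t * (indicator {r<..} t * ennreal (exp (c * (t - r))) * br x0 g t r (xs k w) y) * indicator {0<..} t" for y t
        have m [measurable]: "(\<lambda>(y, t). \<xi> y t) \<in> borel_measurable (borel \<Otimes>\<^sub>M borel)" unfolding \<xi>_def by measurable
        have "UU (\<lambda>y. \<integral>\<^sup>+t\<in>{0<..}. hd (xs k w) y t * (indicator {r<..} t * ((W w * ennreal (exp (c * (t - r)))) * br x0 g t r (xs k w) y)) \<partial>lborel) (xs k w) =
          UU (\<lambda>y. \<integral>\<^sup>+t. W w * \<xi> y t \<partial>lborel) (xs k w)"
          unfolding \<xi>_def by (simp add: mult_ac)
        also have "\<dots> = UU (\<lambda>y. W w * (\<integral>\<^sup>+t. \<xi> y t \<partial>lborel)) (xs k w)"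
          by (intro nn_integral_cong nn_integral_cmult) measurable
        also have "\<dots> = W w * UU (\<lambda>y. \<integral>\<^sup>+t. \<xi> y t \<partial>lborel) (xs k w)"
          by (rule nn_integral_cmult) measurable
        also have "UU (\<lambda>y. \<integral>\<^sup>+t. \<xi> y t \<partial>lborel) (xs k w) = ennreal (1 / (1 - c)) * (ennreal (exp (- r)) * (\<integral>\<^sup>+z. pp r (xs k w) z * g z \<partial>\<Lambda>))"
          unfolding \<xi>_def by (rule holding_bridge_identity[OF True c g])
        finally show "UU (\<lambda>y. \<integral>\<^sup>+t\<in>{0<..}. hd (xs k w) y t * (indicator {r<..} t * ((W w * ennreal (exp (c * (t - r)))) * br x0 g t r (xs k w) y)) \<partial>lborel) (xs k w) =
          W w * (ennreal (1 / (1 - c)) * (ennreal (exp (- r)) * (\<integral>\<^sup>+z. pp r (xs k w) z * g z \<partial>\<Lambda>)))" .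
      qed
      finally show ?thesis using True by simp
    qed simp
  qed
  also have "\<dots> = (\<integral>\<^sup>+r. (\<integral>\<^sup>+w. W w * (ennreal (1 / (1 - c)) * (ennreal (exp (- r)) * (\<integral>\<^sup>+z. pp r (xs k w) z * g z \<partial>\<Lambda>))) * indicator {0<..} r \<partial>PP x) \<partial>lborel)"
    by (intro nn_integral_cong nn_integral_multc[symmetric]) measurable
  also have "\<dots> = (\<integral>\<^sup>+w. (\<integral>\<^sup>+r. W w * (ennreal (1 / (1 - c)) * (ennreal (exp (- r)) * (\<integral>\<^sup>+z. pp r (xs k w) z * g z \<partial>\<Lambda>))) * indicator {0<..} r \<partial>lborel) \<partial>PP x)"
    by (rule LP.Fubini'[symmetric]) measurable
  also have "\<dots> = (\<integral>\<^sup>+w. ennreal (1 / (1 - c)) * (W w * UU g (xs k w)) \<partial>PP x)"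
  proof (rule nn_integral_cong)
    fix w
    let ?h = "\<lambda>r. ennreal (exp (- r)) * (\<integral>\<^sup>+z. pp r (xs k w) z * g z \<partial>\<Lambda>) * indicator {0<..} r"
    have "(\<integral>\<^sup>+r. W w * (ennreal (1 / (1 - c)) * (ennreal (exp (- r)) * (\<integral>\<^sup>+z. pp r (xs k w) z * g z \<partial>\<Lambda>))) * indicator {0<..} r \<partial>lborel)
      = (\<integral>\<^sup>+r. (W w * ennreal (1 / (1 - c))) * ?h r \<partial>lborel)" by (simp add: mult_ac)
    also have "\<dots> = (W w * ennreal (1 / (1 - c))) * (\<integral>\<^sup>+r. ?h r \<partial>lborel)" by (rule nn_integral_cmult) measurable
    also have "(\<integral>\<^sup>+r. ?h r \<partial>lborel) = UU g (xs k w)"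
      unfolding nn_integral_U1[OF g] by (intro nn_integral_cong) (auto simp: nn_integral_semigroup split: split_indicator)
    finally show "(\<integral>\<^sup>+r. W w * (ennreal (1 / (1 - c)) * (ennreal (exp (- r)) * (\<integral>\<^sup>+z. pp r (xs k w) z * g z \<partial>\<Lambda>))) * indicator {0<..} r \<partial>lborel) =
      ennreal (1 / (1 - c)) * (W w * UU g (xs k w))" by (simp add: mult_ac)
  qed
  also have "\<dots> = ennreal (1 / (1 - c)) * (\<integral>\<^sup>+w. W w * UU g (xs k w) \<partial>PP x)"
    by (rule nn_integral_cmult) measurable
  finally show ?thesis .
qed

end

section \<open>The chain killed at the atom and exponential moments of a cycle\<close>

context nummelin_splitting
begin

interpretation L: sigma_finite_measure \<Lambda> by (rule sigma_finite_\<Lambda>)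

text \<open>The exponential weight is the one produced by \<open>bathtub_exp\<close>. The interval
  is open on the right because \<open>hist j\<close> sees the path only strictly before
  \<open>T j\<close>.\<close>

definition pinte :: "('e \<Rightarrow> ennreal) \<Rightarrow> real \<Rightarrow> nat \<Rightarrow> nat \<Rightarrow> 'v \<Rightarrow> ennreal" where
  "pinte g c i j w = (\<integral>\<^sup>+s\<in>{T i w<..<T j w}. g (X (max 0 s) (pr w)) * ennreal (exp (c * (T j w - s))) \<partial>lborel)"

definition pint :: "('e \<Rightarrow> ennreal) \<Rightarrow> nat \<Rightarrow> nat \<Rightarrow> 'v \<Rightarrow> ennreal" where
  "pint g i j w = (\<integral>\<^sup>+s\<in>{T i w<..<T j w}. g (X (max 0 s) (pr w)) \<partial>lborel)"

lemma pint_pinte: "pint g = pinte g 0"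
  by (intro ext) (simp add: pint_def pinte_def)

lemma pinte_hist:
  assumes ij: "i \<le> j" and j: "0 < j" "j \<le> m" and [measurable]: "g \<in> borel_measurable borel"
  shows "pinte g c i j \<in> borel_measurable (hist m)"
proof (rule measurable_hist_mono[OF _ j(2)])
  define Y where "Y s w = (if 0 \<le> s \<and> s < T j w then X s (pr w) else x0)" for s w
  have Ym: "(\<lambda>(s, w). Y s w) \<in> borel \<Otimes>\<^sub>M hist j \<rightarrow>\<^sub>M borel" unfolding Y_def by (rule path_hist[OF j(1)])
  have "(\<lambda>z. (snd z, fst z)) \<in> hist j \<Otimes>\<^sub>M borel \<rightarrow>\<^sub>M borel \<Otimes>\<^sub>M hist j" by measurable
  from measurable_compose[OF this Ym] have [measurable]: "(\<lambda>z. Y (snd z) (fst z)) \<in> hist j \<Otimes>\<^sub>M borel \<rightarrow>\<^sub>M borel" by simp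
  note [measurable] = T_hist[OF order_refl, of j] T_hist[OF ij]
  have "(\<lambda>w. \<integral>\<^sup>+s. g (Y s w) * ennreal (exp (c * (T j w - s))) * (if T i w < s \<and> s < T j w then 1 else 0) \<partial>lborel) \<in> borel_measurable (hist j)"
    by measurable
  then show "pinte g c i j \<in> borel_measurable (hist j)"
  proof (rule measurable_cong[THEN iffD1, rotated])
    fix w assume "w \<in> space (hist j)"
    then have "0 \<le> T i w" by (simp add: T_nonneg)
    then show "(\<integral>\<^sup>+s. g (Y s w) * ennreal (exp (c * (T j w - s))) * (if T i w < s \<and> s < T j w then 1 else 0) \<partial>lborel) = pinte g c i j w"
      unfolding pinte_def by (intro nn_integral_cong) (auto simp: Y_def max_def split: split_indicator)
  qed
qed

lemma pint_hist: "i \<le> j \<Longrightarrow> 0 < j \<Longrightarrow> j \<le> m \<Longrightarrow> g \<in> borel_measurable borel \<Longrightarrow> pint g i j \<in> borel_measurable (hist m)"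
  unfolding pint_pinte by (rule pinte_hist)

lemma pint_N: "i \<le> j \<Longrightarrow> 0 < j \<Longrightarrow> g \<in> borel_measurable borel \<Longrightarrow> pint g i j \<in> borel_measurable N"
  by (rule measurable_hist_N[OF pint_hist[of i j j g]]) simp_all

lemma pinte_step:
  assumes "W \<in> borel_measurable (hist k)" "c < 1" "g \<in> borel_measurable borel"
  shows "(\<integral>\<^sup>+w. W w * pinte g c k (Suc k) w \<partial>PP x) = ennreal (1 / (1 - c)) * (\<integral>\<^sup>+w. W w * UU g (xs k w) \<partial>PP x)"
  unfolding pinte_def by (rule excursion_step[OF assms])

lemma pint_step:
  assumes "W \<in> borel_measurable (hist k)" "g \<in> borel_measurable borel"
  shows "(\<integral>\<^sup>+w. W w * pint g k (Suc k) w \<partial>PP x) = (\<integral>\<^sup>+w. W w * UU g (xs k w) \<partial>PP x)"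
  unfolding pint_pinte using pinte_step[OF assms(1) _ assms(2), of 0 x] by simp

lemma path_measurable: "w \<in> space N \<Longrightarrow> (\<lambda>s. X (max 0 s) (pr w)) \<in> borel \<rightarrow>\<^sub>M borel"
  using measurable_space[OF pr_measurable, of w] by measurable

lemma pint_add:
  assumes w: "w \<in> space N" and ij: "i \<le> j" "j \<le> k" and [measurable]: "g \<in> borel_measurable borel"
  shows "pint g i k w = pint g i j w + pint g j k w"
proof -
  note [measurable] = path_measurable[OF w]
  have t: "T i w \<le> T j w" "T j w \<le> T k w" using T_mono[OF w] ij by auto
  have "pint g i j w + pint g j k w = (\<integral>\<^sup>+s. g (X (max 0 s) (pr w)) * indicator {T i w<..<T j w} s + g (X (max 0 s) (pr w)) * indicator {T j w<..<T k w} s \<partial>lborel)"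
    unfolding pint_def by (rule nn_integral_add[symmetric]) measurable
  also have "\<dots> = pint g i k w" unfolding pint_def
  proof (rule nn_integral_cong_AE)
    show "AE s in lborel. g (X (max 0 s) (pr w)) * indicator {T i w<..<T j w} s + g (X (max 0 s) (pr w)) * indicator {T j w<..<T k w} s =
      g (X (max 0 s) (pr w)) * indicator {T i w<..<T k w} s"
      using AE_lborel_singleton[of "T j w"]
    proof eventually_elim
      case (elim s)
      then consider "s < T j w" | "T j w < s" by linarith
      then show ?case using t by cases (auto split: split_indicator)
    qed
  qed
  finally show ?thesis by simp
qed

lemma pint_bounded:
  assumes "\<And>x. g x \<le> ennreal m" "i \<le> j" "w \<in> space N" "0 \<le> m"
  shows "pint g i j w \<le> ennreal (m * (T j w - T i w))"
proof -
  have "pint g i j w \<le> (\<integral>\<^sup>+s. ennreal m * indicator {T i w<..<T j w} s \<partial>lborel)"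
    unfolding pint_def by (intro nn_integral_mono mult_right_mono assms) simp
  also have "\<dots> = ennreal (m * (T j w - T i w))"
    using T_mono[OF assms(3,2)] assms(4) by (simp add: nn_integral_cmult_indicator ennreal_mult)
  finally show ?thesis .
qed

lemma pint_LINT:
  assumes [measurable]: "g \<in> borel_measurable borel" and g: "\<And>x. 0 \<le> g x" "\<And>x. g x \<le> m" and w: "w \<in> space N"
  shows "pint (\<lambda>x. ennreal (g x)) i j w = ennreal (LINT s:{T i w..T j w}|lborel. g (X (max 0 s) (pr w)))"
proof -
  note [measurable] = path_measurable[OF w]
  have "pint (\<lambda>x. ennreal (g x)) i j w = (\<integral>\<^sup>+s\<in>{T i w..T j w}. ennreal (g (X (max 0 s) (pr w))) \<partial>lborel)"
    unfolding pint_def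
  proof (rule nn_integral_cong_AE)
    show "AE s in lborel. ennreal (g (X (max 0 s) (pr w))) * indicator {T i w<..<T j w} s =
      ennreal (g (X (max 0 s) (pr w))) * indicator {T i w..T j w} s"
      using AE_lborel_singleton[of "T i w"] AE_lborel_singleton[of "T j w"]
      by eventually_elim (auto split: split_indicator)
  qed
  also have "\<dots> = ennreal (LINT s:{T i w..T j w}|lborel. g (X (max 0 s) (pr w)))"
    by (intro nn_set_integral_eq_LINT set_integrable_bounded[where B=m]) (use g in auto)
  finally show ?thesis .
qed

text \<open>Follows the chain for \<open>n\<close> steps that miss the atom, with a decoration
  \<open>D\<close> on each and a payoff \<open>Y\<close> at the end, at the cost of one application
  of \<open>S\<close> per step. It serves the potentials of the killed chain, with \<open>D\<close>
  equal to 1, as well as Laplace weights.\<close>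

lemma na_chain:
  assumes S_meas: "\<And>\<psi>. \<psi> \<in> borel_measurable borel \<Longrightarrow> S \<psi> \<in> borel_measurable borel"
    and D: "\<And>k. D k \<in> borel_measurable (hist (Suc k))"
    and step: "\<And>k W \<psi>. W \<in> borel_measurable (hist k) \<Longrightarrow> \<psi> \<in> borel_measurable borel \<Longrightarrow>
      (\<integral>\<^sup>+w. W w * (ina k w * D k w * \<psi> (xs (Suc k) w)) \<partial>PP x) = (\<integral>\<^sup>+w. W w * S \<psi> (xs k w) \<partial>PP x)"
    and y: "y \<in> borel_measurable borel"
    and Y: "\<And>k W. W \<in> borel_measurable (hist k) \<Longrightarrow>
      (\<integral>\<^sup>+w. W w * Y k w \<partial>PP x) = (\<integral>\<^sup>+w. W w * y (xs k w) \<partial>PP x)"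
    and W: "W \<in> borel_measurable (hist m)"
  shows "(\<integral>\<^sup>+w. W w * ((\<Prod>i\<in>{m..<m+n}. ina i w * D i w) * Y (m + n) w) \<partial>PP x) =
    (\<integral>\<^sup>+w. W w * (S ^^ n) y (xs m w) \<partial>PP x)"
  using W
proof (induction n arbitrary: m W)
  case 0 then show ?case using Y by simp
next
  case (Suc n)
  have Sn: "(S ^^ n) y \<in> borel_measurable borel" for n using y S_meas by (induction n) auto
  have W': "(\<lambda>w. W w * (ina m w * D m w)) \<in> borel_measurable (hist (Suc m))"
    using measurable_hist_mono[OF Suc.prems, of "Suc m"] D[of m] na_hist[of m "Suc m"] by simp
  have prod: "(\<Prod>i\<in>{m..<m + Suc n}. ina i w * D i w) = (ina m w * D m w) * (\<Prod>i\<in>{Suc m..<Suc m + n}. ina i w * D i w)" for w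
    by (subst prod.atLeast_Suc_lessThan) auto
  have "(\<integral>\<^sup>+w. W w * ((\<Prod>i\<in>{m..<m + Suc n}. ina i w * D i w) * Y (m + Suc n) w) \<partial>PP x) =
    (\<integral>\<^sup>+w. (W w * (ina m w * D m w)) * ((\<Prod>i\<in>{Suc m..<Suc m + n}. ina i w * D i w) * Y (Suc m + n) w) \<partial>PP x)"
    unfolding prod by (simp add: mult.assoc)
  also have "\<dots> = (\<integral>\<^sup>+w. (W w * (ina m w * D m w)) * (S ^^ n) y (xs (Suc m) w) \<partial>PP x)"
    by (rule Suc.IH[OF W'])
  also have "\<dots> = (\<integral>\<^sup>+w. W w * S ((S ^^ n) y) (xs m w) \<partial>PP x)"
    using step[OF Suc.prems Sn[of n]] by (simp add: mult.assoc)
  finally show ?case by simp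
qed

lemma UU_meas [measurable]:
  assumes [measurable]: "\<psi> \<in> borel_measurable borel" shows "(\<lambda>x. UU \<psi> x) \<in> borel_measurable borel"
  by (rule measurable_UU[where \<phi>="\<lambda>_. \<psi>" and g="\<lambda>x. x"]; measurable)

definition Qop :: "('e \<Rightarrow> ennreal) \<Rightarrow> 'e \<Rightarrow> ennreal" where "Qop \<phi> x = QQ \<phi> x"

lemma Qop_meas [measurable]:
  assumes [measurable]: "\<psi> \<in> borel_measurable borel" shows "Qop \<psi> \<in> borel_measurable borel"
  unfolding Qop_def[abs_def] by (rule measurable_QQ[where \<phi>="\<lambda>_. \<psi>" and g="\<lambda>x. x"]; measurable)

lemma Qop_pow_meas [measurable]: "\<psi> \<in> borel_measurable borel \<Longrightarrow> (Qop ^^ n) \<psi> \<in> borel_measurable borel"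
  by (induction n) auto

lemma Qop_step:
  assumes W [measurable]: "W \<in> borel_measurable (hist k)" and [measurable]: "\<psi> \<in> borel_measurable borel"
  shows "(\<integral>\<^sup>+w. W w * (ina k w * \<psi> (xs (Suc k) w)) \<partial>PP x) = (\<integral>\<^sup>+w. W w * Qop \<psi> (xs k w) \<partial>PP x)"
proof -
  have "(\<integral>\<^sup>+w. W w * (ina k w * \<psi> (xs (Suc k) w)) \<partial>PP x) = (\<integral>\<^sup>+w. ina k w * (W w * \<psi> (ys k w)) \<partial>PP x)"
    by (intro nn_integral_cong) (simp add: xs_Suc mult_ac)
  also have "\<dots> = (\<integral>\<^sup>+w. QQ (\<lambda>y. W w * \<psi> y) (xs k w) \<partial>PP x)" by (rule step_na) measurable
  also have "\<dots> = (\<integral>\<^sup>+w. W w * Qop \<psi> (xs k w) \<partial>PP x)"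
    unfolding Qop_def by (intro nn_integral_cong nn_integral_cmult) simp
  finally show ?thesis .
qed

lemma UU_step:
  assumes W [measurable]: "W \<in> borel_measurable (hist k)" and [measurable]: "\<psi> \<in> borel_measurable borel"
  shows "(\<integral>\<^sup>+w. W w * \<psi> (xs (Suc k) w) \<partial>PP x) = (\<integral>\<^sup>+w. W w * UU \<psi> (xs k w) \<partial>PP x)"
proof -
  have "(\<integral>\<^sup>+w. W w * \<psi> (xs (Suc k) w) \<partial>PP x) = (\<integral>\<^sup>+w. W w * \<psi> (ys k w) \<partial>PP x)"
    by (intro nn_integral_cong) (simp add: xs_Suc)
  also have "\<dots> = (\<integral>\<^sup>+w. UU (\<lambda>y. W w * \<psi> y) (xs k w) \<partial>PP x)" by (rule step_full) measurable
  also have "\<dots> = (\<integral>\<^sup>+w. W w * UU \<psi> (xs k w) \<partial>PP x)"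
    by (intro nn_integral_cong nn_integral_cmult) simp
  finally show ?thesis .
qed

lemma atom_step:
  assumes W [measurable]: "W \<in> borel_measurable (hist k)" and [measurable]: "\<psi> \<in> borel_measurable borel"
  shows "(\<integral>\<^sup>+w. W w * (ia k w * \<psi> (xs (Suc k) w)) \<partial>PP x) = (\<integral>\<^sup>+w. W w * ia k w \<partial>PP x) * (\<integral>\<^sup>+y. \<psi> y \<partial>\<nu>)"
proof -
  have *: "(\<integral>\<^sup>+w. W w * (ia k w * \<psi> (xs (Suc k) w)) \<partial>PP x) = (\<integral>\<^sup>+w. ennreal a * indicator C (xs k w) * W w \<partial>PP x) * (\<integral>\<^sup>+y. \<psi> y \<partial>\<nu>)"
    if [measurable]: "\<psi> \<in> borel_measurable borel" for \<psi>
  proof -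
    have "(\<integral>\<^sup>+w. W w * (ia k w * \<psi> (xs (Suc k) w)) \<partial>PP x) = (\<integral>\<^sup>+w. ia k w * (W w * \<psi> (ys k w)) \<partial>PP x)"
      by (intro nn_integral_cong) (simp add: xs_Suc mult_ac)
    also have "\<dots> = (\<integral>\<^sup>+w. ennreal a * indicator C (xs k w) * (\<integral>\<^sup>+y. W w * \<psi> y \<partial>\<nu>) \<partial>PP x)" by (rule step_at) measurable
    also have "\<dots> = (\<integral>\<^sup>+w. (ennreal a * indicator C (xs k w) * W w) * (\<integral>\<^sup>+y. \<psi> y \<partial>\<nu>) \<partial>PP x)"
      by (intro nn_integral_cong) (simp add: nn_integral_cmult mult.assoc)
    also have "\<dots> = (\<integral>\<^sup>+w. ennreal a * indicator C (xs k w) * W w \<partial>PP x) * (\<integral>\<^sup>+y. \<psi> y \<partial>\<nu>)"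
    proof (rule nn_integral_multc)
      note [measurable del] = W and [measurable] = measurable_hist_N[OF W]
      show "(\<lambda>w. ennreal a * indicator C (xs k w) * W w) \<in> borel_measurable (PP x)" by measurable
    qed
    finally show ?thesis .
  qed
  show ?thesis using *[of \<psi>] *[of "\<lambda>_. 1"] by (simp add: emeasure_\<nu>_UNIV)
qed

text \<open>The potential of the chain killed at the atom: the mean integral of \<open>g\<close> up
  to the end of the first step on the atom, index 0 included. A cycle does not test its first index,
  since the next atom time lies strictly after the regeneration time; \<open>Psi\<close> puts this
  untested step in front and is the mean over a cycle.\<close>

definition VV :: "('e \<Rightarrow> ennreal) \<Rightarrow> 'e \<Rightarrow> ennreal" where "VV g x = (\<Sum>n. (Qop ^^ n) (UU g) x)"
definition Psi :: "('e \<Rightarrow> ennreal) \<Rightarrow> 'e \<Rightarrow> ennreal" where "Psi g x = UU g x + UU (VV g) x"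

lemma VV_meas [measurable]: "g \<in> borel_measurable borel \<Longrightarrow> VV g \<in> borel_measurable borel"
  unfolding VV_def[abs_def] by (intro borel_measurable_suminf_order Qop_pow_meas UU_meas)

lemma Psi_meas [measurable]: "g \<in> borel_measurable borel \<Longrightarrow> Psi g \<in> borel_measurable borel"
  unfolding Psi_def[abs_def] by (intro borel_measurable_add UU_meas VV_meas)

lemma VV_unfold:
  assumes [measurable]: "g \<in> borel_measurable borel"
  shows "VV g x = UU g x + Qop (VV g) x"
proof -
  have "VV g x = (Qop ^^ 0) (UU g) x + (\<Sum>n. (Qop ^^ Suc n) (UU g) x)"
    unfolding VV_def using suminf_offset[of "\<lambda>n. (Qop ^^ n) (UU g) x" 1] by (simp add: summableI)
  also have "(\<Sum>n. (Qop ^^ Suc n) (UU g) x) = (\<Sum>n. QQ ((Qop ^^ n) (UU g)) x)"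
    by (simp only: funpow.simps(2) o_apply Qop_def)
  also have "\<dots> = QQ (\<lambda>y. \<Sum>n. (Qop ^^ n) (UU g) y) x"
    by (rule nn_integral_suminf[symmetric]) simp
  also have "\<dots> = Qop (VV g) x" by (simp only: Qop_def VV_def[abs_def])
  finally show ?thesis by simp
qed

lemma Qop_le_UU: "\<psi> \<in> borel_measurable borel \<Longrightarrow> Qop \<psi> x \<le> UU \<psi> x"
  by (simp add: Q0_add Qop_def)

lemma VV_le_Psi: "g \<in> borel_measurable borel \<Longrightarrow> VV g x \<le> Psi g x"
  unfolding VV_unfold Psi_def by (intro add_left_mono Qop_le_UU) simp

text \<open>The integral of \<open>g\<close> over \<open>[T\<^sub>m, T\<^sub>k\<^sub>+\<^sub>1)\<close>, where \<open>k\<close> is the first index beyond \<open>m\<close> at which the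
  atom is visited.\<close>
definition cint :: "('e \<Rightarrow> ennreal) \<Rightarrow> nat \<Rightarrow> 'v \<Rightarrow> ennreal" where
  "cint g m w = pint g m (Suc m) w + (\<Sum>n. (\<Prod>i\<in>{Suc m..<Suc m + n}. ina i w) * pint g (Suc m + n) (Suc (Suc m + n)) w)"

lemma cint_N [measurable]:
  assumes g: "g \<in> borel_measurable borel" shows "cint g m \<in> borel_measurable N"
proof -
  have [measurable]: "pint g k (Suc k) \<in> borel_measurable N" for k by (rule pint_N[OF _ _ g]) auto
  show ?thesis unfolding cint_def[abs_def] by measurable
qed

lemma cint_step:
  assumes W [measurable]: "W \<in> borel_measurable (hist m)" and g [measurable]: "g \<in> borel_measurable borel"
  shows "(\<integral>\<^sup>+w. W w * cint g m w \<partial>PP x) = (\<integral>\<^sup>+w. W w * Psi g (xs m w) \<partial>PP x)"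
proof -
  note WN [measurable] = measurable_hist_N[OF W]
  have W': "W \<in> borel_measurable (hist (Suc m))" by (rule measurable_hist_mono[OF W]) simp
  define s where "s n w = (\<Prod>i\<in>{Suc m..<Suc m + n}. ina i w) * pint g (Suc m + n) (Suc (Suc m + n)) w" for n w
  have [measurable]: "pint g k (Suc k) \<in> borel_measurable N" for k by (rule pint_N) auto
  have [measurable]: "s n \<in> borel_measurable N" for n unfolding s_def by measurable
  have 1: "(\<integral>\<^sup>+w. W w * s n w \<partial>PP x) = (\<integral>\<^sup>+w. W w * (Qop ^^ n) (UU g) (xs (Suc m) w) \<partial>PP x)" for n
    using na_chain[where S=Qop and D="\<lambda>_ _. 1" and y="UU g" and Y="\<lambda>k. pint g k (Suc k)" and n=n and x=x, OF _ _ _ _ _ W']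
      Qop_step pint_step[OF _ g] unfolding s_def by simp
  have "(\<integral>\<^sup>+w. W w * cint g m w \<partial>PP x) = (\<integral>\<^sup>+w. W w * pint g m (Suc m) w + (\<Sum>n. W w * s n w) \<partial>PP x)"
    unfolding cint_def s_def[symmetric] by (simp add: distrib_left)
  also have "\<dots> = (\<integral>\<^sup>+w. W w * pint g m (Suc m) w \<partial>PP x) + (\<Sum>n. \<integral>\<^sup>+w. W w * s n w \<partial>PP x)"
  proof -
    have "(\<integral>\<^sup>+w. W w * pint g m (Suc m) w + (\<Sum>n. W w * s n w) \<partial>PP x) =
      (\<integral>\<^sup>+w. W w * pint g m (Suc m) w \<partial>PP x) + (\<integral>\<^sup>+w. (\<Sum>n. W w * s n w) \<partial>PP x)"
      by (rule nn_integral_add) measurable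
    also have "(\<integral>\<^sup>+w. (\<Sum>n. W w * s n w) \<partial>PP x) = (\<Sum>n. \<integral>\<^sup>+w. W w * s n w \<partial>PP x)"
      by (rule nn_integral_suminf) measurable
    finally show ?thesis .
  qed
  also have "\<dots> = (\<integral>\<^sup>+w. W w * UU g (xs m w) \<partial>PP x) + (\<Sum>n. \<integral>\<^sup>+w. W w * (Qop ^^ n) (UU g) (xs (Suc m) w) \<partial>PP x)"
    unfolding 1 pint_step[OF W g] ..
  also have "(\<Sum>n. \<integral>\<^sup>+w. W w * (Qop ^^ n) (UU g) (xs (Suc m) w) \<partial>PP x) = (\<integral>\<^sup>+w. W w * VV g (xs (Suc m) w) \<partial>PP x)"
    unfolding VV_def by (subst nn_integral_suminf[symmetric]) simp_all
  also have "\<dots> = (\<integral>\<^sup>+w. W w * UU (VV g) (xs m w) \<partial>PP x)"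
    by (rule UU_step[OF W]) simp
  also have "(\<integral>\<^sup>+w. W w * UU g (xs m w) \<partial>PP x) + \<dots> = (\<integral>\<^sup>+w. W w * Psi g (xs m w) \<partial>PP x)"
    unfolding Psi_def by (subst nn_integral_add[symmetric]) (simp_all add: distrib_left)
  finally show ?thesis .
qed

definition first_atom :: "nat \<Rightarrow> nat \<Rightarrow> 'v \<Rightarrow> bool" where
  "first_atom m k w \<longleftrightarrow> m \<le> k \<and> atom k w \<and> (\<forall>i\<in>{m..<k}. \<not> atom i w)"

lemma prod_ina: "finite I \<Longrightarrow> (\<Prod>i\<in>I. ina i w) = (if \<forall>i\<in>I. \<not> atom i w then 1 else 0)"
  by (induction I rule: finite_induct) (auto split: split_indicator)

lemma cint_first_atom:
  assumes w: "w \<in> space N" and fa: "first_atom (Suc m) k w" and g: "g \<in> borel_measurable borel"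
  shows "cint g m w = pint g m (Suc k) w"
proof -
  from fa have mk: "Suc m \<le> k" and at: "atom k w" and nat: "\<And>i. Suc m \<le> i \<Longrightarrow> i < k \<Longrightarrow> \<not> atom i w"
    by (auto simp: first_atom_def)
  define d where "d = Suc k - Suc m"
  have "(\<Sum>n. (\<Prod>i\<in>{Suc m..<Suc m + n}. ina i w) * pint g (Suc m + n) (Suc (Suc m + n)) w) =
    (\<Sum>n<d. (\<Prod>i\<in>{Suc m..<Suc m + n}. ina i w) * pint g (Suc m + n) (Suc (Suc m + n)) w)"
  proof (rule suminf_finite)
    fix n assume "n \<notin> {..<d}"
    then have "k \<in> {Suc m..<Suc m + n}" using mk by (auto simp: d_def)
    then show "(\<Prod>i\<in>{Suc m..<Suc m + n}. ina i w) * pint g (Suc m + n) (Suc (Suc m + n)) w = 0"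
    proof -
      have "\<not> (\<forall>i\<in>{Suc m..<Suc m + n}. \<not> atom i w)" using at \<open>k \<in> _\<close> by blast
      then show ?thesis by (simp only: prod_ina[OF finite_atLeastLessThan] if_False mult_zero_left)
    qed
  qed simp
  also have "\<dots> = (\<Sum>n<d. pint g (Suc m + n) (Suc (Suc m + n)) w)"
    by (intro sum.cong refl) (auto simp: prod_ina d_def nat)
  also have "\<dots> = pint g (Suc m) (Suc m + d) w"
  proof (induction d)
    case (Suc d)
    then show ?case using pint_add[OF w _ _ g, of "Suc m" "Suc m + d" "Suc (Suc m + d)"] by simp
  qed (simp add: pint_def)
  finally show ?thesis using mk pint_add[OF w _ _ g, of m "Suc m" "Suc k"] by (simp add: cint_def d_def)
qed

text \<open>Truncated exponential functionals; the index counts the steps that are still followed.\<close>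
primrec exps :: "(nat \<Rightarrow> 'v \<Rightarrow> ennreal) \<Rightarrow> nat \<Rightarrow> nat \<Rightarrow> 'v \<Rightarrow> ennreal" where
  "exps e 0 m w = 1"
| "exps e (Suc n) m w = e m w * (ia m w + ina m w * exps e n (Suc m) w)"

lemma exps_N [measurable]:
  assumes [measurable]: "\<And>k. e k \<in> borel_measurable N"
  shows "exps e n m \<in> borel_measurable N"
proof (induction n arbitrary: m)
  case (Suc n) note [measurable] = Suc show ?case unfolding exps.simps by measurable
next
  case 0
  have "exps e 0 m = (\<lambda>_. 1)" by (rule ext) simp
  then show ?case by simp
qed

lemma exps_mono:
  assumes "\<And>k. 1 \<le> e k w" shows "exps e n m w \<le> exps e (Suc n) m w"
proof (induction n arbitrary: m)
  case 0
  have "ia m w + ina m w * exps e 0 (Suc m) w = 1" by (simp add: at_na)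
  then show ?case using assms[of m] by simp
next
  case (Suc n) then show ?case
    by (simp only: exps.simps(2)) (intro mult_left_mono add_left_mono, auto)
qed

definition eA :: "real \<Rightarrow> ('e \<Rightarrow> real) \<Rightarrow> nat \<Rightarrow> nat \<Rightarrow> 'v \<Rightarrow> ennreal" where
  "eA l g i j w = ennreal (exp (l * enn2real (pint (\<lambda>x. ennreal (g x)) i j w)))"

context
  fixes g :: "'e \<Rightarrow> real" and m K l c Cc :: real
  assumes g [measurable]: "g \<in> borel_measurable borel" and g0: "\<And>x. 0 \<le> g x" and gm: "\<And>x. g x \<le> m" and m: "0 < m"
    and Cc: "0 \<le> Cc" "\<And>x. Psi (\<lambda>x. ennreal (g x)) x \<le> ennreal Cc"
    and K: "K = m + Cc" and l: "0 < l" "l * K < 1" and c: "c = l / (1 - l * K)"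
begin

abbreviation "gg \<equiv> \<lambda>x. ennreal (g x)"

lemma lm: "l * m < 1"
proof -
  have "l * m \<le> l * K" using l Cc unfolding K by (intro mult_left_mono) auto
  then show ?thesis using l by linarith
qed

lemma c_pos: "0 < c" using l by (simp add: c)

text \<open>\<open>c\<close> solves \<open>c (1 - l m) = l (1 + c Cc)\<close>, the relation under
  which \<open>exp_one_step\<close> reproduces \<open>c\<close>. With \<open>K = m + Cc\<close> the
  solution is positive because \<open>l K < 1\<close>.\<close>

lemma c_bound: "1 + c * Cc = (1 - l * m) / (1 - l * K)"
  using l by (simp add: c K field_simps)

lemma pint_finite: "i \<le> j \<Longrightarrow> w \<in> space N \<Longrightarrow> pint gg i j w < \<infinity>"
  using pint_bounded[of gg m i j w] gm m by (auto simp: le_less_trans ennreal_leI intro: le_less_trans[OF _ ennreal_less_top])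

lemma eA_ge1: "1 \<le> eA l g i j w"
  using l by (simp add: eA_def)

lemma eA_add:
  assumes "w \<in> space N" "i \<le> j" "j \<le> k" shows "eA l g i k w = eA l g i j w * eA l g j k w"
  using pint_add[OF assms, of gg] pint_finite[OF assms(2,1)] pint_finite[OF assms(3,1)]
  by (simp add: eA_def enn2real_plus ennreal_mult[symmetric] exp_add[symmetric] distrib_left)

lemma eA_hist: "i \<le> j \<Longrightarrow> 0 < j \<Longrightarrow> j \<le> k \<Longrightarrow> eA l g i j \<in> borel_measurable (hist k)"
  unfolding eA_def[abs_def] using pint_hist[of i j k gg] by measurable

lemma eA_bathtub:
  assumes w: "w \<in> space N"
  shows "eA l g k (Suc k) w \<le> 1 + ennreal l * pinte gg (l * m) k (Suc k) w"
proof -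
  note [measurable] = path_measurable[OF w]
  have e: "enn2real (pint gg k (Suc k) w) = (LINT s:{T k w..T (Suc k) w}|lborel. g (X (max 0 s) (pr w)))"
    unfolding pint_LINT[OF g g0 gm w]
    by (rule enn2real_ennreal) (auto simp: set_lebesgue_integral_def g0 intro!: integral_nonneg_AE)
  have "eA l g k (Suc k) w \<le> 1 + ennreal l * (\<integral>\<^sup>+s\<in>{T k w..T (Suc k) w}. ennreal (g (X (max 0 s) (pr w)) * exp (l * m * (T (Suc k) w - s))) \<partial>lborel)"
    unfolding eA_def e by (rule bathtub_exp) (use g0 gm l m T_increasing[OF w, of k] in auto)
  also have "(\<integral>\<^sup>+s\<in>{T k w..T (Suc k) w}. ennreal (g (X (max 0 s) (pr w)) * exp (l * m * (T (Suc k) w - s))) \<partial>lborel) = pinte gg (l * m) k (Suc k) w"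
    unfolding pinte_def
  proof (rule nn_integral_cong_AE)
    show "AE s in lborel. ennreal (g (X (max 0 s) (pr w)) * exp (l * m * (T (Suc k) w - s))) * indicator {T k w..T (Suc k) w} s =
      ennreal (g (X (max 0 s) (pr w))) * ennreal (exp (l * m * (T (Suc k) w - s))) * indicator {T k w<..<T (Suc k) w} s"
      using AE_lborel_singleton[of "T k w"] AE_lborel_singleton[of "T (Suc k) w"]
      by eventually_elim (auto split: split_indicator simp: ennreal_mult g0)
  qed
  finally show ?thesis .
qed

text \<open>The factor \<open>b\<close> of the later steps depends on the end point, hence on the
  integral over the present interval, and cannot be separated from it. After
  \<open>eA_bathtub\<close> it is kept as it is against the term 1 and replaced by its bound
  \<open>1 + c Cc\<close> in the term linear in the path, whose mean is known.\<close>

lemma exp_one_step: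
  assumes W [measurable]: "W \<in> borel_measurable (hist k)" and b [measurable]: "b \<in> borel_measurable N"
    and bC: "\<And>w. b w \<le> ennreal (1 + c * Cc)"
  shows "(\<integral>\<^sup>+w. W w * (eA l g k (Suc k) w * b w) \<partial>PP x) \<le>
    (\<integral>\<^sup>+w. W w * b w \<partial>PP x) + ennreal c * (\<integral>\<^sup>+w. W w * UU gg (xs k w) \<partial>PP x)"
proof -
  note WN [measurable] = measurable_hist_N[OF W]
  have [measurable]: "pinte gg (l * m) k (Suc k) \<in> borel_measurable N"
    by (rule measurable_hist_N[OF pinte_hist[of k "Suc k" "Suc k"]]) auto
  have "(\<integral>\<^sup>+w. W w * (eA l g k (Suc k) w * b w) \<partial>PP x) \<le>
    (\<integral>\<^sup>+w. W w * b w + ennreal (l * (1 + c * Cc)) * (W w * pinte gg (l * m) k (Suc k) w) \<partial>PP x)"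
  proof (rule nn_integral_mono)
    fix w assume "w \<in> space (PP x)"
    then have w: "w \<in> space N" by simp
    have "eA l g k (Suc k) w * b w \<le> (1 + ennreal l * pinte gg (l * m) k (Suc k) w) * b w"
      by (intro mult_right_mono eA_bathtub w) simp
    also have "\<dots> = b w + ennreal l * pinte gg (l * m) k (Suc k) w * b w" by (simp add: distrib_right)
    also have "\<dots> \<le> b w + ennreal l * pinte gg (l * m) k (Suc k) w * ennreal (1 + c * Cc)"
      by (intro add_left_mono mult_left_mono bC) simp
    finally have "W w * (eA l g k (Suc k) w * b w) \<le> W w * (b w + ennreal l * pinte gg (l * m) k (Suc k) w * ennreal (1 + c * Cc))"
      by (rule mult_left_mono) simp
    also have "\<dots> = W w * b w + ennreal (l * (1 + c * Cc)) * (W w * pinte gg (l * m) k (Suc k) w)"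
    proof -
      have "ennreal (l * (1 + c * Cc)) = ennreal l * ennreal (1 + c * Cc)" using l c_pos Cc by (intro ennreal_mult) auto
      then show ?thesis by (simp only: distrib_left mult_ac)
    qed
    finally show "W w * (eA l g k (Suc k) w * b w) \<le> \<dots>" .
  qed
  also have "\<dots> = (\<integral>\<^sup>+w. W w * b w \<partial>PP x) + ennreal (l * (1 + c * Cc)) * (\<integral>\<^sup>+w. W w * pinte gg (l * m) k (Suc k) w \<partial>PP x)"
    by (subst nn_integral_add) (simp_all add: nn_integral_cmult)
  also have "\<dots> = (\<integral>\<^sup>+w. W w * b w \<partial>PP x) + ennreal (l * (1 + c * Cc)) * (ennreal (1 / (1 - l * m)) * (\<integral>\<^sup>+w. W w * UU gg (xs k w) \<partial>PP x))"
    by (subst pinte_step[OF W lm]) auto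
  also have "ennreal (l * (1 + c * Cc)) * (ennreal (1 / (1 - l * m)) * (\<integral>\<^sup>+w. W w * UU gg (xs k w) \<partial>PP x)) =
    ennreal c * (\<integral>\<^sup>+w. W w * UU gg (xs k w) \<partial>PP x)"
  proof -
    have "l * (1 + c * Cc) * (1 / (1 - l * m)) = c" unfolding c_bound using lm by (simp add: c)
    moreover have "0 \<le> l * (1 + c * Cc)" using l c_pos Cc by simp
    ultimately have "ennreal (l * (1 + c * Cc)) * ennreal (1 / (1 - l * m)) = ennreal c"
      using lm by (simp add: ennreal_mult[symmetric])
    then show ?thesis by (simp add: mult.assoc[symmetric])
  qed
  finally show ?thesis .
qed

lemma VV_le: "VV gg x \<le> ennreal Cc"
  using VV_le_Psi[of gg x] Cc(2)[of x] by simp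

lemma one_VV_le: "1 + ennreal c * VV gg x \<le> ennreal (1 + c * Cc)"
proof -
  have "1 + ennreal c * VV gg x \<le> 1 + ennreal c * ennreal Cc" by (intro add_left_mono mult_left_mono VV_le) simp
  also have "\<dots> = ennreal (1 + c * Cc)" using c_pos Cc by (simp add: ennreal_mult)
  finally show ?thesis .
qed

text \<open>The decomposition of \<open>VV\<close> into \<open>UU gg\<close> and
  \<open>Qop (VV gg)\<close> mirrors one step of \<open>exps\<close>: the present interval costs
  \<open>c\<close> times the first part by \<open>exp_one_step\<close>, and on paths that miss the
  atom the later steps cost \<open>c\<close> times the second.\<close>

lemma exps_bound:
  "W \<in> borel_measurable (hist k) \<Longrightarrow>
    (\<integral>\<^sup>+w. W w * exps (\<lambda>k. eA l g k (Suc k)) n k w \<partial>PP x) \<le> (\<integral>\<^sup>+w. W w * (1 + ennreal c * VV gg (xs k w)) \<partial>PP x)"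
proof (induction n arbitrary: k W)
  case 0
  then show ?case by (auto intro!: nn_integral_mono simp: distrib_left)
next
  case (Suc n)
  let ?e = "\<lambda>k. eA l g k (Suc k)"
  note W = Suc.prems
  note [measurable] = measurable_hist_N[OF W]
  have em [measurable]: "?e k \<in> borel_measurable N" for k
    by (rule measurable_hist_N[OF eA_hist[of k "Suc k" "Suc k"]]) auto
  let ?b = "\<lambda>w. ia k w + ina k w * (1 + ennreal c * VV gg (xs (Suc k) w))"
  have W': "(\<lambda>w. W w * ?e k w * ina k w) \<in> borel_measurable (hist (Suc k))"
    using measurable_hist_mono[OF W, of "Suc k"] eA_hist[of k "Suc k" "Suc k"] na_hist[of k "Suc k"] by simp
  have "(\<integral>\<^sup>+w. W w * exps ?e (Suc n) k w \<partial>PP x) =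
    (\<integral>\<^sup>+w. W w * ?e k w * ia k w + (W w * ?e k w * ina k w) * exps ?e n (Suc k) w \<partial>PP x)"
    by (simp add: distrib_left mult_ac)
  also have "\<dots> = (\<integral>\<^sup>+w. W w * ?e k w * ia k w \<partial>PP x) + (\<integral>\<^sup>+w. (W w * ?e k w * ina k w) * exps ?e n (Suc k) w \<partial>PP x)"
    by (rule nn_integral_add) measurable
  also have "\<dots> \<le> (\<integral>\<^sup>+w. W w * ?e k w * ia k w \<partial>PP x) + (\<integral>\<^sup>+w. (W w * ?e k w * ina k w) * (1 + ennreal c * VV gg (xs (Suc k) w)) \<partial>PP x)"
    by (intro add_left_mono Suc.IH W')
  also have "\<dots> = (\<integral>\<^sup>+w. W w * (?e k w * ?b w) \<partial>PP x)"
    by (subst nn_integral_add[symmetric]) (simp_all add: distrib_left mult_ac)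
  also have "\<dots> \<le> (\<integral>\<^sup>+w. W w * ?b w \<partial>PP x) + ennreal c * (\<integral>\<^sup>+w. W w * UU gg (xs k w) \<partial>PP x)"
  proof (rule exp_one_step[OF W])
    show "?b w \<le> ennreal (1 + c * Cc)" for w
      using one_VV_le[of "xs (Suc k) w"] c_pos Cc(1) by (auto split: split_indicator)
  qed measurable
  also have "(\<integral>\<^sup>+w. W w * ?b w \<partial>PP x) = (\<integral>\<^sup>+w. W w + W w * (ina k w * (ennreal c * VV gg (xs (Suc k) w))) \<partial>PP x)"
    by (intro nn_integral_cong) (auto simp: distrib_left split: split_indicator)
  also have "\<dots> = (\<integral>\<^sup>+w. W w \<partial>PP x) + (\<integral>\<^sup>+w. W w * (ina k w * (ennreal c * VV gg (xs (Suc k) w))) \<partial>PP x)"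
    by (rule nn_integral_add) measurable
  also have "(\<integral>\<^sup>+w. W w * (ina k w * (ennreal c * VV gg (xs (Suc k) w))) \<partial>PP x) = (\<integral>\<^sup>+w. W w * Qop (\<lambda>y. ennreal c * VV gg y) (xs k w) \<partial>PP x)"
    by (rule Qop_step[OF W]) simp
  also have "\<dots> = (\<integral>\<^sup>+w. ennreal c * (W w * Qop (VV gg) (xs k w)) \<partial>PP x)"
    by (intro nn_integral_cong) (simp add: Qop_def nn_integral_cmult mult_ac)
  also have "\<dots> = ennreal c * (\<integral>\<^sup>+w. W w * Qop (VV gg) (xs k w) \<partial>PP x)"
    by (rule nn_integral_cmult) measurable
  finally have "(\<integral>\<^sup>+w. W w * exps ?e (Suc n) k w \<partial>PP x) \<le>
    (\<integral>\<^sup>+w. W w \<partial>PP x) + ennreal c * (\<integral>\<^sup>+w. W w * Qop (VV gg) (xs k w) \<partial>PP x) + ennreal c * (\<integral>\<^sup>+w. W w * UU gg (xs k w) \<partial>PP x)" .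
  also have "\<dots> = (\<integral>\<^sup>+w. W w * (1 + ennreal c * VV gg (xs k w)) \<partial>PP x)"
  proof -
    have "(\<integral>\<^sup>+w. W w * (1 + ennreal c * VV gg (xs k w)) \<partial>PP x) =
      (\<integral>\<^sup>+w. (W w + ennreal c * (W w * Qop (VV gg) (xs k w))) + ennreal c * (W w * UU gg (xs k w)) \<partial>PP x)"
    proof (rule nn_integral_cong)
      fix w
      have "VV gg (xs k w) = UU gg (xs k w) + Qop (VV gg) (xs k w)" by (rule VV_unfold) simp
      then show "W w * (1 + ennreal c * VV gg (xs k w)) = (W w + ennreal c * (W w * Qop (VV gg) (xs k w))) + ennreal c * (W w * UU gg (xs k w))"
        by (simp only: distrib_left mult_ac add_ac mult_1_right mult_1_left)
    qed
    also have "\<dots> = (\<integral>\<^sup>+w. W w + ennreal c * (W w * Qop (VV gg) (xs k w)) \<partial>PP x) + (\<integral>\<^sup>+w. ennreal c * (W w * UU gg (xs k w)) \<partial>PP x)"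
      by (rule nn_integral_add) measurable
    also have "(\<integral>\<^sup>+w. W w + ennreal c * (W w * Qop (VV gg) (xs k w)) \<partial>PP x) = (\<integral>\<^sup>+w. W w \<partial>PP x) + (\<integral>\<^sup>+w. ennreal c * (W w * Qop (VV gg) (xs k w)) \<partial>PP x)"
      by (rule nn_integral_add) measurable
    finally show ?thesis by (simp add: nn_integral_cmult)
  qed
  finally show ?case .
qed

lemma exps_first_atom:
  assumes w: "w \<in> space N"
  shows "first_atom k (k + d) w \<Longrightarrow> eA l g k (Suc (k + d)) w = exps (\<lambda>k. eA l g k (Suc k)) (Suc d) k w"
proof (induction d arbitrary: k)
  case 0 then show ?case by (simp add: first_atom_def)
next
  case (Suc d)
  then have "first_atom (Suc k) (Suc k + d) w" and na: "\<not> atom k w" by (auto simp: first_atom_def)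
  from Suc.IH[OF this(1)] have "eA l g (Suc k) (Suc (Suc k + d)) w = exps (\<lambda>k. eA l g k (Suc k)) (Suc d) (Suc k) w" .
  then show ?case using na eA_add[OF w, of k "Suc k" "Suc (k + Suc d)"] by simp
qed

lemma exp_from:
  assumes W: "W \<in> borel_measurable (hist k)"
    and Y: "\<And>w. w \<in> space N \<Longrightarrow> Y w \<le> (SUP n. exps (\<lambda>k. eA l g k (Suc k)) n k w)"
  shows "(\<integral>\<^sup>+w. W w * Y w \<partial>PP x) \<le> (\<integral>\<^sup>+w. W w * (1 + ennreal c * VV gg (xs k w)) \<partial>PP x)"
proof -
  let ?e = "\<lambda>k. eA l g k (Suc k)"
  note [measurable] = measurable_hist_N[OF W]
  have em [measurable]: "?e k \<in> borel_measurable N" for k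
    by (rule measurable_hist_N[OF eA_hist[of k "Suc k" "Suc k"]]) auto
  have "(\<integral>\<^sup>+w. W w * Y w \<partial>PP x) \<le> (\<integral>\<^sup>+w. (SUP n. W w * exps ?e n k w) \<partial>PP x)"
    by (intro nn_integral_mono) (simp add: SUP_mult_left_ennreal[symmetric] Y mult_left_mono)
  also have "\<dots> = (SUP n. \<integral>\<^sup>+w. W w * exps ?e n k w \<partial>PP x)"
    by (intro nn_integral_monotone_convergence_SUP incseq_SucI le_funI mult_left_mono exps_mono eA_ge1) auto
  also have "\<dots> \<le> (\<integral>\<^sup>+w. W w * (1 + ennreal c * VV gg (xs k w)) \<partial>PP x)"
    by (intro SUP_least exps_bound W)
  finally show ?thesis .
qed

text \<open>A cycle opens with a step that is not tested for the atom, so the bound by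
  \<open>VV\<close> applies one step later; averaging it by \<open>UU\<close> and adding the cost of
  the first interval yields \<open>Psi\<close>.\<close>

lemma exp_cycle:
  assumes W [measurable]: "W \<in> borel_measurable (hist k)" and Ym [measurable]: "Y \<in> borel_measurable N"
    and Y: "\<And>w. w \<in> space N \<Longrightarrow> Y w \<le> (SUP n. exps (\<lambda>k. eA l g k (Suc k)) n (Suc k) w)"
  shows "(\<integral>\<^sup>+w. W w * (eA l g k (Suc k) w * Y w) \<partial>PP x) \<le> (\<integral>\<^sup>+w. W w * (1 + ennreal c * Psi gg (xs k w)) \<partial>PP x)"
proof -
  note WN [measurable] = measurable_hist_N[OF W]
  have "(\<lambda>w. W w * eA l g k (Suc k) w) \<in> borel_measurable (hist (Suc k))"
    using measurable_hist_mono[OF W, of "Suc k"] eA_hist[of k "Suc k" "Suc k"] by simp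
  from exp_from[OF this Y, of x]
  have "(\<integral>\<^sup>+w. W w * (eA l g k (Suc k) w * Y w) \<partial>PP x) \<le> (\<integral>\<^sup>+w. W w * (eA l g k (Suc k) w * (1 + ennreal c * VV gg (xs (Suc k) w))) \<partial>PP x)"
    by (simp add: mult.assoc)
  also have "\<dots> \<le> (\<integral>\<^sup>+w. W w * (1 + ennreal c * VV gg (xs (Suc k) w)) \<partial>PP x) + ennreal c * (\<integral>\<^sup>+w. W w * UU gg (xs k w) \<partial>PP x)"
    by (rule exp_one_step[OF W]) (auto intro: one_VV_le)
  also have "(\<integral>\<^sup>+w. W w * (1 + ennreal c * VV gg (xs (Suc k) w)) \<partial>PP x) = (\<integral>\<^sup>+w. W w * UU (\<lambda>y. 1 + ennreal c * VV gg y) (xs k w) \<partial>PP x)"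
    by (rule UU_step[OF W]) simp
  also have "\<dots> = (\<integral>\<^sup>+w. W w * (1 + ennreal c * UU (VV gg) (xs k w)) \<partial>PP x)"
    using prob_space.emeasure_space_1[OF U1_prob] by (intro nn_integral_cong) (simp add: nn_integral_add nn_integral_cmult)
  also have "\<dots> + ennreal c * (\<integral>\<^sup>+w. W w * UU gg (xs k w) \<partial>PP x) = (\<integral>\<^sup>+w. W w * (1 + ennreal c * Psi gg (xs k w)) \<partial>PP x)"
  proof -
    have "(\<integral>\<^sup>+w. W w * (1 + ennreal c * Psi gg (xs k w)) \<partial>PP x) =
      (\<integral>\<^sup>+w. W w * (1 + ennreal c * UU (VV gg) (xs k w)) + ennreal c * (W w * UU gg (xs k w)) \<partial>PP x)"
      unfolding Psi_def by (intro nn_integral_cong) (simp only: distrib_left mult_ac add_ac)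
    also have "\<dots> = (\<integral>\<^sup>+w. W w * (1 + ennreal c * UU (VV gg) (xs k w)) \<partial>PP x) + (\<integral>\<^sup>+w. ennreal c * (W w * UU gg (xs k w)) \<partial>PP x)"
      by (rule nn_integral_add) measurable
    finally show ?thesis by (simp add: nn_integral_cmult)
  qed
  finally show ?thesis .
qed

end

end

section \<open>Regeneration times and the event of missing the atom for good\<close>

context nummelin_splitting
begin

lemma next_jump_T: "w \<in> space N \<Longrightarrow> next_jump T w (T k w) = T (Suc k) w"
  unfolding next_jump_def
  by (rule cInf_eq_minimum) (auto simp: T_less_iff intro: T_increasing T_mono)

lemma next_jump_attained:
  assumes w: "w \<in> space N" shows "\<exists>k. next_jump T w s = T k w"
proof -
  have "\<exists>k. s < T k w"
    using T_unbounded[OF w] unfolding filterlim_at_top_dense eventually_sequentially by blast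
  then have L: "s < T (LEAST k. s < T k w) w" by (rule LeastI_ex)
  have "next_jump T w s = T (LEAST k. s < T k w) w"
    unfolding next_jump_def
    by (rule cInf_eq_minimum) (use L in \<open>auto intro!: T_mono[OF w] Least_le\<close>)
  then show ?thesis by blast
qed

lemma atom_time_T:
  assumes w: "w \<in> space N" and fa: "first_atom (Suc m) k w"
  shows "atom_time C a Z T w (T m w) = T k w"
  unfolding atom_time_def
proof (rule cInf_eq_minimum)
  have mem: "Z (T j w) w \<in> C \<times> {0..a} \<times> UNIV \<longleftrightarrow> atom j w" for j
    by (auto simp: atom_def xs_def us_def mem_Times_iff)
  show "T k w \<in> {T j w |j. T m w < T j w \<and> Z (T j w) w \<in> C \<times> {0..a} \<times> UNIV}"
    using fa unfolding mem by (auto simp: first_atom_def T_less_iff[OF w])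
  fix t assume "t \<in> {T j w |j. T m w < T j w \<and> Z (T j w) w \<in> C \<times> {0..a} \<times> UNIV}"
  then obtain j where j: "t = T j w" "m < j" "atom j w" unfolding mem by (auto simp: T_less_iff[OF w])
  then have "k \<le> j" using fa by (auto simp: first_atom_def not_less[symmetric])
  then show "T k w \<le> t" using T_mono[OF w] j by simp
qed

lemma regen_step:
  assumes w: "w \<in> space N" and r: "regen_time C a Z T n w = T m w" and fa: "first_atom (Suc m) k w"
  shows "regen_time C a Z T (Suc n) w = T (Suc k) w"
  using atom_time_T[OF w fa] next_jump_T[OF w] r by simp

definition Uop :: "('e \<Rightarrow> ennreal) \<Rightarrow> 'e \<Rightarrow> ennreal" where "Uop \<phi> x = UU \<phi> x"

lemma Uop_meas [measurable]: "\<psi> \<in> borel_measurable borel \<Longrightarrow> Uop \<psi> \<in> borel_measurable borel"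
  unfolding Uop_def[abs_def] by (rule UU_meas)

lemma Uop_pow_meas [measurable]: "\<psi> \<in> borel_measurable borel \<Longrightarrow> (Uop ^^ n) \<psi> \<in> borel_measurable borel"
  by (induction n) auto

lemma Uop_mono: "(\<And>y. \<phi> y \<le> \<psi> y) \<Longrightarrow> Uop \<phi> x \<le> Uop \<psi> x"
  unfolding Uop_def by (intro nn_integral_mono) simp

lemma Qop_mono: "(\<And>y. \<phi> y \<le> \<psi> y) \<Longrightarrow> Qop \<phi> x \<le> Qop \<psi> x"
  unfolding Qop_def by (intro nn_integral_mono) simp

lemma Uop_const: "Uop (\<lambda>_. c) x = c"
  using prob_space.emeasure_space_1[OF U1_prob[of x]] by (simp add: Uop_def)

lemma Uop_add: "\<phi> \<in> borel_measurable borel \<Longrightarrow> \<psi> \<in> borel_measurable borel \<Longrightarrow> Uop (\<lambda>y. \<phi> y + \<psi> y) x = Uop \<phi> x + Uop \<psi> x"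
  unfolding Uop_def by (rule nn_integral_add) simp_all

lemma Uop_cmult: "\<phi> \<in> borel_measurable borel \<Longrightarrow> Uop (\<lambda>y. c * \<phi> y) x = c * Uop \<phi> x"
  unfolding Uop_def by (rule nn_integral_cmult) simp

lemma Qop_add: "\<phi> \<in> borel_measurable borel \<Longrightarrow> \<psi> \<in> borel_measurable borel \<Longrightarrow> Qop (\<lambda>y. \<phi> y + \<psi> y) x = Qop \<phi> x + Qop \<psi> x"
  unfolding Qop_def by (rule nn_integral_add) simp_all

lemma Qop_cmult: "\<phi> \<in> borel_measurable borel \<Longrightarrow> Qop (\<lambda>y. c * \<phi> y) x = c * Qop \<phi> x"
  unfolding Qop_def by (rule nn_integral_cmult) simp

lemma Uop_Qop: "\<phi> \<in> borel_measurable borel \<Longrightarrow> Uop \<phi> x = Qop \<phi> x + ennreal a * indicator C x * (\<integral>\<^sup>+y. \<phi> y \<partial>\<nu>)"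
  unfolding Uop_def Qop_def by (rule Q0_add)

lemma Qop_1: "Qop (\<lambda>_. 1) x + ennreal a * indicator C x = 1"
  using Uop_Qop[of "\<lambda>_. 1" x] Uop_const[of 1 x] by (simp add: emeasure_\<nu>_UNIV)

lemma Qop_1_le: "Qop (\<lambda>_. 1) x \<le> 1"
proof -
  have "Qop (\<lambda>_. 1) x \<le> Qop (\<lambda>_. 1) x + ennreal a * indicator C x" by simp
  then show ?thesis by (simp only: Qop_1)
qed

lemma xs_law:
  assumes "\<psi> \<in> borel_measurable borel"
  shows "(\<integral>\<^sup>+w. \<psi> (xs k w) \<partial>PP x) = (Uop ^^ k) \<psi> x"
  using assms
proof (induction k arbitrary: \<psi>)
  case 0
  have "(\<integral>\<^sup>+w. \<psi> (xs 0 w) \<partial>PP x) = (\<integral>\<^sup>+w. \<psi> x \<partial>PP x)"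
    by (rule nn_integral_cong_AE, use xs_0[of x] in eventually_elim) simp
  then show ?case using prob_space.emeasure_space_1[OF PP_prob[of x]] by simp
next
  case (Suc k)
  have "(\<integral>\<^sup>+w. \<psi> (xs (Suc k) w) \<partial>PP x) = (\<integral>\<^sup>+w. Uop \<psi> (xs k w) \<partial>PP x)"
    using UU_step[of "\<lambda>_. 1" k \<psi> x] Suc.prems by (simp add: Uop_def)
  also have "\<dots> = (Uop ^^ k) (Uop \<psi>) x" by (rule Suc.IH) (use Suc.prems in simp)
  finally show ?case by (simp add: funpow_swap1)
qed

text \<open>The probability that the chain started at \<open>x\<close> misses the atom at every
  index from 0 on, as a decreasing limit.\<close>

definition einf :: "'e \<Rightarrow> ennreal" where "einf x = (INF n. (Qop ^^ n) (\<lambda>_. 1) x)"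

lemma einf_meas [measurable]: "einf \<in> borel_measurable borel"
  unfolding einf_def[abs_def] by measurable

lemma Qn_decr: "(Qop ^^ Suc n) (\<lambda>_. 1) x \<le> (Qop ^^ n) (\<lambda>_. 1) x"
proof (induction n arbitrary: x)
  case (Suc n) then show ?case by (simp only: funpow.simps(2) o_apply) (rule Qop_mono)
qed (simp add: Qop_1_le)

lemma Qn_le_1: "(Qop ^^ n) (\<lambda>_. 1) x \<le> 1"
proof (induction n)
  case (Suc n) then show ?case by (rule order_trans[OF Qn_decr])
qed simp

lemma einf_le_1: "einf x \<le> 1"
  unfolding einf_def using Qn_le_1[of 0 x] by (intro INF_lower2[of 0]) auto

lemma nn_integral_INF_prob:
  assumes "finite_measure K" and m: "\<And>n. \<phi> n \<in> borel_measurable K" and d: "\<And>n x. \<phi> (Suc n) x \<le> \<phi> n x"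
    and l: "\<And>n x. \<phi> n x \<le> (1::ennreal)"
  shows "(\<integral>\<^sup>+x. (INF n. \<phi> n x) \<partial>K) = (INF n. \<integral>\<^sup>+x. \<phi> n x \<partial>K)"
proof (rule nn_integral_monotone_convergence_INF_decseq)
  show "decseq \<phi>" by (intro decseq_SucI le_funI d)
  fix n
  have "(\<integral>\<^sup>+x. \<phi> n x \<partial>K) \<le> (\<integral>\<^sup>+x. 1 \<partial>K)" by (intro nn_integral_mono l)
  also have "\<dots> < \<infinity>" using finite_measure.emeasure_finite[OF assms(1), of "space K"] by (simp add: less_top)
  finally show "(\<integral>\<^sup>+x. \<phi> n x \<partial>K) < \<infinity>" .
qed (fact m)

lemma Qop_einf: "Qop einf x = einf x"
proof -
  have fm: "finite_measure (Q0 x)"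
    using measurable_space[OF measurable_Q0, of x] by (intro subprob_space.axioms(1)) (simp add: space_subprob_algebra)
  have "Qop einf x = (\<integral>\<^sup>+y. (INF n. (Qop ^^ n) (\<lambda>_. 1) y) \<partial>Q0 x)"
    by (simp only: Qop_def[of einf] einf_def)
  also have "\<dots> = (INF n. QQ ((Qop ^^ n) (\<lambda>_. 1)) x)"
  proof (rule nn_integral_INF_prob[OF fm])
    show "(Qop ^^ n) (\<lambda>_. 1) \<in> borel_measurable (Q0 x)" for n
      by (subst measurable_cong_sets[OF sets_Q0 refl]) simp
  qed (rule Qn_decr Qn_le_1)+
  also have "\<dots> = (INF n. (Qop ^^ Suc n) (\<lambda>_. 1) x)" by (simp add: Qop_def)
  also have "\<dots> = einf x" unfolding einf_def
  proof (rule antisym)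
    show "(INF n. (Qop ^^ Suc n) (\<lambda>_. 1) x) \<le> (INF n. (Qop ^^ n) (\<lambda>_. 1) x)"
      by (intro INF_mono) (use Qn_decr in blast)
    show "(INF n. (Qop ^^ n) (\<lambda>_. 1) x) \<le> (INF n. (Qop ^^ Suc n) (\<lambda>_. 1) x)"
      by (intro INF_greatest INF_lower) simp
  qed
  finally show ?thesis .
qed

definition noat :: "nat \<Rightarrow> 'v \<Rightarrow> bool" where "noat m w \<longleftrightarrow> (\<forall>i\<ge>m. \<not> atom i w)"

lemma noat_N [measurable]: "Measurable.pred N (noat m)" unfolding noat_def by measurable

text \<open>All functions are bounded by 1, so decreasing limits pass under the integral;
  \<open>einf\<close> at \<open>xs m\<close> thereby becomes the conditional probability of missing
  the atom from index \<open>m\<close> on.\<close>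

lemma noat_law:
  assumes W: "W \<in> borel_measurable (hist m)" and W1: "\<And>w. W w \<le> 1"
  shows "(\<integral>\<^sup>+w. W w * indicator {w. noat m w} w \<partial>PP x) = (\<integral>\<^sup>+w. W w * einf (xs m w) \<partial>PP x)"
proof -
  note [measurable] = measurable_hist_N[OF W]
  have fm: "finite_measure (PP x)" using PP_prob by (rule prob_space.finite_measure)
  let ?p = "\<lambda>n w. \<Prod>i\<in>{m..<m+n}. ina i w"
  have p1: "?p n w \<le> 1" for n w by (simp only: prod_ina[OF finite_atLeastLessThan]) simp
  have p: "indicator {w. noat m w} w = (INF n. ?p n w)" for w
  proof (cases "noat m w")
    case True
    then have "?p n w = 1" for n by (simp only: prod_ina[OF finite_atLeastLessThan]) (auto simp: noat_def)
    then show ?thesis using True by simp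
  next
    case False
    then obtain i where i: "m \<le> i" "atom i w" by (auto simp: noat_def)
    have "?p (Suc i - m) w = 0" using i by (simp only: prod_ina[OF finite_atLeastLessThan]) auto
    then have "(INF n. ?p n w) \<le> 0" by (metis INF_lower UNIV_I)
    then show ?thesis using False by simp
  qed
  have Wp: "W w * (INF n. \<phi> n) = (INF n. W w * \<phi> n)" if d: "\<And>n. \<phi> (Suc n) \<le> \<phi> n" for w and \<phi> :: "nat \<Rightarrow> ennreal"
  proof (rule LIMSEQ_unique)
    have "(\<lambda>n. \<phi> n) \<longlonglongrightarrow> (INF n. \<phi> n)" by (intro LIMSEQ_INF decseq_SucI d)
    moreover have "W w < \<top>" using W1[of w] by (rule le_less_trans) simp
    ultimately show "(\<lambda>n. W w * \<phi> n) \<longlonglongrightarrow> W w * (INF n. \<phi> n)" by (intro ennreal_tendsto_cmult)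
    show "(\<lambda>n. W w * \<phi> n) \<longlonglongrightarrow> (INF n. W w * \<phi> n)"
      by (intro LIMSEQ_INF decseq_SucI mult_left_mono d) simp
  qed
  have pd: "?p (Suc n) w \<le> ?p n w" for n w
    by (simp only: prod_ina[OF finite_atLeastLessThan]) auto
  have Wp1: "W w * (INF n. ?p n w) = (INF n. W w * ?p n w)" for w by (rule Wp) (rule pd)
  have Wp2: "W w * (INF n. (Qop ^^ n) (\<lambda>_. 1) (xs m w)) = (INF n. W w * (Qop ^^ n) (\<lambda>_. 1) (xs m w))" for w
    by (rule Wp) (rule Qn_decr)
  have c: "(\<integral>\<^sup>+w. W w * ?p n w \<partial>PP x) = (\<integral>\<^sup>+w. W w * (Qop ^^ n) (\<lambda>_. 1) (xs m w) \<partial>PP x)" for n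
    using na_chain[where S=Qop and D="\<lambda>_ _. 1" and y="\<lambda>_. 1" and Y="\<lambda>_ _. 1" and n=n and x=x, OF _ _ _ _ _ W] Qop_step
    by simp
  have W1': "W w * r \<le> 1" if "r \<le> 1" for w r using mult_mono[OF W1[of w] that] by simp
  have "(\<integral>\<^sup>+w. W w * indicator {w. noat m w} w \<partial>PP x) = (INF n. \<integral>\<^sup>+w. W w * ?p n w \<partial>PP x)"
    unfolding p Wp1
  proof (rule nn_integral_INF_prob[OF fm])
    show "W w * ?p (Suc n) w \<le> W w * ?p n w" for n w
      by (intro mult_left_mono pd) simp
  qed (auto intro!: W1' p1)
  also have "\<dots> = (INF n. \<integral>\<^sup>+w. W w * (Qop ^^ n) (\<lambda>_. 1) (xs m w) \<partial>PP x)" unfolding c ..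
  also have "\<dots> = (\<integral>\<^sup>+w. W w * einf (xs m w) \<partial>PP x)"
    unfolding einf_def Wp2
  proof (rule nn_integral_INF_prob[OF fm, symmetric])
    show "W w * (Qop ^^ Suc n) (\<lambda>_. 1) (xs m w) \<le> W w * (Qop ^^ n) (\<lambda>_. 1) (xs m w)" for n w
      by (intro mult_left_mono Qn_decr) simp
  qed (auto intro!: W1' Qn_le_1)
  finally show ?thesis .
qed

lemma bind_return_PP: "return borel x \<bind> PP = PP x"
  by (rule bind_return[where N=N]) (auto intro: measurable_prob_algebraD PP_kernel)

lemma \<mu>_law:
  assumes "g \<in> borel_measurable borel"
  shows "(\<integral>\<^sup>+x. g x \<partial>\<mu>) = (\<integral>\<^sup>+w. (\<integral>\<^sup>+s\<in>{regen_time C a Z T 1 w..regen_time C a Z T 2 w}. g (X s (pr w)) \<partial>lborel) \<partial>PP x)"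
  using \<mu>_normalized[of "return borel x" g] assms by (simp add: bind_return_PP space_prob_algebra prob_space_return)

text \<open>Each holding interval contributes one application of \<open>U1\<close> to the law of its
  left end, and the intervals exhaust the half-line because the jump times are unbounded.\<close>

lemma occupation:
  assumes g [measurable]: "g \<in> borel_measurable borel"
  shows "(\<integral>\<^sup>+w. (\<integral>\<^sup>+s\<in>{0<..}. g (X (max 0 s) (pr w)) \<partial>lborel) \<partial>PP x) = (\<Sum>n. (Uop ^^ Suc n) g x)"
proof -
  have pN [measurable]: "pint g k (Suc k) \<in> borel_measurable N" for k by (rule pint_N) auto
  have "(\<integral>\<^sup>+w. (\<integral>\<^sup>+s\<in>{0<..}. g (X (max 0 s) (pr w)) \<partial>lborel) \<partial>PP x) = (\<integral>\<^sup>+w. (\<Sum>n. pint g n (Suc n) w) \<partial>PP x)"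
  proof (rule nn_integral_cong)
    fix w assume "w \<in> space (PP x)"
    then have w: "w \<in> space N" by simp
    note [measurable] = path_measurable[OF w]
    have S: "(\<Sum>i<n. pint g i (Suc i) w) = pint g 0 n w" for n
    proof (induction n)
      case 0 then show ?case by (simp add: pint_def)
    next
      case (Suc n) then show ?case using pint_add[OF w _ _ g, of 0 n "Suc n"] by simp
    qed
    have i: "(SUP n. g (X (max 0 s) (pr w)) * indicator {T 0 w<..<T n w} s) = g (X (max 0 s) (pr w)) * indicator {0<..} s" for s
    proof (cases "0 < s")
      case True
      obtain n where n: "s < T n w" using T_unbounded[OF w] unfolding filterlim_at_top_dense eventually_sequentially by blast
      show ?thesis
      proof (rule antisym)
        show "(SUP n. g (X (max 0 s) (pr w)) * indicator {T 0 w<..<T n w} s) \<le> g (X (max 0 s) (pr w)) * indicator {0<..} s"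
          using True by (intro SUP_least) (auto split: split_indicator)
        show "g (X (max 0 s) (pr w)) * indicator {0<..} s \<le> (SUP n. g (X (max 0 s) (pr w)) * indicator {T 0 w<..<T n w} s)"
          using n True T_0[OF w] by (intro SUP_upper2[of n]) auto
      qed
    qed (use T_0[OF w] in simp)
    have "(\<integral>\<^sup>+s\<in>{0<..}. g (X (max 0 s) (pr w)) \<partial>lborel) = (\<integral>\<^sup>+s. (SUP n. g (X (max 0 s) (pr w)) * indicator {T 0 w<..<T n w} s) \<partial>lborel)"
      unfolding i ..
    also have "\<dots> = (SUP n. pint g 0 n w)" unfolding pint_def
    proof (rule nn_integral_monotone_convergence_SUP)
      show "incseq (\<lambda>n s. g (X (max 0 s) (pr w)) * indicator {T 0 w<..<T n w} s)"
        using T_increasing[OF w] by (intro incseq_SucI le_funI mult_left_mono) (auto split: split_indicator intro: less_trans)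
    qed measurable
    finally show "(\<integral>\<^sup>+s\<in>{0<..}. g (X (max 0 s) (pr w)) \<partial>lborel) = (\<Sum>n. pint g n (Suc n) w)"
      by (simp add: suminf_eq_SUP S)
  qed
  also have "\<dots> = (\<Sum>n. \<integral>\<^sup>+w. pint g n (Suc n) w \<partial>PP x)" by (rule nn_integral_suminf) simp
  also have "\<dots> = (\<Sum>n. (Uop ^^ Suc n) g x)"
  proof (intro suminf_cong)
    fix n
    have "(\<integral>\<^sup>+w. pint g n (Suc n) w \<partial>PP x) = (\<integral>\<^sup>+w. Uop g (xs n w) \<partial>PP x)"
      using pint_step[of "\<lambda>_. 1" n g x] by (simp add: Uop_def)
    also have "\<dots> = (Uop ^^ Suc n) g x" by (subst xs_law) (simp_all add: funpow_swap1)
    finally show "(\<integral>\<^sup>+w. pint g n (Suc n) w \<partial>PP x) = (Uop ^^ Suc n) g x" .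
  qed
  finally show ?thesis .
qed

lemma Uop_pow_mono: "(\<And>y. \<phi> y \<le> \<psi> y) \<Longrightarrow> (Uop ^^ n) \<phi> x \<le> (Uop ^^ n) \<psi> x"
  by (induction n arbitrary: x) (auto intro: Uop_mono)

lemma Uop_pow_const: "(Uop ^^ n) (\<lambda>_. c) = (\<lambda>_. c)"
proof -
  have "Uop (\<lambda>_. c) = (\<lambda>_. c)" by (rule ext) (rule Uop_const)
  then show ?thesis by (induction n) simp_all
qed

lemma Uop_pow_suminf:
  assumes "\<And>i. \<phi> i \<in> borel_measurable borel"
  shows "(Uop ^^ n) (\<lambda>y. \<Sum>i. \<phi> i y) x = (\<Sum>i. (Uop ^^ n) (\<phi> i) x)"
proof (induction n arbitrary: x)
  case (Suc n)
  have "(Uop ^^ Suc n) (\<lambda>y. \<Sum>i. \<phi> i y) x = Uop (\<lambda>x. \<Sum>i. (Uop ^^ n) (\<phi> i) x) x"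
  proof -
    have "(Uop ^^ n) (\<lambda>y. \<Sum>i. \<phi> i y) = (\<lambda>x. \<Sum>i. (Uop ^^ n) (\<phi> i) x)" by (rule ext) (rule Suc)
    then show ?thesis by (simp only: funpow.simps(2) o_apply)
  qed
  also have "\<dots> = (\<Sum>i. Uop ((Uop ^^ n) (\<phi> i)) x)"
    unfolding Uop_def by (rule nn_integral_suminf) (use assms in \<open>simp add: Uop_def[abs_def, symmetric]\<close>)
  finally show ?case by simp
qed simp

text \<open>If the atom were missed for good with positive probability after a regeneration, then \<open>C\<close>
  would be visited for a bounded expected time from every starting point, and letting the starting
  point move forward in time would give \<open>\<mu>(C) = 0\<close>.\<close>
lemma einf_\<nu>: "(\<integral>\<^sup>+y. einf y \<partial>\<nu>) = 0"
proof (rule ccontr)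
  define \<kappa> where "\<kappa> = (\<integral>\<^sup>+y. einf y \<partial>\<nu>)"
  assume "(\<integral>\<^sup>+y. einf y \<partial>\<nu>) \<noteq> 0"
  then have k0: "\<kappa> \<noteq> 0" by (simp add: \<kappa>_def)
  let ?i = "indicator C :: 'e \<Rightarrow> ennreal"
  \<comment> \<open>\<open>einf\<close> is harmonic for the killed kernel, so under the full kernel
    it gains exactly \<open>a * \<kappa>\<close> on \<open>C\<close>. As all iterates stay below 1,
    the mean number of visits to \<open>C\<close> is at most
    \<open>1 / (a * \<kappa>)\<close>.\<close>
  have U: "Uop einf x = einf x + ennreal a * \<kappa> * ?i x" for x
    by (simp add: Uop_Qop Qop_einf \<kappa>_def mult_ac)
  have Un: "(Uop ^^ n) einf x = einf x + ennreal a * \<kappa> * (\<Sum>i<n. (Uop ^^ i) ?i x)" for n x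
  proof (induction n arbitrary: x)
    case (Suc n)
    have "(Uop ^^ Suc n) einf x = Uop (\<lambda>x. einf x + ennreal a * \<kappa> * (\<Sum>i<n. (Uop ^^ i) ?i x)) x"
    proof -
      have "(Uop ^^ n) einf = (\<lambda>x. einf x + ennreal a * \<kappa> * (\<Sum>i<n. (Uop ^^ i) ?i x))" by (rule ext) (rule Suc)
      then show ?thesis by (simp only: funpow.simps(2) o_apply)
    qed
    also have "\<dots> = Uop einf x + ennreal a * \<kappa> * Uop (\<lambda>x. \<Sum>i<n. (Uop ^^ i) ?i x) x"
      by (simp add: Uop_add Uop_cmult)
    also have "Uop (\<lambda>x. \<Sum>i<n. (Uop ^^ i) ?i x) x = (\<Sum>i<n. (Uop ^^ Suc i) ?i x)"
      unfolding funpow.simps(2) o_apply by (simp add: Uop_def[of "\<lambda>x. \<Sum>i<n. (Uop ^^ i) ?i x"] Uop_def[of "(Uop ^^ i) ?i" for i] nn_integral_sum)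
    also have "Uop einf x + ennreal a * \<kappa> * (\<Sum>i<n. (Uop ^^ Suc i) ?i x) = einf x + ennreal a * \<kappa> * (\<Sum>i<Suc n. (Uop ^^ i) ?i x)"
      unfolding U sum.lessThan_Suc_shift by (simp add: distrib_left add.assoc del: funpow.simps(2))
    finally show ?case .
  qed simp
  define S where "S x = (\<Sum>i. (Uop ^^ Suc i) ?i x)" for x
  have [measurable]: "S \<in> borel_measurable borel" unfolding S_def by measurable
  have Sfin: "S x < \<infinity>" for x
  proof -
    have e1: "(Uop ^^ n) einf x \<le> 1" for n
      using Uop_pow_mono[of einf "\<lambda>_. 1" n x, OF einf_le_1] by (simp add: Uop_pow_const)
    then have b: "ennreal a * \<kappa> * (\<Sum>i<n. (Uop ^^ i) ?i x) \<le> 1" for n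
    proof -
      have "ennreal a * \<kappa> * (\<Sum>i<n. (Uop ^^ i) ?i x) \<le> (Uop ^^ n) einf x" unfolding Un by simp
      also have "\<dots> \<le> 1" by (rule e1)
      finally show ?thesis .
    qed
    have "(\<Sum>i<n. (Uop ^^ Suc i) ?i x) \<le> 1 / (ennreal a * \<kappa>)" for n
    proof -
      have "(\<Sum>i<n. (Uop ^^ Suc i) ?i x) \<le> (\<Sum>i<Suc n. (Uop ^^ i) ?i x)"
        unfolding sum.lessThan_Suc_shift by (simp del: funpow.simps(2))
      also have "\<dots> \<le> 1 / (ennreal a * \<kappa>)"
      proof -
        have "ennreal a * \<kappa> \<noteq> 0" using k0 a_bounds by simp
        moreover have "ennreal a * \<kappa> \<noteq> \<infinity>"
        proof -
          have "\<kappa> \<le> (\<integral>\<^sup>+y. 1 \<partial>\<nu>)" unfolding \<kappa>_def by (intro nn_integral_mono einf_le_1)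
          then have "\<kappa> \<le> 1" by (simp add: emeasure_\<nu>_UNIV)
          then have "\<kappa> \<noteq> \<top>" by (auto simp: top_unique)
          then show ?thesis by (simp add: ennreal_mult_eq_top_iff)
        qed
        ultimately have "(\<Sum>i<Suc n. (Uop ^^ i) ?i x) = (\<Sum>i<Suc n. (Uop ^^ i) ?i x) * (ennreal a * \<kappa>) / (ennreal a * \<kappa>)"
          by (subst mult_divide_eq_ennreal) auto
        also have "\<dots> \<le> 1 / (ennreal a * \<kappa>)"
          using b[of "Suc n"] by (intro divide_right_mono_ennreal) (simp only: mult.commute)
        finally show ?thesis .
      qed
      finally show ?thesis .
    qed
    then have "S x \<le> 1 / (ennreal a * \<kappa>)" unfolding S_def suminf_eq_SUP by (intro SUP_least)
    also have "\<dots> < \<infinity>"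
      unfolding infinity_ennreal_def less_top[symmetric] using k0 a_bounds by (simp add: ennreal_divide_eq_top_iff)
    finally show ?thesis .
  qed
  define \<delta> where "\<delta> = emeasure \<mu> C"
  \<comment> \<open>By the normalization, \<open>\<mu>\<close> of \<open>C\<close> is the mean time
    in \<open>C\<close> during one cycle, whatever the starting point; the total mean time
    \<open>S x\<close> is at least that.\<close>
  have dS: "\<delta> \<le> S x" for x
  proof -
    have "\<delta> = (\<integral>\<^sup>+x. ?i x \<partial>\<mu>)" by (simp add: \<delta>_def sets_\<mu> C_sets)
    also have "\<dots> = (\<integral>\<^sup>+w. (\<integral>\<^sup>+s\<in>{regen_time C a Z T 1 w..regen_time C a Z T 2 w}. ?i (X s (pr w)) \<partial>lborel) \<partial>PP x)"
      by (rule \<mu>_law) simp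
    also have "\<dots> \<le> (\<integral>\<^sup>+w. (\<integral>\<^sup>+s\<in>{0<..}. ?i (X (max 0 s) (pr w)) \<partial>lborel) \<partial>PP x)"
    proof (rule nn_integral_mono)
      fix w assume "w \<in> space (PP x)"
      then have w: "w \<in> space N" by simp
      have "0 \<le> regen_time C a Z T 1 w"
        using next_jump_attained[OF w] T_nonneg[OF w] by (metis One_nat_def regen_time.simps(2))
      then show "(\<integral>\<^sup>+s\<in>{regen_time C a Z T 1 w..regen_time C a Z T 2 w}. ?i (X s (pr w)) \<partial>lborel) \<le> (\<integral>\<^sup>+s\<in>{0<..}. ?i (X (max 0 s) (pr w)) \<partial>lborel)"
        by (intro nn_integral_mono_AE, use AE_lborel_singleton[of 0] in eventually_elim) (auto split: split_indicator simp: max_def)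
    qed
    also have "\<dots> = S x" unfolding S_def by (rule occupation) simp
    finally show ?thesis .
  qed
  \<comment> \<open>From wherever the chain is after \<open>n\<close> steps, the mean remaining time
    in \<open>C\<close> is still at least \<open>\<delta>\<close>. So the partial sums of
    \<open>S x\<close> stay below \<open>S x - \<delta>\<close>, although they converge to the
    finite \<open>S x\<close>.\<close>
  have tail: "S x = (\<Sum>i<n. (Uop ^^ Suc i) ?i x) + (Uop ^^ n) S x" for n x
  proof -
    have "(Uop ^^ n) S x = (\<Sum>i. (Uop ^^ n) ((Uop ^^ Suc i) ?i) x)"
      unfolding S_def[abs_def] by (rule Uop_pow_suminf) simp
    also have "\<dots> = (\<Sum>i. (Uop ^^ Suc (i + n)) ?i x)"
      by (intro suminf_cong) (simp only: funpow_add[symmetric, THEN fun_cong, unfolded o_apply] add_Suc_right add.commute)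
    finally show ?thesis unfolding S_def
      using suminf_offset[of "\<lambda>i. (Uop ^^ Suc i) ?i x" n] by (simp add: summableI add.commute del: funpow.simps(2))
  qed
  have "(\<Sum>i<n. (Uop ^^ Suc i) ?i x) \<le> S x - \<delta>" for n x
  proof -
    have "\<delta> \<le> (Uop ^^ n) S x" using Uop_pow_mono[of "\<lambda>_. \<delta>" S n x, OF dS] by (simp add: Uop_pow_const)
    then have "(\<Sum>i<n. (Uop ^^ Suc i) ?i x) + \<delta> \<le> S x" using tail[of x n] by (metis add_left_mono)
    then show ?thesis by (simp only: ennreal_le_minus_iff) simp
  qed
  then have "(SUP n. \<Sum>i<n. (Uop ^^ Suc i) ?i x) \<le> S x - \<delta>" for x by (intro SUP_least)
  then have "S x \<le> S x - \<delta>" for x by (simp only: S_def suminf_eq_SUP)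
  moreover have "0 < \<delta>" using C_pos by (simp add: \<delta>_def)
  moreover have "S undefined - \<delta> < S undefined" if "0 < \<delta>"
    using that dS[of undefined] Sfin[of undefined] by (intro ennreal_between) (auto intro: less_le_trans)
  ultimately show False by (metis leD)
qed

end

section \<open>The invariant measure as the potential of a cycle\<close>

context nummelin_splitting
begin

abbreviation "ifa m k \<equiv> indicator {w. first_atom m k w} :: 'v \<Rightarrow> ennreal"
abbreviation "pre m k \<equiv> indicator {w. \<forall>i\<in>{m..<k}. \<not> atom i w} :: 'v \<Rightarrow> ennreal"

lemma first_atom_unique: "first_atom m k w \<Longrightarrow> first_atom m j w \<Longrightarrow> k = j"
  unfolding first_atom_def by (metis atLeastLessThan_iff linorder_neqE_nat)

lemma first_atom_or_noat: "noat m w \<or> (\<exists>k. first_atom m k w)"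
proof -
  have "\<exists>k. first_atom m k w" if "\<not> noat m w"
  proof -
    from that obtain k where k: "m \<le> k \<and> atom k w" by (auto simp: noat_def)
    define j where "j = (LEAST k. m \<le> k \<and> atom k w)"
    have "m \<le> j \<and> atom j w" unfolding j_def by (rule LeastI_ex) (use k in blast)
    moreover have "\<not> atom i w" if "m \<le> i" "i < j" for i using not_less_Least[of i "\<lambda>k. m \<le> k \<and> atom k w"] that by (auto simp: j_def)
    ultimately show ?thesis by (auto simp: first_atom_def)
  qed
  then show ?thesis by blast
qed

lemma noat_not_first_atom: "noat m w \<Longrightarrow> \<not> first_atom m k w"
  by (auto simp: noat_def first_atom_def)

lemma ifa_pre: "m \<le> k \<Longrightarrow> ifa m k w = pre m k w * ia k w"
  by (auto simp: first_atom_def split: split_indicator)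

lemma pre_hist: "k \<le> n \<Longrightarrow> pre m k \<in> borel_measurable (hist n)"
proof -
  assume "k \<le> n"
  then have [measurable]: "Measurable.pred (hist n) (atom i)" if "i < k" for i using that by (intro atom_hist) simp
  have "Measurable.pred (hist n) (\<lambda>w. \<forall>i\<in>{m..<k}. \<not> atom i w)"
    by (intro pred_intros_finite) (auto intro!: pred_intros_logic atom_hist \<open>k \<le> n\<close> less_le_trans[OF _ \<open>k \<le> n\<close>])
  then show ?thesis by measurable
qed

lemma first_atom_hist: "k < n \<Longrightarrow> Measurable.pred (hist n) (first_atom m k)"
proof -
  assume k: "k < n"
  have [measurable]: "Measurable.pred (hist n) (\<lambda>w. \<forall>i\<in>{m..<k}. \<not> atom i w)" "Measurable.pred (hist n) (atom k)"
    using k by (auto intro!: pred_intros_finite pred_intros_logic atom_hist)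
  show ?thesis unfolding first_atom_def by measurable
qed

lemma ifa_hist: "k < n \<Longrightarrow> ifa m k \<in> borel_measurable (hist n)"
  using first_atom_hist[of k n m] by measurable

lemma ifa_N [measurable]: "ifa m k \<in> borel_measurable N"
  by (rule measurable_hist_N[OF ifa_hist[of k "Suc k"]]) simp

lemma first_atom_N [measurable]: "Measurable.pred N (first_atom m k)"
  by (rule measurable_hist_N[OF first_atom_hist[of k "Suc k"]]) simp

lemma ifa_step:
  assumes "m \<le> k" and "\<psi> \<in> borel_measurable borel"
  shows "(\<integral>\<^sup>+w. ifa m k w * \<psi> (xs (Suc k) w) \<partial>PP x) = (\<integral>\<^sup>+w. ifa m k w \<partial>PP x) * (\<integral>\<^sup>+y. \<psi> y \<partial>\<nu>)"
  using atom_step[OF pre_hist[OF order_refl, of m k] assms(2), of x] by (simp add: ifa_pre[OF assms(1)] mult.assoc)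

lemma Uop_einf: "Uop einf x = einf x"
  by (simp add: Uop_Qop Qop_einf einf_\<nu>)

lemma noat_1_law: "(\<integral>\<^sup>+w. indicator {w. noat 1 w} w \<partial>PP x) = einf x"
proof -
  have "(\<integral>\<^sup>+w. indicator {w. noat 1 w} w \<partial>PP x) = (\<integral>\<^sup>+w. einf (xs 1 w) \<partial>PP x)"
    using noat_law[of "\<lambda>_. 1" 1 x] by simp
  also have "\<dots> = einf x" by (subst xs_law) (simp_all add: Uop_einf)
  finally show ?thesis .
qed

text \<open>After the first atom the chain restarts from \<open>\<nu>\<close>, for which
  \<open>einf\<close> has mean 0. Index \<open>Suc k\<close> opens the new cycle and is not tested,
  hence \<open>Suc (Suc k)\<close>.\<close>

lemma next_atom_AE: "AE w in PP x. \<forall>k. first_atom 1 k w \<longrightarrow> \<not> noat (Suc (Suc k)) w"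
  unfolding AE_all_countable
proof
  fix k
  show "AE w in PP x. first_atom 1 k w \<longrightarrow> \<not> noat (Suc (Suc k)) w"
  proof (cases "1 \<le> k")
    case True
    have "(\<integral>\<^sup>+w. ifa 1 k w * indicator {w. noat (Suc (Suc k)) w} w \<partial>PP x) = (\<integral>\<^sup>+w. ifa 1 k w * einf (xs (Suc (Suc k)) w) \<partial>PP x)"
      by (rule noat_law) (auto intro!: ifa_hist split: split_indicator)
    also have "\<dots> = (\<integral>\<^sup>+w. ifa 1 k w * Uop einf (xs (Suc k) w) \<partial>PP x)"
      unfolding Uop_def by (rule UU_step) (auto intro: ifa_hist)
    also have "\<dots> = 0" unfolding Uop_einf using ifa_step[OF True, of einf x] by (simp add: einf_\<nu>)
    finally have "AE w in PP x. ifa 1 k w * indicator {w. noat (Suc (Suc k)) w} w = 0"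
      by (subst (asm) nn_integral_0_iff_AE) auto
    then show ?thesis by eventually_elim (auto split: split_indicator_asm)
  qed (simp add: first_atom_def)
qed

lemma nn_integral_Icc_pint:
  assumes "w \<in> space N" and [measurable]: "g \<in> borel_measurable borel"
  shows "(\<integral>\<^sup>+s\<in>{T i w..T j w}. g (X s (pr w)) \<partial>lborel) = pint g i j w"
  unfolding pint_def
  by (rule nn_integral_cong_AE, use AE_lborel_singleton[of "T i w"] AE_lborel_singleton[of "T j w"] in eventually_elim)
    (use T_nonneg[OF assms(1), of i] in \<open>auto split: split_indicator simp: max_def\<close>)

lemma sum_ifa: "(\<Sum>k. ifa m k w * h k) = (if \<exists>k. first_atom m k w then h (THE k. first_atom m k w) else (0::ennreal))"
proof (cases "\<exists>k. first_atom m k w")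
  case True
  then obtain k where k: "first_atom m k w" by blast
  then have "(THE k. first_atom m k w) = k" using first_atom_unique by blast
  moreover have "(\<Sum>j. ifa m j w * h j) = (\<Sum>j\<in>{k}. ifa m j w * h j)"
    using first_atom_unique[OF k] by (intro suminf_finite) (auto split: split_indicator)
  ultimately show ?thesis using True k by simp
qed simp

lemma sum_ifa_eq: "first_atom m k w \<Longrightarrow> (\<Sum>j. ifa m j w * h j) = (h k :: ennreal)"
  using first_atom_unique by (subst sum_ifa) (auto intro!: arg_cong[of _ _ h] the_equality)

text \<open>The normalization speaks of the cycle between the first two regenerations. Its mean is
  that of \<open>Psi\<close> under \<open>\<nu>\<close>, times the probability that an atom beyond
  index 0 exists. This probability is still open here; comparing starting points in this very
  formula will show that it is 1.\<close>

lemma \<mu>_Psi_partial: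
  assumes g [measurable]: "g \<in> borel_measurable borel"
  shows "(\<integral>\<^sup>+x. g x \<partial>\<mu>) = (\<Sum>k. \<integral>\<^sup>+w. ifa 1 k w \<partial>PP x) * (\<integral>\<^sup>+y. Psi g y \<partial>\<nu>)"
proof -
  have "(\<integral>\<^sup>+x. g x \<partial>\<mu>) = (\<integral>\<^sup>+w. (\<integral>\<^sup>+s\<in>{regen_time C a Z T 1 w..regen_time C a Z T 2 w}. g (X s (pr w)) \<partial>lborel) \<partial>PP x)"
    by (rule \<mu>_law[OF g])
  also have "\<dots> = (\<integral>\<^sup>+w. (\<Sum>k. ifa 1 k w * cint g (Suc k) w) \<partial>PP x)"
  proof (rule nn_integral_cong_AE, use next_atom_AE[of x] AE_space in eventually_elim)
    fix w assume good: "\<forall>k. first_atom 1 k w \<longrightarrow> \<not> noat (Suc (Suc k)) w" and "w \<in> space (PP x)"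
    then have w: "w \<in> space N" by simp
    show "(\<integral>\<^sup>+s\<in>{regen_time C a Z T 1 w..regen_time C a Z T 2 w}. g (X s (pr w)) \<partial>lborel) = (\<Sum>k. ifa 1 k w * cint g (Suc k) w)"
    proof (cases "noat 1 w")
      case False
      then obtain k where k: "first_atom 1 k w" using first_atom_or_noat by blast
      then obtain j where j: "first_atom (Suc (Suc k)) j w" using good first_atom_or_noat by blast
      have "regen_time C a Z T 0 w = T 0 w" using T_0[OF w] by simp
      from regen_step[OF w this, of k] have R1: "regen_time C a Z T 1 w = T (Suc k) w" using k by simp
      from regen_step[OF w this j] have R2: "regen_time C a Z T 2 w = T (Suc j) w" by (simp add: numeral_2_eq_2)
      have "(\<integral>\<^sup>+s\<in>{regen_time C a Z T 1 w..regen_time C a Z T 2 w}. g (X s (pr w)) \<partial>lborel) = pint g (Suc k) (Suc j) w"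
        unfolding R1 R2 by (rule nn_integral_Icc_pint[OF w g])
      also have "\<dots> = cint g (Suc k) w" by (rule cint_first_atom[OF w j g, symmetric])
      also have "\<dots> = (\<Sum>k. ifa 1 k w * cint g (Suc k) w)" by (rule sum_ifa_eq[OF k, symmetric])
      finally show ?thesis .
    next
      case True
      \<comment> \<open>Without an atom at any index from 1 on, the set under the infimum is empty,
        and all regeneration times from the first on share the unspecified value
        \<open>next_jump T w (Inf {})\<close>. The cycle degenerates to a single time, and its
        integral is 0.\<close>
      have empty: "{T k w |k. r < T k w \<and> Z (T k w) w \<in> C \<times> {0..a} \<times> UNIV} = {}" if "0 \<le> r" for r
      proof -
        have "\<not> atom k w" if "0 < T k w" for k
          using True that T_0[OF w] by (cases k) (auto simp: noat_def)
        note na = this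
        show ?thesis
        proof (rule equals0I)
          fix t assume "t \<in> {T k w |k. r < T k w \<and> Z (T k w) w \<in> C \<times> {0..a} \<times> UNIV}"
          then obtain k where k: "r < T k w" "Z (T k w) w \<in> C \<times> {0..a} \<times> UNIV" by (elim CollectE exE conjE)
          then have "atom k w" by (simp add: atom_def xs_def us_def mem_Times_iff)
          moreover have "0 < T k w" using k(1) \<open>0 \<le> r\<close> by linarith
          ultimately show False using na by blast
        qed
      qed
      have pos: "0 \<le> next_jump T w r" for r using next_jump_attained[OF w, of r] T_nonneg[OF w] by auto
      have at: "atom_time C a Z T w r = Inf {}" if "0 \<le> r" for r unfolding atom_time_def empty[OF that] ..
      have R: "regen_time C a Z T (Suc n) w = next_jump T w (Inf {})" for n
        by (induction n) (simp_all only: regen_time.simps at[OF order_refl] at[OF pos])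
      have "regen_time C a Z T 1 w = regen_time C a Z T 2 w" using R[of 0] R[of 1] by (simp add: numeral_2_eq_2)
      then have "(\<integral>\<^sup>+s\<in>{regen_time C a Z T 1 w..regen_time C a Z T 2 w}. g (X s (pr w)) \<partial>lborel) = (\<integral>\<^sup>+(s::real). 0 \<partial>lborel)"
        by (intro nn_integral_cong_AE, use AE_lborel_singleton[of "regen_time C a Z T 2 w"] in eventually_elim) (auto split: split_indicator)
      moreover have "(\<Sum>k. ifa 1 k w * cint g (Suc k) w) = 0" using noat_not_first_atom[OF True] by (subst sum_ifa) simp
      ultimately show ?thesis by simp
    qed
  qed
  also have "\<dots> = (\<Sum>k. \<integral>\<^sup>+w. ifa 1 k w * cint g (Suc k) w \<partial>PP x)" by (rule nn_integral_suminf) measurable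
  also have "\<dots> = (\<Sum>k. (\<integral>\<^sup>+w. ifa 1 k w \<partial>PP x) * (\<integral>\<^sup>+y. Psi g y \<partial>\<nu>))"
  proof (intro suminf_cong)
    fix k
    show "(\<integral>\<^sup>+w. ifa 1 k w * cint g (Suc k) w \<partial>PP x) = (\<integral>\<^sup>+w. ifa 1 k w \<partial>PP x) * (\<integral>\<^sup>+y. Psi g y \<partial>\<nu>)"
    proof (cases "1 \<le> k")
      case True
      have "(\<integral>\<^sup>+w. ifa 1 k w * cint g (Suc k) w \<partial>PP x) = (\<integral>\<^sup>+w. ifa 1 k w * Psi g (xs (Suc k) w) \<partial>PP x)"
        by (rule cint_step) (auto intro: ifa_hist)
      then show ?thesis using ifa_step[OF True, of "Psi g" x] by simp
    qed (simp add: first_atom_def)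
  qed
  finally show ?thesis by simp
qed

lemma sum_ifa_law: "(\<Sum>k. \<integral>\<^sup>+w. ifa 1 k w \<partial>PP x) + einf x = 1"
proof -
  have "(\<Sum>k. \<integral>\<^sup>+w. ifa 1 k w \<partial>PP x) + einf x = (\<integral>\<^sup>+w. (\<Sum>k. ifa 1 k w * 1) + indicator {w. noat 1 w} w \<partial>PP x)"
    unfolding noat_1_law[symmetric] by (subst nn_integral_add) (simp_all add: nn_integral_suminf)
  also have "\<dots> = (\<integral>\<^sup>+w. 1 \<partial>PP x)"
    using first_atom_or_noat noat_not_first_atom by (intro nn_integral_cong) (subst sum_ifa, force split: split_indicator)
  finally show ?thesis using prob_space.emeasure_space_1[OF PP_prob[of x]] by simp
qed

text \<open>Sigma-finiteness provides \<open>h\<close> whose integral is positive and finite. The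
  formula for this integral holds from every starting point, so the probability of ever reaching the
  atom is the same everywhere. Then \<open>einf\<close> is constant, and its mean under
  \<open>\<nu>\<close> is 0.\<close>

lemma einf_zero: "einf x = 0"
proof -
  interpret mu: sigma_finite_measure \<mu> by (rule sigma_finite_\<mu>)
  obtain h where h: "h \<in> borel_measurable \<mu>" "integral\<^sup>N \<mu> h \<noteq> \<infinity>" "\<And>x. x \<in> space \<mu> \<Longrightarrow> 0 < h x \<and> h x < \<infinity>"
    using mu.Ex_finite_integrable_function by blast
  have sp: "space \<mu> = UNIV" using sets_eq_imp_space_eq[OF sets_\<mu>] by simp
  have hm [measurable]: "h \<in> borel_measurable borel" using h(1) by (simp cong: measurable_cong_sets add: sets_\<mu>)
  have h0: "integral\<^sup>N \<mu> h \<noteq> 0"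
  proof
    assume "integral\<^sup>N \<mu> h = 0"
    then have "AE x in \<mu>. h x = 0" using h(1) by (simp add: nn_integral_0_iff_AE)
    then have "AE x in \<mu>. False" by eventually_elim (use h(3) sp in \<open>auto simp: less_le\<close>)
    then obtain N' where "{x \<in> space \<mu>. \<not> False} \<subseteq> N'" "emeasure \<mu> N' = 0" "N' \<in> sets \<mu>" by (rule AE_E)
    then have "C \<subseteq> N'" using sp by auto
    then show False using C_pos emeasure_mono[of C N' \<mu>] \<open>emeasure \<mu> N' = 0\<close> \<open>N' \<in> sets \<mu>\<close> by simp
  qed
  define q where "q x = (\<Sum>k. \<integral>\<^sup>+w. ifa 1 k w \<partial>PP x)" for x
  have q: "integral\<^sup>N \<mu> h = q x * (\<integral>\<^sup>+y. Psi h y \<partial>\<nu>)" for x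
    unfolding q_def by (rule \<mu>_Psi_partial[OF hm])
  let ?J = "\<integral>\<^sup>+y. Psi h y \<partial>\<nu>"
  have J: "?J \<noteq> 0" "?J \<noteq> \<top>" using q[of x] h0 h(2) by (auto simp: ennreal_mult_eq_top_iff)
  have "q x = q y" for x y
  proof -
    have "q x * ?J = q y * ?J" using q by metis
    then have "q x * ?J / ?J = q y * ?J / ?J" by simp
    then show ?thesis using J by (simp add: mult_divide_eq_ennreal)
  qed
  moreover have "einf x = 1 - q x" for x
  proof -
    have s: "q x + einf x = 1" unfolding q_def by (rule sum_ifa_law)
    then have "q x \<noteq> \<top>" by auto
    then show ?thesis using s by (metis ennreal_add_diff_cancel_left)
  qed
  ultimately have c: "einf y = einf x" for y by metis
  have "(\<integral>\<^sup>+y. einf y \<partial>\<nu>) = (\<integral>\<^sup>+y. einf x \<partial>\<nu>)" by (intro nn_integral_cong c)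
  also have "\<dots> = einf x" by (simp add: emeasure_\<nu>_UNIV)
  finally have "(\<integral>\<^sup>+y. einf y \<partial>\<nu>) = einf x" .
  then show ?thesis using einf_\<nu> by simp
qed

lemma noat_AE: "AE w in PP x. \<forall>m. \<not> noat m w"
  unfolding AE_all_countable
proof
  fix m
  have "(\<integral>\<^sup>+w. indicator {w. noat m w} w \<partial>PP x) = 0"
    using noat_law[of "\<lambda>_. 1" m x] by (simp add: einf_zero)
  then have "AE w in PP x. indicator {w. noat m w} w = (0::ennreal)" by (subst (asm) nn_integral_0_iff_AE) auto
  then show "AE w in PP x. \<not> noat m w" by eventually_elim (auto split: split_indicator_asm)
qed

lemma \<mu>_Psi:
  assumes "g \<in> borel_measurable borel" shows "(\<integral>\<^sup>+x. g x \<partial>\<mu>) = (\<integral>\<^sup>+y. Psi g y \<partial>\<nu>)"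
  using \<mu>_Psi_partial[OF assms, of undefined] sum_ifa_law[of undefined] by (simp add: einf_zero)

text \<open>With \<open>h = a 1\<^sub>C\<close>, the function \<open>D\<close> solving \<open>D = U\<^sup>1 f + U\<^sup>1 ((1 - h) D)\<close> is bounded because \<open>f\<close> is
  special, and it controls the potential of the chain killed at the atom.\<close>
lemma Psi_bounded:
  assumes f: "special_nonneg P X \<mu> f"
  obtains c :: real where "0 \<le> c" "\<And>x. Psi (\<lambda>x. ennreal (f x)) x \<le> ennreal c"
proof -
  have fm [measurable]: "f \<in> borel_measurable borel" using f by (simp add: special_nonneg_def)
  define h where "h x = a * indicat_real C x" for x
  have [measurable]: "h \<in> borel_measurable borel" unfolding h_def by measurable
  have h01: "0 \<le> h x" "h x \<le> 1" for x using a_bounds by (auto simp: h_def split: split_indicator)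
  have hC: "ennreal (h x) = ennreal a * indicator C x" for x by (auto simp: h_def split: split_indicator)
  have "(\<integral>\<^sup>+x. ennreal (h x) \<partial>\<mu>) = ennreal a * emeasure \<mu> C"
    unfolding hC by (rule nn_integral_cmult_indicator) (simp add: sets_\<mu> C_sets)
  then have hpos: "0 < (\<integral>\<^sup>+x. ennreal (h x) \<partial>\<mu>)" using a_bounds C_pos by (simp add: ennreal_zero_less_mult_iff)
  let ?f = "\<lambda>x. ennreal (f x)" and ?h = "\<lambda>x. ennreal (h x)" and ?q = "\<lambda>x. ennreal (1 - h x)"
  obtain c0 :: real where c0: "\<And>x n. (\<Sum>i<n. iterated_U1 (\<lambda>x. 1 - h x) ?f i x) \<le> ennreal c0"
    using special_iterated_bound[OF f _ h01 hpos] by auto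
  define c where "c = ennreal c0"
  define D where "D x = (\<Sum>n. iterated_U1 (\<lambda>x. 1 - h x) ?f n x)" for x
  have itm [measurable]: "iterated_U1 (\<lambda>x. 1 - h x) ?f n \<in> borel_measurable borel" for n by (rule measurable_iterated_U1) measurable
  have Dm [measurable]: "D \<in> borel_measurable borel" unfolding D_def by measurable
  have Dc: "D x \<le> c" for x unfolding D_def suminf_eq_SUP c_def by (intro SUP_least c0)
  have D_eq: "D x = UU ?f x + Uop (\<lambda>y. ?q y * D y) x" for x
  proof -
    have "D x = UU ?f x + (\<Sum>n. iterated_U1 (\<lambda>x. 1 - h x) ?f (Suc n) x)"
      unfolding D_def using suminf_offset[of "\<lambda>n. iterated_U1 (\<lambda>x. 1 - h x) ?f n x" 1] by (simp add: summableI)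
    also have "(\<Sum>n. iterated_U1 (\<lambda>x. 1 - h x) ?f (Suc n) x) = (\<Sum>n. UU (\<lambda>y. ?q y * iterated_U1 (\<lambda>x. 1 - h x) ?f n y) x)" by simp
    also have "\<dots> = UU (\<lambda>y. \<Sum>n. ?q y * iterated_U1 (\<lambda>x. 1 - h x) ?f n y) x"
      by (rule nn_integral_suminf[symmetric]) simp
    finally show ?thesis by (simp add: D_def Uop_def)
  qed
  have U_split: "Uop D x = Uop (\<lambda>y. ?q y * D y) x + Uop (\<lambda>y. ?h y * D y) x" for x
  proof -
    have "D y = ?q y * D y + ?h y * D y" for y
      unfolding distrib_right[symmetric] using h01[of y] by (simp add: ennreal_plus[symmetric] del: ennreal_plus)
    then have "Uop D x = Uop (\<lambda>y. ?q y * D y + ?h y * D y) x" by simp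
    then show ?thesis by (simp add: Uop_add)
  qed
  \<comment> \<open>\<open>Qop\<close> is bounded by \<open>Uop\<close>, which exceeds the kernel
    weighted by \<open>1 - h\<close> by the term \<open>Uop (h * D)\<close>. Thus \<open>D\<close>
    dominates the killed potential up to an error \<open>c * Uop h\<close> per step.\<close>
  have D_super: "UU ?f x + Qop D x \<le> D x + c * Uop ?h x" for x
  proof -
    have "UU ?f x + Qop D x \<le> UU ?f x + Uop D x" unfolding Uop_def by (intro add_left_mono Qop_le_UU Dm)
    also have "\<dots> = D x + Uop (\<lambda>y. ?h y * D y) x" unfolding U_split D_eq[of x] by (simp add: add.assoc)
    also have "\<dots> \<le> D x + Uop (\<lambda>y. c * ?h y) x"
      by (intro add_left_mono Uop_mono) (simp add: mult.commute mult_right_mono Dc)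
    finally show ?thesis by (simp add: Uop_cmult)
  qed
  \<comment> \<open>\<open>\<zeta> n\<close> adds up these errors along \<open>n\<close> steps of
    the killed chain. It stays bounded because the killed chain loses the mass \<open>h\<close> at
    each step (\<open>Q1\<close>), while \<open>Uop h\<close> exceeds \<open>Qop h\<close> by at
    most \<open>h\<close>; together these give \<open>\<zeta> n + h \<le> 2\<close> by
    induction.\<close>
  define \<zeta> where "\<zeta> n = ((\<lambda>\<phi> x. Uop ?h x + Qop \<phi> x) ^^ n) (\<lambda>_. 0)" for n
  have \<zeta>_Suc: "\<zeta> (Suc n) = (\<lambda>x. Uop ?h x + Qop (\<zeta> n) x)" and \<zeta>_0: "\<zeta> 0 = (\<lambda>_. 0)" for n by (simp_all add: \<zeta>_def)
  have \<zeta>m [measurable]: "\<zeta> n \<in> borel_measurable borel" for n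
    by (induction n) (simp_all add: \<zeta>_0 \<zeta>_Suc Uop_meas Qop_meas)
  have nuh: "(\<integral>\<^sup>+y. ?h y \<partial>\<nu>) \<le> 1"
  proof -
    have "(\<integral>\<^sup>+y. ?h y \<partial>\<nu>) \<le> (\<integral>\<^sup>+y. 1 \<partial>\<nu>)" using h01 by (intro nn_integral_mono) simp
    then show ?thesis by (simp add: emeasure_\<nu>_UNIV)
  qed
  have Q1: "Qop (\<lambda>_. 1) x + ?h x = 1" for x using Qop_1[of x] by (simp add: hC)
  have Uh: "Uop ?h x \<le> Qop ?h x + ?h x" for x
  proof -
    have "Uop ?h x = Qop ?h x + ?h x * (\<integral>\<^sup>+y. ?h y \<partial>\<nu>)" by (subst Uop_Qop) (simp_all add: hC)
    also have "\<dots> \<le> Qop ?h x + ?h x * 1" by (intro add_left_mono mult_left_mono nuh) simp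
    finally show ?thesis by simp
  qed
  have \<zeta>_le: "\<zeta> n x + ?h x \<le> 2" for n x
  proof (induction n arbitrary: x)
    case 0 
    have "?h x \<le> ennreal 2" using h01[of x] by (intro ennreal_leI) linarith
    then show ?case by (simp add: \<zeta>_0)
  next
    case (Suc n)
    have "\<zeta> (Suc n) x + ?h x \<le> ((Qop ?h x + ?h x) + Qop (\<zeta> n) x) + ?h x"
      unfolding \<zeta>_Suc by (intro add_right_mono Uh)
    also have "\<dots> = Qop (\<lambda>y. \<zeta> n y + ?h y) x + 2 * ?h x" 
    proof -
      have "Qop (\<lambda>y. \<zeta> n y + ?h y) x = Qop (\<zeta> n) x + Qop ?h x" by (rule Qop_add) simp_all
      then show ?thesis by (simp only: mult_2 add_ac)
    qed
    also have "\<dots> \<le> Qop (\<lambda>_. 2 * 1) x + 2 * ?h x" by (intro add_right_mono Qop_mono) (simp add: Suc)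
    also have "\<dots> = 2 * (Qop (\<lambda>_. 1) x + ?h x)" by (subst Qop_cmult) (simp_all add: distrib_left)
    finally show ?case by (simp add: Q1)
  qed
  have V: "(\<Sum>i<Suc n. (Qop ^^ i) (UU ?f) x) \<le> D x + c * \<zeta> (Suc n) x" for n x
  proof (induction n arbitrary: x)
    case 0
    have "UU ?f x \<le> D x" unfolding D_eq[of x] by simp
    also have "\<dots> \<le> D x + c * \<zeta> (Suc 0) x" by simp
    finally show ?case by simp
  next
    case (Suc n)
    have "(\<Sum>i<Suc (Suc n). (Qop ^^ i) (UU ?f) x) = UU ?f x + (\<Sum>i<Suc n. (Qop ^^ Suc i) (UU ?f) x)"
      unfolding sum.lessThan_Suc_shift[of _ "Suc n"] by (simp del: funpow.simps(2) sum.lessThan_Suc)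
    also have "(\<Sum>i<Suc n. (Qop ^^ Suc i) (UU ?f) x) = Qop (\<lambda>x. \<Sum>i<Suc n. (Qop ^^ i) (UU ?f) x) x"
      unfolding funpow.simps(2) o_apply by (subst (2) Qop_def) (subst nn_integral_sum, simp_all add: Qop_def[of "(Qop ^^ i) \<phi>" for i \<phi>] del: sum.lessThan_Suc)
    also have "UU ?f x + \<dots> \<le> UU ?f x + Qop (\<lambda>x. D x + c * \<zeta> (Suc n) x) x"
      by (intro add_left_mono Qop_mono Suc)
    also have "\<dots> = (UU ?f x + Qop D x) + c * Qop (\<zeta> (Suc n)) x"
      by (subst Qop_add) (simp_all add: Qop_cmult add.assoc)
    also have "\<dots> \<le> (D x + c * Uop ?h x) + c * Qop (\<zeta> (Suc n)) x" by (intro add_right_mono D_super)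
    also have "\<dots> = D x + c * \<zeta> (Suc (Suc n)) x" unfolding \<zeta>_Suc[of "Suc n"] by (simp add: distrib_left add.assoc)
    finally show ?case .
  qed
  have c2: "D x + c * \<zeta> n x \<le> c + c * 2" for n x
  proof -
    have "\<zeta> n x \<le> \<zeta> n x + ?h x" by simp
    also have "\<dots> \<le> 2" by (rule \<zeta>_le)
    finally show ?thesis by (intro add_mono Dc mult_left_mono) simp_all
  qed
  have VVc: "VV ?f x \<le> c + c * 2" for x
    unfolding VV_def suminf_eq_SUP
  proof (rule SUP_least)
    fix n
    have "(\<Sum>i<n. (Qop ^^ i) (UU ?f) x) \<le> (\<Sum>i<Suc n. (Qop ^^ i) (UU ?f) x)" by simp
    also have "\<dots> \<le> c + c * 2" using V[of x n] c2[of x "Suc n"] by (rule order_trans)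
    finally show "(\<Sum>i<n. (Qop ^^ i) (UU ?f) x) \<le> c + c * 2" .
  qed
  have "Psi ?f x \<le> c + (c + c * 2)" for x
  proof -
    have "UU ?f x \<le> D x" unfolding D_eq[of x] by simp
    then have "UU ?f x \<le> c" using Dc order_trans by blast
    moreover have "UU (VV ?f) x \<le> Uop (\<lambda>_. c + c * 2) x" unfolding Uop_def by (intro nn_integral_mono VVc)
    ultimately show ?thesis unfolding Psi_def Uop_const by (rule add_mono)
  qed
  moreover have "c + (c + c * 2) = ennreal (4 * max 0 c0)"
  proof -
    define d where "d = max 0 c0"
    have d: "0 \<le> d" "c = ennreal d" by (simp_all add: d_def c_def max_def ennreal_neg)
    have 1: "c * 2 = ennreal (d * 2)" using d by (simp add: ennreal_mult)
    have 2: "ennreal (d + d * 2) = ennreal d + ennreal (d * 2)" by (rule ennreal_plus) (use d in auto)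
    have 3: "ennreal (d + (d + d * 2)) = ennreal d + ennreal (d + d * 2)" by (rule ennreal_plus) (use d in auto)
    have "d + (d + d * 2) = 4 * d" by simp
    then show ?thesis unfolding d_def[symmetric] 1 unfolding d(2) 2[symmetric] 3[symmetric] by (rule arg_cong)
  qed
  ultimately show ?thesis by (intro that[of "4 * max 0 c0"]) auto
qed

end

section \<open>Functionals of successive cycles\<close>

context nummelin_splitting
begin

definition lapw :: "real \<Rightarrow> nat \<Rightarrow> nat \<Rightarrow> 'v \<Rightarrow> ennreal" where
  "lapw r i j w = ennreal (exp (- r * (T j w - T i w)))"

text \<open>The Laplace weight of the cycle that opens at index \<open>m\<close>, as a sum over the
  number of misses. At most one summand is nonzero on a path, and each can be integrated by
  \<open>na_chain\<close>.\<close>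

definition lp :: "real \<Rightarrow> nat \<Rightarrow> 'v \<Rightarrow> ennreal" where
  "lp r m w = lapw r m (Suc m) w *
    (\<Sum>n. (\<Prod>i\<in>{Suc m..<Suc m + n}. ina i w * lapw r i (Suc i) w) * (ia (Suc m + n) w * lapw r (Suc m + n) (Suc (Suc m + n)) w))"

lemma lapw_add: "lapw r i j w * lapw r j k w = lapw r i k w"
  by (simp add: lapw_def ennreal_mult[symmetric] exp_add[symmetric] algebra_simps)

lemma lapw_hist: "i \<le> n \<Longrightarrow> j \<le> n \<Longrightarrow> lapw r i j \<in> borel_measurable (hist n)"
  unfolding lapw_def[abs_def] using T_hist[of i n] T_hist[of j n] by measurable

lemma lapw_N [measurable]: "lapw r i j \<in> borel_measurable N"
  unfolding lapw_def[abs_def] by measurable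

lemma lp_first_atom:
  assumes fa: "first_atom (Suc m) k w" shows "lp r m w = lapw r m (Suc k) w"
proof -
  from fa have mk: "Suc m \<le> k" and at: "atom k w" and nat: "\<And>i. Suc m \<le> i \<Longrightarrow> i < k \<Longrightarrow> \<not> atom i w"
    by (auto simp: first_atom_def)
  define d where "d = k - Suc m"
  let ?t = "\<lambda>n. (\<Prod>i\<in>{Suc m..<Suc m + n}. ina i w * lapw r i (Suc i) w) * (ia (Suc m + n) w * lapw r (Suc m + n) (Suc (Suc m + n)) w)"
  have "?t n = 0" if "n \<noteq> d" for n
  proof (cases "n < d")
    case True
    then have "\<not> atom (Suc m + n) w" by (intro nat) (auto simp: d_def)
    then show ?thesis by simp
  next
    case False
    then have "k \<in> {Suc m..<Suc m + n}" using that mk by (auto simp: d_def)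
    moreover have "ina k w * lapw r k (Suc k) w = 0" using at by simp
    ultimately have "(\<Prod>i\<in>{Suc m..<Suc m + n}. ina i w * lapw r i (Suc i) w) = 0" by (intro prod_zero) blast+
    then show ?thesis by (simp only: mult_zero_left)
  qed
  then have "(\<Sum>n. ?t n) = (\<Sum>n\<in>{d}. ?t n)" by (intro suminf_finite) auto
  also have "\<dots> = (\<Prod>i\<in>{Suc m..<k}. ina i w * lapw r i (Suc i) w) * lapw r k (Suc k) w"
    using mk at by (simp add: d_def)
  also have "(\<Prod>i\<in>{Suc m..<k}. ina i w * lapw r i (Suc i) w) = (\<Prod>i\<in>{Suc m..<k}. lapw r i (Suc i) w)"
    using nat by (intro prod.cong refl) auto
  also have "\<dots> = lapw r (Suc m) k w"
    using mk by (induction rule: dec_induct) (simp_all add: lapw_add, simp add: lapw_def)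
  finally show ?thesis by (simp add: lp_def lapw_add)
qed

lemma lap_step:
  assumes e: "e \<in> borel_measurable (stopped k)"
    and step: "\<And>\<psi>. (\<lambda>(w, y). \<psi> w y) \<in> borel_measurable (hist k \<Otimes>\<^sub>M borel) \<Longrightarrow>
      (\<integral>\<^sup>+w. e w * \<psi> w (ys k w) \<partial>PP x) = (\<integral>\<^sup>+w. S (\<psi> w) (xs k w) \<partial>PP x)"
    and S: "\<And>c x \<psi>. \<psi> \<in> borel_measurable borel \<Longrightarrow> S (\<lambda>y. c * \<psi> y) x = c * S \<psi> x"
    and W [measurable]: "W \<in> borel_measurable (hist k)" and [measurable]: "\<psi> \<in> borel_measurable borel"
  shows "(\<integral>\<^sup>+w. W w * (e w * lapw r k (Suc k) w * \<psi> (xs (Suc k) w)) \<partial>PP x) =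
    (\<integral>\<^sup>+w. W w * S (\<lambda>y. \<integral>\<^sup>+t\<in>{0<..}. hd (xs k w) y t * (ennreal (exp (- r * t)) * \<psi> y) \<partial>lborel) (xs k w) \<partial>PP x)"
proof -
  have "(\<integral>\<^sup>+w. W w * (e w * lapw r k (Suc k) w * \<psi> (xs (Suc k) w)) \<partial>PP x) =
    (\<integral>\<^sup>+w. e w * (W w * (ennreal (exp (- r * sg k w)) * \<psi> (ys k w))) \<partial>PP x)"
    by (intro nn_integral_cong) (simp add: lapw_def sg_def xs_Suc mult_ac)
  also have "\<dots> = (\<integral>\<^sup>+w. S (\<lambda>y. \<integral>\<^sup>+t\<in>{0<..}. hd (xs k w) y t * (W w * (ennreal (exp (- r * t)) * \<psi> y)) \<partial>lborel) (xs k w) \<partial>PP x)"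
    by (rule step_time_weighted[OF _ e step, rotated]) (assumption, measurable)
  also have "\<dots> = (\<integral>\<^sup>+w. W w * S (\<lambda>y. \<integral>\<^sup>+t\<in>{0<..}. hd (xs k w) y t * (ennreal (exp (- r * t)) * \<psi> y) \<partial>lborel) (xs k w) \<partial>PP x)"
  proof (intro nn_integral_cong)
    fix w
    have "(\<integral>\<^sup>+t\<in>{0<..}. hd (xs k w) y t * (W w * (ennreal (exp (- r * t)) * \<psi> y)) \<partial>lborel) =
      W w * (\<integral>\<^sup>+t\<in>{0<..}. hd (xs k w) y t * (ennreal (exp (- r * t)) * \<psi> y) \<partial>lborel)" for y
      by (subst nn_integral_cmult[symmetric]) (auto intro!: nn_integral_cong simp: mult_ac)
    then show "S (\<lambda>y. \<integral>\<^sup>+t\<in>{0<..}. hd (xs k w) y t * (W w * (ennreal (exp (- r * t)) * \<psi> y)) \<partial>lborel) (xs k w) =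
      W w * S (\<lambda>y. \<integral>\<^sup>+t\<in>{0<..}. hd (xs k w) y t * (ennreal (exp (- r * t)) * \<psi> y) \<partial>lborel) (xs k w)"
      by (simp add: S)
  qed
  finally show ?thesis .
qed

text \<open>The conditional transform of a cycle length depends on the past through
  \<open>xs m\<close> alone. Unlike for integrals, the final step must be on the atom; its payoff
  \<open>y\<close> averages the holding time over an end point drawn from
  \<open>\<nu>\<close>.\<close>

lemma lp_law:
  obtains \<theta> where "\<theta> \<in> borel_measurable borel"
    "\<And>x (W :: 'v \<Rightarrow> ennreal) m. W \<in> borel_measurable (hist m) \<Longrightarrow> (\<integral>\<^sup>+w. W w * lp r m w \<partial>PP x) = (\<integral>\<^sup>+w. W w * \<theta> (xs m w) \<partial>PP x)"
proof -
  define wt where "wt \<psi> x y = (\<integral>\<^sup>+t\<in>{0<..}. hd x y t * (ennreal (exp (- r * t)) * \<psi> y) \<partial>lborel)" for \<psi> :: "'e \<Rightarrow> ennreal" and x y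
  have wt [measurable]: "(\<lambda>(x, y). wt \<psi> x y) \<in> borel_measurable (borel \<Otimes>\<^sub>M borel)" if [measurable]: "\<psi> \<in> borel_measurable borel" for \<psi>
    unfolding wt_def by measurable
  define S where "S \<psi> x = QQ (wt \<psi> x) x" for \<psi> x
  define B where "B \<psi> x = UU (wt \<psi> x) x" for \<psi> x
  define y where "y x = ennreal a * indicator C x * (\<integral>\<^sup>+z. wt (\<lambda>_. 1) x z \<partial>\<nu>)" for x
  interpret nu: prob_space \<nu> by (rule prob_\<nu>)
  have Sm: "S \<psi> \<in> borel_measurable borel" if [measurable]: "\<psi> \<in> borel_measurable borel" for \<psi> unfolding S_def by measurable
  have Bm: "B \<psi> \<in> borel_measurable borel" if [measurable]: "\<psi> \<in> borel_measurable borel" for \<psi> unfolding B_def by measurable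
  have ym [measurable]: "y \<in> borel_measurable borel" unfolding y_def by measurable
  have Snm [measurable]: "(S ^^ n) y \<in> borel_measurable borel" for n by (induction n) (simp_all add: Sm)
  define V where "V x = (\<Sum>n. (S ^^ n) y x)" for x
  have Vm [measurable]: "V \<in> borel_measurable borel" unfolding V_def by measurable
  have D: "lapw r k (Suc k) \<in> borel_measurable (hist (Suc k))" for k by (rule lapw_hist) auto
  have na: "(\<integral>\<^sup>+w. W w * (ina k w * lapw r k (Suc k) w * \<psi> (xs (Suc k) w)) \<partial>PP x) = (\<integral>\<^sup>+w. W w * S \<psi> (xs k w) \<partial>PP x)"
    if "W \<in> borel_measurable (hist k)" "\<psi> \<in> borel_measurable borel" for W :: "'v \<Rightarrow> ennreal" and k \<psi> x
    unfolding S_def wt_def by (rule lap_step[where S=QQ, OF na_stopped step_na]) (use that in \<open>simp_all add: nn_integral_cmult\<close>)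
  have full: "(\<integral>\<^sup>+w. W w * (lapw r k (Suc k) w * \<psi> (xs (Suc k) w)) \<partial>PP x) = (\<integral>\<^sup>+w. W w * B \<psi> (xs k w) \<partial>PP x)"
    if "W \<in> borel_measurable (hist k)" "\<psi> \<in> borel_measurable borel" for W :: "'v \<Rightarrow> ennreal" and k \<psi> x
    unfolding B_def wt_def using lap_step[where S=UU and e="\<lambda>_. 1" and W=W and \<psi>=\<psi> and k=k] step_full that by (simp add: nn_integral_cmult)
  have at: "(\<integral>\<^sup>+w. W w * (ia k w * lapw r k (Suc k) w) \<partial>PP x) = (\<integral>\<^sup>+w. W w * y (xs k w) \<partial>PP x)"
    if "W \<in> borel_measurable (hist k)" for W :: "'v \<Rightarrow> ennreal" and k x
    using lap_step[where S="\<lambda>\<phi> x. ennreal a * indicator C x * (\<integral>\<^sup>+z. \<phi> z \<partial>\<nu>)" and W=W and \<psi>="\<lambda>_. 1" and k=k and x=x, OF at_stopped step_at]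
    unfolding y_def wt_def using that by (simp add: nn_integral_cmult mult_ac)
  show ?thesis
  proof (rule that[of "B V"])
    fix x m and W :: "'v \<Rightarrow> ennreal" assume W [measurable]: "W \<in> borel_measurable (hist m)"
    define s where "s n w = (\<Prod>i\<in>{Suc m..<Suc m + n}. ina i w * lapw r i (Suc i) w) * (ia (Suc m + n) w * lapw r (Suc m + n) (Suc (Suc m + n)) w)" for n w
    have [measurable]: "s n \<in> borel_measurable N" for n unfolding s_def by measurable
    note WN [measurable] = measurable_hist_N[OF W]
    have W': "(\<lambda>w. W w * lapw r m (Suc m) w) \<in> borel_measurable (hist (Suc m))"
      using measurable_hist_mono[OF W, of "Suc m"] D by simp
    have "(\<integral>\<^sup>+w. W w * lp r m w \<partial>PP x) = (\<integral>\<^sup>+w. (\<Sum>n. (W w * lapw r m (Suc m) w) * s n w) \<partial>PP x)"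
      unfolding lp_def s_def by (simp add: mult.assoc)
    also have "\<dots> = (\<Sum>n. \<integral>\<^sup>+w. (W w * lapw r m (Suc m) w) * s n w \<partial>PP x)" by (rule nn_integral_suminf) measurable
    also have "\<dots> = (\<Sum>n. \<integral>\<^sup>+w. (W w * lapw r m (Suc m) w) * (S ^^ n) y (xs (Suc m) w) \<partial>PP x)"
      unfolding s_def by (intro suminf_cong na_chain[OF Sm D na ym at W'])
    also have "\<dots> = (\<integral>\<^sup>+w. (W w * lapw r m (Suc m) w) * V (xs (Suc m) w) \<partial>PP x)"
      unfolding V_def by (subst nn_integral_suminf[symmetric]) simp_all
    also have "\<dots> = (\<integral>\<^sup>+w. W w * B V (xs m w) \<partial>PP x)" using full[OF W Vm, of x] by (simp add: mult.assoc)
    finally show "(\<integral>\<^sup>+w. W w * lp r m w \<partial>PP x) = (\<integral>\<^sup>+w. W w * B V (xs m w) \<partial>PP x)" .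
  qed (rule Bm[OF Vm])
qed

text \<open>\<open>reg j i\<close> says that the \<open>j\<close>-th regeneration time is \<open>T\<^sub>i\<close>.\<close>
primrec reg :: "nat \<Rightarrow> nat \<Rightarrow> 'v \<Rightarrow> bool" where
  "reg 0 i w \<longleftrightarrow> i = 0"
| "reg (Suc j) i w \<longleftrightarrow> (\<exists>k<i. i = Suc k \<and> (\<exists>m<k. reg j m w \<and> first_atom (Suc m) k w))"

abbreviation "ireg j i \<equiv> indicator {w. reg j i w} :: 'v \<Rightarrow> ennreal"

lemma reg_unique: "reg j i w \<Longrightarrow> reg j k w \<Longrightarrow> i = k"
proof (induction j arbitrary: i k)
  case (Suc j) then show ?case using first_atom_unique by simp metis
qed simp

lemma other_reg: "reg j i w \<Longrightarrow> k \<noteq> i \<Longrightarrow> \<not> reg j k w"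
  using reg_unique by metis

lemma reg_SucI: "reg j m w \<Longrightarrow> first_atom (Suc m) k w \<Longrightarrow> reg (Suc j) (Suc k) w"
  by (auto simp: first_atom_def intro!: exI[of _ m])

lemma reg_ex: "\<forall>m. \<not> noat m w \<Longrightarrow> \<exists>i. reg j i w"
proof (induction j)
  case (Suc j) then show ?case using first_atom_or_noat reg_SucI by blast
qed simp

lemma reg_hist: "i \<le> n \<Longrightarrow> Measurable.pred (hist n) (reg j i)"
proof (induction j arbitrary: i n)
  case (Suc j)
  have "Measurable.pred (hist n) (\<lambda>w. \<exists>k\<in>{..<i}. i = Suc k \<and> (\<exists>m\<in>{..<k}. reg j m w \<and> first_atom (Suc m) k w))"
    by (intro pred_intros_finite pred_intros_logic Suc.IH first_atom_hist) (use Suc.prems in auto)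
  moreover have "reg (Suc j) i = (\<lambda>w. \<exists>k\<in>{..<i}. i = Suc k \<and> (\<exists>m\<in>{..<k}. reg j m w \<and> first_atom (Suc m) k w))"
    by (intro ext) (simp only: reg.simps bex_simps lessThan_iff Bex_def)
  ultimately show ?case by (simp only:)
next
  case 0
  have "reg 0 i = (\<lambda>_. i = 0)" by (intro ext) simp
  then show ?case by simp
qed

lemma reg_N [measurable]: "Measurable.pred N (reg j i)"
  by (rule measurable_hist_N[OF reg_hist[OF order_refl]])

lemma reg_time: "w \<in> space N \<Longrightarrow> reg j i w \<Longrightarrow> regen_time C a Z T j w = T i w"
proof (induction j arbitrary: i)
  case 0 then show ?case by (simp add: T_0)
next
  case (Suc j) then show ?case using regen_step by (metis reg.simps(2))
qed

text \<open>Measurability with respect to the past before the random index of the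
  \<open>j\<close>-th regeneration, in the manner of the sigma-algebra of a stopping time.
  \<open>hist i\<close> contains the starting point \<open>xs i\<close> of the cycle but not the
  labels drawn at \<open>T i\<close>.\<close>

definition past :: "nat \<Rightarrow> ('v \<Rightarrow> ennreal) \<Rightarrow> bool" where
  "past j W \<longleftrightarrow> W \<in> borel_measurable N \<and> (\<forall>i. (\<lambda>w. W w * ireg j i w) \<in> borel_measurable (hist i))"

text \<open>A sum over indicators instead of a chosen index, as also in \<open>cyc\<close>: at most
  one term is nonzero, the value is 0 where the regeneration does not exist, and integrals can be
  taken term by term.\<close>

definition val :: "nat \<Rightarrow> (nat \<Rightarrow> 'v \<Rightarrow> ennreal) \<Rightarrow> 'v \<Rightarrow> ennreal" where
  "val j G w = (\<Sum>i. ireg j i w * G i w)"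

definition cyc :: "(nat \<Rightarrow> nat \<Rightarrow> 'v \<Rightarrow> ennreal) \<Rightarrow> nat \<Rightarrow> 'v \<Rightarrow> ennreal" where
  "cyc \<phi> j w = (\<Sum>i. \<Sum>m<i. ireg j m w * ireg (Suc j) i w * \<phi> m i w)"

lemma val_eq: "reg j i w \<Longrightarrow> val j G w = G i w"
  unfolding val_def using reg_unique by (subst suminf_finite[of "{i}"]) (auto split: split_indicator)

lemma cyc_eq:
  assumes "reg j m w" "reg (Suc j) i w" shows "cyc \<phi> j w = \<phi> m i w"
proof -
  obtain m' where "reg j m' w" "m' < i" using assms(2) by auto
  then have mi: "m < i" using reg_unique assms(1) by metis
  have "cyc \<phi> j w = (\<Sum>i'\<in>{i}. \<Sum>m<i'. ireg j m w * ireg (Suc j) i' w * \<phi> m i' w)"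
    unfolding cyc_def
    by (rule suminf_finite) (use other_reg[OF assms(2)] in \<open>auto simp del: reg.simps\<close>)
  also have "\<dots> = (\<Sum>m'\<in>{m}. ireg j m' w * ireg (Suc j) i w * \<phi> m' i w)"
  proof -
    have "(\<Sum>m'<i. ireg j m' w * ireg (Suc j) i w * \<phi> m' i w) = (\<Sum>m'\<in>{m}. ireg j m' w * ireg (Suc j) i w * \<phi> m' i w)"
      by (rule sum.mono_neutral_right) (use mi other_reg[OF assms(1)] in \<open>auto simp del: reg.simps\<close>)
    then show ?thesis by (simp del: reg.simps)
  qed
  finally show ?thesis using assms by (simp del: reg.simps)
qed

lemma ireg_hist: "i \<le> n \<Longrightarrow> ireg j i \<in> borel_measurable (hist n)"
  using reg_hist[of i n j] by measurable

lemma past_1: "past 0 (\<lambda>_. 1)"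
  unfolding past_def using ireg_hist by (simp del: reg.simps)

lemma past_N: "past j W \<Longrightarrow> W \<in> borel_measurable N"
  by (simp add: past_def)

lemma past_hist: "past j W \<Longrightarrow> i \<le> n \<Longrightarrow> (\<lambda>w. W w * ireg j i w) \<in> borel_measurable (hist n)"
  unfolding past_def using measurable_hist_mono by blast

lemma past_fun:
  assumes "past j W" "f \<in> borel_measurable borel" "f 0 = 0" shows "past j (\<lambda>w. f (W w))"
proof -
  have *: "f (W w) * ireg j i w = f (W w * ireg j i w)" for i w using assms(3) by (auto split: split_indicator)
  show ?thesis unfolding past_def *
    using assms(1,2) by (auto simp: past_def intro: measurable_compose)
qed

lemma past_add:
  assumes "past j W" "past j V" shows "past j (\<lambda>w. W w + V w)"
  unfolding past_def distrib_right
proof (intro conjI allI)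
  note [measurable] = assms[THEN past_N]
  show "(\<lambda>w. W w + V w) \<in> borel_measurable N" by measurable
  fix i
  have [measurable]: "(\<lambda>w. W w * ireg j i w) \<in> borel_measurable (hist i)" "(\<lambda>w. V w * ireg j i w) \<in> borel_measurable (hist i)"
    using assms by (auto simp: past_def)
  show "(\<lambda>w. W w * ireg j i w + V w * ireg j i w) \<in> borel_measurable (hist i)" by measurable
qed

text \<open>A regeneration at \<open>Suc k\<close> is caused by the atom at \<open>k\<close>.
  Splitting off that indicator leaves a factor in \<open>hist k\<close>, the form in which
  \<open>atom_step\<close> can be applied.\<close>

lemma reg_split: "W * ireg (Suc j) (Suc k) w = (\<Sum>m<k. W * ireg j m w * pre (Suc m) k w) * ia k w"
proof (cases "reg (Suc j) (Suc k) w")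
  case True
  then obtain m where m: "m < k" "reg j m w" "first_atom (Suc m) k w" by auto
  have *: "(\<Sum>m<k. W * ireg j m w * pre (Suc m) k w) = (\<Sum>m\<in>{m}. W * ireg j m w * pre (Suc m) k w)"
    by (rule sum.mono_neutral_right) (use m(1) other_reg[OF m(2)] in auto)
  have "pre (Suc m) k w = 1" "ia k w = 1" "ireg j m w = 1" "ireg (Suc j) (Suc k) w = 1"
    using m True by (auto simp: first_atom_def)
  then show ?thesis unfolding * by simp
next
  case False
  have z: "W * ireg j m w * pre (Suc m) k w * ia k w = 0" if "m < k" for m
    using False that by (auto simp: first_atom_def split: split_indicator)
  have "(\<Sum>m<k. W * ireg j m w * pre (Suc m) k w) * ia k w = (\<Sum>m<k. W * ireg j m w * pre (Suc m) k w * ia k w)"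
    by (rule sum_distrib_right)
  also have "\<dots> = 0" by (rule sum.neutral) (use z in blast)
  finally show ?thesis using False by (simp only: indicator_simps mem_Collect_eq mult_zero_right not_False_eq_True)
qed

lemma past_split_hist: "past j W \<Longrightarrow> (\<lambda>w. \<Sum>m<k. W w * ireg j m w * pre (Suc m) k w) \<in> borel_measurable (hist k)"
  by (intro borel_measurable_sum borel_measurable_times_ennreal past_hist pre_hist) auto

lemma past_Suc:
  assumes "past j W" shows "past (Suc j) W"
  unfolding past_def
proof (intro conjI allI)
  show "(\<lambda>w. W w * ireg (Suc j) i w) \<in> borel_measurable (hist i)" for i
  proof (cases i)
    case (Suc k)
    show ?thesis unfolding Suc reg_split
      by (intro borel_measurable_times_ennreal measurable_hist_mono[OF past_split_hist[OF assms]] at_hist) auto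
  qed simp
qed (rule past_N[OF assms])

lemma past_cyc:
  assumes W: "past j W" and \<phi>: "\<And>m i. m < i \<Longrightarrow> \<phi> m i \<in> borel_measurable (hist i)"
  shows "past (Suc j) (\<lambda>w. W w * cyc \<phi> j w)"
  unfolding past_def
proof (intro conjI allI)
  have [measurable]: "(\<lambda>w. \<Sum>m<i. ireg j m w * ireg (Suc j) i w * \<phi> m i w) \<in> borel_measurable N" for i
    by (intro borel_measurable_sum borel_measurable_times_ennreal measurable_hist_N[OF \<phi>] measurable_hist_N[OF ireg_hist[OF order_refl]]) auto
  show "(\<lambda>w. W w * cyc \<phi> j w) \<in> borel_measurable N"
    unfolding cyc_def using past_N[OF W] by measurable
  fix i
  have "(\<lambda>w. (\<Sum>m<i. (W w * ireg j m w) * (ireg (Suc j) i w * \<phi> m i w))) \<in> borel_measurable (hist i)"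
    by (intro borel_measurable_sum borel_measurable_times_ennreal past_hist[OF W] ireg_hist \<phi>) auto
  moreover have "W w * cyc \<phi> j w * ireg (Suc j) i w = (\<Sum>m<i. (W w * ireg j m w) * (ireg (Suc j) i w * \<phi> m i w))" for w
  proof (cases "reg (Suc j) i w")
    case True
    then obtain k m where "i = Suc k" "m < k" and m2: "reg j m w" by auto
    then have m: "m < i" "reg j m w" by auto
    have "(\<Sum>m<i. (W w * ireg j m w) * (ireg (Suc j) i w * \<phi> m i w)) = (\<Sum>m\<in>{m}. (W w * ireg j m w) * (ireg (Suc j) i w * \<phi> m i w))"
      by (rule sum.mono_neutral_right) (use m(1) other_reg[OF m(2)] in auto)
    then show ?thesis using cyc_eq[OF m(2) True, of \<phi>] m True by (simp del: reg.simps)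
  qed (simp del: reg.simps)
  ultimately show "(\<lambda>w. W w * cyc \<phi> j w * ireg (Suc j) i w) \<in> borel_measurable (hist i)" by simp
qed

lemma reg_sum: "\<forall>m. \<not> noat m w \<Longrightarrow> (\<Sum>i. ireg j i w) = 1"
  using reg_ex[of w j] val_eq[of j _ w "\<lambda>_ _. 1"] by (auto simp: val_def)

text \<open>\<open>W\<close> stops at regeneration \<open>j\<close> and \<open>G\<close> starts at
  regeneration \<open>j + 1\<close>. What lies between enters only through the event
  \<open>pre\<close> and the atom, so cycle \<open>j\<close>, whose last bridge sees the next
  starting point, acts as a buffer: the start of \<open>G\<close> has law \<open>\<nu>\<close>
  independently of \<open>W\<close>. The relation \<open>rel\<close> covers exact laws and upper
  bounds.\<close>

lemma regen_transfer:
  assumes W: "past j W" and rel: "rel = (\<le>) \<or> rel = (=)"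
    and G: "\<And>k. G k \<in> borel_measurable N" and \<Theta>: "\<Theta> \<in> borel_measurable borel"
    and law: "\<And>k V. V \<in> borel_measurable (hist k) \<Longrightarrow> rel (\<integral>\<^sup>+w. V w * G k w \<partial>PP x) (\<integral>\<^sup>+w. V w * \<Theta> (xs k w) \<partial>PP x)"
  shows "rel (\<integral>\<^sup>+w. W w * val (Suc j) G w \<partial>PP x) ((\<integral>\<^sup>+w. W w \<partial>PP x) * (\<integral>\<^sup>+y. \<Theta> y \<partial>\<nu>))"
proof -
  note [measurable] = past_N[OF W] G
  define U where "U k w = (\<Sum>m<k. W w * ireg j m w * pre (Suc m) k w)" for k w
  have U: "U k \<in> borel_measurable (hist k)" for k unfolding U_def by (rule past_split_hist[OF W])
  note [measurable] = measurable_hist_N[OF U]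
  have Ua: "(\<lambda>w. U k w * ia k w) \<in> borel_measurable (hist (Suc k))" for k
    using measurable_hist_mono[OF U, of k "Suc k"] at_hist[of k "Suc k"] by simp
  have sp: "W w * val (Suc j) H w = (\<Sum>k. (U k w * ia k w) * H (Suc k) w)" for H w
  proof -
    have "val (Suc j) H w = (\<Sum>k. ireg (Suc j) (Suc k) w * H (Suc k) w)"
      unfolding val_def using suminf_offset[of "\<lambda>i. ireg (Suc j) i w * H i w" 1] by (simp add: summableI del: reg.simps) simp
    then have "W w * val (Suc j) H w = (\<Sum>k. (W w * ireg (Suc j) (Suc k) w) * H (Suc k) w)"
      by (simp add: mult.assoc del: reg.simps)
    then show ?thesis unfolding reg_split U_def .
  qed
  have 1: "(\<integral>\<^sup>+w. W w * val (Suc j) G w \<partial>PP x) = (\<Sum>k. \<integral>\<^sup>+w. (U k w * ia k w) * G (Suc k) w \<partial>PP x)"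
    unfolding sp by (rule nn_integral_suminf) measurable
  \<comment> \<open>Regenerations exist almost surely, so the events in \<open>sp\<close> cover the
    space up to a null set and their weights add up to the integral of \<open>W\<close>.\<close>
  have "(\<integral>\<^sup>+w. W w \<partial>PP x) = (\<integral>\<^sup>+w. W w * val (Suc j) (\<lambda>_ _. 1) w \<partial>PP x)"
    by (rule nn_integral_cong_AE, use noat_AE[of x] in eventually_elim)
      (simp add: val_def reg_sum del: reg.simps)
  also have "\<dots> = (\<Sum>k. \<integral>\<^sup>+w. U k w * ia k w \<partial>PP x)"
    unfolding sp by (subst nn_integral_suminf) simp_all
  finally have "(\<integral>\<^sup>+w. W w \<partial>PP x) * (\<integral>\<^sup>+y. \<Theta> y \<partial>\<nu>) = (\<Sum>k. (\<integral>\<^sup>+w. U k w * ia k w \<partial>PP x) * (\<integral>\<^sup>+y. \<Theta> y \<partial>\<nu>))" by simp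
  also have "\<dots> = (\<Sum>k. \<integral>\<^sup>+w. (U k w * ia k w) * \<Theta> (xs (Suc k) w) \<partial>PP x)"
    using atom_step[where x=x, OF U \<Theta>] by (simp add: mult.assoc)
  finally show ?thesis unfolding 1 using rel law[OF Ua] by (auto intro!: suminf_le summableI)
qed

lemma lap_cyc:
  obtains \<Phi> where "\<And>x j W. past j W \<Longrightarrow> (\<integral>\<^sup>+w. W w * cyc (lapw r) (Suc j) w \<partial>PP x) = (\<integral>\<^sup>+w. W w \<partial>PP x) * \<Phi>"
proof -
  obtain \<theta> where \<theta>: "\<theta> \<in> borel_measurable borel"
    "\<And>x (W :: 'v \<Rightarrow> ennreal) m. W \<in> borel_measurable (hist m) \<Longrightarrow> (\<integral>\<^sup>+w. W w * lp r m w \<partial>PP x) = (\<integral>\<^sup>+w. W w * \<theta> (xs m w) \<partial>PP x)"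
    by (rule lp_law[where r=r]) blast
  have lpN: "lp r k \<in> borel_measurable N" for k unfolding lp_def[abs_def] by measurable
  show ?thesis
  proof (rule that)
    fix x j W assume W: "past j W"
    have "(\<integral>\<^sup>+w. W w * cyc (lapw r) (Suc j) w \<partial>PP x) = (\<integral>\<^sup>+w. W w * val (Suc j) (lp r) w \<partial>PP x)"
    proof (rule nn_integral_cong_AE, use noat_AE[of x] in eventually_elim)
      fix w assume n: "\<forall>m. \<not> noat m w"
      then obtain m k where m: "reg (Suc j) m w" "first_atom (Suc m) k w" using reg_ex first_atom_or_noat by metis
      then show "W w * cyc (lapw r) (Suc j) w = W w * val (Suc j) (lp r) w"
        by (simp add: cyc_eq[OF m(1) reg_SucI[OF m]] val_eq lp_first_atom del: reg.simps)
    qed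
    also have "\<dots> = (\<integral>\<^sup>+w. W w \<partial>PP x) * (\<integral>\<^sup>+y. \<theta> y \<partial>\<nu>)"
      by (rule regen_transfer[OF W _ lpN \<theta>(1), where rel="(=)"]) (simp_all add: \<theta>(2))
    finally show "(\<integral>\<^sup>+w. W w * cyc (lapw r) (Suc j) w \<partial>PP x) = (\<integral>\<^sup>+w. W w \<partial>PP x) * (\<integral>\<^sup>+y. \<theta> y \<partial>\<nu>)" .
  qed
qed

end

section \<open>Centered cycles, incomplete ends and the maximal inequality\<close>

text \<open>Since \<open>exp u \<ge> 1\<close>, it is enough that
  \<open>2 v \<le> exp v - exp (- v)\<close>; with the Taylor bound \<open>s \<le> exp v\<close>
  this follows from \<open>s * s - 2 * v * s - 1 = (v\<^sup>2 / 2)\<^sup>2\<close>. It trades a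
  signed exponent for an absolute one and gains a first-order term, which centering turns into a
  cancellation.\<close>

lemma exp_signed_ineq:
  fixes u v :: real
  assumes "0 \<le> u" "0 \<le> v" shows "exp (u - v) + 2 * v \<le> exp (u + v)"
proof -
  define s where "s = 1 + v + v\<^sup>2 / 2"
  have s1: "1 \<le> s" using assms by (simp add: s_def)
  have e: "s \<le> exp v" unfolding s_def by (rule exp_lower_Taylor_quadratic) fact
  have "s * s - 2 * v * s - 1 = (v\<^sup>2 / 2)\<^sup>2" by (simp add: s_def power2_eq_square algebra_simps)
  then have "2 * v * s \<le> s * s - 1" using zero_le_power2[of "v\<^sup>2 / 2"] by linarith
  then have "2 * v \<le> s - 1 / s" using s1 by (simp add: field_simps)
  also have "\<dots> \<le> exp v - exp (- v)"
  proof -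
    have "exp (- v) \<le> 1 / s" using e s1 by (simp add: exp_minus inverse_eq_divide frac_le)
    then show ?thesis using e by linarith
  qed
  also have "\<dots> \<le> exp u * (exp v - exp (- v))"
  proof -
    have "1 * (exp v - exp (- v)) \<le> exp u * (exp v - exp (- v))" using assms by (intro mult_right_mono) auto
    then show ?thesis by simp
  qed
  also have "\<dots> = exp (u + v) - exp (u - v)" by (simp add: exp_add exp_diff exp_minus field_simps)
  finally show ?thesis by simp
qed

context nummelin_splitting
begin

lemma cyc_N:
  assumes "\<And>m i. m < i \<Longrightarrow> \<phi> m i \<in> borel_measurable (hist i)" shows "cyc \<phi> j \<in> borel_measurable N"
proof -
  have "(\<lambda>w. \<Sum>m<i. ireg j m w * ireg (Suc j) i w * \<phi> m i w) \<in> borel_measurable N" for i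
    by (intro borel_measurable_sum borel_measurable_times_ennreal measurable_hist_N[OF assms] measurable_hist_N[OF ireg_hist[OF order_refl]]) auto
  then show ?thesis unfolding cyc_def[abs_def] by measurable
qed

lemma val_N: "(\<And>i. G i \<in> borel_measurable N) \<Longrightarrow> val j G \<in> borel_measurable N"
  unfolding val_def[abs_def]
  by (intro borel_measurable_suminf_order borel_measurable_times_ennreal measurable_hist_N[OF ireg_hist[OF order_refl]]) auto

text \<open>The cycle indices start at 1, as cycle 0 does not begin with \<open>\<nu>\<close>.
  Within one parity \<open>lap_cyc\<close> applies factor by factor, since each product belongs to
  the past two regenerations after its predecessor.\<close>

lemma lap_prod:
  obtains \<Phi> where "\<And>x b q. (\<integral>\<^sup>+w. (\<Prod>i<q. cyc (lapw r) (Suc (2 * i + b)) w) \<partial>PP x) = \<Phi> ^ q"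
proof -
  obtain \<Phi> where \<Phi>: "\<And>x j W. past j W \<Longrightarrow> (\<integral>\<^sup>+w. W w * cyc (lapw r) (Suc j) w \<partial>PP x) = (\<integral>\<^sup>+w. W w \<partial>PP x) * \<Phi>"
    by (rule lap_cyc[where r=r]) blast
  have p1: "past b (\<lambda>_. 1)" for b by (induction b) (auto intro: past_1 past_Suc)
  have p: "past (2 * q + b) (\<lambda>w. \<Prod>i<q. cyc (lapw r) (Suc (2 * i + b)) w)" for q b
  proof (induction q)
    case (Suc q)
    have "past (Suc (Suc (2 * q + b))) (\<lambda>w. (\<Prod>i<q. cyc (lapw r) (Suc (2 * i + b)) w) * cyc (lapw r) (Suc (2 * q + b)) w)"
      by (intro past_cyc past_Suc Suc lapw_hist) auto
    then show ?case by simp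
  qed (simp add: p1)
  show ?thesis
  proof (rule that)
    show "(\<integral>\<^sup>+w. (\<Prod>i<q. cyc (lapw r) (Suc (2 * i + b)) w) \<partial>PP x) = \<Phi> ^ q" for x b q
    proof (induction q)
      case 0 then show ?case using prob_space.emeasure_space_1[OF PP_prob[of x]] by simp
    next
      case (Suc q) then show ?case using \<Phi>[OF p[of q b], of x] by (simp add: mult.commute)
    qed
  qed
qed

lemma markov_level:
  assumes W [measurable]: "W \<in> borel_measurable N" and e: "(\<integral>\<^sup>+w. W w \<partial>PP x) \<le> ennreal e" and h: "0 < h"
  shows "emeasure (PP x) {w \<in> space N. ennreal h \<le> W w} \<le> ennreal (e / h)"
proof -
  have le: "1 \<le> ennreal (1 / h) * W w" if "ennreal h \<le> W w" for w
  proof -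
    have "ennreal (1 / h) * ennreal h \<le> ennreal (1 / h) * W w" by (intro mult_left_mono that) simp
    then show ?thesis using h by (simp add: ennreal_mult[symmetric])
  qed
  have "emeasure (PP x) {w \<in> space N. ennreal h \<le> W w} \<le> emeasure (PP x) {w \<in> space N. 1 \<le> ennreal (1 / h) * W w}"
    using le by (intro emeasure_mono) (auto simp: sets_PP)
  also have "\<dots> \<le> ennreal (1 / h) * (\<integral>\<^sup>+w. W w * indicator (space N) w \<partial>PP x)"
    by (rule nn_integral_Markov_inequality) (simp_all add: sets_PP)
  also have "(\<integral>\<^sup>+w. W w * indicator (space N) w \<partial>PP x) = (\<integral>\<^sup>+w. W w \<partial>PP x)" by (intro nn_integral_cong) simp
  also have "ennreal (1 / h) * (\<integral>\<^sup>+w. W w \<partial>PP x) \<le> ennreal (1 / h) * ennreal e" by (intro mult_left_mono e) simp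
  also have "\<dots> = ennreal (e / h)" using h by (simp add: ennreal_mult'[symmetric])
  finally show ?thesis .
qed

text \<open>An elementary form of Doob's inequality: the product is frozen when it first reaches the level.\<close>
lemma parity_max:
  assumes \<phi>: "\<And>m i. m < i \<Longrightarrow> \<phi> m i \<in> borel_measurable (hist i)"
    and \<rho>: "1 \<le> \<rho>" and h: "0 < h"
    and step: "\<And>j W. past j W \<Longrightarrow> (\<integral>\<^sup>+w. W w \<partial>PP x) < \<infinity> \<Longrightarrow>
      (\<integral>\<^sup>+w. W w * cyc \<phi> (Suc j) w \<partial>PP x) \<le> (\<integral>\<^sup>+w. W w \<partial>PP x) * ennreal \<rho>"
  shows "emeasure (PP x) {w \<in> space N. \<exists>m\<le>q. ennreal h \<le> (\<Prod>i<m. cyc \<phi> (Suc (2 * i + b)) w)} \<le> ennreal (\<rho> ^ q / h)"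
proof -
  \<comment> \<open>Dividing each factor by \<open>\<rho>\<close> makes the product a
    supermartingale. If \<open>m \<le> q\<close> factors reach the level \<open>h\<close>, the
    normalized product reaches \<open>h / \<rho> ^ m \<ge> h / \<rho> ^ q\<close>, so one threshold
    serves all \<open>m\<close>.\<close>
  define thr where "thr = ennreal (h / \<rho> ^ q)"
  define B where "B = rec_nat (\<lambda>_. 1) (\<lambda>i B w. B w * indicator {thr..} (B w) + B w * indicator {..<thr} (B w) * ennreal (1 / \<rho>) * cyc \<phi> (Suc (2 * i + b)) w)"
  have B0: "B 0 = (\<lambda>_. 1)" by (simp add: B_def)
  have BS: "B (Suc i) = (\<lambda>w. B i w * indicator {thr..} (B i w) + B i w * indicator {..<thr} (B i w) * ennreal (1 / \<rho>) * cyc \<phi> (Suc (2 * i + b)) w)" for i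
    by (simp add: B_def)
  have p1: "past b (\<lambda>_. 1)" for b by (induction b) (auto intro: past_1 past_Suc)
  have up: "past j (\<lambda>w. W w * indicator {thr..} (W w))" if "past j W" for j W
    by (rule past_fun[OF that, of "\<lambda>z. z * indicator {thr..} z"]) simp_all
  have low: "past j (\<lambda>w. W w * indicator {..<thr} (W w) * ennreal (1 / \<rho>))" if "past j W" for j W
    by (rule past_fun[OF that, of "\<lambda>z. z * indicator {..<thr} z * ennreal (1 / \<rho>)"]) simp_all
  have pB: "past (2 * i + b) (B i)" for i
  proof (induction i)
    case (Suc i)
    have "past (Suc (Suc (2 * i + b))) (B (Suc i))" unfolding BS
      by (intro past_add past_cyc past_Suc[OF low[OF Suc]] past_Suc[OF past_Suc[OF up[OF Suc]]] \<phi>)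
    then show ?case by simp
  qed (simp add: B0 p1)
  note [measurable] = past_N[OF pB] cyc_N[OF \<phi>]
  have EB: "(\<integral>\<^sup>+w. B i w \<partial>PP x) \<le> 1" for i
  proof (induction i)
    case 0 then show ?case using prob_space.emeasure_space_1[OF PP_prob[of x]] by (simp add: B0)
  next
    case (Suc i)
    let ?L = "\<lambda>w. B i w * indicator {..<thr} (B i w) * ennreal (1 / \<rho>)"
    have "?L w \<le> B i w" for w
    proof -
      have "ennreal (1 / \<rho>) \<le> 1" using \<rho> by simp
      then have "?L w \<le> B i w * 1 * 1" by (intro mult_mono) (auto split: split_indicator)
      then show ?thesis by simp
    qed
    then have "(\<integral>\<^sup>+w. ?L w \<partial>PP x) \<le> (\<integral>\<^sup>+w. B i w \<partial>PP x)" by (rule nn_integral_mono)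
    also have "\<dots> < \<infinity>" using Suc by (rule le_less_trans) simp
    finally have fin: "(\<integral>\<^sup>+w. ?L w \<partial>PP x) < \<infinity>" .
    have "(\<integral>\<^sup>+w. B (Suc i) w \<partial>PP x) = (\<integral>\<^sup>+w. B i w * indicator {thr..} (B i w) \<partial>PP x) + (\<integral>\<^sup>+w. ?L w * cyc \<phi> (Suc (2 * i + b)) w \<partial>PP x)"
      unfolding BS by (rule nn_integral_add) measurable
    also have "\<dots> \<le> (\<integral>\<^sup>+w. B i w * indicator {thr..} (B i w) \<partial>PP x) + (\<integral>\<^sup>+w. ?L w \<partial>PP x) * ennreal \<rho>"
      by (intro add_left_mono step low pB fin)
    also have "(\<integral>\<^sup>+w. ?L w \<partial>PP x) * ennreal \<rho> = (\<integral>\<^sup>+w. B i w * indicator {..<thr} (B i w) \<partial>PP x)"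
    proof -
      have "ennreal (1 / \<rho>) * ennreal \<rho> = 1" using \<rho> by (simp add: ennreal_mult[symmetric])
      moreover have "(\<integral>\<^sup>+w. ?L w \<partial>PP x) = (\<integral>\<^sup>+w. B i w * indicator {..<thr} (B i w) \<partial>PP x) * ennreal (1 / \<rho>)"
        by (rule nn_integral_multc) measurable
      ultimately show ?thesis by (simp only: mult.assoc mult_1_right)
    qed
    also have "(\<integral>\<^sup>+w. B i w * indicator {thr..} (B i w) \<partial>PP x) + \<dots> = (\<integral>\<^sup>+w. B i w \<partial>PP x)"
      by (subst nn_integral_add[symmetric]) (auto intro!: nn_integral_cong split: split_indicator)
    finally show ?case using Suc by simp
  qed
  have hit: "thr \<le> B q w" if "m \<le> q" "ennreal h \<le> (\<Prod>i<m. cyc \<phi> (Suc (2 * i + b)) w)" for m w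
  proof -
    have stay: "thr \<le> B n w" if "i \<le> n" "thr \<le> B i w" for i n
      using that by (induction n rule: dec_induct) (auto simp: BS not_less)
    have cont: "(\<exists>i\<le>m. thr \<le> B i w) \<or> B m w = ennreal ((1 / \<rho>) ^ m) * (\<Prod>i<m. cyc \<phi> (Suc (2 * i + b)) w)" for m
    proof (induction m)
      case (Suc m)
      show ?case
      proof (cases "\<exists>i\<le>m. thr \<le> B i w")
        case False
        then have "B m w < thr" by (auto simp: not_le)
        moreover have "ennreal ((1 / \<rho>) ^ Suc m) = ennreal ((1 / \<rho>) ^ m) * ennreal (1 / \<rho>)"
          using \<rho> by (simp add: ennreal_mult[symmetric] mult.commute)
        ultimately show ?thesis using Suc False by (auto simp: BS mult_ac)
      qed (auto intro: le_SucI)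
    qed (simp add: B0)
    show ?thesis
    proof (cases "\<exists>i\<le>m. thr \<le> B i w")
      case True then show ?thesis using stay[of _ q] \<open>m \<le> q\<close> by (auto dest: order_trans)
    next
      case False
      then have Bm: "B m w = ennreal ((1 / \<rho>) ^ m) * (\<Prod>i<m. cyc \<phi> (Suc (2 * i + b)) w)" using cont[of m] by blast
      have "ennreal ((1 / \<rho>) ^ m) * ennreal h \<le> B m w" unfolding Bm by (intro mult_left_mono that(2)) simp
      moreover have "thr \<le> ennreal ((1 / \<rho>) ^ m) * ennreal h"
      proof -
        have "\<rho> ^ m \<le> \<rho> ^ q" using \<rho> \<open>m \<le> q\<close> by (intro power_increasing) auto
        then have "h / \<rho> ^ q \<le> (1 / \<rho>) ^ m * h" using \<rho> h by (simp add: power_divide frac_le)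
        then show ?thesis unfolding thr_def using \<rho> h by (subst ennreal_mult[symmetric]) (auto intro: ennreal_leI)
      qed
      ultimately show ?thesis using stay[OF \<open>m \<le> q\<close>] by (blast intro: order_trans)
    qed
  qed
  have tp: "0 < h / \<rho> ^ q" using h \<rho> by simp
  have "emeasure (PP x) {w \<in> space N. \<exists>m\<le>q. ennreal h \<le> (\<Prod>i<m. cyc \<phi> (Suc (2 * i + b)) w)} \<le> emeasure (PP x) {w \<in> space N. thr \<le> B q w}"
    using hit by (intro emeasure_mono) (auto simp: sets_PP)
  also have "\<dots> \<le> ennreal (1 / (h / \<rho> ^ q))" unfolding thr_def by (rule markov_level) (use EB[of q] tp in auto)
  also have "\<dots> = ennreal (\<rho> ^ q / h)" by simp
  finally show ?thesis .
qed

text \<open>\<open>pint\<close> takes values in \<open>ennreal\<close>, so the signed integral is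
  assembled from its two parts; \<open>sgw_II\<close> identifies the result with the Bochner
  integral.\<close>

definition sgw :: "real \<Rightarrow> ('e \<Rightarrow> real) \<Rightarrow> nat \<Rightarrow> nat \<Rightarrow> 'v \<Rightarrow> ennreal" where
  "sgw l f i j w = ennreal (exp (l * (enn2real (pint (\<lambda>x. ennreal (f x)) i j w) - enn2real (pint (\<lambda>x. ennreal (- f x)) i j w))))"

lemma sgw_hist:
  assumes [measurable]: "f \<in> borel_measurable borel" and "i < j" shows "sgw l f i j \<in> borel_measurable (hist j)"
proof -
  have [measurable]: "pint (\<lambda>x. ennreal (f x)) i j \<in> borel_measurable (hist j)" "pint (\<lambda>x. ennreal (- f x)) i j \<in> borel_measurable (hist j)"
    using assms(2) by (auto intro!: pint_hist)
  show ?thesis unfolding sgw_def[abs_def] by measurable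
qed

context
  fixes f :: "'e \<Rightarrow> real" and m K l c Cc :: real
  assumes f [measurable]: "f \<in> borel_measurable borel" and fm: "\<And>x. \<bar>f x\<bar> \<le> m" and m: "0 < m"
    and Cc: "0 \<le> Cc" "\<And>x. Psi (\<lambda>x. ennreal \<bar>f x\<bar>) x \<le> ennreal Cc"
    and K: "K = m + Cc" and l: "0 < l" "l * K < 1" and c: "c = l / (1 - l * K)"
begin

abbreviation "g \<equiv> \<lambda>x. \<bar>f x\<bar>"

text \<open>A majorant of the exponential over the cycle from \<open>k\<close> that does not mention
  the random end of the cycle; \<open>GE_ge\<close> shows the domination wherever the cycle
  ends.\<close>

definition GE :: "nat \<Rightarrow> 'v \<Rightarrow> ennreal" where
  "GE k w = eA l g k (Suc k) w * (SUP n. exps (\<lambda>k. eA l g k (Suc k)) n (Suc k) w)"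

lemma gm [measurable]: "g \<in> borel_measurable borel" by measurable

lemmas g_hyps = gm abs_ge_zero fm m Cc K l c

lemma eA_N [measurable]: "eA l g k (Suc k) \<in> borel_measurable N"
  by (rule measurable_hist_N[OF eA_hist[OF g_hyps, of k "Suc k" "Suc k"]]) auto

lemma exps_SUP_N: "(\<lambda>w. SUP n. exps (\<lambda>k. eA l g k (Suc k)) n k w) \<in> borel_measurable N"
  by (intro borel_measurable_SUP exps_N eA_N) simp

lemma GE_N [measurable]: "GE k \<in> borel_measurable N"
  unfolding GE_def[abs_def] using exps_SUP_N eA_N by measurable

lemma GE_law: "W \<in> borel_measurable (hist k) \<Longrightarrow>
    (\<integral>\<^sup>+w. W w * GE k w \<partial>PP x) \<le> (\<integral>\<^sup>+w. W w * (1 + ennreal c * Psi (\<lambda>x. ennreal (g x)) (xs k w)) \<partial>PP x)"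
  unfolding GE_def by (rule exp_cycle[OF g_hyps _ exps_SUP_N]) auto

lemma exps_SUP_ge:
  assumes "w \<in> space N" "first_atom k j w" shows "eA l g k (Suc j) w \<le> (SUP n. exps (\<lambda>k. eA l g k (Suc k)) n k w)"
proof -
  have "k + (j - k) = j" using assms(2) by (simp add: first_atom_def)
  then have "eA l g k (Suc j) w = exps (\<lambda>k. eA l g k (Suc k)) (Suc (j - k)) k w"
    using exps_first_atom[OF g_hyps assms(1), of k "j - k"] assms(2) by simp
  then show ?thesis using SUP_upper[of "Suc (j - k)" UNIV "\<lambda>n. exps (\<lambda>k. eA l g k (Suc k)) n k w"] by simp
qed

lemma GE_ge:
  assumes "w \<in> space N" "first_atom (Suc k) j w" shows "eA l g k (Suc j) w \<le> GE k w"
  unfolding GE_def eA_add[OF g_hyps assms(1), of k "Suc k" "Suc j", OF le_SucI[OF order_refl] less_imp_le_nat]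
  using exps_SUP_ge[OF assms] assms(2) eA_add[OF g_hyps assms(1), of k "Suc k" "Suc j"]
  by (auto simp: first_atom_def intro!: mult_left_mono)

lemma one_Psi_le: "1 + ennreal c * Psi (\<lambda>x. ennreal (g x)) y \<le> ennreal (1 / (1 - l * K))"
proof -
  have "1 + ennreal c * Psi (\<lambda>x. ennreal (g x)) y \<le> 1 + ennreal c * ennreal Cc" by (intro add_left_mono mult_left_mono Cc) simp
  also have "\<dots> = ennreal (1 + c * Cc)" 
  proof -
    have "0 \<le> c" using l by (simp add: c)
    then show ?thesis using Cc(1) by (simp add: ennreal_mult)
  qed
  also have "\<dots> \<le> ennreal (1 / (1 - l * K))"
    unfolding c_bound[OF g_hyps] using l m by (intro ennreal_leI divide_right_mono) auto
  finally show ?thesis .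
qed

lemma first_end: "(\<integral>\<^sup>+w. GE 0 w \<partial>PP x) \<le> ennreal (1 / (1 - l * K))"
proof -
  have "(\<integral>\<^sup>+w. GE 0 w \<partial>PP x) \<le> (\<integral>\<^sup>+w. 1 + ennreal c * Psi (\<lambda>x. ennreal (g x)) (xs 0 w) \<partial>PP x)"
    using GE_law[of "\<lambda>_. 1" 0 x] by simp
  also have "\<dots> \<le> (\<integral>\<^sup>+w. ennreal (1 / (1 - l * K)) \<partial>PP x)" by (intro nn_integral_mono one_Psi_le)
  finally have "(\<integral>\<^sup>+w. GE 0 w \<partial>PP x) \<le> (\<integral>\<^sup>+w. ennreal (1 / (1 - l * K)) \<partial>PP x)" .
  then show ?thesis using prob_space.emeasure_space_1[OF PP_prob[of x]] by simp
qed

text \<open>Controls the integral of \<open>|f|\<close> from \<open>t\<close> to the end of the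
  current cycle. On the rest of the holding interval around \<open>t\<close> the crude rate
  \<open>m\<close> is used, so that only the residual holding time matters; the later steps are
  treated as in a cycle, each tested for the atom.\<close>

definition HT :: "real \<Rightarrow> 'v \<Rightarrow> ennreal" where
  "HT t w = (\<Sum>k. indicator {T k w..<T (Suc k) w} t * ennreal (exp (l * m * (T (Suc k) w - t))) *
     (SUP n. exps (\<lambda>k. eA l g k (Suc k)) n (Suc k) w))"

lemma HT_N [measurable]: "HT t \<in> borel_measurable N"
proof -
  note [measurable] = exps_SUP_N
  have iv: "indicator {T k w..<T (Suc k) w} t = (if T k w \<le> t \<and> t < T (Suc k) w then 1 else 0 :: ennreal)" for k w
    by (simp add: indicator_def)
  show ?thesis unfolding HT_def[abs_def] iv by measurable
qed

lemma memoryless: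
  assumes c: "c' < 1"
  shows "(\<integral>\<^sup>+w. indicator {T k w..<T (Suc k) w} t * ennreal (exp (c' * (T (Suc k) w - t))) \<partial>PP x) =
    ennreal (1 / (1 - c')) * (\<integral>\<^sup>+w. (if T k w \<le> t then ennreal (exp (T k w - t)) else 0) \<partial>PP x)"
proof -
  note [measurable] = T_hist[OF order_refl, of k]
  have "(\<integral>\<^sup>+w. indicator {T k w..<T (Suc k) w} t * ennreal (exp (c' * (T (Suc k) w - t))) \<partial>PP x) =
    (\<integral>\<^sup>+w. (if T k w \<le> t \<and> t - T k w < sg k w then ennreal (exp (c' * (sg k w - (t - T k w)))) else 0) \<partial>PP x)"
    by (intro nn_integral_cong) (auto simp: sg_def algebra_simps split: split_indicator)
  also have "\<dots> = (\<integral>\<^sup>+w. (\<integral>\<^sup>+s\<in>{0<..}. ennreal (exp (- s)) * (if T k w \<le> t \<and> t - T k w < s then ennreal (exp (c' * (s - (t - T k w)))) else 0) \<partial>lborel) \<partial>PP x)"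
    by (rule exponential_step) measurable
  also have "\<dots> = (\<integral>\<^sup>+w. ennreal (1 / (1 - c')) * (if T k w \<le> t then ennreal (exp (T k w - t)) else 0) \<partial>PP x)"
  proof (rule nn_integral_cong)
    fix w
    show "(\<integral>\<^sup>+s\<in>{0<..}. ennreal (exp (- s)) * (if T k w \<le> t \<and> t - T k w < s then ennreal (exp (c' * (s - (t - T k w)))) else 0) \<partial>lborel) =
      ennreal (1 / (1 - c')) * (if T k w \<le> t then ennreal (exp (T k w - t)) else 0)"
    proof (cases "T k w \<le> t")
      case True
      define v where "v = t - T k w"
      have "ennreal (exp (- s)) * ennreal (exp (c' * (s - v))) = ennreal (exp (- v)) * ennreal (exp (- (1 - c') * (s - v)))" for s
        by (simp add: ennreal_mult[symmetric] exp_add[symmetric] algebra_simps)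
      then have "(\<integral>\<^sup>+s\<in>{0<..}. ennreal (exp (- s)) * (if T k w \<le> t \<and> v < s then ennreal (exp (c' * (s - v))) else 0) \<partial>lborel) =
        (\<integral>\<^sup>+s. ennreal (exp (- v)) * (ennreal (exp (- (1 - c') * (s - v))) * indicator {v<..} s) \<partial>lborel)"
        using True by (intro nn_integral_cong) (auto simp: v_def mult.assoc split: split_indicator)
      also have "\<dots> = ennreal (exp (- v)) * ennreal (1 / (1 - c'))"
        using nn_integral_exp_tail[of "1 - c'" v] c by (simp add: nn_integral_cmult)
      finally show ?thesis using True unfolding v_def by (simp add: mult.commute)
    qed simp
  qed
  also have "\<dots> = ennreal (1 / (1 - c')) * (\<integral>\<^sup>+w. (if T k w \<le> t then ennreal (exp (T k w - t)) else 0) \<partial>PP x)"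
    by (rule nn_integral_cmult) measurable
  finally show ?thesis .
qed

text \<open>By lack of memory, the residual holding time contributes the factor
  \<open>1 / (1 - l m)\<close> for every \<open>k\<close>, relative to \<open>c' = 0\<close>. For
  \<open>c' = 0\<close> the sum over \<open>k\<close> is at most 1, as the holding intervals are
  disjoint. Together with \<open>1 + c Cc\<close> the constant is again
  \<open>1 / (1 - l K)\<close>.\<close>

lemma last_end:
  assumes t: "0 \<le> t" shows "(\<integral>\<^sup>+w. HT t w \<partial>PP x) \<le> ennreal (1 / (1 - l * K))"
proof -
  note [measurable] = exps_SUP_N
  let ?w = "\<lambda>c' k w. indicator {T k w..<T (Suc k) w} t * ennreal (exp (c' * (T (Suc k) w - t)))"
  have iv: "indicator {T k w..<T (Suc k) w} t = (if T k w \<le> t \<and> t < T (Suc k) w then 1 else 0 :: ennreal)" for k w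
    by (simp add: indicator_def)
  have wh: "?w c' k \<in> borel_measurable (hist (Suc k))" for c' k
    unfolding iv using T_hist[of k "Suc k"] T_hist[of "Suc k" "Suc k"] by measurable
  note [measurable] = measurable_hist_N[OF wh]
  have "(\<integral>\<^sup>+w. HT t w \<partial>PP x) = (\<Sum>k. \<integral>\<^sup>+w. ?w (l * m) k w * (SUP n. exps (\<lambda>k. eA l g k (Suc k)) n (Suc k) w) \<partial>PP x)"
    unfolding HT_def by (rule nn_integral_suminf) measurable
  also have "\<dots> \<le> (\<Sum>k. ennreal (1 + c * Cc) * (\<integral>\<^sup>+w. ?w (l * m) k w \<partial>PP x))"
  proof (intro suminf_le summableI)
    fix k
    have "(\<integral>\<^sup>+w. ?w (l * m) k w * (SUP n. exps (\<lambda>k. eA l g k (Suc k)) n (Suc k) w) \<partial>PP x) \<le>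
      (\<integral>\<^sup>+w. ?w (l * m) k w * (1 + ennreal c * VV (\<lambda>x. ennreal (g x)) (xs (Suc k) w)) \<partial>PP x)"
      by (rule exp_from[OF g_hyps wh]) simp
    also have "\<dots> \<le> (\<integral>\<^sup>+w. ?w (l * m) k w * ennreal (1 + c * Cc) \<partial>PP x)"
      by (intro nn_integral_mono mult_left_mono one_VV_le[OF g_hyps]) simp
    also have "\<dots> = ennreal (1 + c * Cc) * (\<integral>\<^sup>+w. ?w (l * m) k w \<partial>PP x)"
      by (subst nn_integral_multc) (auto simp: mult.commute)
    finally show "(\<integral>\<^sup>+w. ?w (l * m) k w * (SUP n. exps (\<lambda>k. eA l g k (Suc k)) n (Suc k) w) \<partial>PP x) \<le> \<dots>" .
  qed
  also have "\<dots> = (\<Sum>k. ennreal (1 + c * Cc) * (ennreal (1 / (1 - l * m)) * (\<integral>\<^sup>+w. ?w 0 k w \<partial>PP x)))"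
    unfolding memoryless[OF lm[OF g_hyps]] by (simp add: memoryless[of 0, simplified])
  also have "\<dots> = ennreal (1 + c * Cc) * (ennreal (1 / (1 - l * m)) * (\<integral>\<^sup>+w. (\<Sum>k. ?w 0 k w) \<partial>PP x))"
  proof -
    have sw: "(\<integral>\<^sup>+w. (\<Sum>k. ?w 0 k w) \<partial>PP x) = (\<Sum>k. \<integral>\<^sup>+w. ?w 0 k w \<partial>PP x)" by (rule nn_integral_suminf) measurable
    show ?thesis unfolding sw by (simp only: ennreal_suminf_cmult)
  qed
  also have "(\<integral>\<^sup>+w. (\<Sum>k. ?w 0 k w) \<partial>PP x) \<le> (\<integral>\<^sup>+w. 1 \<partial>PP x)"
  proof (rule nn_integral_mono)
    fix w assume "w \<in> space (PP x)"
    then have w: "w \<in> space N" by simp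
    show "(\<Sum>k. ?w 0 k w) \<le> 1"
    proof (cases "\<exists>k. t \<in> {T k w..<T (Suc k) w}")
      case True
      then obtain k where k: "T k w \<le> t" "t < T (Suc k) w" by auto
      have "(\<Sum>j. ?w 0 j w) = (\<Sum>j\<in>{k}. ?w 0 j w)"
      proof (rule suminf_finite)
        fix j assume "j \<notin> {k}"
        then have "j < k \<or> k < j" by auto
        then have "\<not> (T j w \<le> t \<and> t < T (Suc j) w)"
          using T_mono[OF w, of "Suc j" k] T_mono[OF w, of "Suc k" j] k by auto
        then show "?w 0 j w = 0" by auto
      qed simp
      then show ?thesis by (simp split: split_indicator)
    next
      case False
      then have "?w 0 k w = 0" for k by (auto split: split_indicator)
      then show ?thesis by simp
    qed
  qed
  finally have "(\<integral>\<^sup>+w. HT t w \<partial>PP x) \<le> ennreal (1 + c * Cc) * (ennreal (1 / (1 - l * m)) * 1)"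
    using prob_space.emeasure_space_1[OF PP_prob[of x]] by (simp add: mult_left_mono)
  also have "\<dots> = ennreal (1 / (1 - l * K))"
  proof -
    have "(1 + c * Cc) * (1 / (1 - l * m)) = 1 / (1 - l * K)" unfolding c_bound[OF g_hyps] using lm[OF g_hyps] by simp
    moreover have "0 \<le> 1 + c * Cc" using Cc l by (simp add: c)
    ultimately show ?thesis using lm[OF g_hyps] by (simp add: ennreal_mult[symmetric])
  qed
  finally show ?thesis .
qed

lemma HT_ge:
  assumes w: "w \<in> space N" and k: "T k w \<le> t" "t < T (Suc k) w" and j: "first_atom (Suc i) j w" "i \<le> k" "k \<le> j"
  shows "ennreal (exp (l * m * (T (Suc k) w - t))) * eA l g (Suc k) (Suc j) w \<le> HT t w"
proof -
  let ?S = "SUP n. exps (\<lambda>k. eA l g k (Suc k)) n (Suc k) w"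
  let ?h = "\<lambda>k. indicator {T k w..<T (Suc k) w} t * ennreal (exp (l * m * (T (Suc k) w - t))) * (SUP n. exps (\<lambda>k. eA l g k (Suc k)) n (Suc k) w)"
  have S: "eA l g (Suc k) (Suc j) w \<le> ?S"
  proof (cases "k = j")
    case True
    then show ?thesis using SUP_upper[of 0 UNIV "\<lambda>n. exps (\<lambda>k. eA l g k (Suc k)) n (Suc k) w"] by (simp add: eA_def pint_def)
  next
    case False
    then have "first_atom (Suc k) j w" using j by (auto simp: first_atom_def)
    then show ?thesis by (rule exps_SUP_ge[OF w])
  qed
  have "?h k = ennreal (exp (l * m * (T (Suc k) w - t))) * ?S" using k by simp
  moreover have "?h k \<le> (\<Sum>k. ?h k)" using sum_le_suminf[OF summableI, of "{k}" ?h] by simp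
  ultimately have "ennreal (exp (l * m * (T (Suc k) w - t))) * ?S \<le> HT t w" unfolding HT_def by (simp only:)
  then show ?thesis by (rule order_trans[OF mult_left_mono[OF S], rotated]) simp
qed

text \<open>Write the cycle integral as \<open>A - B\<close> with positive and negative part. Then
  \<open>exp (l (A - B)) + 2 l B \<le> exp (l (A + B))\<close> by \<open>exp_signed_ineq\<close>.
  Centering makes the mean of \<open>2 B\<close> equal to the mean \<open>J\<close> of
  \<open>A + B\<close>, so the bound \<open>1 + c J\<close> is reduced by \<open>l J\<close>, and
  only \<open>c - l = l\<^sup>2 K / (1 - l K)\<close> remains, which is of second order in
  \<open>l\<close>.\<close>

lemma signed_cycle:
  assumes W: "past j W" and fin: "(\<integral>\<^sup>+w. W w \<partial>PP x) < \<infinity>"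
    and cen: "(\<integral>\<^sup>+x. ennreal (f x) \<partial>\<mu>) = (\<integral>\<^sup>+x. ennreal (- f x) \<partial>\<mu>)"
  shows "(\<integral>\<^sup>+w. W w * cyc (sgw l f) (Suc j) w \<partial>PP x) \<le> (\<integral>\<^sup>+w. W w \<partial>PP x) * ennreal (1 + l\<^sup>2 * K\<^sup>2 / (1 - l * K))"
proof -
  let ?n = "\<lambda>x. ennreal (- f x)" and ?p = "\<lambda>x. ennreal (f x)" and ?g = "\<lambda>x. ennreal (g x)"
  have gpn: "?g x = ?p x + ?n x" for x by (cases "0 \<le> f x") (simp_all add: ennreal_neg)
  have cN: "cint ?n k \<in> borel_measurable N" for k by (rule cint_N) simp
  have [measurable]: "cyc (sgw l f) (Suc j) \<in> borel_measurable N" "val (Suc j) GE \<in> borel_measurable N" "val (Suc j) (cint ?n) \<in> borel_measurable N"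
    by (rule cyc_N[of "sgw l f"], rule sgw_hist[OF f], assumption, rule val_N, rule GE_N, rule val_N, rule cN)
  note [measurable] = past_N[OF W]
  define J where "J = (\<integral>\<^sup>+y. Psi ?g y \<partial>\<nu>)"
  have Jn: "J = 2 * (\<integral>\<^sup>+y. Psi ?n y \<partial>\<nu>)"
  proof -
    have "J = (\<integral>\<^sup>+x. ?p x + ?n x \<partial>\<mu>)" unfolding J_def gpn[symmetric] by (rule \<mu>_Psi[symmetric]) simp
    also have "\<dots> = (\<integral>\<^sup>+x. ?p x \<partial>\<mu>) + (\<integral>\<^sup>+x. ?n x \<partial>\<mu>)" by (rule nn_integral_add) (simp_all cong: measurable_cong_sets add: sets_\<mu>)
    also have "\<dots> = 2 * (\<integral>\<^sup>+x. ?n x \<partial>\<mu>)" unfolding cen by (simp add: mult_2)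
    finally show ?thesis by (subst (asm) \<mu>_Psi) simp_all
  qed
  have "J \<le> (\<integral>\<^sup>+y. ennreal Cc \<partial>\<nu>)" unfolding J_def by (intro nn_integral_mono Cc)
  then have JC: "J \<le> ennreal Cc" by (simp add: emeasure_\<nu>_UNIV)
  then obtain Jr where Jr: "J = ennreal Jr" "0 \<le> Jr" "Jr \<le> Cc"
    using Cc(1) by (cases J) (auto simp: top_unique)
  obtain e where e: "(\<integral>\<^sup>+w. W w \<partial>PP x) = ennreal e" "0 \<le> e" using fin by (cases "\<integral>\<^sup>+w. W w \<partial>PP x") auto
  have "(\<integral>\<^sup>+w. W w * cyc (sgw l f) (Suc j) w \<partial>PP x) + ennreal (2 * l) * (\<integral>\<^sup>+w. W w * val (Suc j) (cint ?n) w \<partial>PP x) =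
    (\<integral>\<^sup>+w. W w * cyc (sgw l f) (Suc j) w + ennreal (2 * l) * (W w * val (Suc j) (cint ?n) w) \<partial>PP x)"
    by (subst nn_integral_add) (simp_all add: nn_integral_cmult)
  also have "\<dots> \<le> (\<integral>\<^sup>+w. W w * val (Suc j) GE w \<partial>PP x)"
  proof (rule nn_integral_mono_AE, use noat_AE[of x] AE_space in eventually_elim)
    fix w assume n: "\<forall>m. \<not> noat m w" and "w \<in> space (PP x)"
    then have w: "w \<in> space N" by simp
    obtain i k where i: "reg (Suc j) i w" "first_atom (Suc i) k w" using reg_ex[OF n, of "Suc j"] n first_atom_or_noat[of "Suc _"] by blast
    define A B where "A = enn2real (pint ?p i (Suc k) w)" and "B = enn2real (pint ?n i (Suc k) w)"
    have ik: "i \<le> Suc k" using i(2) by (simp add: first_atom_def)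
    have fin: "pint h i (Suc k) w < \<top>" if "\<And>x. h x \<le> ?g x" for h
    proof -
      have "pint h i (Suc k) w \<le> ennreal (m * (T (Suc k) w - T i w))"
        by (rule pint_bounded[OF order_trans[OF that ennreal_leI[OF fm]] ik w]) (use m in simp)
      then show ?thesis by (rule le_less_trans) simp
    qed
    have fp: "pint ?p i (Suc k) w < \<top>" and fn: "pint ?n i (Suc k) w < \<top>" by (auto intro!: fin ennreal_leI)
    have "pint ?g i (Suc k) w = pint ?p i (Suc k) w + pint ?n i (Suc k) w"
    proof -
      note [measurable] = path_measurable[OF w]
      show ?thesis unfolding pint_def gpn by (subst nn_integral_add[symmetric]) (simp_all add: distrib_right)
    qed
    then have gAB: "enn2real (pint ?g i (Suc k) w) = A + B" using fp fn by (simp add: enn2real_plus A_def B_def)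
    have Bn: "pint ?n i (Suc k) w = ennreal B" using fn by (simp add: B_def)
    have AB: "0 \<le> A" "0 \<le> B" by (simp_all add: A_def B_def)
    have "cyc (sgw l f) (Suc j) w + ennreal (2 * l) * val (Suc j) (cint ?n) w = ennreal (exp (l * (A - B))) + ennreal (2 * l) * ennreal B"
      unfolding cyc_eq[OF i(1) reg_SucI[OF i]] val_eq[OF i(1)] cint_first_atom[OF w i(2), of ?n, simplified] Bn by (simp add: sgw_def A_def B_def)
    also have "\<dots> = ennreal (exp (l * A - l * B) + 2 * (l * B))" using l AB by (simp add: ennreal_mult[symmetric] ennreal_plus[symmetric] right_diff_distrib mult.assoc del: ennreal_plus)
    also have "\<dots> \<le> ennreal (exp (l * A + l * B))" using l AB by (intro ennreal_leI exp_signed_ineq) auto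
    also have "\<dots> = eA l g i (Suc k) w" by (simp add: eA_def gAB distrib_left)
    also have "\<dots> \<le> val (Suc j) GE w" unfolding val_eq[OF i(1)] by (rule GE_ge[OF w i(2)])
    finally have *: "cyc (sgw l f) (Suc j) w + ennreal (2 * l) * val (Suc j) (cint ?n) w \<le> val (Suc j) GE w" .
    show "W w * cyc (sgw l f) (Suc j) w + ennreal (2 * l) * (W w * val (Suc j) (cint ?n) w) \<le> W w * val (Suc j) GE w"
      using mult_left_mono[OF *, of "W w"] by (simp add: distrib_left mult.left_commute)
  qed
  also have "\<dots> \<le> (\<integral>\<^sup>+w. W w \<partial>PP x) * (\<integral>\<^sup>+y. 1 + ennreal c * Psi ?g y \<partial>\<nu>)"
    by (rule regen_transfer[OF W, where rel="(\<le>)"]) (auto intro!: GE_law)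
  also have "(\<integral>\<^sup>+y. 1 + ennreal c * Psi ?g y \<partial>\<nu>) = 1 + ennreal c * J"
    by (simp add: nn_integral_add nn_integral_cmult emeasure_\<nu>_UNIV J_def)
  also have "(\<integral>\<^sup>+w. W w * val (Suc j) (cint ?n) w \<partial>PP x) = (\<integral>\<^sup>+w. W w \<partial>PP x) * (\<integral>\<^sup>+y. Psi ?n y \<partial>\<nu>)"
    by (rule regen_transfer[OF W, where rel="(=)"]) (auto intro!: cint_step cN)
  also have "ennreal (2 * l) * ((\<integral>\<^sup>+w. W w \<partial>PP x) * (\<integral>\<^sup>+y. Psi ?n y \<partial>\<nu>)) = ennreal (l * e * Jr)"
  proof -
    have "ennreal (2 * l) * ((\<integral>\<^sup>+w. W w \<partial>PP x) * (\<integral>\<^sup>+y. Psi ?n y \<partial>\<nu>)) = ennreal l * (ennreal e * J)"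
      using l unfolding Jn e by (simp add: ennreal_mult mult_ac)
    then show ?thesis using l e Jr by (simp add: ennreal_mult mult.assoc)
  qed
  finally have "(\<integral>\<^sup>+w. W w * cyc (sgw l f) (Suc j) w \<partial>PP x) + ennreal (l * e * Jr) \<le> ennreal e * (1 + ennreal c * J)" unfolding e .
  also have "ennreal e * (1 + ennreal c * J) = ennreal (e * (1 + c * Jr))"
  proof -
    have "0 \<le> c" using l by (simp add: c)
    then show ?thesis using e Jr by (simp add: ennreal_mult)
  qed
  finally have "(\<integral>\<^sup>+w. W w * cyc (sgw l f) (Suc j) w \<partial>PP x) \<le> ennreal (e * (1 + c * Jr)) - ennreal (l * e * Jr)"
    unfolding ennreal_le_minus_iff by blast
  also have "\<dots> = ennreal (e * (1 + c * Jr) - l * e * Jr)" using l e Jr by (intro ennreal_minus) auto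
  also have "\<dots> \<le> ennreal (e * (1 + l\<^sup>2 * K\<^sup>2 / (1 - l * K)))"
  proof (rule ennreal_leI)
    have cl: "c - l = l\<^sup>2 * K / (1 - l * K)" using l by (simp add: c field_simps power2_eq_square)
    have K0: "0 \<le> K" using m Cc by (simp add: K)
    have "(c - l) * Jr \<le> (l\<^sup>2 * K / (1 - l * K)) * K"
      unfolding cl using Jr m K K0 l by (intro mult_left_mono) auto
    then have "e * (1 + (c - l) * Jr) \<le> e * (1 + l\<^sup>2 * K\<^sup>2 / (1 - l * K))"
      using e by (intro mult_left_mono) (auto simp: power2_eq_square mult_ac)
    then show "e * (1 + c * Jr) - l * e * Jr \<le> e * (1 + l\<^sup>2 * K\<^sup>2 / (1 - l * K))" by (simp add: algebra_simps)
  qed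
  finally show ?thesis using e l by (simp add: ennreal_mult)
qed

end

end

section \<open>The slowly varying normalization\<close>

text \<open>\<open>b j\<close> compares the tail with \<open>exp (- \<alpha> j)\<close> on a
  geometric grid. Its running minimum still has ratios tending to 1: it either stays, or drops to
  \<open>b (n + 2)\<close> from at most \<open>b (n + 1)\<close>. The minimum reaches up to
  \<open>Suc n\<close> because \<open>G s\<close> is estimated at the next grid point. Dividing by
  \<open>n + 1\<close> is the slack that later lets \<open>Lambda_star\<close> grow.\<close>

lemma slow_minorant:
  fixes G :: "real \<Rightarrow> real"
  assumes anti: "\<And>x y. x \<le> y \<Longrightarrow> G y \<le> G x" and pos: "\<And>x. 0 < G x" and le1: "\<And>x. G x \<le> 1" and \<alpha>: "0 < \<alpha>"
    and lim: "(\<lambda>n. G (exp (real (Suc n))) / G (exp (real n))) \<longlonglongrightarrow> exp (- \<alpha>)"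
  obtains a :: "nat \<Rightarrow> real" where "\<And>n. 0 < a n" "\<And>n. a n \<le> 1" "(\<lambda>n. a (Suc n) / a n) \<longlonglongrightarrow> 1"
    "\<And>n s. 1 \<le> s \<Longrightarrow> s < exp (real (Suc n)) \<Longrightarrow> exp (- \<alpha>) * real (Suc n) * a n \<le> s powr \<alpha> * G s"
proof -
  define b where "b j = exp (\<alpha> * real j) * G (exp (real j))" for j :: nat
  define m where "m n = Min (b ` {..Suc n})" for n
  have bpos: "0 < b j" for j using pos by (simp add: b_def)
  have mpos: "0 < m n" for n unfolding m_def using bpos by (subst Min_gr_iff) auto
  have mle: "m n \<le> b j" if "j \<le> Suc n" for j n unfolding m_def using that by (intro Min_le) auto
  have mS: "m (Suc n) = min (m n) (b (Suc (Suc n)))" for n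
    unfolding m_def atMost_Suc[of "Suc n"] by (simp add: min.commute)
  have bl: "(\<lambda>n. b (Suc n) / b n) \<longlonglongrightarrow> 1"
  proof -
    have "b (Suc n) / b n = exp \<alpha> * (G (exp (real (Suc n))) / G (exp (real n)))" for n
      by (simp add: b_def distrib_left exp_add)
    then show ?thesis using tendsto_mult[OF tendsto_const lim, of "exp \<alpha>"] by (simp add: exp_minus)
  qed
  have ml: "(\<lambda>n. m (Suc n) / m n) \<longlonglongrightarrow> 1"
  proof (rule tendsto_sandwich)
    show "\<forall>\<^sub>F n in sequentially. min 1 (b (Suc (Suc n)) / b (Suc n)) \<le> m (Suc n) / m n"
    proof (rule always_eventually, rule allI)
      fix n
      show "min 1 (b (Suc (Suc n)) / b (Suc n)) \<le> m (Suc n) / m n"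
      proof (cases "m n \<le> b (Suc (Suc n))")
        case True then show ?thesis using mpos[of n] by (simp add: mS)
      next
        case False
        have "b (Suc (Suc n)) / b (Suc n) \<le> b (Suc (Suc n)) / m n"
          using mle[of "Suc n" n] mpos[of n] bpos by (intro divide_left_mono mult_pos_pos) (auto intro: less_imp_le)
        then show ?thesis using False by (simp add: mS)
      qed
    qed
    show "\<forall>\<^sub>F n in sequentially. m (Suc n) / m n \<le> 1" using mpos by (intro always_eventually allI) (simp add: mS)
    show "(\<lambda>n. min 1 (b (Suc (Suc n)) / b (Suc n))) \<longlonglongrightarrow> 1"
      using tendsto_min[OF tendsto_const LIMSEQ_Suc[OF bl], of 1] by simp
  qed simp
  define a where "a n = m n / real (Suc n)" for n
  show ?thesis
  proof (rule that[of a])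
    show "0 < a n" for n using mpos by (simp add: a_def)
    show "a n \<le> 1" for n
    proof -
      have "m n \<le> 1" using mle[of 0 n] le1[of 1] by (simp add: b_def)
      then show ?thesis using mpos[of n] by (simp add: a_def divide_le_eq)
    qed
    have "a (Suc n) / a n = m (Suc n) / m n * (real (Suc n) / real (Suc (Suc n)))" for n by (simp add: a_def)
    then show "(\<lambda>n. a (Suc n) / a n) \<longlonglongrightarrow> 1"
      using tendsto_mult[OF ml LIMSEQ_Suc[OF LIMSEQ_n_over_Suc_n]] by (simp only: mult_1)
    fix n and s :: real assume s: "1 \<le> s" "s < exp (real (Suc n))"
    define k where "k = nat \<lfloor>ln s\<rfloor>"
    have ls: "0 \<le> ln s" using s by simp
    have k: "real k \<le> ln s" "ln s < real (Suc k)" using ls unfolding k_def by linarith+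
    have "ln s < real (Suc n)" using s by (metis exp_less_cancel_iff exp_ln less_le_trans zero_less_one)
    then have kn: "k \<le> n" using k by linarith
    have "exp (- \<alpha>) * m n \<le> exp (- \<alpha>) * b (Suc k)" using kn by (intro mult_left_mono mle) auto
    also have "\<dots> = exp (\<alpha> * real k) * G (exp (real (Suc k)))" by (simp add: b_def distrib_left exp_add exp_minus)
    also have "\<dots> \<le> s powr \<alpha> * G s"
    proof (intro mult_mono anti)
      show "exp (\<alpha> * real k) \<le> s powr \<alpha>" using s k \<alpha> by (simp add: powr_def)
      show "s \<le> exp (real (Suc k))" using k s by (metis exp_le_cancel_iff exp_ln less_imp_le less_le_trans zero_less_one)
    qed (use pos in \<open>auto intro: less_imp_le\<close>)
    finally show "exp (- \<alpha>) * real (Suc n) * a n \<le> s powr \<alpha> * G s" by (simp add: a_def)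
  qed
qed

text \<open>Rescaling by \<open>c\<close> moves the index by at most \<open>k\<close> places, and
  over boundedly many places the ratio still tends to 1.\<close>

lemma slowly_varying_floor_ln:
  fixes a :: "nat \<Rightarrow> real" and c :: real
  assumes pos: "\<And>n. 0 < a n" and lim: "(\<lambda>n. a (Suc n) / a n) \<longlonglongrightarrow> 1" and c: "0 < c"
  shows "((\<lambda>t. a (nat \<lfloor>ln (c * t)\<rfloor>) / a (nat \<lfloor>ln t\<rfloor>)) \<longlongrightarrow> 1) at_top"
proof -
  define k where "k = nat \<lceil>\<bar>ln c\<bar>\<rceil> + 1"
  have k: "\<bar>ln c\<bar> + 1 \<le> real k" unfolding k_def by linarith
  have nz: "a n \<noteq> 0" for n using pos[of n] by simp
  have lk: "(\<lambda>n. a (n + j) / a n) \<longlonglongrightarrow> 1" for j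
  proof (induction j)
    case 0 then show ?case by (simp add: nz)
  next
    case (Suc j)
    have "a (n + Suc j) / a n = a (Suc (n + j)) / a (n + j) * (a (n + j) / a n)" for n by (simp add: nz)
    then show ?case using tendsto_mult[OF LIMSEQ_ignore_initial_segment[OF lim, of j] Suc] by (simp only: mult_1)
  qed
  have inv: "(\<lambda>n. a n / a (n + j)) \<longlonglongrightarrow> 1" for j using tendsto_inverse[OF lk[of j]] by simp
  show ?thesis
  proof (rule tendstoI)
    fix e :: real assume e: "0 < e"
    have "\<forall>\<^sub>F n in sequentially. \<forall>j\<in>{..k}. dist (a (n + j) / a n) 1 < e \<and> dist (a n / a (n + j)) 1 < e"
      by (intro eventually_ball_finite ballI eventually_conj tendstoD[OF lk e] tendstoD[OF inv e] finite_atMost)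
    then obtain n0 where n0: "\<And>n j. n0 \<le> n \<Longrightarrow> j \<le> k \<Longrightarrow> dist (a (n + j) / a n) 1 < e \<and> dist (a n / a (n + j)) 1 < e"
      unfolding eventually_sequentially by auto
    show "\<forall>\<^sub>F t in at_top. dist (a (nat \<lfloor>ln (c * t)\<rfloor>) / a (nat \<lfloor>ln t\<rfloor>)) 1 < e"
      using eventually_ge_at_top[of "max (exp (real n0)) (exp (real n0) / c)"]
    proof eventually_elim
      case (elim t)
      then have t: "exp (real n0) \<le> t" "exp (real n0) \<le> c * t" using c by (auto simp: field_simps)
      have tp: "0 < t" by (rule less_le_trans[OF exp_gt_zero t(1)])
      have lc: "ln (c * t) = ln c + ln t" using c tp by (simp add: ln_mult)
      have n0t: "real n0 \<le> ln t" "real n0 \<le> ln (c * t)" using t tp c by (simp_all add: ln_ge_iff)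
      define u v where "u = nat \<lfloor>ln t\<rfloor>" and "v = nat \<lfloor>ln (c * t)\<rfloor>"
      have u: "real u \<le> ln t" "ln t < real u + 1" and v: "real v \<le> ln (c * t)" "ln (c * t) < real v + 1"
        using n0t unfolding u_def v_def by linarith+
      have nn: "n0 \<le> u" "n0 \<le> v" using u v n0t by linarith+
      have uv: "u \<le> v + k" "v \<le> u + k" using u v k lc by linarith+
      show ?case unfolding u_def[symmetric] v_def[symmetric]
      proof (cases "u \<le> v")
        case True then show "dist (a v / a u) 1 < e" using n0[of u "v - u"] nn uv by simp
      next
        case False then show "dist (a v / a u) 1 < e" using n0[of v "u - v"] nn uv by simp
      qed
    qed
  qed
qed

text \<open>The reciprocal is summable by the ratio test, hence tends to 0.\<close>

lemma ratio_1_mult_exp_large: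
  fixes a :: "nat \<Rightarrow> real"
  assumes pos: "\<And>n. 0 < a n" and lim: "(\<lambda>n. a (Suc n) / a n) \<longlonglongrightarrow> 1" and \<delta>: "0 < \<delta>"
  shows "\<forall>\<^sub>F n in sequentially. m \<le> a n * exp (\<delta> * real n)"
proof -
  define c where "c n = 1 / (a n * exp (\<delta> * real n))" for n
  have cp: "0 < c n" for n using pos by (simp add: c_def)
  have "(\<lambda>n. a n / a (Suc n)) \<longlonglongrightarrow> 1" using tendsto_inverse[OF lim] by simp
  moreover have "1 < exp (\<delta> / 2)" using \<delta> by simp
  ultimately have "\<forall>\<^sub>F n in sequentially. a n / a (Suc n) < exp (\<delta> / 2)" by (rule order_tendstoD(2))
  then obtain n0 where n0: "\<And>n. n0 \<le> n \<Longrightarrow> a n / a (Suc n) < exp (\<delta> / 2)" unfolding eventually_sequentially by auto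
  have "summable c"
  proof (rule summable_ratio_test)
    show "exp (- \<delta> / 2) < 1" using \<delta> by simp
    fix n assume "n0 \<le> n"
    have "c (Suc n) = (a n / a (Suc n)) * exp (- \<delta>) * c n" using pos[of n] pos[of "Suc n"]
      by (simp add: c_def distrib_left exp_add exp_minus field_simps)
    also have "\<dots> \<le> exp (\<delta> / 2) * exp (- \<delta>) * c n" using n0[OF \<open>n0 \<le> n\<close>] cp[of n] by (intro mult_right_mono) auto
    also have "exp (\<delta> / 2) * exp (- \<delta>) = exp (- \<delta> / 2)" by (simp add: exp_add[symmetric])
    finally show "norm (c (Suc n)) \<le> exp (- \<delta> / 2) * norm (c n)" using cp[of n] cp[of "Suc n"] by simp
  qed
  then have "c \<longlonglongrightarrow> 0" by (rule summable_LIMSEQ_zero)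
  then have "\<forall>\<^sub>F n in sequentially. c n < 1 / max m 1" by (rule order_tendstoD(2)) simp
  then show ?thesis
  proof eventually_elim
    case (elim n)
    then have "max m 1 < a n * exp (\<delta> * real n)" using pos[of n] by (simp add: c_def field_simps)
    then show ?case by simp
  qed
qed

text \<open>The ratio is computed for the asymptotic equivalent, where the slowly varying factor
  cancels in the limit and the power contributes \<open>exp (- \<alpha>)\<close>.\<close>

lemma tail_ratio:
  fixes G l :: "real \<Rightarrow> real"
  assumes l: "slowly_varying l" and \<alpha>: "\<alpha> < 1"
    and tail: "G \<sim>[at_top] (\<lambda>x. x powr (- \<alpha>) * l x / Gamma (1 - \<alpha>))"
  shows "((\<lambda>x. G (exp 1 * x) / G x) \<longlongrightarrow> exp (- \<alpha>)) at_top" and "\<forall>\<^sub>F x in at_top. G x \<noteq> 0"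
proof -
  define h where "h x = x powr (- \<alpha>) * l x / Gamma (1 - \<alpha>)" for x
  have Gp: "0 < Gamma (1 - \<alpha>)" using \<alpha> by (intro Gamma_real_pos) simp
  obtain b0 where b0: "\<And>t. b0 \<le> t \<Longrightarrow> 0 < l t" using l by (auto simp: slowly_varying_def)
  have lp: "\<forall>\<^sub>F x in at_top. 0 < l x" using eventually_ge_at_top[of b0] by eventually_elim (rule b0)
  have hp: "\<forall>\<^sub>F x in at_top. h x \<noteq> 0" using lp eventually_gt_at_top[of 0] by eventually_elim (use Gp in \<open>simp add: h_def\<close>)
  have \<rho>: "((\<lambda>x. G x / h x) \<longlongrightarrow> 1) at_top"
    using tail[folded h_def] by (rule asymp_equivD_strong) (use hp in eventually_elim, simp)
  have "\<forall>\<^sub>F x in at_top. 0 < G x / h x" using order_tendstoD(1)[OF \<rho>, of 0] by simp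
  then show G0: "\<forall>\<^sub>F x in at_top. G x \<noteq> 0" by eventually_elim auto
  have e: "filterlim (\<lambda>x::real. exp 1 * x) at_top at_top"
    by (rule filterlim_tendsto_pos_mult_at_top[OF tendsto_const _ filterlim_ident]) simp
  have "((\<lambda>x. (G (exp 1 * x) / h (exp 1 * x)) * inverse (G x / h x) * (exp (- \<alpha>) * (l (exp 1 * x) / l x))) \<longlongrightarrow> 1 * inverse 1 * (exp (- \<alpha>) * 1)) at_top"
    using l by (intro tendsto_mult tendsto_inverse filterlim_compose[OF \<rho> e] \<rho> tendsto_const) (auto simp: slowly_varying_def)
  moreover have "\<forall>\<^sub>F x in at_top. (G (exp 1 * x) / h (exp 1 * x)) * inverse (G x / h x) * (exp (- \<alpha>) * (l (exp 1 * x) / l x)) = G (exp 1 * x) / G x"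
    using hp eventually_compose_filterlim[OF hp e] lp G0 eventually_gt_at_top[of 0]
  proof eventually_elim
    case (elim x)
    have "exp (- \<alpha>) * (l (exp 1 * x) / l x) = h (exp 1 * x) / h x"
      using elim Gp by (simp add: h_def powr_mult exp_powr_real)
    then show ?case using elim by simp
  qed
  ultimately show "((\<lambda>x. G (exp 1 * x) / G x) \<longlongrightarrow> exp (- \<alpha>)) at_top"
    by (simp only: tendsto_cong) simp
qed

text \<open>Two one-sided estimates take the place of a Tauberian theorem: \<open>F_le\<close>
  bounds \<open>- ln (F r)\<close> from below by the tail at \<open>1 / r\<close>, and
  \<open>F_ge\<close> bounds it from above by an affine function of \<open>r\<close>, which keeps
  the supremum finite.\<close>

lemma tail_normalization:
  fixes Y :: "'a \<Rightarrow> real"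
  assumes Q: "prob_space Q" and Ym [measurable]: "Y \<in> borel_measurable Q" and Y0: "AE w in Q. 0 \<le> Y w"
    and \<alpha>: "0 < \<alpha>" "\<alpha> < 1" and l: "slowly_varying l"
    and tail: "(\<lambda>x. measure Q {w \<in> space Q. Y w > x}) \<sim>[at_top] (\<lambda>x. x powr (- \<alpha>) * l x / Gamma (1 - \<alpha>))"
    and F: "\<And>r. F r = (\<integral>w. exp (- r * Y w) \<partial>Q)"
  obtains L t1 where "slowly_varying L" "threshold \<alpha> L t1" "\<And>s. threshold \<alpha> L s \<Longrightarrow> t1 \<le> s"
    "\<And>t. t1 \<le> t \<Longrightarrow> 1 \<le> t \<and> 10 \<le> t powr \<alpha> \<and> 0 < L t \<and> L t \<le> 1" "\<And>r. 0 < r \<Longrightarrow> 0 < F r"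
    "\<And>t \<eta>. t1 \<le> t \<Longrightarrow> 0 < \<eta> \<Longrightarrow> \<eta> \<le> \<alpha> / 2 \<Longrightarrow>
      bdd_above (Lambda_objective \<alpha> F L \<eta> t ` {0<..}) \<and> 0 < Lambda_star \<alpha> F L \<eta> t"
    "\<And>\<eta>. 0 < \<eta> \<Longrightarrow> \<eta> \<le> \<alpha> / 2 \<Longrightarrow> filterlim (\<lambda>t. Lambda_star \<alpha> F L \<eta> t) at_top at_top"
proof -
  interpret Q: prob_space Q by fact
  define G where "G x = measure Q {w \<in> space Q. Y w > x}" for x
  have anti: "G y \<le> G x" if "x \<le> y" for x y unfolding G_def using that by (intro Q.finite_measure_mono) auto
  have le1: "G x \<le> 1" for x unfolding G_def by simp
  note tr = tail_ratio[OF l \<alpha>(2) tail[folded G_def]]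
  have pos: "0 < G x" for x
  proof -
    obtain z where "\<And>y. z \<le> y \<Longrightarrow> G y \<noteq> 0" using tr(2) unfolding eventually_at_top_linorder by auto
    then have "G (max x z) \<noteq> 0" by simp
    moreover have "0 \<le> G (max x z)" unfolding G_def by simp
    ultimately show ?thesis using anti[of x "max x z"] by simp
  qed
  have lim: "(\<lambda>n. G (exp (real (Suc n))) / G (exp (real n))) \<longlonglongrightarrow> exp (- \<alpha>)"
    using filterlim_compose[OF tr(1) filterlim_compose[OF exp_at_top filterlim_real_sequentially]] by (simp add: exp_add)
  obtain a :: "nat \<Rightarrow> real" where apos: "\<And>n. 0 < a n" and a1: "\<And>n. a n \<le> 1" and alim: "(\<lambda>n. a (Suc n) / a n) \<longlonglongrightarrow> 1"
    and aG: "\<And>n s. 1 \<le> s \<Longrightarrow> s < exp (real (Suc n)) \<Longrightarrow> exp (- \<alpha>) * real (Suc n) * a n \<le> s powr \<alpha> * G s"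
    using slow_minorant[OF anti pos le1 \<alpha>(1) lim] by blast
  have "\<forall>\<^sub>F n in sequentially. G (exp (real (Suc n))) / G (exp (real n)) < 1"
    using order_tendstoD(2)[OF lim, of 1] \<alpha> by simp
  then obtain n where "G (exp (real (Suc n))) / G (exp (real n)) < 1" unfolding eventually_sequentially by blast
  then have "G (exp (real (Suc n))) < G (exp (real n))" using pos[of "exp (real n)"] by (simp add: divide_less_eq)
  \<comment> \<open>The tail decreases strictly somewhere along the grid, so this \<open>m\<close>
    is not exceeded with a positive probability \<open>p\<close>.\<close>
  define m where "m = exp (real (Suc n))"
  define p where "p = 1 - G m"
  have p: "0 < p" using \<open>G (exp (real (Suc n))) < _\<close> le1[of "exp (real n)"] by (simp add: p_def m_def)
  have m0: "0 < m" by (simp add: m_def)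
  have pm: "p = measure Q {w \<in> space Q. Y w \<le> m}"
  proof -
    have "{w \<in> space Q. Y w \<le> m} = space Q - {w \<in> space Q. Y w > m}" by auto
    then show ?thesis unfolding p_def G_def using Q.prob_compl[of "{w \<in> space Q. Y w > m}"] by simp
  qed
  have int: "integrable Q (\<lambda>w. exp (- r * Y w))" if "0 < r" for r
    by (rule Q.integrable_const_bound[where B=1], use Y0 in eventually_elim) (use that in auto)
  have ii: "integrable Q (\<lambda>w. c * indicat_real A w)" if "A \<in> sets Q" for A c
    using that by (intro integrable_mult_right integrable_real_indicator) (auto simp: less_top[symmetric])
  have F_ge: "exp (- r * m) * p \<le> F r" if r: "0 < r" for r
  proof -
    have "exp (- r * m) * p = (\<integral>w. exp (- r * m) * indicator {w \<in> space Q. Y w \<le> m} w \<partial>Q)" by (simp add: pm)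
    also have "\<dots> \<le> (\<integral>w. exp (- r * Y w) \<partial>Q)"
      by (rule integral_mono_AE[OF ii int[OF r]]) (use r in \<open>auto split: split_indicator\<close>)
    finally show ?thesis by (simp add: F)
  qed
  have Fpos: "0 < F r" if "0 < r" for r
    by (rule less_le_trans[OF _ F_ge[OF that]]) (use p in simp)
  have F_le: "(1 - exp (- 1)) * G (1 / r) \<le> - ln (F r)" if r: "0 < r" for r
  proof -
    have "(1 - exp (- 1)) * G (1 / r) = (\<integral>w. (1 - exp (- 1)) * indicator {w \<in> space Q. Y w > 1 / r} w \<partial>Q)" by (simp add: G_def)
    also have "\<dots> \<le> (\<integral>w. 1 - exp (- r * Y w) \<partial>Q)"
    proof (rule integral_mono_AE[OF ii])
      show "AE w in Q. (1 - exp (- 1)) * indicator {w \<in> space Q. Y w > 1 / r} w \<le> 1 - exp (- r * Y w)"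
        using Y0 by eventually_elim (use r in \<open>auto split: split_indicator simp: field_simps\<close>)
    qed (use int[OF r] in auto)
    also have "\<dots> = 1 - F r" using int[OF r] by (simp add: F Q.prob_space)
    also have "\<dots> \<le> - ln (F r)" using ln_le_minus_one[OF Fpos[OF r]] by simp
    finally show ?thesis .
  qed
  \<comment> \<open>The smallest value of
    \<open>(1 - 2 * \<eta> / (2 - \<alpha>)) * (1 - \<alpha>)\<close>, taken at
    \<open>\<eta> = \<alpha> / 2\<close>; it makes the choice of \<open>n1\<close> uniform in
    \<open>\<eta>\<close>.\<close>
  define \<delta> where "\<delta> = 2 * (1 - \<alpha>)\<^sup>2 / (2 - \<alpha>)"
  have \<delta>: "0 < \<delta>" using \<alpha> by (simp add: \<delta>_def)
  obtain n1 where n1: "\<And>n. n1 \<le> n \<Longrightarrow> m \<le> a n * exp (\<delta> * real n)"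
    using ratio_1_mult_exp_large[OF apos alim \<delta>, of m] unfolding eventually_sequentially by auto
  define \<kappa> :: real where "\<kappa> = (1 - exp (- 1)) * exp (- 1)"
  have \<kappa>: "0 < \<kappa>" by (simp add: \<kappa>_def)
  \<comment> \<open>The three lower bounds provide boundedness of the objective,
    \<open>\<kappa> * ln t \<ge> 2\<close> and \<open>t powr \<alpha> \<ge> 10\<close>.\<close>
  define t1 where "t1 = max (exp (real n1)) (max (exp (2 / \<kappa>)) (10 powr (1 / \<alpha>)))"
  define L where "L t = (if t < t1 then t + 2 else a (nat \<lfloor>ln t\<rfloor>))" for t
  have t1: "1 \<le> t1" by (simp add: t1_def le_max_iff_disj)
  have L: "L t = a (nat \<lfloor>ln t\<rfloor>)" if "t1 \<le> t" for t using that by (simp add: L_def)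
  have tp: "10 \<le> t powr \<alpha>" if "t1 \<le> t" for t
  proof -
    have "(10 powr (1 / \<alpha>)) powr \<alpha> \<le> t powr \<alpha>" using that \<alpha> by (intro powr_mono2) (auto simp: t1_def)
    then show ?thesis using \<alpha> by (simp add: powr_powr)
  qed
  have g: "0 < 2 * \<eta> / (2 - \<alpha>)" "2 * \<eta> / (2 - \<alpha>) \<le> \<alpha> / (2 - \<alpha>)" "2 * \<eta> / (2 - \<alpha>) < 1" if "0 < \<eta>" "\<eta> \<le> \<alpha> / 2" for \<eta>
  proof -
    show "0 < 2 * \<eta> / (2 - \<alpha>)" using that \<alpha> by simp
    show *: "2 * \<eta> / (2 - \<alpha>) \<le> \<alpha> / (2 - \<alpha>)" using that \<alpha> by (intro divide_right_mono) auto
    have "\<alpha> / (2 - \<alpha>) < 1" using \<alpha> by (simp add: divide_less_eq)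
    then show "2 * \<eta> / (2 - \<alpha>) < 1" using * by simp
  qed
  have sv: "slowly_varying L"
    unfolding slowly_varying_def
  proof (intro conjI exI[of _ t1] allI impI)
    have "(\<lambda>t. a (nat \<lfloor>ln t\<rfloor>)) \<in> borel_measurable (restrict_space borel {t1..})"
      by (intro measurable_restrict_space1) measurable
    then show "L \<in> borel_measurable (restrict_space borel {t1..})"
      by (rule measurable_cong[THEN iffD1, rotated]) (simp add: L)
    show "0 < L t" if "t1 \<le> t" for t using that by (simp add: L apos)
    fix c :: real assume c: "0 < c"
    have "\<forall>\<^sub>F t in at_top. a (nat \<lfloor>ln (c * t)\<rfloor>) / a (nat \<lfloor>ln t\<rfloor>) = L (c * t) / L t"
      using eventually_ge_at_top[of "max t1 (t1 / c)"] by eventually_elim (use c in \<open>auto simp: L field_simps\<close>)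
    then show "((\<lambda>t. L (c * t) / L t) \<longlongrightarrow> 1) at_top"
      by (rule Lim_transform_eventually[OF slowly_varying_floor_ln[OF apos alim c]])
  qed
  have thr: "threshold \<alpha> L t1"
    unfolding threshold_def
  proof (intro conjI allI impI)
    fix \<eta> t assume \<eta>: "0 < \<eta>" "\<eta> \<le> \<alpha> / 2" and t: "t1 \<le> t"
    have "\<eta> * \<alpha> \<le> \<alpha> / 2 * \<alpha>" using \<eta> \<alpha> by (intro mult_right_mono) auto
    also have "\<dots> \<le> \<alpha> / 2 * (2 - \<alpha>)" using \<alpha> by (intro mult_left_mono) auto
    finally have e0: "0 \<le> \<alpha> + 2 * \<eta> * ((1 - \<alpha>) / (2 - \<alpha>)) + (- (\<alpha> / 2) - \<eta>)" using \<alpha> by (simp add: field_simps)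
    have "1 \<le> t powr (\<alpha> + 2 * \<eta> * ((1 - \<alpha>) / (2 - \<alpha>)) + (- (\<alpha> / 2) - \<eta>))"
      using t1 t e0 by (intro ge_one_powr_ge_zero) auto
    moreover have "L t \<le> 1" "0 < L t" using t by (simp_all add: L a1 apos)
    ultimately have "1 \<le> t powr (\<alpha> + 2 * \<eta> * ((1 - \<alpha>) / (2 - \<alpha>)) + (- (\<alpha> / 2) - \<eta>)) / L t" by (simp add: le_divide_eq)
    then show "1 \<le> t powr (\<alpha> + 2 * \<eta> * ((1 - \<alpha>) / (2 - \<alpha>))) / L t * t powr (- (\<alpha> / 2) - \<eta>)" by (simp only: powr_add times_divide_eq_left)
  qed (use t1 in simp)
  have thr_ge: "t1 \<le> s" if s: "threshold \<alpha> L s" for s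
  proof (rule ccontr)
    assume "\<not> t1 \<le> s"
    then have Ls: "L s = s + 2" by (simp add: L_def)
    have s0: "0 \<le> s" using s by (simp add: threshold_def)
    \<comment> \<open>At \<open>\<eta> = \<alpha> / 2\<close> the exponents combine to some
      \<open>e\<close> between 0 and 1, so the condition at \<open>s < t1\<close> would say
      \<open>s + 2 \<le> s powr e\<close>, which is impossible.\<close>
    define e where "e = \<alpha> + 2 * (\<alpha> / 2) * ((1 - \<alpha>) / (2 - \<alpha>)) + (- (\<alpha> / 2) - \<alpha> / 2)"
    have e: "e = \<alpha> * (1 - \<alpha>) / (2 - \<alpha>)" by (simp add: e_def)
    have e01: "0 \<le> e" "e \<le> 1"
    proof -
      show "0 \<le> e" unfolding e using \<alpha> by simp
      have "\<alpha> * (1 - \<alpha>) \<le> 1 * (2 - \<alpha>)" using \<alpha> by (intro mult_mono) auto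
      then show "e \<le> 1" unfolding e using \<alpha> by (simp add: divide_le_eq)
    qed
    have "1 \<le> s powr (\<alpha> + 2 * (\<alpha> / 2) * ((1 - \<alpha>) / (2 - \<alpha>))) / L s * s powr (- (\<alpha> / 2) - \<alpha> / 2)"
      using s \<alpha> unfolding threshold_def by (elim conjE allE[of _ "\<alpha> / 2"] allE[of _ s]) simp
    then have "1 \<le> s powr e / (s + 2)" unfolding e_def Ls by (simp only: powr_add times_divide_eq_left)
    then have "s + 2 \<le> s powr e" using s0 by (simp add: le_divide_eq)
    also have "\<dots> \<le> (1 + s) powr 1"
      using s0 e01 by (intro order_trans[OF powr_mono2 powr_mono]) auto
    finally show False using s0 by simp
  qed
  \<comment> \<open>The witness \<open>r = 1 / s\<close> with
    \<open>s = t powr (1 - 2 * \<eta> / (2 - \<alpha>))\<close> makes the linear term equal to 1. As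
    \<open>1 \<le> s \<le> t\<close>, the index \<open>n\<close> of \<open>t\<close> may be used in
    \<open>aG\<close> for \<open>s\<close>.\<close>
  have obj: "\<kappa> * ln t - 1 \<le> Lambda_objective \<alpha> F L \<eta> t (1 / t powr (1 - 2 * \<eta> / (2 - \<alpha>)))"
    if \<eta>: "0 < \<eta>" "\<eta> \<le> \<alpha> / 2" and t: "t1 \<le> t" for \<eta> t
  proof -
    define s where "s = t powr (1 - 2 * \<eta> / (2 - \<alpha>))"
    have tg: "1 \<le> t" using t t1 by simp
    have s1: "1 \<le> s" unfolding s_def using g[OF \<eta>] tg by (intro ge_one_powr_ge_zero) auto
    have "s \<le> t powr 1" unfolding s_def using g[OF \<eta>] tg by (intro powr_mono) auto
    then have st: "s \<le> t" using tg by simp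
    define n where "n = nat \<lfloor>ln t\<rfloor>"
    have n: "ln t < real (Suc n)" using tg unfolding n_def by (simp add: le_nat_floor) linarith
    then have "t < exp (real (Suc n))" using tg by (metis exp_less_cancel_iff exp_ln less_le_trans zero_less_one)
    then have sG: "exp (- \<alpha>) * real (Suc n) * a n \<le> s powr \<alpha> * G s" using s1 st by (intro aG) auto
    have sa: "t powr (\<alpha> - \<alpha> * (2 * \<eta> / (2 - \<alpha>))) = s powr \<alpha>" unfolding s_def powr_powr by (simp add: algebra_simps)
    have Ln: "L t = a n" using t by (simp add: L n_def)
    have "\<kappa> * ln t \<le> \<kappa> * real (Suc n)" using n \<kappa> by (intro mult_left_mono) auto
    also have "\<dots> \<le> (1 - exp (- 1)) * (exp (- \<alpha>) * real (Suc n))"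
      unfolding \<kappa>_def mult.assoc using \<alpha> by (intro mult_left_mono mult_right_mono) auto
    also have "\<dots> \<le> (1 - exp (- 1)) * (s powr \<alpha> * G s / a n)"
      using sG apos[of n] by (intro mult_left_mono) (auto simp: le_divide_eq)
    also have "\<dots> = ((1 - exp (- 1)) * G s) * (s powr \<alpha> / a n)" by simp
    also have "\<dots> \<le> - ln (F (1 / s)) * (s powr \<alpha> / a n)"
      using F_le[of "1 / s"] s1 apos[of n] by (intro mult_right_mono) auto
    finally have "\<kappa> * ln t - 1 \<le> - ln (F (1 / s)) * (s powr \<alpha> / a n) - 1" by simp
    also have "\<dots> = Lambda_objective \<alpha> F L \<eta> t (1 / s)"
      using s1 unfolding Lambda_objective_def sa Ln s_def[symmetric] by simp
    finally show ?thesis unfolding s_def .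
  qed
  have bdd: "bdd_above (Lambda_objective \<alpha> F L \<eta> t ` {0<..})" if \<eta>: "0 < \<eta>" "\<eta> \<le> \<alpha> / 2" and t: "t1 \<le> t" for \<eta> t
  proof -
    define s where "s = t powr (1 - 2 * \<eta> / (2 - \<alpha>))"
    have tg: "1 \<le> t" using t t1 by simp
    define n where "n = nat \<lfloor>ln t\<rfloor>"
    have Ln: "L t = a n" using t by (simp add: L n_def)
    have "exp (real n1) \<le> t" using t by (simp add: t1_def)
    then have "real n1 \<le> ln t" using tg by (simp add: ln_ge_iff)
    then have nn: "n1 \<le> n" "real n \<le> ln t" unfolding n_def by linarith+
    have sa: "t powr (\<alpha> - \<alpha> * (2 * \<eta> / (2 - \<alpha>))) = s powr \<alpha>" unfolding s_def powr_powr by (simp add: algebra_simps)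
    have s0: "0 < s" using tg by (simp add: s_def)
    have \<delta>': "\<delta> \<le> (1 - 2 * \<eta> / (2 - \<alpha>)) * (1 - \<alpha>)"
    proof -
      have "\<delta> = (1 - \<alpha> / (2 - \<alpha>)) * (1 - \<alpha>)" using \<alpha> by (simp add: \<delta>_def field_simps power2_eq_square)
      also have "\<dots> \<le> (1 - 2 * \<eta> / (2 - \<alpha>)) * (1 - \<alpha>)" using g[OF \<eta>] \<alpha> by (intro mult_right_mono) auto
      finally show ?thesis .
    qed
    have "m \<le> a n * exp (\<delta> * real n)" by (rule n1[OF nn(1)])
    also have "\<dots> \<le> a n * exp ((1 - 2 * \<eta> / (2 - \<alpha>)) * (1 - \<alpha>) * ln t)"
    proof -
      have "\<delta> * real n \<le> (1 - 2 * \<eta> / (2 - \<alpha>)) * (1 - \<alpha>) * ln t" using nn \<delta> \<delta>' tg by (intro mult_mono) auto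
      then show ?thesis using apos[of n] by simp
    qed
    also have "\<dots> = a n * s powr (1 - \<alpha>)" using tg by (simp add: s_def powr_powr) (simp add: powr_def)
    finally have "m * s powr \<alpha> \<le> a n * s powr (1 - \<alpha>) * s powr \<alpha>" by (intro mult_right_mono) auto
    also have "\<dots> = a n * s" using s0 by (simp add: powr_add[symmetric] mult.assoc)
    \<comment> \<open>This makes the coefficient of \<open>r\<close> in the estimate of the
      objective nonpositive, so the bound that follows is uniform in \<open>r\<close>.\<close>
    finally have ms: "m * (s powr \<alpha> / a n) \<le> s" using apos[of n] by (simp add: divide_le_eq mult.commute)
    have "Lambda_objective \<alpha> F L \<eta> t r \<le> - ln p * (s powr \<alpha> / a n)" if r: "0 < r" for r
    proof -
      have "ln (exp (- r * m) * p) \<le> ln (F r)" using F_ge[OF r] p Fpos[OF r] by (subst ln_le_cancel_iff) auto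
      then have "- ln (F r) \<le> r * m - ln p" using p by (simp add: ln_mult)
      then have "- ln (F r) * (s powr \<alpha> / a n) \<le> (r * m - ln p) * (s powr \<alpha> / a n)" using apos[of n] by (intro mult_right_mono) auto
      also have "\<dots> = r * (m * (s powr \<alpha> / a n)) - ln p * (s powr \<alpha> / a n)" by (simp only: left_diff_distrib mult.assoc)
      also have "\<dots> \<le> r * s - ln p * (s powr \<alpha> / a n)" using mult_left_mono[OF ms, of r] r by linarith
      finally show ?thesis unfolding Lambda_objective_def sa Ln s_def[symmetric] by simp
    qed
    then show ?thesis by (intro bdd_aboveI2[where M="- ln p * (s powr \<alpha> / a n)"]) simp
  qed
  have star: "\<kappa> * ln t - 1 \<le> Lambda_star \<alpha> F L \<eta> t" if \<eta>: "0 < \<eta>" "\<eta> \<le> \<alpha> / 2" and t: "t1 \<le> t" for \<eta> t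
  proof -
    have "0 < 1 / t powr (1 - 2 * \<eta> / (2 - \<alpha>))" using t t1 by simp
    then show ?thesis unfolding Lambda_star_def
      by (intro order_trans[OF obj[OF that]] cSUP_upper bdd[OF that]) simp
  qed
  show ?thesis
  proof (rule that[OF sv thr thr_ge _ Fpos])
    show "1 \<le> t \<and> 10 \<le> t powr \<alpha> \<and> 0 < L t \<and> L t \<le> 1" if "t1 \<le> t" for t using that t1 tp[OF that] by (simp add: L apos a1)
    show "bdd_above (Lambda_objective \<alpha> F L \<eta> t ` {0<..}) \<and> 0 < Lambda_star \<alpha> F L \<eta> t" if "t1 \<le> t" "0 < \<eta>" "\<eta> \<le> \<alpha> / 2" for t \<eta>
    proof -
      have "exp (2 / \<kappa>) \<le> t" using that by (simp add: t1_def)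
      then have "2 / \<kappa> \<le> ln t" using that t1 by (simp add: ln_ge_iff)
      then have "2 \<le> \<kappa> * ln t" using \<kappa> by (simp add: divide_le_eq mult.commute)
      then show ?thesis using star[OF that(2,3,1)] bdd[OF that(2,3,1)] by simp
    qed
    show "filterlim (\<lambda>t. Lambda_star \<alpha> F L \<eta> t) at_top at_top" if "0 < \<eta>" "\<eta> \<le> \<alpha> / 2" for \<eta>
    proof (rule filterlim_at_top_mono)
      show "filterlim (\<lambda>t. - 1 + \<kappa> * ln t) at_top at_top"
        by (rule filterlim_tendsto_add_at_top[OF tendsto_const filterlim_tendsto_pos_mult_at_top[OF tendsto_const \<kappa> ln_at_top]])
      show "\<forall>\<^sub>F t in at_top. - 1 + \<kappa> * ln t \<le> Lambda_star \<alpha> F L \<eta> t"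
        using eventually_ge_at_top[of t1] by eventually_elim (use star[OF that] in force)
    qed
  qed
qed

section \<open>Decomposition of the path and union bound\<close>

lemma sum_parity:
  fixes h :: "nat \<Rightarrow> real"
  shows "(\<Sum>j<n. h j) = (\<Sum>e<(n + 1) div 2. h (2 * e)) + (\<Sum>e<n div 2. h (2 * e + 1))"
proof (induction n)
  case (Suc n)
  show ?case
  proof (cases "even n")
    case True
    then obtain k where "n = 2 * k" by (elim evenE)
    then show ?thesis using Suc by simp
  next
    case False
    then obtain k where "n = 2 * k + 1" by (elim oddE)
    then show ?thesis using Suc by simp
  qed
qed simp

lemma emeasure_Un_le:
  assumes "A \<in> sets M" "B \<in> sets M" "emeasure M A \<le> ennreal a" "emeasure M B \<le> ennreal b" "0 \<le> a" "0 \<le> b"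
  shows "emeasure M (A \<union> B) \<le> ennreal (a + b)"
  using order_trans[OF emeasure_subadditive[OF assms(1,2)] add_mono[OF assms(3,4)]] assms(5,6) by simp

context nummelin_splitting
begin

definition II :: "('e \<Rightarrow> real) \<Rightarrow> 'v \<Rightarrow> real \<Rightarrow> real" where
  "II f w s = (LINT u:{0..s}|lborel. f (X (max 0 u) (pr w)))"

lemma II_0: "II f w 0 = 0"
  unfolding II_def set_lebesgue_integral_def
  by (rule integral_eq_zero_AE, use AE_lborel_singleton[of 0] in eventually_elim) (auto split: split_indicator)

lemma II_uminus: "II (\<lambda>x. - f x) w s = - II f w s"
  by (simp add: II_def set_lebesgue_integral_def)

lemma jump_index: assumes w: "w \<in> space N" and t: "0 \<le> t" obtains k where "T k w \<le> t" "t < T (Suc k) w"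
proof -
  have ex: "\<exists>k. t < T k w" using T_unbounded[OF w] unfolding filterlim_at_top_dense eventually_sequentially by blast
  define k where "k = (LEAST k. t < T k w)"
  have k: "t < T k w" unfolding k_def using ex by (rule LeastI_ex)
  then obtain j where j: "k = Suc j" using t T_0[OF w] by (cases k) auto
  then have "\<not> t < T j w" using not_less_Least[of j "\<lambda>k. t < T k w"] by (simp add: k_def)
  then show ?thesis using k j that by (simp add: not_less)
qed

context
  fixes f :: "'e \<Rightarrow> real" and m :: real
  assumes f [measurable]: "f \<in> borel_measurable borel" and fm: "\<And>x. \<bar>f x\<bar> \<le> m"
begin

lemma II_int:
  assumes w: "w \<in> space N"
  shows "set_integrable lborel {c..b} (\<lambda>u. f (X (max 0 u) (pr w)))" "set_integrable lborel {c..b} (\<lambda>u. \<bar>f (X (max 0 u) (pr w))\<bar>)"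
proof -
  note [measurable] = path_measurable[OF w]
  show "set_integrable lborel {c..b} (\<lambda>u. f (X (max 0 u) (pr w)))" "set_integrable lborel {c..b} (\<lambda>u. \<bar>f (X (max 0 u) (pr w))\<bar>)"
    by (rule set_integrable_bounded[where B=m], measurable, simp add: fm)+
qed

lemma II_diff:
  assumes w: "w \<in> space N" and cb: "0 \<le> c" "c \<le> b"
  shows "II f w b - II f w c = (LINT u:{c..b}|lborel. f (X (max 0 u) (pr w)))"
    and "II (\<lambda>x. \<bar>f x\<bar>) w b - II (\<lambda>x. \<bar>f x\<bar>) w c = (LINT u:{c..b}|lborel. \<bar>f (X (max 0 u) (pr w))\<bar>)"
proof -
  have U: "{0..b} = {0..c} \<union> {c..b}" using cb by auto
  have ae: "AE u in lborel. \<not> (u \<in> {0..c} \<and> u \<in> {c..b})" using AE_lborel_singleton[of c] by eventually_elim auto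
  show "II f w b - II f w c = (LINT u:{c..b}|lborel. f (X (max 0 u) (pr w)))"
    unfolding II_def U by (subst set_integral_Un_AE[OF ae]) (auto intro: II_int[OF w])
  show "II (\<lambda>x. \<bar>f x\<bar>) w b - II (\<lambda>x. \<bar>f x\<bar>) w c = (LINT u:{c..b}|lborel. \<bar>f (X (max 0 u) (pr w))\<bar>)"
    unfolding II_def U by (subst set_integral_Un_AE[OF ae]) (auto intro: II_int[OF w])
qed

lemma II_abs:
  assumes w: "w \<in> space N" and cb: "0 \<le> c" "c \<le> b"
  shows "\<bar>II f w b - II f w c\<bar> \<le> II (\<lambda>x. \<bar>f x\<bar>) w b - II (\<lambda>x. \<bar>f x\<bar>) w c"
  unfolding II_diff[OF assms] set_lebesgue_integral_def
  using integral_norm_bound[of lborel "\<lambda>u. indicator {c..b} u *\<^sub>R f (X (max 0 u) (pr w))"] by (simp add: abs_mult)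

lemma II_lip:
  assumes w: "w \<in> space N" and cb: "0 \<le> c" "c \<le> b"
  shows "II (\<lambda>x. \<bar>f x\<bar>) w b - II (\<lambda>x. \<bar>f x\<bar>) w c \<le> m * (b - c)"
proof -
  have "(LINT u:{c..b}|lborel. \<bar>f (X (max 0 u) (pr w))\<bar>) \<le> (LINT u:{c..b}|lborel. m)"
    by (rule set_integral_mono[OF II_int(2)[OF w] set_integrable_bounded[where B="\<bar>m\<bar>"]]) (auto simp: fm)
  then show ?thesis unfolding II_diff(2)[OF assms] using cb by (simp add: set_lebesgue_integral_def mult.commute)
qed

lemma pint_abs_II:
  assumes w: "w \<in> space N" and ij: "i \<le> j"
  shows "enn2real (pint (\<lambda>x. ennreal \<bar>f x\<bar>) i j w) = II (\<lambda>x. \<bar>f x\<bar>) w (T j w) - II (\<lambda>x. \<bar>f x\<bar>) w (T i w)"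
proof -
  have t: "0 \<le> T i w" "T i w \<le> T j w" using T_nonneg[OF w] T_mono[OF w ij] by auto
  have "pint (\<lambda>x. ennreal \<bar>f x\<bar>) i j w = ennreal (LINT s:{T i w..T j w}|lborel. \<bar>f (X (max 0 s) (pr w))\<bar>)"
    by (rule pint_LINT[where m=m]) (simp_all add: fm w)
  also have "\<dots> = ennreal (II (\<lambda>x. \<bar>f x\<bar>) w (T j w) - II (\<lambda>x. \<bar>f x\<bar>) w (T i w))" by (simp add: II_diff(2)[OF w t])
  finally show ?thesis using II_abs[OF w t] by simp
qed

lemma sgw_II:
  assumes w: "w \<in> space N" and ij: "i \<le> j"
  shows "sgw l f i j w = ennreal (exp (l * (II f w (T j w) - II f w (T i w))))"
proof -
  have t: "0 \<le> T i w" "T i w \<le> T j w" using T_nonneg[OF w] T_mono[OF w ij] by auto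
  note [measurable] = path_measurable[OF w]
  have m0: "0 \<le> m" using fm[of undefined] by linarith
  have P: "enn2real (pint (\<lambda>x. ennreal (h x)) i j w) = (LINT s:{T i w..T j w}|lborel. max 0 (h (X (max 0 s) (pr w))))"
    and int: "set_integrable lborel {T i w..T j w} (\<lambda>s. max 0 (h (X (max 0 s) (pr w))))"
    if [measurable]: "h \<in> borel_measurable borel" and hm: "\<And>x. \<bar>h x\<bar> \<le> m" for h
  proof -
    have e: "(\<lambda>x. ennreal (h x)) = (\<lambda>x. ennreal (max 0 (h x)))" by (auto simp: max_def ennreal_neg fun_eq_iff)
    have h2: "max 0 (h x) \<le> m" for x using hm[of x] m0 by auto
    have "pint (\<lambda>x. ennreal (h x)) i j w = ennreal (LINT s:{T i w..T j w}|lborel. max 0 (h (X (max 0 s) (pr w))))"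
      unfolding e by (rule pint_LINT[where m=m]) (simp_all add: h2 w del: max.bounded_iff)
    moreover have "0 \<le> (LINT s:{T i w..T j w}|lborel. max 0 (h (X (max 0 s) (pr w))))"
      unfolding set_lebesgue_integral_def by (rule integral_nonneg_AE) simp
    ultimately show "enn2real (pint (\<lambda>x. ennreal (h x)) i j w) = (LINT s:{T i w..T j w}|lborel. max 0 (h (X (max 0 s) (pr w))))" by simp
    show "set_integrable lborel {T i w..T j w} (\<lambda>s. max 0 (h (X (max 0 s) (pr w))))"
      by (rule set_integrable_bounded[where B=m]) (measurable, use h2 in \<open>simp del: max.bounded_iff\<close>)
  qed
  have fm': "\<bar>- f x\<bar> \<le> m" for x using fm[of x] by simp
  have "max 0 (f x) - max 0 (- f x) = f x" for x by (auto simp: max_def)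
  then have "enn2real (pint (\<lambda>x. ennreal (f x)) i j w) - enn2real (pint (\<lambda>x. ennreal (- f x)) i j w) = (LINT s:{T i w..T j w}|lborel. f (X (max 0 s) (pr w)))"
    unfolding P[OF f fm] P[OF borel_measurable_uminus[OF f] fm']
    by (subst set_integral_diff(2)[symmetric]) (use int[OF f fm] int[OF borel_measurable_uminus[OF f] fm'] in auto)
  then show ?thesis unfolding sgw_def II_diff(1)[OF w t] by simp
qed

end

lemma reg_path:
  assumes n: "\<forall>m. \<not> noat m w"
  obtains i where "\<And>j. reg j (i j) w" "i 0 = 0" "\<And>j. \<exists>k. i (Suc j) = Suc k \<and> first_atom (Suc (i j)) k w"
proof -
  obtain i where i: "\<And>j. reg j (i j) w" using reg_ex[OF n] by metis
  have "\<exists>k. i (Suc j) = Suc k \<and> first_atom (Suc (i j)) k w" for j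
  proof -
    obtain k m where km: "i (Suc j) = Suc k" "reg j m w" "first_atom (Suc m) k w" using i[of "Suc j"] by auto
    then show ?thesis using reg_unique[OF km(2) i[of j]] by auto
  qed
  moreover have "i 0 = 0" using i[of 0] by simp
  ultimately show ?thesis using that i by blast
qed

text \<open>The cycle around \<open>t\<close> is completed, so the integral up to \<open>t\<close>
  is the first incomplete cycle plus \<open>n\<close> whole cycles minus the part from
  \<open>t\<close> to the next regeneration. Since \<open>5/24 + 5/24 + 7/24 + 7/24 = 1\<close>, one
  piece must be large, unless \<open>n\<close> exceeds \<open>2 * q\<close>; otherwise each parity
  has at most \<open>q\<close> whole cycles.\<close>

lemma path_cases:
  fixes i :: "nat \<Rightarrow> nat" and f :: "'e \<Rightarrow> real"
  assumes w: "w \<in> space N" and f: "f \<in> borel_measurable borel" "\<And>x. \<bar>f x\<bar> \<le> m"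
    and i0: "i 0 = 0" and i: "\<And>j. i j < i (Suc j)" and t: "0 \<le> t" and y: "0 < y" "y \<le> \<bar>II f w t\<bar>"
  defines "A \<equiv> II (\<lambda>x. \<bar>f x\<bar>) w" and "\<tau> \<equiv> \<lambda>j. T (i j) w"
  shows "5 * y / 24 \<le> A (\<tau> 1) \<or> (\<exists>n. \<tau> n \<le> t \<and> t < \<tau> (Suc n) \<and> 5 * y / 24 \<le> A (\<tau> (Suc n)) - A t) \<or>
    (\<exists>b\<in>{0, 1}. \<exists>k\<le>q. 7 * y / 24 \<le> \<bar>\<Sum>e<k. II f w (\<tau> (Suc (Suc (2 * e + b)))) - II f w (\<tau> (Suc (2 * e + b)))\<bar>) \<or> \<tau> (Suc (2 * q)) \<le> t"
proof (rule ccontr)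
  let ?J = "II f w"
  define h where "h j = ?J (\<tau> (Suc (Suc j))) - ?J (\<tau> (Suc j))" for j
  assume neg: "\<not> ?thesis"
  then have n1: "A (\<tau> 1) < 5 * y / 24" and n2: "\<And>n. \<tau> n \<le> t \<Longrightarrow> t < \<tau> (Suc n) \<Longrightarrow> A (\<tau> (Suc n)) - A t < 5 * y / 24"
    and n3: "\<And>k b. b \<in> {0, 1} \<Longrightarrow> k \<le> q \<Longrightarrow> \<bar>\<Sum>e<k. h (2 * e + b)\<bar> < 7 * y / 24" and n4: "t < \<tau> (Suc (2 * q))"
    unfolding h_def by (meson not_le)+
  have ii: "i j \<le> i k \<longleftrightarrow> j \<le> k" for j k using strict_mono_less_eq[of i] i by (simp add: strict_mono_Suc_iff)
  have \<tau>m: "\<tau> j \<le> \<tau> k" if "j \<le> k" for j k unfolding \<tau>_def using that by (intro T_mono[OF w]) (simp add: ii)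
  have ik: "k \<le> i k" for k using strict_mono_imp_increasing[of i] i by (simp add: strict_mono_Suc_iff)
  obtain j where j: "T j w \<le> t" "t < T (Suc j) w" by (rule jump_index[OF w t])
  have ex: "t < \<tau> (Suc j)" using j(2) T_mono[OF w ik[of "Suc j"]] by (simp add: \<tau>_def)
  define n' where "n' = (LEAST k. t < \<tau> k)"
  have n': "t < \<tau> n'" unfolding n'_def by (rule LeastI[of "\<lambda>k. t < \<tau> k", OF ex])
  have "\<tau> 0 = 0" using T_0[OF w] by (simp add: \<tau>_def i0)
  then obtain n where n: "n' = Suc n" using n' t by (cases n') auto
  then have tn: "\<tau> n \<le> t" using not_less_Least[of n "\<lambda>k. t < \<tau> k"] by (simp add: n'_def)
  have tSn: "t < \<tau> (Suc n)" using n' n by simp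
  have nq: "n \<le> 2 * q"
  proof (rule ccontr)
    assume "\<not> n \<le> 2 * q"
    then have "\<tau> (Suc (2 * q)) \<le> \<tau> n" by (intro \<tau>m) simp
    then show False using tn n4 by simp
  qed
  have \<tau>1: "0 \<le> \<tau> 1" unfolding \<tau>_def by (rule T_nonneg[OF w])
  have "\<bar>?J (\<tau> 1) - ?J 0\<bar> \<le> A (\<tau> 1) - A 0" unfolding A_def by (rule II_abs[OF f w order_refl \<tau>1])
  then have e1: "\<bar>?J (\<tau> 1)\<bar> < 5 * y / 24" using n1 by (simp add: A_def II_0)
  have "\<bar>?J (\<tau> (Suc n)) - ?J t\<bar> \<le> A (\<tau> (Suc n)) - A t" unfolding A_def by (rule II_abs[OF f w t less_imp_le[OF tSn]])
  then have e2: "\<bar>?J (\<tau> (Suc n)) - ?J t\<bar> < 5 * y / 24" using n2[OF tn tSn] by simp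
  have "(\<Sum>j<n. h j) = ?J (\<tau> (Suc n)) - ?J (\<tau> 1)"
    unfolding h_def using sum_lessThan_telescope[of "\<lambda>j. ?J (\<tau> (Suc j))" n] by simp
  then have "?J t = ?J (\<tau> 1) + (\<Sum>j<n. h j) - (?J (\<tau> (Suc n)) - ?J t)" by simp
  also have "(\<Sum>j<n. h j) = (\<Sum>e<(n + 1) div 2. h (2 * e + 0)) + (\<Sum>e<n div 2. h (2 * e + 1))" using sum_parity[of h n] by simp
  finally have eq: "?J t = ?J (\<tau> 1) + ((\<Sum>e<(n + 1) div 2. h (2 * e + 0)) + (\<Sum>e<n div 2. h (2 * e + 1))) - (?J (\<tau> (Suc n)) - ?J t)" .
  have s1: "\<bar>\<Sum>e<(n + 1) div 2. h (2 * e + 0)\<bar> < 7 * y / 24" by (rule n3) (use nq in auto)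
  have s2: "\<bar>\<Sum>e<n div 2. h (2 * e + 1)\<bar> < 7 * y / 24" by (rule n3) (use nq in auto)
  have "\<bar>?J t\<bar> < y" using e1 e2 s1 s2 eq by linarith
  then show False using y by simp
qed

text \<open>With \<open>k = 4 / (5 K)\<close> each end has exponential moment at most
  \<open>1 / (1 - k K) = 5\<close>, and the level \<open>5 y / 24\<close> gives the exponent
  \<open>y / (6 K)\<close>; the two ends make 10. Two parities and two signs make 4. If
  \<open>2 q\<close> whole cycles fit before \<open>t\<close>, those of one parity last at most
  \<open>t / 2\<close> in total, whence \<open>exp (- (r t / 2))\<close> and the factor 2.\<close>

lemma deviation_bound:
  fixes f :: "'e \<Rightarrow> real" and m K l Cc r t y \<phi> :: real and q :: nat
  assumes f: "f \<in> borel_measurable borel" and fm: "\<And>x. \<bar>f x\<bar> \<le> m" and m: "0 < m"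
    and Cc: "0 \<le> Cc" "\<And>x. Psi (\<lambda>x. ennreal \<bar>f x\<bar>) x \<le> ennreal Cc" and K: "K = m + Cc"
    and cen: "(\<integral>\<^sup>+x. ennreal (f x) \<partial>\<mu>) = (\<integral>\<^sup>+x. ennreal (- f x) \<partial>\<mu>)"
    and l: "0 < l" "l * K < 1" and t: "0 \<le> t" and y: "0 < y" and r: "0 < r" and \<phi>: "0 \<le> \<phi>"
    and lap: "\<And>b. (\<integral>\<^sup>+w. (\<Prod>e<q. cyc (lapw r) (Suc (2 * e + b)) w) \<partial>PP x) = ennreal \<phi> ^ q"
    and D: "\<And>w. w \<in> D \<Longrightarrow> w \<in> space N \<and> y \<le> \<bar>II f w t\<bar>"
  shows "emeasure (PP x) D \<le>
    ennreal (10 * exp (- (y / (6 * K))) + 4 * ((1 + l\<^sup>2 * K\<^sup>2 / (1 - l * K)) ^ q / exp (l * (7 * y / 24))) + 2 * (\<phi> ^ q / exp (- (r * t / 2))))"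
proof -
  have K0: "0 < K" using m Cc by (simp add: K)
  define k where "k = 4 / (5 * K)"
  have k: "0 < k" "k * K < 1" "1 / (1 - k * K) = 5" using K0 by (simp_all add: k_def)
  define \<rho> where "\<rho> = 1 + l\<^sup>2 * K\<^sup>2 / (1 - l * K)"
  have \<rho>: "1 \<le> \<rho>" using l by (simp add: \<rho>_def)
  define E1 where "E1 = {w \<in> space N. ennreal (exp (k * (5 * y / 24))) \<le> GE f k 0 w}"
  define E2 where "E2 = {w \<in> space N. ennreal (exp (k * (5 * y / 24))) \<le> HT f m k t w}"
  define E3 where "E3 h b = {w \<in> space N. \<exists>k\<le>q. ennreal (exp (l * (7 * y / 24))) \<le> (\<Prod>e<k. cyc (sgw l h) (Suc (2 * e + b)) w)}" for h b
  define E4 where "E4 b = {w \<in> space N. ennreal (exp (- (r * t / 2))) \<le> (\<Prod>e<q. cyc (lapw r) (Suc (2 * e + b)) w)}" for b :: nat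
  note hk = f fm m Cc K k(1,2) refl[of "k / (1 - k * K)"]
  note hl = f fm m Cc K l refl[of "l / (1 - l * K)"]
  have f': "(\<lambda>x. - f x) \<in> borel_measurable borel" using f by measurable
  have fm': "\<bar>- f x\<bar> \<le> m" for x using fm[of x] by simp
  have Cc': "Psi (\<lambda>x. ennreal \<bar>- f x\<bar>) x \<le> ennreal Cc" for x using Cc(2)[of x] by simp
  have cen': "(\<integral>\<^sup>+x. ennreal (- f x) \<partial>\<mu>) = (\<integral>\<^sup>+x. ennreal (- (- f x)) \<partial>\<mu>)" using cen by simp
  note [measurable] = GE_N[OF hk] HT_N[OF hk]
  have mc: "cyc (sgw l h) j \<in> borel_measurable N" if "h \<in> borel_measurable borel" for h j
    by (rule cyc_N) (rule sgw_hist[OF that])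
  have ml: "cyc (lapw r) j \<in> borel_measurable N" for j by (rule cyc_N) (rule lapw_hist, auto)
  have ee: "ennreal (5 / exp (k * (5 * y / 24))) = ennreal (5 * exp (- (y / (6 * K))))"
    using K0 by (simp add: k_def exp_minus field_simps)
  have S1: "E1 \<in> sets (PP x)" and S2: "E2 \<in> sets (PP x)" unfolding E1_def E2_def sets_PP by measurable
  have S3: "E3 h b \<in> sets (PP x)" if "h \<in> borel_measurable borel" for h b
  proof -
    note [measurable] = mc[OF that]
    show ?thesis unfolding E3_def sets_PP by measurable
  qed
  have S4: "E4 b \<in> sets (PP x)" for b
  proof -
    note [measurable] = ml
    show ?thesis unfolding E4_def sets_PP by measurable
  qed
  have B1: "emeasure (PP x) E1 \<le> ennreal (5 * exp (- (y / (6 * K))))"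
    unfolding E1_def ee[symmetric] by (rule markov_level) (use first_end[OF hk, of x] k(3) in auto)
  have B2: "emeasure (PP x) E2 \<le> ennreal (5 * exp (- (y / (6 * K))))"
    unfolding E2_def ee[symmetric] by (rule markov_level) (use last_end[OF hk t, of x] k(3) in auto)
  have B3: "emeasure (PP x) (E3 f b) \<le> ennreal (\<rho> ^ q / exp (l * (7 * y / 24)))" for b
    unfolding E3_def
    by (rule parity_max[OF sgw_hist[OF f] \<rho> exp_gt_zero], assumption, unfold \<rho>_def, rule signed_cycle[OF hl _ _ cen], assumption+)
  have B3': "emeasure (PP x) (E3 (\<lambda>x. - f x) b) \<le> ennreal (\<rho> ^ q / exp (l * (7 * y / 24)))" for b
    unfolding E3_def
    by (rule parity_max[OF sgw_hist[OF f'] \<rho> exp_gt_zero], assumption, unfold \<rho>_def,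
        rule signed_cycle[OF f' fm' m Cc(1) Cc' K l refl _ _ cen'], assumption+)
  have B4: "emeasure (PP x) (E4 b) \<le> ennreal (\<phi> ^ q / exp (- (r * t / 2)))" for b
  proof -
    note [measurable] = ml
    show ?thesis unfolding E4_def by (rule markov_level) (use lap[of b] \<phi> in \<open>auto simp: ennreal_power\<close>)
  qed
  define s where "s = \<rho> ^ q / exp (l * (7 * y / 24))"
  define u where "u = \<phi> ^ q / exp (- (r * t / 2))"
  have s0: "0 \<le> s" and u0: "0 \<le> u" using \<rho> \<phi> by (simp_all add: s_def u_def)
  define EE where "EE = ((E1 \<union> E2) \<union> ((E3 f 0 \<union> E3 f 1) \<union> (E3 (\<lambda>x. - f x) 0 \<union> E3 (\<lambda>x. - f x) 1))) \<union> (E4 0 \<union> E4 1)"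
  have EE: "EE \<in> sets (PP x)" unfolding EE_def using S1 S2 S3[OF f] S3[OF f'] S4 by (intro sets.Un)
  have "emeasure (PP x) EE \<le> ennreal (((5 * exp (- (y / (6 * K))) + 5 * exp (- (y / (6 * K)))) + ((s + s) + (s + s))) + (u + u))"
    unfolding EE_def
    by (intro emeasure_Un_le sets.Un S1 S2 S3[OF f] S3[OF f'] S4 B1 B2 B3[folded s_def] B3'[folded s_def] B4[folded u_def] add_nonneg_nonneg s0 u0) auto
  moreover have "AE w in PP x. w \<in> D \<longrightarrow> w \<in> EE"
    using noat_AE[of x]
  proof eventually_elim
    case (elim w)
    show ?case
    proof
      assume "w \<in> D"
      then have w: "w \<in> space N" and yJ: "y \<le> \<bar>II f w t\<bar>" using D by auto
      obtain i where reg: "\<And>j. reg j (i j) w" and i0: "i 0 = 0" and ik: "\<And>j. \<exists>k. i (Suc j) = Suc k \<and> first_atom (Suc (i j)) k w"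
        by (rule reg_path[OF elim]) blast
      have im: "i j < i (Suc j)" for j using ik[of j] by (auto simp: first_atom_def)
      define \<tau> where "\<tau> j = T (i j) w" for j
      let ?A = "II (\<lambda>x. \<bar>f x\<bar>) w"
      have P3: "(\<Prod>e<j. cyc (sgw l h) (Suc (2 * e + b)) w) = ennreal (exp (l * (\<Sum>e<j. II h w (\<tau> (Suc (Suc (2 * e + b)))) - II h w (\<tau> (Suc (2 * e + b))))))"
        if h: "h \<in> borel_measurable borel" "\<And>x. \<bar>h x\<bar> \<le> m" for h j b
      proof -
        have "cyc (sgw l h) (Suc (2 * e + b)) w = ennreal (exp (l * (II h w (\<tau> (Suc (Suc (2 * e + b)))) - II h w (\<tau> (Suc (2 * e + b))))))" for e
          unfolding cyc_eq[OF reg reg] \<tau>_def using less_imp_le[OF im] by (rule sgw_II[OF h w])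
        then show ?thesis by (simp add: prod_ennreal exp_sum sum_distrib_left)
      qed
      have P4: "(\<Prod>e<j. cyc (lapw r) (Suc (2 * e + b)) w) = ennreal (exp (- r * (\<Sum>e<j. \<tau> (Suc (Suc (2 * e + b))) - \<tau> (Suc (2 * e + b)))))" for j b
      proof -
        have "cyc (lapw r) (Suc (2 * e + b)) w = ennreal (exp (- r * (\<tau> (Suc (Suc (2 * e + b))) - \<tau> (Suc (2 * e + b)))))" for e
          unfolding cyc_eq[OF reg reg] \<tau>_def lapw_def ..
        then show ?thesis by (simp only: prod_ennreal exp_ge_zero exp_sum[OF finite_lessThan] sum_distrib_left)
      qed
      consider (first) "5 * y / 24 \<le> ?A (\<tau> 1)"
        | (last) n where "\<tau> n \<le> t" "t < \<tau> (Suc n)" "5 * y / 24 \<le> ?A (\<tau> (Suc n)) - ?A t"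
        | (cycles) b j where "b = 0 \<or> b = 1" "j \<le> q" "7 * y / 24 \<le> \<bar>\<Sum>e<j. II f w (\<tau> (Suc (Suc (2 * e + b)))) - II f w (\<tau> (Suc (2 * e + b)))\<bar>"
        | (number) "\<tau> (Suc (2 * q)) \<le> t"
        using path_cases[OF w f fm i0 im t y yJ, of q] unfolding \<tau>_def by blast
      then show "w \<in> EE"
      proof cases
        case first
        obtain j where j: "i (Suc 0) = Suc j" "first_atom (Suc 0) j w" using ik[of 0] i0 by auto
        have "exp (k * (5 * y / 24)) \<le> exp (k * ?A (\<tau> 1))" using first k by simp
        also have "?A (\<tau> 1) = enn2real (pint (\<lambda>x. ennreal \<bar>f x\<bar>) 0 (Suc j) w)"
          using pint_abs_II[OF f fm w, of 0 "Suc j"] j T_0[OF w] by (simp add: \<tau>_def II_0)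
        finally have "ennreal (exp (k * (5 * y / 24))) \<le> eA k (\<lambda>x. \<bar>f x\<bar>) 0 (Suc j) w" unfolding eA_def by (rule ennreal_leI)
        then have "w \<in> E1" using GE_ge[OF hk w j(2)] w unfolding E1_def by (auto intro: order_trans)
        then show ?thesis by (simp add: EE_def)
      next
        case (last n)
        obtain j where j: "i (Suc n) = Suc j" "first_atom (Suc (i n)) j w" using ik[of n] by auto
        obtain k' where k': "T k' w \<le> t" "t < T (Suc k') w" by (rule jump_index[OF w t])
        have "T (i n) w < T (Suc k') w" using last(1) k'(2) by (simp add: \<tau>_def)
        then have a1: "i n \<le> k'" using T_less_iff[OF w] by simp
        have "T k' w < T (Suc j) w" using last(2) k'(1) by (simp add: \<tau>_def j(1))
        then have a2: "k' \<le> j" using T_less_iff[OF w] by simp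
        have "?A (\<tau> (Suc n)) - ?A t = (?A (T (Suc k') w) - ?A t) + (?A (T (Suc j) w) - ?A (T (Suc k') w))" by (simp add: \<tau>_def j(1))
        also have "\<dots> \<le> m * (T (Suc k') w - t) + enn2real (pint (\<lambda>x. ennreal \<bar>f x\<bar>) (Suc k') (Suc j) w)"
          using II_lip[OF f fm w t, of "T (Suc k') w"] k' pint_abs_II[OF f fm w, of "Suc k'" "Suc j"] a2 by simp
        finally have "k * (5 * y / 24) \<le> k * (m * (T (Suc k') w - t) + enn2real (pint (\<lambda>x. ennreal \<bar>f x\<bar>) (Suc k') (Suc j) w))"
          using last(3) k(1) by (intro mult_left_mono) auto
        then have "ennreal (exp (k * (5 * y / 24))) \<le> ennreal (exp (k * m * (T (Suc k') w - t))) * eA k (\<lambda>x. \<bar>f x\<bar>) (Suc k') (Suc j) w"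
          unfolding eA_def by (simp add: ennreal_mult[symmetric] exp_add[symmetric] distrib_left mult.assoc)
        also have "\<dots> \<le> HT f m k t w" by (rule HT_ge[OF hk w k' j(2) a1 a2])
        finally have "w \<in> E2" using w by (simp add: E2_def)
        then show ?thesis by (simp add: EE_def)
      next
        case (cycles b j)
        let ?S = "\<lambda>h. \<Sum>e<j. II h w (\<tau> (Suc (Suc (2 * e + b)))) - II h w (\<tau> (Suc (2 * e + b)))"
        have "?S (\<lambda>x. - f x) = - ?S f" by (simp add: II_uminus sum_negf[symmetric])
        then have "7 * y / 24 \<le> ?S f \<or> 7 * y / 24 \<le> ?S (\<lambda>x. - f x)" using cycles(3) by linarith
        then have "w \<in> E3 f b \<or> w \<in> E3 (\<lambda>x. - f x) b"
        proof
          assume "7 * y / 24 \<le> ?S f"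
          then have "ennreal (exp (l * (7 * y / 24))) \<le> (\<Prod>e<j. cyc (sgw l f) (Suc (2 * e + b)) w)"
            unfolding P3[OF f fm] using l by (intro ennreal_leI) simp
          then show ?thesis using w cycles(2) unfolding E3_def by blast
        next
          assume "7 * y / 24 \<le> ?S (\<lambda>x. - f x)"
          then have "ennreal (exp (l * (7 * y / 24))) \<le> (\<Prod>e<j. cyc (sgw l (\<lambda>x. - f x)) (Suc (2 * e + b)) w)"
            unfolding P3[OF f' fm'] using l by (intro ennreal_leI) simp
          then show ?thesis using w cycles(2) unfolding E3_def by blast
        qed
        then show ?thesis using cycles(1) by (auto simp: EE_def)
      next
        case number
        define d where "d j = \<tau> (Suc (Suc j)) - \<tau> (Suc j)" for j
        have "(\<Sum>j<2 * q. d j) = \<tau> (Suc (2 * q)) - \<tau> 1"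
          unfolding d_def using sum_lessThan_telescope[of "\<lambda>j. \<tau> (Suc j)" "2 * q"] by simp
        also have "\<dots> \<le> t" using number T_nonneg[OF w, of "i 1"] by (simp add: \<tau>_def)
        finally have "(\<Sum>e<q. d (2 * e + 0)) + (\<Sum>e<q. d (2 * e + 1)) \<le> t" using sum_parity[of d "2 * q"] by simp
        then have "(\<Sum>e<q. d (2 * e + 0)) \<le> t / 2 \<or> (\<Sum>e<q. d (2 * e + 1)) \<le> t / 2" by linarith
        then obtain b where b: "b = 0 \<or> b = 1" "(\<Sum>e<q. d (2 * e + b)) \<le> t / 2" by blast
        have "r * (\<Sum>e<q. d (2 * e + b)) \<le> r * (t / 2)" using b(2) r by (intro mult_left_mono) auto
        then have "ennreal (exp (- (r * t / 2))) \<le> (\<Prod>e<q. cyc (lapw r) (Suc (2 * e + b)) w)"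
          unfolding P4 d_def by (intro ennreal_leI) simp
        then have "w \<in> E4 b" using w by (simp add: E4_def)
        then show ?thesis using b(1) by (auto simp: EE_def)
      qed
    qed
  qed
  then have "emeasure (PP x) D \<le> emeasure (PP x) EE" using EE by (rule emeasure_mono_AE)
  ultimately show ?thesis unfolding \<rho>_def[symmetric] s_def[symmetric] u_def[symmetric] by (simp add: algebra_simps)
qed

end

section \<open>Choice of the free parameters\<close>

text \<open>\<open>n\<close> is the number of cycles allowed for, and \<open>q\<close> its rounded
  half for one parity. The threshold condition amounts to
  \<open>t powr (\<alpha> / 2 + \<eta>) \<le> t powr \<gamma> / L\<close>, hence
  \<open>y \<le> n\<close>. From \<open>g + \<gamma> = \<alpha> + 2 \<eta>\<close> one gets
  \<open>E * n = y\<^sup>2\<close>, so a Bernstein exponent of order \<open>y\<^sup>2 / n\<close>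
  becomes the rate \<open>E\<close> of the statement.\<close>

lemma numeric_bounds:
  fixes K t x \<eta> \<alpha> L :: real
  defines "y \<equiv> t powr (\<alpha> / 2 + \<eta>) * x" and "g \<equiv> 2 * \<eta> / (2 - \<alpha>)"
  assumes K: "0 < K" and \<alpha>: "0 < \<alpha>" "\<alpha> < 1" and \<eta>: "0 < \<eta>" and t: "1 \<le> t" "10 \<le> t powr \<alpha>" and L: "0 < L" "L \<le> 1"
    and thr: "1 \<le> t powr (\<alpha> + 2 * \<eta> * ((1 - \<alpha>) / (2 - \<alpha>))) / L * t powr (- (\<alpha> / 2) - \<eta>)" and x: "0 < x"
  obtains q :: nat and l :: real where "0 < l" "l * K < 1"
    "(1 + l\<^sup>2 * K\<^sup>2 / (1 - l * K)) ^ q / exp (l * (7 * y / 24)) \<le> exp (- (1 / (42 * max (K\<^sup>2) K)) * t powr g * min (x\<^sup>2) x * L)"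
    "\<And>r \<phi>. 0 < r \<Longrightarrow> 0 < \<phi> \<Longrightarrow> \<phi> \<le> 1 \<Longrightarrow> \<phi> ^ q / exp (- (r * t / 2)) \<le>
      exp (- (1 / 2) * t powr g * max x 1 * (- ln \<phi> * t powr (\<alpha> - \<alpha> * g) * (1 / L) - r * t powr (1 - g)))"
proof -
  define \<gamma> where "\<gamma> = \<alpha> + g * (1 - \<alpha>)"
  have \<gamma>: "\<alpha> + 2 * \<eta> * ((1 - \<alpha>) / (2 - \<alpha>)) = \<gamma>" by (simp add: \<gamma>_def g_def)
  have g: "0 < g" using \<eta> \<alpha> by (simp add: g_def)
  have g\<gamma>: "g + \<gamma> = (\<alpha> / 2 + \<eta>) + (\<alpha> / 2 + \<eta>)"
  proof -
    have "g * (2 - \<alpha>) = 2 * \<eta>" using \<alpha> by (simp add: g_def)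
    then show ?thesis by (simp add: \<gamma>_def algebra_simps)
  qed
  define B where "B = max (K\<^sup>2) K"
  have B: "0 < B" "K\<^sup>2 \<le> B" "K \<le> B" using K by (auto simp: B_def)
  define n where "n = t powr \<gamma> * max x 1 / L"
  define q where "q = nat \<lceil>n / 2\<rceil>"
  define z where "z = 7 * y / 24"
  have tp: "0 < t powr c" for c using t by simp
  have y0: "0 < y" using x t by (simp add: y_def)
  have z0: "0 < z" using y0 by (simp add: z_def)
  have n10: "10 \<le> n"
  proof -
    have "t powr \<alpha> \<le> t powr \<gamma>" using t g \<alpha> by (intro powr_mono) (auto simp: \<gamma>_def)
    then have "10 * 1 \<le> t powr \<gamma> * max x 1" using t by (intro mult_mono) auto
    also have "\<dots> \<le> n" unfolding n_def using L tp[of \<gamma>] by (simp add: le_divide_eq mult_left_le)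
    finally show ?thesis by simp
  qed
  have q: "n / 2 \<le> real q" "real q \<le> n / 2 + 1" using n10 unfolding q_def by linarith+
  have q0: "0 < real q" using q n10 by linarith
  have yn: "y \<le> n"
  proof -
    have "t powr (\<alpha> / 2 + \<eta>) * 1 \<le> t powr (\<alpha> / 2 + \<eta>) * (t powr \<gamma> / L * t powr (- (\<alpha> / 2) - \<eta>))"
      using thr unfolding \<gamma> by (intro mult_left_mono) auto
    also have "\<dots> = t powr \<gamma> / L * (t powr (\<alpha> / 2 + \<eta>) * t powr (- (\<alpha> / 2) - \<eta>))" by (simp add: mult_ac)
    also have "t powr (\<alpha> / 2 + \<eta>) * t powr (- (\<alpha> / 2) - \<eta>) = 1" using t by (simp add: powr_add[symmetric])
    finally have "t powr (\<alpha> / 2 + \<eta>) \<le> t powr \<gamma> / L" by simp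
    then have "y \<le> t powr \<gamma> / L * max x 1" unfolding y_def using x L by (intro mult_mono) auto
    then show ?thesis by (simp add: n_def)
  qed
  define v where "v = 2 * real q * K\<^sup>2"
  \<comment> \<open>\<open>l = z / D\<close> is the choice from Bernstein's inequality:
    \<open>1 - l K = v / D\<close>, and \<open>l z - q l\<^sup>2 K\<^sup>2 / (1 - l K)\<close>
    equals \<open>z\<^sup>2 / (2 D)\<close>.\<close>
  define D where "D = v + K * z"
  have v0: "0 < v" using q0 K by (simp add: v_def)
  have D0: "0 < D" using v0 K z0 by (simp add: D_def add_pos_pos)
  define l where "l = z / D"
  have l0: "0 < l" using z0 D0 by (simp add: l_def)
  have lK: "1 - l * K = v / D" using D0 by (simp add: l_def D_def field_simps)
  \<comment> \<open>\<open>n \<ge> 10\<close> gives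
    \<open>v \<le> (n + 2) B \<le> 12/10 n B\<close>, and \<open>12/10 + 7/24 = 179/120\<close>.
    With \<open>z = 7 y / 24\<close> the constant 42 is then admissible, as
    \<open>179/60 \<le> 42 * 49/576\<close>.\<close>
  have DB: "D \<le> 179 / 120 * (B * n)"
  proof -
    have "v \<le> (n + 2) * B" unfolding v_def using q B K q0 n10 by (intro mult_mono) auto
    also have "\<dots> \<le> (12 / 10 * n) * B" using n10 B by (intro mult_right_mono) auto
    finally have "v \<le> 12 / 10 * (B * n)" by (simp add: mult_ac)
    moreover have "K * z \<le> B * (7 / 24 * n)" using B K yn z0 by (intro mult_mono) (auto simp: z_def)
    ultimately show ?thesis by (simp add: D_def)
  qed
  have mm: "min (x\<^sup>2) x * max x 1 = x\<^sup>2"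
  proof (cases "x \<le> 1")
    case True
    then have "x\<^sup>2 \<le> x" using x by (simp add: power2_eq_square mult_left_le)
    then show ?thesis using True by (simp add: min_def max_def)
  next
    case False
    then have "x \<le> x\<^sup>2" using x by (simp add: power2_eq_square)
    then show ?thesis using False by (auto simp: min_def max_def power2_eq_square)
  qed
  define E where "E = t powr g * min (x\<^sup>2) x * L"
  have En: "E * n = y\<^sup>2"
  proof -
    have "E * n = (t powr g * t powr \<gamma>) * (min (x\<^sup>2) x * max x 1)" using L by (simp add: E_def n_def field_simps)
    also have "\<dots> = t powr (g + \<gamma>) * x\<^sup>2" unfolding mm by (simp add: powr_add)
    also have "\<dots> = y\<^sup>2" unfolding g\<gamma> y_def by (simp only: powr_add power2_eq_square mult_ac)
    finally show ?thesis .
  qed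
  have E0: "0 < E" using En y0 n10 by (metis less_le_trans linorder_not_less mult_nonpos_nonneg not_less_iff_gr_or_eq order_less_imp_le zero_less_power zero_less_numeral)
  have key: "1 / (42 * B) * E \<le> z\<^sup>2 / (2 * D)"
  proof -
    have "E * (2 * D) \<le> E * (179 / 60 * (B * n))" using DB E0 by (intro mult_left_mono) auto
    also have "\<dots> = 179 / 60 * B * y\<^sup>2" using En by (simp add: mult_ac)
    also have "\<dots> \<le> 42 * (49 / 576) * B * y\<^sup>2" using B y0 by (intro mult_right_mono) auto
    also have "\<dots> = 42 * B * z\<^sup>2" by (simp add: z_def power2_eq_square)
    finally show ?thesis using B D0 by (simp add: divide_le_eq le_divide_eq mult_ac)
  qed
  show ?thesis
  proof (rule that[of l q])
    show "0 < l" by (rule l0)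
    have "0 < v / D" using v0 D0 by simp
    then show "l * K < 1" using lK by linarith
    have u: "real q * (l\<^sup>2 * K\<^sup>2 / (1 - l * K)) = z\<^sup>2 / (2 * D)"
      unfolding lK using v0 D0 q0 K by (simp add: l_def v_def power2_eq_square)
    have "(1 + l\<^sup>2 * K\<^sup>2 / (1 - l * K)) ^ q \<le> exp (l\<^sup>2 * K\<^sup>2 / (1 - l * K)) ^ q"
      using lK v0 D0 by (intro power_mono exp_ge_add_one_self add_nonneg_nonneg) auto
    also have "\<dots> = exp (z\<^sup>2 / (2 * D))" unfolding exp_of_nat_mult[symmetric] u ..
    finally have "(1 + l\<^sup>2 * K\<^sup>2 / (1 - l * K)) ^ q / exp (l * z) \<le> exp (z\<^sup>2 / (2 * D)) / exp (l * z)" by (intro divide_right_mono) auto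
    also have "\<dots> = exp (- (z\<^sup>2 / (2 * D)))"
      unfolding exp_diff[symmetric] using D0 by (simp add: l_def power2_eq_square field_simps)
    also have "\<dots> \<le> exp (- (1 / (42 * B) * E))" using key by simp
    finally show "(1 + l\<^sup>2 * K\<^sup>2 / (1 - l * K)) ^ q / exp (l * (7 * y / 24)) \<le> exp (- (1 / (42 * max (K\<^sup>2) K)) * t powr g * min (x\<^sup>2) x * L)"
      unfolding z_def[symmetric] B_def[symmetric] by (simp add: E_def mult.assoc)
    fix r \<phi> :: real assume r: "0 < r" and \<phi>: "0 < \<phi>" "\<phi> \<le> 1"
    have "\<phi> ^ q / exp (- (r * t / 2)) = exp (real q * ln \<phi> + r * t / 2)"
    proof -
      have p: "\<phi> ^ q = exp (real q * ln \<phi>)" using \<phi> by (simp add: exp_of_nat_mult)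
      show ?thesis unfolding p exp_diff[symmetric] by simp
    qed
    also have "\<dots> \<le> exp (n / 2 * ln \<phi> + max x 1 * (r * t) / 2)"
    proof -
      have "real q * ln \<phi> \<le> n / 2 * ln \<phi>" using q \<phi> by (intro mult_right_mono_neg) auto
      moreover have "1 * (r * t) \<le> max x 1 * (r * t)" using r t by (intro mult_right_mono) auto
      ultimately show ?thesis by simp
    qed
    also have "n / 2 * ln \<phi> + max x 1 * (r * t) / 2 =
      - (1 / 2) * t powr g * max x 1 * (- ln \<phi> * t powr (\<alpha> - \<alpha> * g) * (1 / L) - r * t powr (1 - g))"
    proof -
      have 1: "t powr g * t powr (\<alpha> - \<alpha> * g) = t powr \<gamma>" by (simp add: powr_add[symmetric] \<gamma>_def algebra_simps)
      have 2: "t powr g * t powr (1 - g) = t" using t by (simp add: powr_add[symmetric])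
      have "- (1 / 2) * t powr g * max x 1 * (- ln \<phi> * t powr (\<alpha> - \<alpha> * g) * (1 / L) - r * t powr (1 - g)) =
        1 / 2 * max x 1 * (ln \<phi> * (t powr g * t powr (\<alpha> - \<alpha> * g)) / L + r * (t powr g * t powr (1 - g)))"
        by (simp add: algebra_simps)
      also have "\<dots> = n / 2 * ln \<phi> + max x 1 * (r * t) / 2" unfolding 1 2 by (simp add: n_def algebra_simps)
      finally show ?thesis ..
    qed
    finally show "\<phi> ^ q / exp (- (r * t / 2)) \<le>
      exp (- (1 / 2) * t powr g * max x 1 * (- ln \<phi> * t powr (\<alpha> - \<alpha> * g) * (1 / L) - r * t powr (1 - g)))" .
  qed
qed

section \<open>Return to the original process and an arbitrary initial law\<close>

lemma nn_integral_eq_of_centered: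
  assumes "has_bochner_integral M f (0 :: real)"
  shows "(\<integral>\<^sup>+x. ennreal (f x) \<partial>M) = (\<integral>\<^sup>+x. ennreal (- f x) \<partial>M)"
proof -
  have i: "integrable M f" and "integral\<^sup>L M f = 0" using assms by (auto simp: has_bochner_integral_iff)
  then have "enn2real (\<integral>\<^sup>+x. ennreal (f x) \<partial>M) = enn2real (\<integral>\<^sup>+x. ennreal (- f x) \<partial>M)" by (simp add: real_lebesgue_integral_def)
  moreover have "(\<integral>\<^sup>+x. ennreal (f x) \<partial>M) < \<top>" "(\<integral>\<^sup>+x. ennreal (- f x) \<partial>M) < \<top>"
    using i by (auto simp: real_integrable_def less_top)
  ultimately show ?thesis by (metis ennreal_enn2real)
qed

context nummelin_splitting
begin

text \<open>The infimum over a random set of jump times is attained at the least selected index,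
  since the jump times increase; where the set is empty it is the constant
  \<open>Inf {}\<close>.\<close>

lemma Inf_T_N:
  assumes [measurable]: "\<And>k. Measurable.pred N (sel k)"
  shows "(\<lambda>w. Inf {T k w | k. sel k w}) \<in> borel_measurable N"
proof -
  have [measurable]: "(\<lambda>w. T (LEAST k. sel k w) w) \<in> borel_measurable N" by (rule measurable_compose_countable) measurable
  have "(\<lambda>w. if \<exists>k. sel k w then T (LEAST k. sel k w) w else Inf {}) \<in> borel_measurable N" by measurable
  then show ?thesis
  proof (rule measurable_cong[THEN iffD1, rotated])
    fix w assume w: "w \<in> space N"
    show "(if \<exists>k. sel k w then T (LEAST k. sel k w) w else Inf {}) = Inf {T k w | k. sel k w}"
    proof (cases "\<exists>k. sel k w")
      case True
      have "Inf {T k w | k. sel k w} = T (LEAST k. sel k w) w"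
        using LeastI_ex[OF True] by (intro cInf_eq_minimum) (auto intro: T_mono[OF w] Least_le)
      then show ?thesis using True by simp
    next
      case False
      then have "{T k w | k. sel k w} = {}" by blast
      then show ?thesis using False by simp
    qed
  qed
qed

lemma regen_time_N [measurable]: "regen_time C a Z T n \<in> borel_measurable N"
proof (induction n)
  case 0
  have "regen_time C a Z T 0 = (\<lambda>_. 0)" by (rule ext) simp
  then show ?case by simp
next
  case (Suc n)
  note [measurable] = Suc
  have at: "Z (T k w) w \<in> C \<times> {0..a} \<times> UNIV \<longleftrightarrow> atom k w" for k w
    by (cases "Z (T k w) w") (auto simp: atom_def xs_def us_def)
  have [measurable]: "(\<lambda>w. atom_time C a Z T w (regen_time C a Z T n w)) \<in> borel_measurable N"
    unfolding atom_time_def at by (rule Inf_T_N) measurable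
  have "(\<lambda>w. next_jump T w (atom_time C a Z T w (regen_time C a Z T n w))) \<in> borel_measurable N"
    unfolding next_jump_def by (rule Inf_T_N) measurable
  moreover have "regen_time C a Z T (Suc n) = (\<lambda>w. next_jump T w (atom_time C a Z T w (regen_time C a Z T n w)))"
    by (rule ext) simp
  ultimately show ?case by (simp only:)
qed

lemma bind_PP:
  assumes \<pi>: "\<pi> \<in> space (prob_algebra borel)"
  shows "PP \<in> \<pi> \<rightarrow>\<^sub>M subprob_algebra N" "sets (\<pi> \<bind> PP) = sets N" "space (\<pi> \<bind> PP) = space N" "prob_space (\<pi> \<bind> PP)"
proof -
  have \<pi>': "sets \<pi> = sets borel" "prob_space \<pi>" using \<pi> by (auto simp: space_prob_algebra)
  show 1: "PP \<in> \<pi> \<rightarrow>\<^sub>M subprob_algebra N"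
    using measurable_prob_algebraD[OF PP_kernel] by (simp cong: measurable_cong_sets add: \<pi>')
  show 2: "sets (\<pi> \<bind> PP) = sets N" by (rule sets_bind) (auto simp: sets_PP prob_space.not_empty[OF \<pi>'(2)])
  show "space (\<pi> \<bind> PP) = space N" by (rule sets_eq_imp_space_eq[OF 2])
  show "prob_space (\<pi> \<bind> PP)" by (rule prob_space.prob_space_bind[OF \<pi>'(2) _ 1]) (simp add: PP_prob)
qed

text \<open>The tail and the transform are given for one initial law, while the estimates involve
  cycles of every index from 1 on and every starting point. By \<open>lap_prod\<close> the transform
  \<open>\<Phi>\<close> of such a cycle depends on neither, so the two agree.\<close>

lemma cycle_law:
  assumes \<pi>: "\<pi> \<in> space (prob_algebra borel)" and r: "0 < r"
  defines "Y \<equiv> \<lambda>w. regen_time C a Z T 2 w - regen_time C a Z T 1 w"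
  shows "AE w in \<pi> \<bind> PP. 0 \<le> Y w" and "(\<integral>w. exp (- r * Y w) \<partial>(\<pi> \<bind> PP)) \<le> 1"
    and "(\<integral>\<^sup>+w. (\<Prod>i<q. cyc (lapw r) (Suc (2 * i + b)) w) \<partial>PP x) = ennreal (\<integral>w. exp (- r * Y w) \<partial>(\<pi> \<bind> PP)) ^ q"
proof -
  note bind = bind_PP[OF \<pi>]
  have Ym [measurable]: "Y \<in> borel_measurable N" unfolding Y_def by measurable
  have ae: "AE w in PP x. 0 \<le> Y w \<and> ennreal (exp (- r * Y w)) = cyc (lapw r) (Suc 0) w" for x
    using noat_AE[of x] AE_space
  proof eventually_elim
    case (elim w)
    then have w: "w \<in> space N" by simp
    obtain i where i: "\<And>j. reg j (i j) w" and ik: "\<And>j. \<exists>k. i (Suc j) = Suc k \<and> first_atom (Suc (i j)) k w"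
      by (rule reg_path[OF elim(1)]) blast
    have "i 1 \<le> i (Suc 1)" using ik[of 1] by (auto simp: first_atom_def)
    then have "T (i 1) w \<le> T (i (Suc 1)) w" by (rule T_mono[OF w])
    moreover have Y: "Y w = T (i (Suc 1)) w - T (i 1) w"
      using reg_time[OF w i[of "Suc 1"]] reg_time[OF w i[of 1]] by (simp add: Y_def numeral_2_eq_2)
    moreover have "cyc (lapw r) (Suc 0) w = lapw r (i 1) (i (Suc 1)) w" using cyc_eq[OF i[of "Suc 0"] i[of "Suc (Suc 0)"]] by simp
    ultimately show ?case by (simp add: lapw_def)
  qed
  show AE0: "AE w in \<pi> \<bind> PP. 0 \<le> Y w"
  proof (subst AE_bind[OF bind(1)])
    have "AE w in PP x. 0 \<le> Y w" for x using ae[of x] by eventually_elim simp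
    then show "AE x in \<pi>. AE w in PP x. 0 \<le> Y w" by simp
  qed measurable
  obtain \<Phi> where \<Phi>: "\<And>x b q. (\<integral>\<^sup>+w. (\<Prod>i<q. cyc (lapw r) (Suc (2 * i + b)) w) \<partial>PP x) = \<Phi> ^ q"
    by (rule lap_prod[of r]) blast
  have \<Phi>1: "(\<integral>\<^sup>+w. ennreal (exp (- r * Y w)) \<partial>PP x) = \<Phi>" for x
  proof -
    have "(\<integral>\<^sup>+w. ennreal (exp (- r * Y w)) \<partial>PP x) = (\<integral>\<^sup>+w. cyc (lapw r) (Suc 0) w \<partial>PP x)"
      by (rule nn_integral_cong_AE, use ae[of x] in eventually_elim) simp
    also have "\<dots> = \<Phi>" using \<Phi>[where x=x and q=1 and b=0] by simp
    finally show ?thesis .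
  qed
  have one: "ennreal (exp (- r * Y w)) \<le> 1" if "0 \<le> Y w" for w using that r by simp
  have "\<Phi> \<le> (\<integral>\<^sup>+w. 1 \<partial>PP undefined)" unfolding \<Phi>1[of undefined, symmetric]
    by (rule nn_integral_mono_AE, use ae[of undefined] in eventually_elim) (blast intro: one)
  then have \<Phi>le: "\<Phi> \<le> 1" using prob_space.emeasure_space_1[OF PP_prob[of undefined]] by simp
  have "(\<integral>\<^sup>+w. ennreal (exp (- r * Y w)) \<partial>(\<pi> \<bind> PP)) = (\<integral>\<^sup>+x. \<Phi> \<partial>\<pi>)"
    by (subst nn_integral_bind[OF _ bind(1)]) (simp_all add: \<Phi>1[simplified])
  also have "\<dots> = \<Phi>" using \<pi> prob_space.emeasure_space_1[of \<pi>] by (simp add: space_prob_algebra)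
  finally have nn: "(\<integral>\<^sup>+w. ennreal (exp (- r * Y w)) \<partial>(\<pi> \<bind> PP)) = \<Phi>" .
  have "(\<lambda>w. exp (- r * Y w)) \<in> borel_measurable (\<pi> \<bind> PP)"
    by (subst measurable_cong_sets[OF bind(2) refl]) measurable
  then have I: "(\<integral>w. exp (- r * Y w) \<partial>(\<pi> \<bind> PP)) = enn2real \<Phi>" unfolding nn[symmetric]
    by (rule integral_eq_nn_integral) simp
  obtain c where c: "\<Phi> = ennreal c" "0 \<le> c" using \<Phi>le by (cases \<Phi>) (auto simp: top_unique)
  show "(\<integral>w. exp (- r * Y w) \<partial>(\<pi> \<bind> PP)) \<le> 1" unfolding I using \<Phi>le c by simp
  show "(\<integral>\<^sup>+w. (\<Prod>i<q. cyc (lapw r) (Suc (2 * i + b)) w) \<partial>PP x) = ennreal (\<integral>w. exp (- r * Y w) \<partial>(\<pi> \<bind> PP)) ^ q"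
    unfolding \<Phi> I using c by simp
qed

text \<open>The mean integral up to the first regeneration is \<open>Psi\<close>, so
  \<open>C_const\<close> is the supremum of \<open>Psi\<close>. It is finite by
  \<open>Psi_bounded\<close>, hence \<open>enn2real\<close> is harmless and \<open>C_const\<close>
  may serve as \<open>Cc\<close>.\<close>

lemma Psi_le_C_const:
  assumes f: "special P X \<mu> f"
  shows "Psi (\<lambda>x. ennreal \<bar>f x\<bar>) x \<le> ennreal (C_const PP Z T C a f)"
proof -
  have [measurable]: "f \<in> borel_measurable borel" and sp: "special_nonneg P X \<mu> (\<lambda>x. \<bar>f x\<bar>)" using f by (auto simp: special_def)
  let ?g = "\<lambda>x. ennreal \<bar>f x\<bar>"
  let ?I = "\<lambda>w. \<integral>\<^sup>+s\<in>{0..regen_time C a Z T 1 w}. ennreal \<bar>f (fst (Z s w))\<bar> \<partial>lborel"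
  have gm: "?g \<in> borel_measurable borel" by measurable
  have eq: "(\<integral>\<^sup>+w. ?I w \<partial>PP x) = Psi ?g x" for x
  proof -
    have "(\<integral>\<^sup>+w. ?I w \<partial>PP x) = (\<integral>\<^sup>+w. cint ?g 0 w \<partial>PP x)"
    proof (rule nn_integral_cong_AE, use noat_AE[of x] AE_space in eventually_elim)
      fix w assume n: "\<forall>m. \<not> noat m w" and "w \<in> space (PP x)"
      then have w: "w \<in> space N" by simp
      obtain k where k: "first_atom (Suc 0) k w" using first_atom_or_noat[of "Suc 0" w] n by blast
      have "regen_time C a Z T 1 w = T (Suc k) w" using regen_step[OF w _ k, of 0] T_0[OF w] by simp
      then have "?I w = (\<integral>\<^sup>+s\<in>{T 0 w..T (Suc k) w}. ?g (X s (pr w)) \<partial>lborel)"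
        using T_0[OF w] Z1_eq_X[OF _ w] by (intro nn_integral_cong) (auto split: split_indicator)
      also have "\<dots> = cint ?g 0 w" unfolding nn_integral_Icc_pint[OF w gm] by (rule cint_first_atom[OF w k gm, symmetric])
      finally show "?I w = cint ?g 0 w" .
    qed
    also have "\<dots> = (\<integral>\<^sup>+w. Psi ?g (xs 0 w) \<partial>PP x)" using cint_step[of "\<lambda>_. 1" 0 ?g x] by simp
    also have "\<dots> = (\<integral>\<^sup>+w. Psi ?g x \<partial>PP x)" by (rule nn_integral_cong_AE, use xs_0[of x] in eventually_elim) simp
    finally show ?thesis using prob_space.emeasure_space_1[OF PP_prob[of x]] by simp
  qed
  obtain c :: real where c: "\<And>x. Psi ?g x \<le> ennreal c" using Psi_bounded[OF sp] by metis
  have fin: "(SUP x. Psi ?g x) < \<top>" by (rule le_less_trans[OF SUP_least[OF c]]) simp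
  have "Psi ?g x \<le> (SUP x. Psi ?g x)" by (rule SUP_upper) simp
  also have "\<dots> = ennreal (C_const PP Z T C a f)" unfolding C_const_def eq using fin by simp
  finally show ?thesis .
qed

lemma deviation_transfer:
  assumes \<pi>: "\<pi> \<in> space (prob_algebra borel)" and c: "0 \<le> c"
    and bound: "\<And>x D. (\<And>w. w \<in> D \<Longrightarrow> w \<in> space N \<and> y \<le> \<bar>II f w t\<bar>) \<Longrightarrow> emeasure (PP x) D \<le> ennreal c"
  shows "measure (\<pi> \<bind> P) {w \<in> space M. \<bar>LINT u:{0..t}|lborel. f (X u w)\<bar> \<ge> y} \<le> c"
proof -
  let ?A = "{w \<in> space M. \<bar>LINT u:{0..t}|lborel. f (X u w)\<bar> \<ge> y}"
  have \<pi>': "sets \<pi> = sets borel" "prob_space \<pi>" using \<pi> by (auto simp: space_prob_algebra)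
  have ker: "P \<in> \<pi> \<rightarrow>\<^sub>M subprob_algebra M"
    using measurable_prob_algebraD[OF P_kernel] by (simp cong: measurable_cong_sets add: \<pi>')
  have s: "sets (\<pi> \<bind> P) = sets M" by (rule sets_bind) (auto simp: sets_P prob_space.not_empty[OF \<pi>'(2)])
  show ?thesis
  proof (cases "?A \<in> sets M")
    \<comment> \<open>\<open>measure\<close> is 0 by convention on sets outside the
      sigma-algebra.\<close>
    case False
    then show ?thesis using c s by (simp add: measure_notin_sets)
  next
    case True
    have "emeasure (P x) ?A \<le> ennreal c" for x
    proof -
      have "emeasure (P x) ?A = emeasure (PP x) (pr -` ?A \<inter> space N)"
        unfolding extension[of x, symmetric] using True pr_measurable
        by (subst emeasure_distr) (auto cong: measurable_cong_sets simp: sets_PP)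
      also have "\<dots> \<le> ennreal c"
      proof (rule bound)
        fix w assume "w \<in> pr -` ?A \<inter> space N"
        moreover have "(LINT u:{0..t}|lborel. f (X u (pr w))) = II f w t"
          unfolding II_def by (rule set_lebesgue_integral_cong) auto
        ultimately show "w \<in> space N \<and> y \<le> \<bar>II f w t\<bar>" by simp
      qed
      finally show ?thesis .
    qed
    then have "(\<integral>\<^sup>+x. emeasure (P x) ?A \<partial>\<pi>) \<le> (\<integral>\<^sup>+x. ennreal c \<partial>\<pi>)" by (intro nn_integral_mono)
    also have "\<dots> = ennreal c" using prob_space.emeasure_space_1[OF \<pi>'(2)] by simp
    finally have "emeasure (\<pi> \<bind> P) ?A \<le> ennreal c"
      using True by (subst emeasure_bind[OF prob_space.not_empty[OF \<pi>'(2)] ker]) auto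
    then show ?thesis unfolding measure_def using c by (metis enn2real_leI)
  qed
qed

text \<open>The bound at a fixed rate \<open>r\<close>, where the number of cycles contributes
  \<open>Lambda_objective\<close> at \<open>r\<close> instead of its supremum. Two parities give the
  factor 2, below the 8 of the final bound.\<close>

lemma deviation_at_rate:
  assumes f_bounded: "bounded (range f)" and f_special: "special P X \<mu> f" and f_centered: "has_bochner_integral \<mu> f 0"
    and \<pi>: "\<pi> \<in> space (prob_algebra borel)" and \<pi>0: "\<pi>0 \<in> space (prob_algebra borel)"
    and F: "F r = (\<integral>w. exp (- r * (regen_time C a Z T 2 w - regen_time C a Z T 1 w)) \<partial>(\<pi>0 \<bind> PP))" "0 < F r"
    and r: "0 < r" and \<alpha>: "0 < \<alpha>" "\<alpha> < 1" and \<eta>: "0 < \<eta>" and t: "1 \<le> t" "10 \<le> t powr \<alpha>" and L: "0 < L t" "L t \<le> 1"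
    and thr: "1 \<le> t powr (\<alpha> + 2 * \<eta> * ((1 - \<alpha>) / (2 - \<alpha>))) / L t * t powr (- (\<alpha> / 2) - \<eta>)"
  shows "measure (\<pi> \<bind> P) {w \<in> space M. \<bar>LINT u:{0..t}|lborel. f (X u w)\<bar> \<ge> t powr (\<alpha> / 2 + \<eta>) * x}
    \<le> 4 * exp (- (1 / (42 * B_const PP Z T C a f)) * t powr (2 * \<eta> / (2 - \<alpha>)) * min (x\<^sup>2) x * L t)
      + 4 * exp 1 * exp (- (1 / (6 * K_const PP Z T C a f)) * t powr (\<alpha> / 2 + \<eta>) * x)
      + 2 * exp (- (1 / 2) * t powr (2 * \<eta> / (2 - \<alpha>)) * max x 1 * Lambda_objective \<alpha> F L \<eta> t r)" (is "measure _ ?A \<le> 4 * ?a + ?b + ?c")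
proof -
  define m where "m = (SUP x. \<bar>f x\<bar>)"
  define Cc where "Cc = C_const PP Z T C a f"
  define K where "K = m + Cc"
  have KK: "K_const PP Z T C a f = K" by (simp add: K_const_def K_def m_def Cc_def)
  have BB: "B_const PP Z T C a f = max (K\<^sup>2) K" by (simp add: B_const_def KK)
  have f [measurable]: "f \<in> borel_measurable borel" using f_special by (simp add: special_def)
  have fm: "\<bar>f z\<bar> \<le> m" for z
  proof -
    obtain e where "\<And>z. norm (f z) \<le> e" using f_bounded by (auto simp: bounded_iff)
    then show ?thesis unfolding m_def by (intro cSUP_upper bdd_aboveI2[where M=e]) auto
  qed
  have m0: "0 \<le> m" using fm[of undefined] by linarith
  have Cc0: "0 \<le> Cc" by (simp add: Cc_def C_const_def)
  show ?thesis
  proof (cases "m = 0 \<or> x \<le> 0")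
    case True
    interpret prob_space "\<pi> \<bind> P"
      using \<pi> by (intro prob_space.prob_space_bind[where S=M])
        (auto simp: space_prob_algebra P_prob intro!: measurable_prob_algebraD P_kernel cong: measurable_cong_sets)
    \<comment> \<open>If \<open>x \<le> 0\<close> or \<open>f\<close> vanishes, the first exponent
      is nonnegative (with \<open>1 / 0 = 0\<close> in the second case), so \<open>4 * ?a\<close>
      alone exceeds any probability.\<close>
    have "0 \<le> - (1 / (42 * B_const PP Z T C a f)) * t powr (2 * \<eta> / (2 - \<alpha>)) * min (x\<^sup>2) x * L t"
    proof (cases "x \<le> 0")
      case True
      have "0 \<le> B_const PP Z T C a f" unfolding BB by (simp add: le_max_iff_disj)
      moreover have "min (x\<^sup>2) x \<le> 0" using True by (simp add: min_le_iff_disj)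
      ultimately show ?thesis using L by (intro mult_nonneg_nonneg mult_nonpos_nonpos mult_nonpos_nonneg) auto
    next
      case False
      then have "f z = 0" for z using \<open>m = 0 \<or> x \<le> 0\<close> fm[of z] by simp
      then have "Cc = 0" by (simp add: Cc_def C_const_def)
      then show ?thesis using False \<open>m = 0 \<or> x \<le> 0\<close> by (simp add: BB K_def)
    qed
    then have "1 \<le> ?a" by simp
    moreover have "measure (\<pi> \<bind> P) ?A \<le> 1" by simp
    moreover have "0 \<le> ?b" "0 \<le> ?c" by simp_all
    ultimately show ?thesis by linarith
  next
    case False
    then have m: "0 < m" and x: "0 < x" using m0 by auto
    have K0: "0 < K" using m Cc0 by (simp add: K_def)
    let ?y = "t powr (\<alpha> / 2 + \<eta>) * x"
    obtain q :: nat and l where l: "0 < l" "l * K < 1"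
      and cyc: "(1 + l\<^sup>2 * K\<^sup>2 / (1 - l * K)) ^ q / exp (l * (7 * ?y / 24)) \<le> exp (- (1 / (42 * max (K\<^sup>2) K)) * t powr (2 * \<eta> / (2 - \<alpha>)) * min (x\<^sup>2) x * L t)"
      and num: "\<And>r \<phi>. 0 < r \<Longrightarrow> 0 < \<phi> \<Longrightarrow> \<phi> \<le> 1 \<Longrightarrow> \<phi> ^ q / exp (- (r * t / 2)) \<le>
        exp (- (1 / 2) * t powr (2 * \<eta> / (2 - \<alpha>)) * max x 1 * (- ln \<phi> * t powr (\<alpha> - \<alpha> * (2 * \<eta> / (2 - \<alpha>))) * (1 / L t) - r * t powr (1 - 2 * \<eta> / (2 - \<alpha>))))"
      by (rule numeric_bounds[OF K0 \<alpha> \<eta> t L thr x]) blast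
    have y: "0 < ?y" using x t by simp
    have F1: "F r \<le> 1" unfolding F(1) by (rule cycle_law(2)[OF \<pi>0 r])
    have lap: "(\<integral>\<^sup>+w. (\<Prod>e<q. cyc (lapw r) (Suc (2 * e + b)) w) \<partial>PP z) = ennreal (F r) ^ q" for b z
      unfolding F(1) by (rule cycle_law(3)[OF \<pi>0 r])
    let ?d = "10 * exp (- (?y / (6 * K))) + 4 * ((1 + l\<^sup>2 * K\<^sup>2 / (1 - l * K)) ^ q / exp (l * (7 * ?y / 24))) + 2 * (F r ^ q / exp (- (r * t / 2)))"
    have d0: "0 \<le> ?d" using l F(2) K0 by (intro add_nonneg_nonneg mult_nonneg_nonneg divide_nonneg_nonneg zero_le_power) auto
    have "measure (\<pi> \<bind> P) ?A \<le> ?d"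
      by (rule deviation_transfer[OF \<pi> d0],
          rule deviation_bound[OF f fm m Cc0 Psi_le_C_const[OF f_special, folded Cc_def] K_def nn_integral_eq_of_centered[OF f_centered] l _ y r _ lap])
        (use t F in auto)
    also have "\<dots> \<le> ?b + 4 * ?a + ?c"
    proof (intro add_mono mult_left_mono)
      \<comment> \<open>\<open>exp 1\<close> is at least \<open>1 + 1 + 1/2\<close>, which absorbs
        the 10 of the two ends into \<open>4 * exp 1\<close>.\<close>
      have "10 \<le> 4 * exp (1 :: real)" using exp_lower_Taylor_quadratic[of "1 :: real"] by simp
      then have "10 * exp (- (?y / (6 * K))) \<le> 4 * exp 1 * exp (- (?y / (6 * K)))" by (intro mult_right_mono) auto
      then show "10 * exp (- (?y / (6 * K))) \<le> ?b" unfolding KK by simp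
      show "(1 + l\<^sup>2 * K\<^sup>2 / (1 - l * K)) ^ q / exp (l * (7 * ?y / 24)) \<le> ?a" unfolding BB by (rule cyc)
      show "F r ^ q / exp (- (r * t / 2)) \<le> exp (- (1 / 2) * t powr (2 * \<eta> / (2 - \<alpha>)) * max x 1 * Lambda_objective \<alpha> F L \<eta> t r)"
        unfolding Lambda_objective_def by (rule num[OF r F(2) F1])
    qed auto
    finally show ?thesis by linarith
  qed
qed

end

text \<open>The left side is free of \<open>r\<close>, so taking logarithms turns the bounds into
  one common upper bound for \<open>h\<close>, which the supremum inherits whether or not it is
  attained.\<close>

lemma le_exp_SUP:
  fixes V c :: real and h :: "real \<Rightarrow> real"
  assumes c: "0 < c" and V: "\<And>r. r \<in> I \<Longrightarrow> V \<le> 2 * exp (- c * h r)" and I: "I \<noteq> {}"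
  shows "V \<le> 2 * exp (- c * (SUP r\<in>I. h r))"
proof (cases "0 < V")
  case True
  have "(SUP r\<in>I. h r) \<le> - ln (V / 2) / c"
  proof (rule cSUP_least[OF I])
    fix r assume "r \<in> I"
    then have "ln (V / 2) \<le> ln (exp (- c * h r))" using V[of r] True by (subst ln_le_cancel_iff) auto
    then have "c * h r \<le> - ln (V / 2)" by simp
    then show "h r \<le> - ln (V / 2) / c" unfolding pos_le_divide_eq[OF c] by (simp only: mult.commute)
  qed
  then have "(SUP r\<in>I. h r) * c \<le> - ln (V / 2)" unfolding pos_le_divide_eq[OF c] .
  then have "ln (V / 2) \<le> - c * (SUP r\<in>I. h r)" by (simp add: mult.commute)
  then have "exp (ln (V / 2)) \<le> exp (- c * (SUP r\<in>I. h r))" by simp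
  then show ?thesis using True by simp
next
  case False
  then show ?thesis using exp_gt_zero[of "- c * (SUP r\<in>I. h r)"] by linarith
qed

theorem theorem3p3:
  fixes M :: "'w measure"
    and P :: "'e::polish_space \<Rightarrow> 'w measure"
    and X :: "real \<Rightarrow> 'w \<Rightarrow> 'e"
    and \<mu> \<Lambda> :: "'e measure"
    and p :: "real \<Rightarrow> 'e \<Rightarrow> 'e \<Rightarrow> real"
    and C :: "'e set"
    and a :: real
    and \<nu> :: "'e measure"
    and x0 :: 'e
    and N :: "'v measure"
    and PP :: "'e \<Rightarrow> 'v measure"
    and pr :: "'v \<Rightarrow> 'w"
    and Z :: "real \<Rightarrow> 'v \<Rightarrow> 'e \<times> real \<times> 'e"
    and T :: "nat \<Rightarrow> 'v \<Rightarrow> real"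
    and R :: "nat \<Rightarrow> 'v \<Rightarrow> real"
    and \<pi>0 :: "'e measure"
    and \<alpha> :: real
    and l :: "real \<Rightarrow> real"
    and F :: "real \<Rightarrow> real"
    and f :: "'e \<Rightarrow> real"
  assumes splitting: "nummelin_splitting M P X \<mu> \<Lambda> p C a \<nu> x0 N PP pr Z T"
    and R_def: "R = regen_time C a Z T"
    and \<pi>0: "\<pi>0 \<in> space (prob_algebra borel)"
    and \<alpha>: "0 < \<alpha>" "\<alpha> < 1"
    and l: "slowly_varying l"
    and tail: "(\<lambda>x. measure (\<pi>0 \<bind> PP) {\<omega> \<in> space N. R 2 \<omega> - R 1 \<omega> > x})
                 \<sim>[at_top] (\<lambda>x. x powr (- \<alpha>) * l x / Gamma (1 - \<alpha>))"
    and F_def: "\<And>r. F r = (\<integral>\<omega>. exp (- r * (R 2 \<omega> - R 1 \<omega>)) \<partial>(\<pi>0 \<bind> PP))"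
    and f_bounded: "bounded (range f)"
    and f_special: "special P X \<mu> f"
    and f_centered: "has_bochner_integral \<mu> f 0"
  shows "\<exists>t0 L. slowly_varying L \<and> threshold \<alpha> L t0 \<and>
    (\<forall>s. threshold \<alpha> L s \<longrightarrow>
      (\<forall>x. \<forall>\<pi> \<in> space (prob_algebra borel). \<forall>t\<ge>s. \<forall>\<eta>. 0 < \<eta> \<and> \<eta> \<le> \<alpha> / 2 \<longrightarrow>
        measure (\<pi> \<bind> P)
          {\<omega> \<in> space M. \<bar>LINT u:{0..t}|lborel. f (X u \<omega>)\<bar> \<ge> t powr (\<alpha> / 2 + \<eta>) * x}
        \<le> 4 * exp (- (1 / (42 * B_const PP Z T C a f)) * t powr (2 * \<eta> / (2 - \<alpha>))
                    * min (x\<^sup>2) x * L t)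
          + 4 * exp 1 * exp (- (1 / (6 * K_const PP Z T C a f)) * t powr (\<alpha> / 2 + \<eta>) * x)
          + 8 * exp (- (1 / 2) * t powr (2 * \<eta> / (2 - \<alpha>)) * max x 1 * Lambda_star \<alpha> F L \<eta> t))) \<and>
    (\<forall>s. threshold \<alpha> L s \<longrightarrow>
      (\<forall>t\<ge>s. \<forall>\<eta>. 0 < \<eta> \<and> \<eta> \<le> \<alpha> / 2 \<longrightarrow>
        bdd_above (Lambda_objective \<alpha> F L \<eta> t ` {0<..}) \<and> 0 < Lambda_star \<alpha> F L \<eta> t)) \<and>
    (\<forall>\<eta>. 0 < \<eta> \<and> \<eta> \<le> \<alpha> / 2 \<longrightarrow>
      Liminf at_top (\<lambda>t. ereal (Lambda_star \<alpha> F L \<eta> t)) \<ge> ereal ((1 - \<alpha>) * \<alpha> powr (\<alpha> / (1 - \<alpha>)))) \<and>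
    (1 - \<alpha>) * \<alpha> powr (\<alpha> / (1 - \<alpha>)) > 0"
proof -
  interpret nummelin_splitting M P X \<mu> \<Lambda> p C a \<nu> x0 N PP pr Z T by (rule splitting)
  let ?Y = "\<lambda>\<omega>. R 2 \<omega> - R 1 \<omega>"
  have F: "F r = (\<integral>\<omega>. exp (- r * (regen_time C a Z T 2 \<omega> - regen_time C a Z T 1 \<omega>)) \<partial>(\<pi>0 \<bind> PP))" for r
    unfolding F_def R_def ..
  note bind = bind_PP[OF \<pi>0]
  have Ym: "?Y \<in> borel_measurable (\<pi>0 \<bind> PP)"
    unfolding R_def by (subst measurable_cong_sets[OF bind(2) refl]) measurable
  have Y0: "AE \<omega> in \<pi>0 \<bind> PP. 0 \<le> ?Y \<omega>" unfolding R_def by (rule cycle_law(1)[OF \<pi>0 zero_less_one])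
  obtain L t1 where sv: "slowly_varying L" and thr: "threshold \<alpha> L t1" and thr_ge: "\<And>s. threshold \<alpha> L s \<Longrightarrow> t1 \<le> s"
    and L: "\<And>t. t1 \<le> t \<Longrightarrow> 1 \<le> t \<and> 10 \<le> t powr \<alpha> \<and> 0 < L t \<and> L t \<le> 1" and Fpos: "\<And>r. 0 < r \<Longrightarrow> 0 < F r"
    and bdd: "\<And>t \<eta>. t1 \<le> t \<Longrightarrow> 0 < \<eta> \<Longrightarrow> \<eta> \<le> \<alpha> / 2 \<Longrightarrow>
      bdd_above (Lambda_objective \<alpha> F L \<eta> t ` {0<..}) \<and> 0 < Lambda_star \<alpha> F L \<eta> t"
    and lim: "\<And>\<eta>. 0 < \<eta> \<Longrightarrow> \<eta> \<le> \<alpha> / 2 \<Longrightarrow> filterlim (\<lambda>t. Lambda_star \<alpha> F L \<eta> t) at_top at_top"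
    by (rule tail_normalization[OF bind(4) Ym Y0 \<alpha> l tail[folded bind(3)] F_def]) blast
  show ?thesis
  proof (intro exI[of _ t1] exI[of _ L] conjI sv thr allI impI ballI)
    fix s x t \<eta> :: real and \<pi> :: "'e measure"
    assume s: "threshold \<alpha> L s" and \<pi>: "\<pi> \<in> space (prob_algebra borel)" and t: "s \<le> t" and \<eta>: "0 < \<eta> \<and> \<eta> \<le> \<alpha> / 2"
    have t1: "t1 \<le> t" using thr_ge[OF s] t by simp
    \<comment> \<open>The two terms without \<open>r\<close> are moved to the left, so that the
      supremum over \<open>r\<close> is taken in the third term alone.\<close>
    let ?V = "measure (\<pi> \<bind> P) {\<omega> \<in> space M. \<bar>LINT u:{0..t}|lborel. f (X u \<omega>)\<bar> \<ge> t powr (\<alpha> / 2 + \<eta>) * x}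
      - (4 * exp (- (1 / (42 * B_const PP Z T C a f)) * t powr (2 * \<eta> / (2 - \<alpha>)) * min (x\<^sup>2) x * L t)
      + 4 * exp 1 * exp (- (1 / (6 * K_const PP Z T C a f)) * t powr (\<alpha> / 2 + \<eta>) * x))"
    let ?c = "1 / 2 * t powr (2 * \<eta> / (2 - \<alpha>)) * max x 1"
    have "?V \<le> 2 * exp (- ?c * Lambda_star \<alpha> F L \<eta> t)"
      unfolding Lambda_star_def
    proof (rule le_exp_SUP)
      show "0 < ?c" using L[OF t1] by simp
      fix r :: real assume "r \<in> {0<..}"
      then have r: "0 < r" by simp
      have "1 \<le> t powr (\<alpha> + 2 * \<eta> * ((1 - \<alpha>) / (2 - \<alpha>))) / L t * t powr (- (\<alpha> / 2) - \<eta>)"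
        using s t \<eta> unfolding threshold_def by blast
      then show "?V \<le> 2 * exp (- ?c * Lambda_objective \<alpha> F L \<eta> t r)"
        using deviation_at_rate[where F=F and r=r and L=L, OF f_bounded f_special f_centered \<pi> \<pi>0 F[of r] Fpos[OF r] r \<alpha>, of \<eta> t x] \<eta> L[OF t1] by simp
    qed simp
    also have "\<dots> \<le> 8 * exp (- ?c * Lambda_star \<alpha> F L \<eta> t)" by simp
    finally show "measure (\<pi> \<bind> P)
          {\<omega> \<in> space M. \<bar>LINT u:{0..t}|lborel. f (X u \<omega>)\<bar> \<ge> t powr (\<alpha> / 2 + \<eta>) * x}
        \<le> 4 * exp (- (1 / (42 * B_const PP Z T C a f)) * t powr (2 * \<eta> / (2 - \<alpha>))
                    * min (x\<^sup>2) x * L t)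
          + 4 * exp 1 * exp (- (1 / (6 * K_const PP Z T C a f)) * t powr (\<alpha> / 2 + \<eta>) * x)
          + 8 * exp (- (1 / 2) * t powr (2 * \<eta> / (2 - \<alpha>)) * max x 1 * Lambda_star \<alpha> F L \<eta> t)" by simp
  next
    fix s t \<eta> :: real assume s: "threshold \<alpha> L s" and t: "s \<le> t" and \<eta>: "0 < \<eta> \<and> \<eta> \<le> \<alpha> / 2"
    show "bdd_above (Lambda_objective \<alpha> F L \<eta> t ` {0<..})" "0 < Lambda_star \<alpha> F L \<eta> t"
      using bdd[of t \<eta>] thr_ge[OF s] t \<eta> by auto
  next
    fix \<eta> :: real assume \<eta>: "0 < \<eta> \<and> \<eta> \<le> \<alpha> / 2"
    then have "\<forall>\<^sub>F t in at_top. (1 - \<alpha>) * \<alpha> powr (\<alpha> / (1 - \<alpha>)) \<le> Lambda_star \<alpha> F L \<eta> t"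
      using lim[of \<eta>] by (simp add: filterlim_at_top)
    then show "ereal ((1 - \<alpha>) * \<alpha> powr (\<alpha> / (1 - \<alpha>))) \<le> Liminf at_top (\<lambda>t. ereal (Lambda_star \<alpha> F L \<eta> t))"
      by (intro Liminf_bounded) simp
  next
    show "(1 - \<alpha>) * \<alpha> powr (\<alpha> / (1 - \<alpha>)) > 0" using \<alpha> by simp
  qed
qed

end
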